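(* Let $k$ be a field and $I$ a set. For any (augmented) object $A\in 2\text{-Cat}_I$, the object $\mathcal{B}^*\mathcal{B}(A)$ is cofibrant in the model structure on $2\text{-Cat}_I$ described in the context.
   Context: Complexes are cohomologically graded complexes of $k$-vector spaces; $V[1]^i=V^{i+1}$. Let $\mathbb{E}=\{\mathbb{E}_{ij}\}_{i,j\in I}$ be a collection of sets. For $n\ge1$, $\mathrm{Path}^n(i,j)$ is the set of sequences $(s_1,\dots,s_n)$ with $s_l\in\mathbb{E}_{i_{l-1},i_l}$, $i_0=i$, $i_n=j$; $\mathrm{Cell}^n(i,j)$ is the set of pairs $(s;t)$ with $s\in\mathrm{Path}^n(i,j)$, $t\in\mathbb{E}_{ij}$. A cell $c=(s;t)$ is pictured as a polygon with $\mathrm{top}(c)=s$ and $\mathrm{bot}(c)=t$. An object $(I,\mathbb{E},A)$ of $2\text{-Cat}_I$ consists of such $\mathbb{E}$, a complex $A_{ij}(s;t)$ for each cell, units $\mathrm{Id}_t\in A_{ij}(t;t)$, and associative and unital composition chain maps $$A_{ij}(t_1,\dots,t_n;u)\otimes A_{i_0i_1}(s^1;t_1)\otimes\cdots\otimes A_{i_{n-1}i_n}(s^n;t_n)\to A_{ij}(s^1\cdots s^n;u)$$ ($s^l\in\mathrm{Path}^{m_l}(i_{l-1},i_l)$, concatenated paths). A morphism $F:A\to B$ consists of maps $(\mathbb{E}_A)_{ij}\to(\mathbb{E}_B)_{ij}$ and chain maps $A_{ij}(s)\to B_{ij}(F(s))$ for all cells $s$, compatible with compositions and units. $A$ is augmented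 if it is equipped with a morphism (identity on $\mathbb{E}$) to the unit object ($k$ in each cell $(t;t)$, zero elsewhere); $\bar A$ is the kernel. A decomposition $D$ of a cell $(s_1,\dots,s_n;t)$ is a decomposition of the polygon by chords labelled by elements of $\mathbb{E}$ into cells; equivalently, a planar rooted tree with every vertex having at least one input, edges labelled by 1-morphisms, leaves labelled $s_1,\dots,s_n$ in order and root labelled $t$, such that at each vertex the inputs and the output form a cell. The tree without vertices is allowed for the cell $(t;t)$. $\mathrm{Cell}(D)$ is the set of cells (vertices) of $D$. For a collection $V$ of complexes indexed by cells put $F(V)(\nabla)=\bigoplus_{D}\bigotimes_{c\in\mathrm{Cell}(D)}V(\mathrm{top}(c);\mathrm{bot}(c))$, the sum over all decompositions $D$ of the cell $\nabla$. Gluing of decompositions gives the free object of $2\text{-Cat}_I$ on $V$; cutting gives the corresponding cofree coalgebra. Bar construction: $\mathcal{B}(A)$ is the cofree coalgebra on $\bar A[1]$ with differential the sum of the one induced by the differential of $A$ and the sum, over all chords between two cells $c,c'$, of the maps which remove the chord, gluing $c$ and $c'$ into one cell and composing the corresponding elements by the structure of $A$ (with Koszul signs). Cobar construction: $\mathcal{B}^*(C)$ is the free object on $\bar C[-1]$ ($\bar C$ the coaugmentation coideal) with differential the sum of the one induced by the differential of $C$ and the one defined by reversing all arrows, i.e. splitting a cell into two cells by a chord using the coalgebra structure of $C$. Model structure: let $A_{i,j}(1)$ be the DG-category with objects $\mathbb{E}_{ij}$ and morphism complexes $A_{ij}(s;t)$. $F:A\to B$ is a weak equivalence if all $F:A_{ij}(s)\to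 B_{ij}(F(s))$ ($s$ a cell) are quasi-isomorphisms and all functors $H^0(A_{i,j}(1))\to H^0(B_{i,j}(1))$ induced by $F$ are equivalences. It is a fibration if all $F:A_{ij}(s)\to B_{ij}(F(s))$ are termwise surjective and all functors $H^0(A_{i,j}(1))\to H^0(B_{i,j}(1))$ are isofibrations: for every $c\in(\mathbb{E}_A)_{ij}$ and closed degree $0$ morphism $\psi:F(c)\to b$ in $B_{i,j}(1)$ whose class in $H^0$ is an isomorphism there is a closed degree $0$ morphism $\phi:c\to d$ in $A_{i,j}(1)$ whose class in $H^0$ is an isomorphism and $F(\phi)=\psi$. An object is cofibrant if the morphism from the initial object to it has the left lifting property with respect to all morphisms that are both fibrations and weak equivalences. *)

theory Defs
  imports Complex_Main "HOL-Library.Function_Algebras"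
begin

section \<open>Cells and collections of complexes\<close>

text \<open>A 1-morphism carries its two end points, so that a path determines the indices
  \<open>i\<^sub>0, \<dots>, i\<^sub>n\<close> even if the sets \<open>E i j\<close> are not disjoint.
  A cell \<open>(s, t)\<close> consists of its top \<open>s\<close> and its bottom \<open>t\<close>.\<close>

type_synonym ('i, 'e) arr = "'i \<times> 'e \<times> 'i"
type_synonym ('i, 'e) cell = "('i, 'e) arr list \<times> ('i, 'e) arr"

text \<open>\<open>El s t n v\<close> is the vector \<open>v\<close> seen as an element of degree \<open>n\<close> of the complex at the
  cell \<open>(s, t)\<close>.\<close>

datatype ('i, 'e, 'v) el =
  El (etop: "('i, 'e) arr list") (ebot: "('i, 'e) arr") (edeg: int) (evec: 'v)

text \<open>All the vector spaces \<open>cx V c n\<close> (cell \<open>c\<close>, degree \<open>n\<close>) are subspaces of one ambient vector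
  space, given by the type \<open>'v\<close> and the scalar multiplication \<open>scl V\<close>. This is no restriction
  (take the direct sum of all of them). The subspaces need not be independent or disjoint: the
  operations receive the cell and the degree along with the vector.\<close>

record ('k, 'i, 'e, 'v) coll =
  objs :: "'i set"
  onemor :: "'i \<Rightarrow> 'i \<Rightarrow> 'e set"
  scl :: "'k \<Rightarrow> 'v \<Rightarrow> 'v"
  cx :: "('i, 'e) cell \<Rightarrow> int \<Rightarrow> 'v set"
  diff :: "('i, 'e, 'v) el \<Rightarrow> 'v"

definition arrows :: "('k, 'i, 'e, 'v, 'z) coll_scheme \<Rightarrow> 'i \<Rightarrow> 'i \<Rightarrow> ('i, 'e) arr set" where
  "arrows V i j = {(i, e, j) | e. e \<in> onemor V i j}"

primrec is_path :: "('k, 'i, 'e, 'v, 'z) coll_scheme \<Rightarrow> 'i \<Rightarrow> ('i, 'e) arr list \<Rightarrow> 'i \<Rightarrow> bool" where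
  "is_path V i [] j \<longleftrightarrow> i = j"
| "is_path V i (a # s) j \<longleftrightarrow> (\<exists>l\<in>objs V. a \<in> arrows V i l \<and> is_path V l s j)"

definition Path :: "('k, 'i, 'e, 'v, 'z) coll_scheme \<Rightarrow> nat \<Rightarrow> 'i \<Rightarrow> 'i \<Rightarrow> ('i, 'e) arr list set" where
  "Path V n i j = {s. length s = n \<and> is_path V i s j}"

definition cells :: "('k, 'i, 'e, 'v, 'z) coll_scheme \<Rightarrow> ('i, 'e) cell set" where
  "cells V = (\<Union>i\<in>objs V. \<Union>j\<in>objs V. \<Union>n\<in>{1..}. Path V n i j \<times> arrows V i j)"

definition elems :: "('k, 'i, 'e, 'v, 'z) coll_scheme \<Rightarrow> ('i, 'e, 'v) el set" where
  "elems V = {x. (etop x, ebot x) \<in> cells V \<and> evec x \<in> cx V (etop x, ebot x) (edeg x)}"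

definition dE :: "('k, 'i, 'e, 'v, 'z) coll_scheme \<Rightarrow> ('i, 'e, 'v) el \<Rightarrow> ('i, 'e, 'v) el" where
  "dE V x = El (etop x) (ebot x) (edeg x + 1) (diff V x)"

definition lin_on ::
  "('k \<Rightarrow> 'v \<Rightarrow> 'v) \<Rightarrow> ('k \<Rightarrow> 'w \<Rightarrow> 'w) \<Rightarrow> 'v set \<Rightarrow> ('v::plus \<Rightarrow> 'w::plus) \<Rightarrow> bool" where
  "lin_on s1 s2 U f \<longleftrightarrow>
     (\<forall>a b. \<forall>v\<in>U. \<forall>w\<in>U. f (s1 a v + s1 b w) = s2 a (f v) + s2 b (f w))"

definition complexes :: "('k::field, 'i, 'e, 'v::ab_group_add, 'z) coll_scheme \<Rightarrow> bool" where
  "complexes V \<longleftrightarrow> vector_space (scl V) \<and>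
     (\<forall>(s, t)\<in>cells V. \<forall>n.
        module.subspace (scl V) (cx V (s, t) n) \<and>
        lin_on (scl V) (scl V) (cx V (s, t) n) (\<lambda>v. diff V (El s t n v)) \<and>
        (\<forall>v\<in>cx V (s, t) n. diff V (El s t n v) \<in> cx V (s, t) (n + 1) \<and>
                              diff V (dE V (El s t n v)) = 0))"

definition sg :: "int \<Rightarrow> 'k::field" where
  "sg n = (if even n then 1 else - 1)"

definition up :: "int \<Rightarrow> ('i, 'e, 'v) el \<Rightarrow> ('i, 'e, 'v) el" where
  "up p x = El (etop x) (ebot x) (edeg x + p) (evec x)"

text \<open>\<open>shift p V\<close> is \<open>V[p]\<close>; an element \<open>x\<close> of \<open>V[p]\<close> is the element \<open>up p x\<close> of \<open>V\<close>.\<close>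

definition shift ::
  "int \<Rightarrow> ('k::field, 'i, 'e, 'v, 'z) coll_scheme \<Rightarrow> ('k, 'i, 'e, 'v) coll" where
  "shift p V = \<lparr>objs = objs V, onemor = onemor V, scl = scl V,
     cx = (\<lambda>c n. cx V c (n + p)), diff = (\<lambda>x. scl V (sg p) (diff V (up p x)))\<rparr>"

definition kernel ::
  "('k, 'i, 'e, 'v, 'z) coll_scheme \<Rightarrow> (('i, 'e, 'v) el \<Rightarrow> 'k::zero) \<Rightarrow> ('k, 'i, 'e, 'v, 'z) coll_scheme"
where
  "kernel V f = V\<lparr>cx := \<lambda>c n. {v \<in> cx V c n. f (El (fst c) (snd c) n v) = 0}\<rparr>"


section \<open>The category 2-Cat over a set \<open>I\<close>\<close>

record ('k, 'i, 'e, 'v) twocat = "('k, 'i, 'e, 'v) coll" +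
  ident :: "('i, 'e) arr \<Rightarrow> 'v"
  opcomp :: "('i, 'e, 'v) el \<Rightarrow> ('i, 'e, 'v) el list \<Rightarrow> 'v"

definition idE :: "('k, 'i, 'e, 'v, 'z) twocat_scheme \<Rightarrow> ('i, 'e) arr \<Rightarrow> ('i, 'e, 'v) el" where
  "idE A a = El [a] a 0 (ident A a)"

definition composable ::
  "('k, 'i, 'e, 'v, 'z) coll_scheme \<Rightarrow> ('i, 'e, 'v) el \<Rightarrow> ('i, 'e, 'v) el list \<Rightarrow> bool" where
  "composable A x ys \<longleftrightarrow> x \<in> elems A \<and> set ys \<subseteq> elems A \<and> map ebot ys = etop x"

definition compE ::
  "('k, 'i, 'e, 'v, 'z) twocat_scheme \<Rightarrow> ('i, 'e, 'v) el \<Rightarrow> ('i, 'e, 'v) el list \<Rightarrow> ('i, 'e, 'v) el" where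
  "compE A x ys = El (concat (map etop ys)) (ebot x) (edeg x + sum_list (map edeg ys)) (opcomp A x ys)"

text \<open>The Koszul sign of the permutation
  \<open>y\<^sub>1 \<otimes> \<dots> \<otimes> y\<^sub>n \<otimes> z\<^sub>1 \<otimes> \<dots> \<otimes> z\<^sub>n \<mapsto> y\<^sub>1 \<otimes> z\<^sub>1 \<otimes> \<dots> \<otimes> y\<^sub>n \<otimes> z\<^sub>n\<close>, as a function of the degrees.\<close>

fun shuffle_sign :: "int list \<Rightarrow> int list \<Rightarrow> 'k::field" where
  "shuffle_sign (y # ys) (z # zs) = sg (z * sum_list ys) * shuffle_sign ys zs"
| "shuffle_sign _ _ = 1"

definition two_cat :: "'i set \<Rightarrow> ('k::field, 'i, 'e, 'v::ab_group_add) twocat \<Rightarrow> bool" where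
  "two_cat I A \<longleftrightarrow> objs A = I \<and> complexes A \<and>
     (\<forall>i\<in>I. \<forall>j\<in>I. \<forall>a\<in>arrows A i j. idE A a \<in> elems A \<and> diff A (idE A a) = 0) \<and>
     (\<forall>x ys. composable A x ys \<longrightarrow> compE A x ys \<in> elems A) \<and>
     (\<forall>s t n v w ys a b. composable A (El s t n v) ys \<and> composable A (El s t n w) ys \<longrightarrow>
        opcomp A (El s t n (scl A a v + scl A b w)) ys =
          scl A a (opcomp A (El s t n v) ys) + scl A b (opcomp A (El s t n w) ys)) \<and>
     (\<forall>x ls s t n v w rs a b.
        composable A x (ls @ El s t n v # rs) \<and> composable A x (ls @ El s t n w # rs) \<longrightarrow>
        opcomp A x (ls @ El s t n (scl A a v + scl A b w) # rs) =
          scl A a (opcomp A x (ls @ El s t n v # rs)) + scl A b (opcomp A x (ls @ El s t n w # rs))) \<and>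
     (\<forall>x ys. composable A x ys \<longrightarrow>
        diff A (compE A x ys) = opcomp A (dE A x) ys +
          (\<Sum>l<length ys. scl A (sg (edeg x + sum_list (map edeg (take l ys))))
                           (opcomp A x (ys[l := dE A (ys ! l)])))) \<and>
     (\<forall>x ys zss. composable A x ys \<and> list_all2 (composable A) ys zss \<longrightarrow>
        opcomp A (compE A x ys) (concat zss) =
          scl A (shuffle_sign (map edeg ys) (map (sum_list \<circ> map edeg) zss))
            (opcomp A x (map2 (compE A) ys zss))) \<and>
     (\<forall>x\<in>elems A. opcomp A x (map (idE A) (etop x)) = evec x \<and>
                   opcomp A (idE A (ebot x)) [x] = evec x)"

record ('i, 'e, 'f, 'v, 'w) mor =
  mor1 :: "'i \<Rightarrow> 'i \<Rightarrow> 'e \<Rightarrow> 'f"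
  mor2 :: "('i, 'e, 'v) el \<Rightarrow> 'w"

definition marr :: "('i, 'e, 'f, 'v, 'w) mor \<Rightarrow> ('i, 'e) arr \<Rightarrow> ('i, 'f) arr" where
  "marr F = (\<lambda>(i, e, j). (i, mor1 F i j e, j))"

definition mcell :: "('i, 'e, 'f, 'v, 'w) mor \<Rightarrow> ('i, 'e) cell \<Rightarrow> ('i, 'f) cell" where
  "mcell F = (\<lambda>(s, t). (map (marr F) s, marr F t))"

definition mE :: "('i, 'e, 'f, 'v, 'w) mor \<Rightarrow> ('i, 'e, 'v) el \<Rightarrow> ('i, 'f, 'w) el" where
  "mE F x = El (map (marr F) (etop x)) (marr F (ebot x)) (edeg x) (mor2 F x)"

definition is_mor ::
  "('k::field, 'i, 'e, 'v::ab_group_add) twocat \<Rightarrow> ('k, 'i, 'f, 'w::ab_group_add) twocat \<Rightarrow>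
   ('i, 'e, 'f, 'v, 'w) mor \<Rightarrow> bool" where
  "is_mor A B F \<longleftrightarrow> objs A = objs B \<and>
     (\<forall>i\<in>objs A. \<forall>j\<in>objs A. mor1 F i j ` onemor A i j \<subseteq> onemor B i j) \<and>
     (\<forall>(s, t)\<in>cells A. \<forall>n. lin_on (scl A) (scl B) (cx A (s, t) n) (\<lambda>v. mor2 F (El s t n v))) \<and>
     (\<forall>x\<in>elems A. mE F x \<in> elems B \<and> mor2 F (dE A x) = diff B (mE F x)) \<and>
     (\<forall>x ys. composable A x ys \<longrightarrow> mor2 F (compE A x ys) = opcomp B (mE F x) (map (mE F) ys)) \<and>
     (\<forall>i\<in>objs A. \<forall>j\<in>objs A. \<forall>a\<in>arrows A i j. mor2 F (idE A a) = ident B (marr F a))"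

definition mor_comp ::
  "('i, 'f, 'g, 'w, 'u) mor \<Rightarrow> ('i, 'e, 'f, 'v, 'w) mor \<Rightarrow> ('i, 'e, 'g, 'v, 'u) mor" where
  "mor_comp G F = \<lparr>mor1 = (\<lambda>i j e. mor1 G i j (mor1 F i j e)), mor2 = (\<lambda>x. mor2 G (mE F x))\<rparr>"

text \<open>Equality of morphisms has to be restricted to the 1-morphisms and elements of the source.\<close>

definition mor_eq ::
  "('k, 'i, 'e, 'v) twocat \<Rightarrow> ('i, 'e, 'f, 'v, 'w) mor \<Rightarrow> ('i, 'e, 'f, 'v, 'w) mor \<Rightarrow> bool" where
  "mor_eq A F G \<longleftrightarrow>
     (\<forall>i\<in>objs A. \<forall>j\<in>objs A. \<forall>e\<in>onemor A i j. mor1 F i j e = mor1 G i j e) \<and>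
     (\<forall>x\<in>elems A. mor2 F x = mor2 G x)"

definition unit_obj :: "'i set \<Rightarrow> ('i \<Rightarrow> 'i \<Rightarrow> 'e set) \<Rightarrow> ('k::field, 'i, 'e, 'k) twocat" where
  "unit_obj I E = \<lparr>objs = I, onemor = E, scl = (*),
     cx = (\<lambda>(s, t) n. if s = [t] \<and> n = 0 then UNIV else {0}), diff = (\<lambda>_. 0),
     ident = (\<lambda>_. 1), opcomp = (\<lambda>x ys. evec x * prod_list (map evec ys))\<rparr>"

definition augmentation ::
  "('k::field, 'i, 'e, 'v::ab_group_add) twocat \<Rightarrow> ('i, 'e, 'e, 'v, 'k) mor \<Rightarrow> bool" where
  "augmentation A \<epsilon> \<longleftrightarrow> is_mor A (unit_obj (objs A) (onemor A)) \<epsilon> \<and>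
     (\<forall>i\<in>objs A. \<forall>j\<in>objs A. \<forall>e\<in>onemor A i j. mor1 \<epsilon> i j e = e)"


section \<open>Decompositions and the free object\<close>

text \<open>A decomposition of a cell, each of whose vertices is decorated with a homogeneous element of
  a collection at the corresponding cell. The labels of the edges are the entries of the tops and
  bottoms of the decorations.\<close>

datatype ('i, 'e, 'v) dtree =
  Leaf "('i, 'e) arr"
| Node "('i, 'e, 'v) el" "('i, 'e, 'v) dtree list"

primrec root :: "('i, 'e, 'v) dtree \<Rightarrow> ('i, 'e) arr" where
  "root (Leaf a) = a"
| "root (Node x ts) = ebot x"

primrec leaves :: "('i, 'e, 'v) dtree \<Rightarrow> ('i, 'e) arr list" where
  "leaves (Leaf a) = [a]"
| "leaves (Node x ts) = concat (map leaves ts)"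

primrec tdeg :: "('i, 'e, 'v) dtree \<Rightarrow> int" where
  "tdeg (Leaf a) = 0"
| "tdeg (Node x ts) = edeg x + sum_list (map tdeg ts)"

primrec tmap :: "(('i, 'e, 'v) el \<Rightarrow> ('i, 'e, 'w) el) \<Rightarrow> ('i, 'e, 'v) dtree \<Rightarrow> ('i, 'e, 'w) dtree" where
  "tmap f (Leaf a) = Leaf a"
| "tmap f (Node x ts) = Node (f x) (map (tmap f) ts)"

definition corolla :: "('i, 'e, 'v) el \<Rightarrow> ('i, 'e, 'v) dtree" where
  "corolla x = Node x (map Leaf (etop x))"

inductive_set trees :: "('k, 'i, 'e, 'v, 'z) coll_scheme \<Rightarrow> ('i, 'e, 'v) dtree set"
  for V :: "('k, 'i, 'e, 'v, 'z) coll_scheme" where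
  leaf: "i \<in> objs V \<Longrightarrow> j \<in> objs V \<Longrightarrow> a \<in> arrows V i j \<Longrightarrow> Leaf a \<in> trees V"
| node: "x \<in> elems V \<Longrightarrow> \<forall>t\<in>set ts. t \<in> trees V \<Longrightarrow> map root ts = etop x \<Longrightarrow> Node x ts \<in> trees V"

definition trees_of ::
  "('k, 'i, 'e, 'v, 'z) coll_scheme \<Rightarrow> ('i, 'e) cell \<Rightarrow> ('i, 'e, 'v) dtree set" where
  "trees_of V c = {T \<in> trees V. (leaves T, root T) = c}"

text \<open>The three trees agree except that at one vertex they carry \<open>v\<close>, \<open>w\<close> and \<open>a v + b w\<close>
  (in the same degree).\<close>

inductive tree_lin ::
  "('k \<Rightarrow> 'v::plus \<Rightarrow> 'v) \<Rightarrow> 'k \<Rightarrow> 'k \<Rightarrow>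
   ('i, 'e, 'v) dtree \<Rightarrow> ('i, 'e, 'v) dtree \<Rightarrow> ('i, 'e, 'v) dtree \<Rightarrow> bool"
  for s :: "'k \<Rightarrow> 'v \<Rightarrow> 'v" and a b :: 'k where
  here: "tree_lin s a b (Node (El p q n v) ts) (Node (El p q n w) ts)
           (Node (El p q n (s a v + s b w)) ts)"
| below: "tree_lin s a b t1 t2 t3 \<Longrightarrow>
    tree_lin s a b (Node x (l @ t1 # r)) (Node x (l @ t2 # r)) (Node x (l @ t3 # r))"

text \<open>Multilinear in the decorations, separately for each decomposition and each choice of the
  degrees of the decorations.\<close>

definition multilin ::
  "('k \<Rightarrow> 'w::plus \<Rightarrow> 'w) \<Rightarrow> ('k, 'i, 'e, 'v::plus, 'z) coll_scheme \<Rightarrow> ('i, 'e) cell \<Rightarrow>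
   (('i, 'e, 'v) dtree \<Rightarrow> 'w) \<Rightarrow> bool" where
  "multilin s V c f \<longleftrightarrow>
     (\<forall>a b. \<forall>t1\<in>trees_of V c. \<forall>t2\<in>trees_of V c. \<forall>t3\<in>trees_of V c.
        tree_lin (scl V) a b t1 t2 t3 \<longrightarrow> f t3 = s a (f t1) + s b (f t2))"

text \<open>The sum \<open>\<Oplus>\<^sub>D \<Otimes>\<^sub>c V(c)\<close> over all decompositions \<open>D\<close> of a cell is realised inside the dual of the
  space of all \<open>k\<close>-valued multilinear functions on decorated decompositions: the pure tensor of
  the decorations of \<open>T\<close> is the evaluation at \<open>T\<close>, and the sum of tensor products is the span
  of the pure tensors. The factors of a tensor product are ordered by listing each vertex before
  the subtrees at its inputs, and these from left to right; all Koszul signs refer to this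
  order. The universal property is \<open>free_cx_universal\<close> below.\<close>

type_synonym ('k, 'i, 'e, 'v) tens = "(('i, 'e, 'v) dtree \<Rightarrow> 'k) \<Rightarrow> 'k"

definition ptens ::
  "('k::field, 'i, 'e, 'v::plus, 'z) coll_scheme \<Rightarrow> ('i, 'e, 'v) dtree \<Rightarrow> ('k, 'i, 'e, 'v) tens" where
  "ptens V T = (\<lambda>\<phi>. if multilin (*) V (leaves T, root T) \<phi> then \<phi> T else 0)"

definition tscale :: "'k::field \<Rightarrow> ('k, 'i, 'e, 'v) tens \<Rightarrow> ('k, 'i, 'e, 'v) tens" where
  "tscale r x = (\<lambda>\<phi>. r * x \<phi>)"

definition free_cx ::
  "('k::field, 'i, 'e, 'v::plus, 'z) coll_scheme \<Rightarrow> ('i, 'e) cell \<Rightarrow> int \<Rightarrow> ('k, 'i, 'e, 'v) tens set" where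
  "free_cx V c n = module.span tscale {ptens V T | T. T \<in> trees_of V c \<and> tdeg T = n}"

text \<open>Let \<open>g T\<close> be a tensor, written as a functional of \<open>\<phi>\<close>, depending multilinearly on \<open>T\<close>.
  Then \<open>\<lambda>\<phi>. x (\<lambda>T. g T \<phi>)\<close> is the value at \<open>x\<close> of the linear extension
  \<open>ptens V T \<mapsto> g T\<close>: for \<open>x = \<Sum> a\<^sub>T ptens V T\<close> it is \<open>\<Sum> a\<^sub>T g T\<close>. The operations below are
  defined in this way; \<open>on_cell\<close> only normalises the value at functions that are not multilinear.\<close>

definition on_cell ::
  "('k::field, 'i, 'e, 'v::plus, 'z) coll_scheme \<Rightarrow> ('i, 'e) cell \<Rightarrow>
   ('k, 'i, 'e, 'v) tens \<Rightarrow> ('k, 'i, 'e, 'v) tens" where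
  "on_cell V c g = (\<lambda>\<phi>. if multilin (*) V c \<phi> then g \<phi> else 0)"

fun blocks :: "nat list \<Rightarrow> 'a list \<Rightarrow> 'a list list" where
  "blocks [] ts = []"
| "blocks (n # ns) ts = take n ts # blocks ns (drop n ts)"

text \<open>Gluing: \<open>graft T ts\<close> glues the trees \<open>ts\<close> to the leaves of \<open>T\<close>. The sign \<open>graft_sign T ts\<close> is
  the Koszul sign of moving the decorations of \<open>ts\<close> from behind those of \<open>T\<close> to their places
  in \<open>graft T ts\<close>.\<close>

primrec graft :: "('i, 'e, 'v) dtree \<Rightarrow> ('i, 'e, 'v) dtree list \<Rightarrow> ('i, 'e, 'v) dtree" where
  "graft (Leaf a) = hd"
| "graft (Node x us) = (\<lambda>ts. Node x
     (map2 (\<lambda>g b. g b) (map graft us) (blocks (map (length \<circ> leaves) us) ts)))"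

primrec graft_sign :: "('i, 'e, 'v) dtree \<Rightarrow> ('i, 'e, 'v) dtree list \<Rightarrow> 'k::field" where
  "graft_sign (Leaf a) = (\<lambda>ts. 1)"
| "graft_sign (Node x us) = (\<lambda>ts. let bs = blocks (map (length \<circ> leaves) us) ts in
     shuffle_sign (map tdeg us) (map (sum_list \<circ> map tdeg) bs) *
     prod_list (map2 (\<lambda>g b. g b) (map graft_sign us) bs))"

text \<open>\<open>bind_list [y\<^sub>1, \<dots>, y\<^sub>n]\<close> extends a function of lists of \<open>n\<close> trees multilinearly to
  \<open>y\<^sub>1 \<otimes> \<dots> \<otimes> y\<^sub>n\<close>.\<close>

primrec bind_list :: "('k, 'i, 'e, 'v) tens list \<Rightarrow> (('i, 'e, 'v) dtree list \<Rightarrow> 'k) \<Rightarrow> 'k" where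
  "bind_list [] \<phi> = \<phi> []"
| "bind_list (y # ys) \<phi> = y (\<lambda>t. bind_list ys (\<lambda>ts. \<phi> (t # ts)))"

text \<open>A map of degree 1 that acts on a tree by a local modification \<open>\<rho>\<close> at each vertex in turn
  (\<open>\<rho> x ts\<close> is the tensor that replaces \<open>Node x ts\<close>), with the Koszul sign of passing the
  preceding vertices.\<close>

primrec at_vertices ::
  "(('i, 'e, 'v) el \<Rightarrow> ('i, 'e, 'v) dtree list \<Rightarrow> ('k::field, 'i, 'e, 'v) tens) \<Rightarrow>
   ('i, 'e, 'v) dtree \<Rightarrow> ('k, 'i, 'e, 'v) tens" where
  "at_vertices \<rho> (Leaf a) = (\<lambda>\<phi>. 0)"
| "at_vertices \<rho> (Node x ts) = (\<lambda>\<phi>. \<rho> x ts \<phi> +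
     (\<Sum>l<length ts. sg (edeg x + sum_list (map tdeg (take l ts))) *
        (map (at_vertices \<rho>) ts ! l) (\<lambda>T. \<phi> (Node x (ts[l := T])))))"

text \<open>Replace a vertex \<open>x\<close> by the combination \<open>\<theta> x\<close> of decompositions of the cell of \<open>x\<close>.\<close>

definition insert_at ::
  "(('i, 'e, 'v) el \<Rightarrow> ('k::field, 'i, 'e, 'v) tens) \<Rightarrow>
   ('i, 'e, 'v) el \<Rightarrow> ('i, 'e, 'v) dtree list \<Rightarrow> ('k, 'i, 'e, 'v) tens" where
  "insert_at \<theta> x ts = (\<lambda>\<phi>. \<theta> x (\<lambda>S. graft_sign S ts * \<phi> (graft S ts)))"

definition diff_vertex ::
  "('k::field, 'i, 'e, 'v, 'z) coll_scheme \<Rightarrow> ('i, 'e, 'v) el \<Rightarrow> ('k, 'i, 'e, 'v) tens" where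
  "diff_vertex V x = (\<lambda>\<phi>. \<phi> (corolla (dE V x)))"

definition free_coll ::
  "('k::field, 'i, 'e, 'v::plus) coll \<Rightarrow>
   (('i, 'e, 'v) el \<Rightarrow> ('i, 'e, 'v) dtree list \<Rightarrow> ('k, 'i, 'e, 'v) tens) \<Rightarrow>
   ('k, 'i, 'e, ('k, 'i, 'e, 'v) tens) coll" where
  "free_coll V \<rho> = \<lparr>objs = objs V, onemor = onemor V, scl = tscale, cx = free_cx V,
     diff = (\<lambda>x. on_cell V (etop x, ebot x) (\<lambda>\<phi>. evec x (\<lambda>T. at_vertices \<rho> T \<phi>)))\<rparr>"

definition free_obj ::
  "('k::field, 'i, 'e, 'v::plus) coll \<Rightarrow> (('i, 'e, 'v) el \<Rightarrow> ('k, 'i, 'e, 'v) tens) \<Rightarrow>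
   ('k, 'i, 'e, ('k, 'i, 'e, 'v) tens) twocat" where
  "free_obj V \<theta> = coll.extend (free_coll V (insert_at \<theta>)) (twocat.fields
     (\<lambda>a. ptens V (Leaf a))
     (\<lambda>x ys. on_cell V (concat (map etop ys), ebot x) (\<lambda>\<phi>.
        evec x (\<lambda>T. bind_list (map evec ys) (\<lambda>ts. graft_sign T ts * \<phi> (graft T ts))))))"


section \<open>Bar and cobar construction\<close>

text \<open>The part of a coaugmented coalgebra that enters the cobar construction. The coaugmentation
  coideal is the kernel of \<open>counit\<close>. For \<open>x\<close> in the coideal, \<open>split x\<close> is the sum of the
  components of the (reduced) coproduct that divide the cell of \<open>x\<close> into two cells by a chord,
  as an element of the free collection on the coideal that is supported on trees with two
  vertices.\<close>

record ('k, 'i, 'e, 'v) coalg = "('k, 'i, 'e, 'v) coll" +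
  counit :: "('i, 'e, 'v) el \<Rightarrow> 'k"
  split :: "('i, 'e, 'v) el \<Rightarrow> ('k, 'i, 'e, 'v) tens"

text \<open>The partial composition \<open>x \<circ>\<^sub>l y\<close> in \<open>A\<close> of elements of \<open>A[1]\<close>, as an element of \<open>A[1]\<close>.\<close>

definition glue ::
  "('k, 'i, 'e, 'v, 'z) twocat_scheme \<Rightarrow> ('i, 'e, 'v) el \<Rightarrow> nat \<Rightarrow> ('i, 'e, 'v) el \<Rightarrow> ('i, 'e, 'v) el" where
  "glue A x l y = up (- 1) (compE A (up 1 x)
     (map (idE A) (take l (etop x)) @ up 1 y # map (idE A) (drop (Suc l) (etop x))))"

text \<open>The sum over all chords between the vertex \<open>x\<close> and the vertices directly above it. If
  \<open>\<sigma>\<close> denotes the suspension, the map on two neighbouring factors is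
  \<open>\<sigma> v \<otimes> \<sigma> w \<mapsto> (-1)\<^bsup>|v|\<^esup> \<sigma> (v \<circ>\<^sub>l w)\<close>; before, \<open>\<sigma> w\<close> is moved past the subtrees to the left of it.\<close>

definition contract ::
  "('k::field, 'i, 'e, 'v, 'z) twocat_scheme \<Rightarrow>
   ('i, 'e, 'v) el \<Rightarrow> ('i, 'e, 'v) dtree list \<Rightarrow> ('k, 'i, 'e, 'v) tens" where
  "contract A x ts = (\<lambda>\<phi>. \<Sum>l<length ts. case ts ! l of Leaf a \<Rightarrow> 0 | Node y us \<Rightarrow>
     sg (edeg y * sum_list (map tdeg (take l ts))) * sg (edeg x + 1) *
     \<phi> (Node (glue A x l y) (take l ts @ us @ drop (Suc l) ts)))"

text \<open>The sum of \<open>\<pm> \<psi> T' p U\<close> over all chords of \<open>T\<close>, where cutting the chord gives the tree \<open>T'\<close>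
  containing the root and the tree \<open>U\<close> that was attached to the \<open>p\<close>-th leaf of \<open>T'\<close>; the sign is
  that of moving the decorations of \<open>U\<close> behind those of \<open>T'\<close>.\<close>

primrec cut_sum ::
  "('i, 'e, 'v) dtree \<Rightarrow> (('i, 'e, 'v) dtree \<Rightarrow> nat \<Rightarrow> ('i, 'e, 'v) dtree \<Rightarrow> 'k::field) \<Rightarrow> 'k" where
  "cut_sum (Leaf a) = (\<lambda>\<psi>. 0)"
| "cut_sum (Node x ts) = (\<lambda>\<psi>. \<Sum>l<length ts.
     let p0 = length (concat (map leaves (take l ts)));
         d = sum_list (map tdeg (drop (Suc l) ts))
     in (case ts ! l of Leaf a \<Rightarrow> 0 | Node y us \<Rightarrow>
           sg (tdeg (ts ! l) * d) * \<psi> (Node x (ts[l := Leaf (root (ts ! l))])) p0 (ts ! l)) +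
        (map cut_sum ts ! l) (\<lambda>T' p U. sg (tdeg U * d) * \<psi> (Node x (ts[l := T'])) (p0 + p) U))"

definition ptensE ::
  "('k::field, 'i, 'e, 'v::plus, 'z) coll_scheme \<Rightarrow> ('i, 'e, 'v) dtree \<Rightarrow>
   ('i, 'e, ('k, 'i, 'e, 'v) tens) el" where
  "ptensE V T = El (leaves T) (root T) (tdeg T) (ptens V T)"

definition two_vertex_tree :: "('i, 'e, 'v) el \<Rightarrow> nat \<Rightarrow> ('i, 'e, 'v) el \<Rightarrow> ('i, 'e, 'v) dtree" where
  "two_vertex_tree x p y =
     Node x (map Leaf (take p (etop x)) @ corolla y # map Leaf (drop (Suc p) (etop x)))"

text \<open>The counit of the cofree coalgebra: the coefficient of the tree without vertices.\<close>

definition cofree_counit :: "('i, 'e, ('k::field, 'i, 'e, 'v) tens) el \<Rightarrow> 'k" where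
  "cofree_counit x = evec x (\<lambda>T. case T of Leaf a \<Rightarrow> 1 | Node y us \<Rightarrow> 0)"

definition bar ::
  "('k::field, 'i, 'e, 'v::ab_group_add) twocat \<Rightarrow> ('i, 'e, 'e, 'v, 'k) mor \<Rightarrow>
   ('k, 'i, 'e, ('k, 'i, 'e, 'v) tens) coalg" where
  "bar A \<epsilon> = (let V = shift 1 (kernel A (mor2 \<epsilon>));
       B = free_coll V (\<lambda>x ts \<phi>. insert_at (diff_vertex V) x ts \<phi> + contract A x ts \<phi>)
     in coll.extend B (coalg.fields cofree_counit
       (\<lambda>x. on_cell (kernel B cofree_counit) (etop x, ebot x) (\<lambda>\<phi>.
          evec x (\<lambda>T. cut_sum T (\<lambda>T' p U. \<phi> (two_vertex_tree (ptensE V T') p (ptensE V U))))))))"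

text \<open>On generators the differential is
  \<open>\<sigma> x \<mapsto> - \<sigma> (d x) + \<Sum> (-1)\<^bsup>|x'|\<^esup> \<sigma> x' \<otimes> \<sigma> x''\<close>, where \<open>\<Sum> x' \<otimes> x'' = split x\<close> and \<open>\<sigma>\<close> denotes the
  desuspension; the first sign is part of the differential of \<open>shift (- 1)\<close>.\<close>

definition cobar ::
  "('k::field, 'i, 'e, 'v::ab_group_add) coalg \<Rightarrow> ('k, 'i, 'e, ('k, 'i, 'e, 'v) tens) twocat" where
  "cobar C = (let V = shift (- 1) (kernel C (counit C)) in
     free_obj V (\<lambda>x \<phi>. diff_vertex V x \<phi> +
       split C (up (- 1) x)
         (\<lambda>S. (case S of Leaf a \<Rightarrow> 1 | Node x' us \<Rightarrow> sg (edeg x')) * \<phi> (tmap (up 1) S))))"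


section \<open>Model structure\<close>

record ('o, 'm) cat =
  Ob :: "'o set"
  Hom :: "'o \<Rightarrow> 'o \<Rightarrow> 'm set"
  Idt :: "'o \<Rightarrow> 'm"
  Cmp :: "'o \<Rightarrow> 'o \<Rightarrow> 'o \<Rightarrow> 'm \<Rightarrow> 'm \<Rightarrow> 'm"

text \<open>\<open>Cmp C a b c g f\<close> is \<open>g \<circ> f\<close> for \<open>f : a \<rightarrow> b\<close> and \<open>g : b \<rightarrow> c\<close>.\<close>

definition is_iso :: "('o, 'm) cat \<Rightarrow> 'o \<Rightarrow> 'o \<Rightarrow> 'm \<Rightarrow> bool" where
  "is_iso C a b f \<longleftrightarrow> f \<in> Hom C a b \<and>
     (\<exists>g\<in>Hom C b a. Cmp C a b a g f = Idt C a \<and> Cmp C b a b f g = Idt C b)"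

definition is_functor ::
  "('o, 'm) cat \<Rightarrow> ('p, 'n) cat \<Rightarrow> ('o \<Rightarrow> 'p) \<Rightarrow> ('o \<Rightarrow> 'o \<Rightarrow> 'm \<Rightarrow> 'n) \<Rightarrow> bool" where
  "is_functor C D Fo Fm \<longleftrightarrow> Fo ` Ob C \<subseteq> Ob D \<and>
     (\<forall>a\<in>Ob C. Fm a a (Idt C a) = Idt D (Fo a)) \<and>
     (\<forall>a\<in>Ob C. \<forall>b\<in>Ob C. Fm a b ` Hom C a b \<subseteq> Hom D (Fo a) (Fo b)) \<and>
     (\<forall>a\<in>Ob C. \<forall>b\<in>Ob C. \<forall>c\<in>Ob C. \<forall>f\<in>Hom C a b. \<forall>g\<in>Hom C b c.
        Fm a c (Cmp C a b c g f) = Cmp D (Fo a) (Fo b) (Fo c) (Fm b c g) (Fm a b f))"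

definition natural_iso ::
  "('o, 'm) cat \<Rightarrow> ('p, 'n) cat \<Rightarrow> ('o \<Rightarrow> 'p) \<Rightarrow> ('o \<Rightarrow> 'o \<Rightarrow> 'm \<Rightarrow> 'n) \<Rightarrow>
   ('o \<Rightarrow> 'p) \<Rightarrow> ('o \<Rightarrow> 'o \<Rightarrow> 'm \<Rightarrow> 'n) \<Rightarrow> ('o \<Rightarrow> 'n) \<Rightarrow> bool" where
  "natural_iso C D Fo Fm Go Gm \<eta> \<longleftrightarrow>
     (\<forall>a\<in>Ob C. is_iso D (Fo a) (Go a) (\<eta> a)) \<and>
     (\<forall>a\<in>Ob C. \<forall>b\<in>Ob C. \<forall>f\<in>Hom C a b.
        Cmp D (Fo a) (Fo b) (Go b) (\<eta> b) (Fm a b f) = Cmp D (Fo a) (Go a) (Go b) (Gm a b f) (\<eta> a))"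

definition is_equivalence ::
  "('o, 'm) cat \<Rightarrow> ('p, 'n) cat \<Rightarrow> ('o \<Rightarrow> 'p) \<Rightarrow> ('o \<Rightarrow> 'o \<Rightarrow> 'm \<Rightarrow> 'n) \<Rightarrow> bool" where
  "is_equivalence C D Fo Fm \<longleftrightarrow> is_functor C D Fo Fm \<and>
     (\<exists>Go Gm \<eta> \<theta>. is_functor D C Go Gm \<and>
        natural_iso C C (\<lambda>a. a) (\<lambda>a b f. f) (\<lambda>a. Go (Fo a)) (\<lambda>a b f. Gm (Fo a) (Fo b) (Fm a b f)) \<eta> \<and>
        natural_iso D D (\<lambda>a. Fo (Go a)) (\<lambda>a b f. Fm (Go a) (Go b) (Gm a b f)) (\<lambda>a. a) (\<lambda>a b f. f) \<theta>)"

definition cocycles ::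
  "('k, 'i, 'e, 'v::ab_group_add, 'z) coll_scheme \<Rightarrow> ('i, 'e) cell \<Rightarrow> int \<Rightarrow> 'v set" where
  "cocycles V c n = {v \<in> cx V c n. diff V (El (fst c) (snd c) n v) = 0}"

definition cohom_class ::
  "('k, 'i, 'e, 'v::ab_group_add, 'z) coll_scheme \<Rightarrow> ('i, 'e) cell \<Rightarrow> int \<Rightarrow> 'v \<Rightarrow> 'v set" where
  "cohom_class V c n z = {z + diff V (El (fst c) (snd c) (n - 1) b) | b. b \<in> cx V c (n - 1)}"

definition cohom ::
  "('k, 'i, 'e, 'v::ab_group_add, 'z) coll_scheme \<Rightarrow> ('i, 'e) cell \<Rightarrow> int \<Rightarrow> 'v set set" where
  "cohom V c n = cohom_class V c n ` cocycles V c n"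

definition cohom_map ::
  "('k, 'i, 'f, 'w::ab_group_add) twocat \<Rightarrow> ('i, 'e, 'f, 'v, 'w) mor \<Rightarrow> ('i, 'e) cell \<Rightarrow> int \<Rightarrow>
   'v set \<Rightarrow> 'w set" where
  "cohom_map B F c n K = (\<Union>z\<in>K. cohom_class B (mcell F c) n (mor2 F (El (fst c) (snd c) n z)))"

text \<open>\<open>H\<^sup>0\<close> of the DG-category with objects \<open>E i j\<close> and morphism complexes at the cells with one
  input.\<close>

definition H0 ::
  "('k, 'i, 'e, 'v::ab_group_add) twocat \<Rightarrow> 'i \<Rightarrow> 'i \<Rightarrow> (('i, 'e) arr, 'v set) cat" where
  "H0 A i j = \<lparr>Ob = arrows A i j, Hom = (\<lambda>s t. cohom A ([s], t) 0),
     Idt = (\<lambda>t. cohom_class A ([t], t) 0 (ident A t)),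
     Cmp = (\<lambda>a b c g f. \<Union>v\<in>g. \<Union>u\<in>f.
        cohom_class A ([a], c) 0 (opcomp A (El [b] c 0 v) [El [a] b 0 u]))\<rparr>"

definition weak_equivalence ::
  "('k, 'i, 'e, 'v::ab_group_add) twocat \<Rightarrow> ('k, 'i, 'f, 'w::ab_group_add) twocat \<Rightarrow>
   ('i, 'e, 'f, 'v, 'w) mor \<Rightarrow> bool" where
  "weak_equivalence A B F \<longleftrightarrow>
     (\<forall>c\<in>cells A. \<forall>n. bij_betw (cohom_map B F c n) (cohom A c n) (cohom B (mcell F c) n)) \<and>
     (\<forall>i\<in>objs A. \<forall>j\<in>objs A.
        is_equivalence (H0 A i j) (H0 B i j) (marr F) (\<lambda>s t. cohom_map B F ([s], t) 0))"

definition fibration ::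
  "('k, 'i, 'e, 'v::ab_group_add) twocat \<Rightarrow> ('k, 'i, 'f, 'w::ab_group_add) twocat \<Rightarrow>
   ('i, 'e, 'f, 'v, 'w) mor \<Rightarrow> bool" where
  "fibration A B F \<longleftrightarrow>
     (\<forall>(s, t)\<in>cells A. \<forall>n. (\<lambda>v. mor2 F (El s t n v)) ` cx A (s, t) n = cx B (mcell F (s, t)) n) \<and>
     (\<forall>i\<in>objs A. \<forall>j\<in>objs A. \<forall>c\<in>arrows A i j. \<forall>b\<in>arrows B i j.
        \<forall>\<psi>\<in>cocycles B ([marr F c], b) 0.
        is_iso (H0 B i j) (marr F c) b (cohom_class B ([marr F c], b) 0 \<psi>) \<longrightarrow>
        (\<exists>d\<in>arrows A i j. \<exists>\<phi>\<in>cocycles A ([c], d) 0.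
           is_iso (H0 A i j) c d (cohom_class A ([c], d) 0 \<phi>) \<and>
           marr F d = b \<and> mor2 F (El [c] d 0 \<phi>) = \<psi>))"

definition has_llp ::
  "('k::field, 'i, 'a, 'u::ab_group_add) twocat \<Rightarrow> ('k, 'i, 'e, 'v::ab_group_add) twocat \<Rightarrow>
   ('i, 'a, 'e, 'u, 'v) mor \<Rightarrow>
   ('k, 'i, 'f, 'x::ab_group_add) twocat \<Rightarrow> ('k, 'i, 'g, 'y::ab_group_add) twocat \<Rightarrow>
   ('i, 'f, 'g, 'x, 'y) mor \<Rightarrow> bool" where
  "has_llp A B f X Y p \<longleftrightarrow>
     (\<forall>u v. is_mor A X u \<and> is_mor B Y v \<and> mor_eq A (mor_comp p u) (mor_comp v f) \<longrightarrow>
        (\<exists>h. is_mor B X h \<and> mor_eq A (mor_comp h f) u \<and> mor_eq B (mor_comp p h) v))"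

text \<open>The initial object has no 1-morphisms, hence no cells.\<close>

definition initial_obj :: "'i set \<Rightarrow> ('k::field, 'i, unit, 'k) twocat" where
  "initial_obj I = unit_obj I (\<lambda>i j. {})"

definition initial_mor :: "('i, unit, 'e, 'k, 'v::zero) mor" where
  "initial_mor = \<lparr>mor1 = (\<lambda>i j e. undefined), mor2 = (\<lambda>x. 0)\<rparr>"

text \<open>The type arguments are the types \<open>'f, 'x\<close> (\<open>'g, 'y\<close>) of 1-morphisms and of vectors of the
  source (target) of the trivial fibrations. As one cannot quantify over types inside a
  definition, cofibrancy is the assertion of this predicate for all type arguments.\<close>

definition cofibrant ::
  "('f \<times> 'x::ab_group_add) itself \<Rightarrow> ('g \<times> 'y::ab_group_add) itself \<Rightarrow>
   'i set \<Rightarrow> ('k::field, 'i, 'e, 'v::ab_group_add) twocat \<Rightarrow> bool" where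
  "cofibrant _ _ I C \<longleftrightarrow> two_cat I C \<and>
     (\<forall>(X :: ('k, 'i, 'f, 'x) twocat) (Y :: ('k, 'i, 'g, 'y) twocat) p.
        two_cat I X \<and> two_cat I Y \<and> is_mor X Y p \<and> fibration X Y p \<and> weak_equivalence X Y p \<longrightarrow>
        has_llp (initial_obj I) C initial_mor X Y p)"


section \<open>Universal properties\<close>

lemma vector_space_tscale: "vector_space (tscale :: 'k::field \<Rightarrow> ('k, 'i, 'e, 'v) tens \<Rightarrow> _)"
  by unfold_locales (simp_all add: tscale_def fun_eq_iff algebra_simps)

lemma multilin_ptens: "multilin tscale V c (ptens V)"
  by (auto simp: multilin_def ptens_def tscale_def trees_of_def fun_eq_iff)

text \<open>Multilinear maps factor uniquely through the pure tensors.\<close>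

lemma free_cx_universal:
  fixes V :: "('k::field, 'i, 'e, 'v::ab_group_add, 'z) coll_scheme"
    and s :: "'k \<Rightarrow> 'w::ab_group_add \<Rightarrow> 'w"
  assumes s: "vector_space s" and f: "multilin s V c f"
  shows "\<exists>g. Vector_Spaces.linear tscale s g \<and> (\<forall>T\<in>trees_of V c. g (ptens V T) = f T)"
    and "Vector_Spaces.linear tscale s g \<Longrightarrow> Vector_Spaces.linear tscale s h \<Longrightarrow>
         (\<And>T. T \<in> trees_of V c \<Longrightarrow> tdeg T = n \<Longrightarrow> g (ptens V T) = h (ptens V T)) \<Longrightarrow>
         x \<in> free_cx V c n \<Longrightarrow> g x = h x"
proof -
  interpret W: vector_space s by fact
  interpret K: vector_space "(*) :: 'k \<Rightarrow> 'k \<Rightarrow> 'k"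
    by unfold_locales (simp_all add: algebra_simps)
  interpret M: vector_space "tscale :: 'k \<Rightarrow> ('k, 'i, 'e, 'v) tens \<Rightarrow> _"
    by (rule vector_space_tscale)
  interpret MW: vector_space_pair "tscale :: 'k \<Rightarrow> ('k, 'i, 'e, 'v) tens \<Rightarrow> _" s ..
  interpret WK: vector_space_pair s "(*) :: 'k \<Rightarrow> 'k \<Rightarrow> 'k" ..
  let ?P = "ptens V ` trees_of V c"
  obtain B where B: "B \<subseteq> ?P" "M.independent B" "?P \<subseteq> M.span B"
    using M.maximal_independent_subset[of ?P] by metis
  obtain t where t: "\<And>b. b \<in> B \<Longrightarrow> t b \<in> trees_of V c \<and> ptens V (t b) = b"
  proof -
    have "\<forall>b\<in>B. \<exists>T. T \<in> trees_of V c \<and> ptens V T = b"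
      using B(1) by auto
    then show ?thesis
      using that by metis
  qed
  obtain g where g: "Vector_Spaces.linear tscale s g" "\<And>b. b \<in> B \<Longrightarrow> g b = f (t b)"
    using MW.linear_independent_extend[OF B(2), of "\<lambda>b. f (t b)"] by metis
  have "g (ptens V T) = f T" if T: "T \<in> trees_of V c" for T
  proof -
    have "ptens V T \<in> M.span B"
      using B(3) T by auto
    then obtain F r where F: "finite F" "F \<subseteq> B" "ptens V T = (\<Sum>b\<in>F. tscale (r b) b)"
      unfolding M.span_explicit by blast
    have gT: "g (ptens V T) = (\<Sum>b\<in>F. s (r b) (f (t b)))"
      using F g by (auto simp: MW.linear_sum MW.linear_scale intro!: sum.cong)
    define w where "w = f T - (\<Sum>b\<in>F. s (r b) (f (t b)))"
    have eq: "\<psi> w = 0" if \<psi>: "Vector_Spaces.linear s (*) \<psi>" for \<psi>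
    proof -
      have m: "multilin (*) V c (\<lambda>T. \<psi> (f T))"
        using f \<psi> unfolding multilin_def
        by (simp add: WK.linear_add WK.linear_scale)
      have ev: "ptens V T' (\<lambda>T. \<psi> (f T)) = \<psi> (f T')" if "T' \<in> trees_of V c" for T'
        using that m by (auto simp: ptens_def trees_of_def)
      have sum_ev: "(\<Sum>b\<in>F. tscale (r b) b) \<phi> = (\<Sum>b\<in>F. r b * b \<phi>)" for \<phi>
        using F(1) by (induction F rule: finite_induct) (auto simp: tscale_def)
      have "\<psi> (f T) = ptens V T (\<lambda>T. \<psi> (f T))"
        using ev T by simp
      also have "\<dots> = (\<Sum>b\<in>F. r b * b (\<lambda>T. \<psi> (f T)))"
        by (simp only: F(3) sum_ev)
      also have "\<dots> = (\<Sum>b\<in>F. r b * \<psi> (f (t b)))"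
        proof (intro sum.cong refl)
          fix b assume "b \<in> F"
          then have "t b \<in> trees_of V c" "ptens V (t b) = b"
            using t F(2) by auto
          then show "r b * b (\<lambda>T. \<psi> (f T)) = r b * \<psi> (f (t b))"
            using ev[of "t b"] by simp
        qed
      also have "\<dots> = \<psi> (\<Sum>b\<in>F. s (r b) (f (t b)))"
        using \<psi> by (simp add: WK.linear_sum WK.linear_scale)
      finally show ?thesis
        using \<psi> by (simp add: w_def WK.linear_diff)
    qed
    have "w = 0"
    proof (rule ccontr)
      assume "w \<noteq> 0"
      then obtain \<psi> where "Vector_Spaces.linear s (*) \<psi>" "\<psi> w = 1"
        using WK.linear_independent_extend[of "{w}" "\<lambda>_. 1"] by auto
      with eq show False by force
    qed
    then show ?thesis
      by (simp add: gT w_def)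
  qed
  with g(1) show "\<exists>g. Vector_Spaces.linear tscale s g \<and> (\<forall>T\<in>trees_of V c. g (ptens V T) = f T)"
    by blast
  show "g x = h x" if "Vector_Spaces.linear tscale s g" "Vector_Spaces.linear tscale s h"
    "\<And>T. T \<in> trees_of V c \<Longrightarrow> tdeg T = n \<Longrightarrow> g (ptens V T) = h (ptens V T)"
    "x \<in> free_cx V c n" for g h
    using MW.linear_eq_on_span[OF that(1,2) _ that(4)[unfolded free_cx_def]] that(3) by auto
qed

lemma cells_initial: "cells (initial_obj I) = {}"
  by (auto simp: cells_def arrows_def initial_obj_def unit_obj_def)

lemma initial_obj_initial:
  shows "two_cat I (initial_obj I :: ('k::field, 'i, unit, 'k) twocat)"
    and "objs A = I \<Longrightarrow> is_mor (initial_obj I) A initial_mor"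
    and "mor_eq (initial_obj I) F G"
proof -
  have e: "elems (initial_obj I) = {}"
    by (simp add: elems_def cells_initial)
  have vs: "vector_space ((*) :: 'k \<Rightarrow> 'k \<Rightarrow> 'k)"
    by unfold_locales (simp_all add: algebra_simps)
  have [simp]: "scl (initial_obj I) = (*)" "objs (initial_obj I) = I" "onemor (initial_obj I) i j = {}"
    "arrows (initial_obj I) i j = {}" for i j
    by (simp_all add: initial_obj_def unit_obj_def arrows_def)
  show "two_cat I (initial_obj I :: ('k::field, 'i, unit, 'k) twocat)"
    using vs by (simp add: two_cat_def complexes_def cells_initial e composable_def)
  show "objs A = I \<Longrightarrow> is_mor (initial_obj I) A initial_mor"
    by (simp add: is_mor_def e cells_initial composable_def)
  show "mor_eq (initial_obj I) F G"
    by (simp add: mor_eq_def e)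
qed

end

theory Submission
 imports Defs
begin

text \<open>The differential of a generator of the cobar construction is its internal part plus terms
 that only involve generators with fewer vertices: the underlying bar construction is filtered by the
 number of vertices of trees, and cutting as well as contracting a chord lowers this number. Hence a
 morphism to the base of a trivial fibration \<open>p\<close> lifts by recursion on the filtration.
 With a linear section \<open>\<sigma>\<close> of \<open>p\<close> and a linear contraction
 \<open>h\<close> of its acyclic kernel, the lift of \<open>v\<close> on generators is
 \<open>K x = \<sigma> v x - h (d \<sigma> v x - \<sigma> v d1 x - K (rest x))\<close>, with \<open>d1\<close> the
 internal part of the differential. On 1-morphisms \<open>p\<close> is surjective, being essentially
 surjective and an isofibration.\<close>

section \<open>Koszul signs and grafting\<close>

text \<open>The internal part \<open>d1\<close> of the differential of a generator stays in the same
  stage of the filtration, so a recursion on stages alone cannot solve for the lift. The contraction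
  \<open>h\<close> takes care of it: the defect \<open>err\<close> of the naive lift lies in the
  kernel of \<open>p\<close> and satisfies \<open>d (err x) = - err (d1 x)\<close>, and then
  \<open>d h + h d = 1\<close> makes the corrections at \<open>x\<close> and at \<open>d1 x\<close>
  consistent. That identity rests on the square of the differential being zero. This is also part of
  the claim, as a cofibrant object must be an object of 2-Cat. It is reduced to three facts on
  decorated trees: the bar differential squares to zero, it is a coderivation for cutting, and
  cutting is coassociative. Elements of free objects are functionals on functions of decorated
  trees, and they are linear on multilinear functions only. Hence each computation is done on trees,
  under a finite combination, and comes with a proof that the function of trees at hand is
  multilinear; this bookkeeping accounts for much of the length.\<close>

lemma sg_0 [simp]: "sg 0 = 1"
 and sg_minus [simp]: "sg (- a) = sg a"
 and sg_sq [simp]: "sg a * sg a = 1"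
 and sg_sq_left [simp]: "sg a * (sg a * r) = r" by (simp_all add: sg_def)

lemma sg_add: "sg (a + b) = sg a * sg b"
 and sg_diff: "sg (a - b) = sg a * sg b" by (auto simp: sg_def)

abbreviation deg_sum :: "('i, 'e, 'v) dtree list => int" where
 "deg_sum ts \<equiv> sum_list (map tdeg ts)"

abbreviation fleaves :: "('i, 'e, 'v) dtree list => ('i, 'e) arr list" where
 "fleaves ts \<equiv> concat (map leaves ts)"

abbreviation nleaves :: "('i, 'e, 'v) dtree => nat" where
 "nleaves t \<equiv> length (leaves t)"

text \<open>Koszul signs in a list depend on the position, so facts on lists of subtrees are proved
  one tree at a time, together with the facts on trees. The induction rule of the datatype has a
  hypothesis for each member of the list, but no induction along the list.\<close>

lemma tree_induct [case_names Leaf Node Nil Cons]: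
 assumes "\<And>a. P (Leaf a)" and "\<And>x ts. Q ts ==> P (Node x ts)"
  and "Q []" and "\<And>t ts. P t ==> Q ts ==> Q (t # ts)"
 shows "P t" and "Q ts"
proof -
 have Q: "(\<forall>t\<in>set ts. P t) ==> Q ts" for ts by (induction ts) (auto intro: assms)
 show P: "P t" for t by (induction t) (auto intro: assms Q)
 show "Q ts" using P Q by blast
qed

fun shuffle_exp :: "int list => int list => int" where
 "shuffle_exp (y # ys) (z # zs) = z * sum_list ys + shuffle_exp ys zs"
| "shuffle_exp _ _ = 0"

lemma shuffle_sign_exp: "shuffle_sign ys zs = sg (shuffle_exp ys zs)"
 by (induction ys zs rule: shuffle_exp.induct) (auto simp: sg_add)

text \<open>Grafting a flat list of trees onto a forest, with the exponent of the Koszul sign. Unlike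
 \<open>graft_sign\<close>, the exponent is an exact integer, so that the identities between signs become
 bilinear identities of integers.\<close>

primrec fgraft ::
 "('i, 'e, 'v) dtree list => ('i, 'e, 'v) dtree list => ('i, 'e, 'v) dtree list" where
 "fgraft [] ts = []"
| "fgraft (u # us) ts =
  graft u (take (nleaves u) ts) # fgraft us (drop (nleaves u) ts)"

primrec graft_exp :: "('i, 'e, 'v) dtree => ('i, 'e, 'v) dtree list => int" where
 "graft_exp (Leaf a) = (%ts. 0)"
| "graft_exp (Node x us) = (%ts. let bs = blocks (map (length \<circ> leaves) us) ts in
  shuffle_exp (map tdeg us) (map (sum_list \<circ> map tdeg) bs) +
  sum_list (map2 (%g b. g b) (map graft_exp us) bs))"

primrec fgraft_exp :: "('i, 'e, 'v) dtree list => ('i, 'e, 'v) dtree list => int" where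
 "fgraft_exp [] ts = 0"
| "fgraft_exp (u # us) ts =
  deg_sum (take (nleaves u) ts) * deg_sum us + graft_exp u (take (nleaves u) ts) +
  fgraft_exp us (drop (nleaves u) ts)"

lemma prod_list_sg: "prod_list (map (%x. sg (f x)) xs) = sg (sum_list (map f xs))" by (induction xs) (auto simp: sg_add)

lemma graft_sign_exp: "(graft_sign T ts :: 'k::field) = sg (graft_exp T ts)"
proof (induction T arbitrary: ts)
 case (Node x us)
 have "prod_list (map2 (%g b. g b) (map graft_sign us) bs) =
   (sg (sum_list (map2 (%g b. g b) (map graft_exp us) bs)) :: 'k)" for bs
  using Node.IH
 proof (induction us arbitrary: bs)
  case (Cons u us)
  then show ?case by (cases bs) (simp_all add: sg_add)
 qed simp
 then show ?case by (simp add: Let_def shuffle_sign_exp sg_add)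
qed simp

lemma graft_Node: "graft (Node x us) ts = Node x (fgraft us ts)" by (simp, induction us arbitrary: ts) auto

lemma graft_exp_Node: "graft_exp (Node x us) ts = fgraft_exp us ts"
 by (simp add: Let_def, induction us arbitrary: ts) (auto simp: algebra_simps)

lemma fgraft_exp_blocks:
 "fgraft_exp us ts =
  shuffle_exp (map tdeg us) (map (sum_list \<circ> map tdeg) (blocks (map (length \<circ> leaves) us) ts)) +
  sum_list (map2 graft_exp us (blocks (map (length \<circ> leaves) us) ts))"
 by (induction us arbitrary: ts) (auto simp: algebra_simps)

lemma fgraft_blocks:
 "fgraft us ts = map2 graft us (blocks (map (length \<circ> leaves) us) ts)" by (induction us arbitrary: ts) auto

declare graft.simps(2) [simp del] graft_exp.simps(2) [simp del]

declare graft_Node [simp] graft_exp_Node [simp]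

lemma concat_blocks: "length ts = sum_list ns ==> concat (blocks ns ts) = ts" by (induction ns arbitrary: ts) auto

lemma length_blocks [simp]: "length (blocks ns ts) = length ns" by (induction ns arbitrary: ts) auto

lemma comp_Leaf [simp]: "tdeg \<circ> Leaf = (%_. 0)" "leaves \<circ> Leaf = (%a. [a])" "root \<circ> Leaf = (%a. a)"
 by auto

lemma length_fgraft [simp]: "length (fgraft us ts) = length us" by (induction us arbitrary: ts) auto

lemma fgraft_append:
 "length xs = length (fleaves as) ==>
 fgraft (as @ bs) (xs @ ys) = fgraft as xs @ fgraft bs ys" by (induction as arbitrary: xs) auto

text \<open>The mixed term is the sign of \<open>xs\<close>, which ends up in \<open>as\<close>,
  passing the decorations of \<open>bs\<close>.\<close>

lemma fgraft_exp_append: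
 "length xs = length (fleaves as) ==>
 fgraft_exp (as @ bs) (xs @ ys) =
  fgraft_exp as xs + deg_sum xs * deg_sum bs + fgraft_exp bs ys"
proof (induction as arbitrary: xs)
 case (Cons a as)
 define n where "n = nleaves a"
 have n: "n \<le> length xs" "length (drop n xs) = length (fleaves as)" using Cons.prems by (auto simp: n_def)
 have xs: "deg_sum xs = deg_sum (take n xs) + deg_sum (drop n xs)" by (metis append_take_drop_id map_append sum_list.append)
 show ?case using Cons.IH[OF n(2)] n(1) by (simp add: n_def[symmetric] xs algebra_simps)
qed simp

lemma fgraft_Leaf [simp]: "length ts = length as ==> fgraft (map Leaf as) ts = ts"
 by (induction as arbitrary: ts) (auto simp: length_Suc_conv)

lemma fgraft_exp_Leaf [simp]: "fgraft_exp (map Leaf as) ts = 0" by (induction as arbitrary: ts) auto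

lemma leaves_tdeg_graft:
 "length ts = nleaves T ==>
  leaves (graft T ts) = fleaves ts \<and> tdeg (graft T ts) = tdeg T + deg_sum ts"
 "length ts = length (fleaves us) ==>
  fleaves (fgraft us ts) = fleaves ts \<and>
  deg_sum (fgraft us ts) = deg_sum us + deg_sum ts"
proof (induction T and us arbitrary: ts and ts rule: tree_induct)
 case (Leaf a)
 then show ?case by (auto simp: length_Suc_conv)
next
 case (Cons t us)
 let ?n = "nleaves t"
 have ts: "fleaves ts = fleaves (take ?n ts) @ fleaves (drop ?n ts)"
  "deg_sum ts = deg_sum (take ?n ts) + deg_sum (drop ?n ts)"
  by (metis append_take_drop_id map_append concat_append sum_list.append)+
 show ?case
  using Cons.IH(1)[of "take ?n ts"] Cons.IH(2)[of "drop ?n ts"] Cons.prems by (simp add: ts)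
qed auto

lemmas leaves_graft [simp] = leaves_tdeg_graft(1)[THEN conjunct1]
 and tdeg_graft [simp] = leaves_tdeg_graft(1)[THEN conjunct2]
 and fleaves_graft [simp] = leaves_tdeg_graft(2)[THEN conjunct1]
 and deg_sum_graft [simp] = leaves_tdeg_graft(2)[THEN conjunct2]

lemma root_graft [simp]: "map root ts = leaves T ==> root (graft T ts) = root T" by (cases T) auto

lemma map_root_graft [simp]:
 "map root ts = fleaves us ==> map root (fgraft us ts) = map root us"
proof (induction us arbitrary: ts)
 case (Cons u us)
 have "map root (take (nleaves u) ts) = leaves u" "map root (drop (nleaves u) ts) = fleaves us"
  using Cons.prems by (simp_all add: take_map[symmetric] drop_map[symmetric])
 then show ?case using Cons.IH by simp
qed simp

text \<open>Both orders of gluing realise the same permutation of the decorations of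
  \<open>T\<close>, \<open>ts\<close> and \<open>zs\<close>. An exponent adds the products of
  degrees over the pairs that change places, and each pair does so at most once on either side;
  hence the equality holds in the integers and the induction is plain ring arithmetic.\<close>

lemma graft_assoc_aux:
 "length ts = nleaves T ==> length zs = length (fleaves ts) ==>
  graft (graft T ts) zs = graft T (fgraft ts zs) \<and>
  graft_exp T ts + graft_exp (graft T ts) zs =
   graft_exp T (fgraft ts zs) + fgraft_exp ts zs"
 "length ts = length (fleaves us) ==> length zs = length (fleaves ts) ==>
  fgraft (fgraft us ts) zs = fgraft us (fgraft ts zs) \<and>
  fgraft_exp us ts + fgraft_exp (fgraft us ts) zs =
   fgraft_exp us (fgraft ts zs) + fgraft_exp ts zs"
proof (induction T and us arbitrary: ts zs and ts zs rule: tree_induct)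
 case (Leaf a)
 then show ?case by (auto simp: length_Suc_conv)
next
 case (Cons u us)
 define a where "a = take (nleaves u) ts"
 define b where "b = drop (nleaves u) ts"
 define c where "c = take (length (fleaves a)) zs"
 define d where "d = drop (length (fleaves a)) zs"
 have ts: "ts = a @ b" and zs: "zs = c @ d" by (simp_all add: a_def b_def c_def d_def)
 have len: "length a = nleaves u" "length b = length (fleaves us)" using Cons.prems by (auto simp: a_def b_def)
 have len2: "length c = length (fleaves a)" "length d = length (fleaves b)" using Cons.prems by (auto simp: c_def d_def ts)
 show ?case
  using Cons.IH(1)[OF len(1) len2(1)] Cons.IH(2)[OF len(2) len2(2)] len len2
  by (simp add: ts zs fgraft_append fgraft_exp_append algebra_simps)
qed auto

lemmas graft_assoc = graft_assoc_aux(1)[THEN conjunct1]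
 and graft_exp_assoc = graft_assoc_aux(1)[THEN conjunct2]
 and fgraft_assoc = graft_assoc_aux(2)[THEN conjunct1]
 and fgraft_exp_assoc = graft_assoc_aux(2)[THEN conjunct2]

lemma graft_unit_aux:
 fixes T :: "('i, 'e, 'v) dtree" and us :: "('i, 'e, 'v) dtree list"
 shows "graft T (map Leaf (leaves T)) = T \<and> graft_exp T (map Leaf (leaves T)) = 0"
 "fgraft us (map Leaf (fleaves us)) = us \<and>
 fgraft_exp us (map Leaf (fleaves us)) = 0"
 by (induction T and us rule: tree_induct) (auto simp del: concat_map_singleton simp: take_map[symmetric] drop_map[symmetric])

lemmas graft_unit [simp] = graft_unit_aux(1)[THEN conjunct1]
 and graft_exp_unit [simp] = graft_unit_aux(1)[THEN conjunct2]

lemma leaves_corolla [simp]: "leaves (corolla x) = etop x"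
 and root_corolla [simp]: "root (corolla x) = ebot x"
 and tdeg_corolla [simp]: "tdeg (corolla x) = edeg x" by (simp_all add: corolla_def)

lemma graft_corolla [simp]: "length ts = length (etop x) ==> graft (corolla x) ts = Node x ts"
 and graft_exp_corolla [simp]: "graft_exp (corolla x) ts = 0" by (simp_all add: corolla_def)

text \<open>The sign is therefore constant on a \<open>tree_lin\<close> triple and can be pulled out
  of linear relations.\<close>

lemma graft_exp_deg_cong:
 fixes T :: "('i, 'e, 'v) dtree"
 shows "map tdeg ts = map tdeg ts' ==> graft_exp T ts = graft_exp T ts'"
 "map tdeg ts = map tdeg ts' ==>
  fgraft_exp (us :: ('i, 'e, 'v) dtree list) ts = fgraft_exp us ts'"
proof (induction T and us arbitrary: ts ts' and ts ts' rule: tree_induct)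
 case (Cons u us)
 have "map tdeg (take n ts) = map tdeg (take n ts')" "map tdeg (drop n ts) = map tdeg (drop n ts')" for n
  using Cons.prems by (metis take_map, metis drop_map)
 then show ?case using Cons.IH by (metis fgraft_exp.simps(2))
next
 case (Node x us)
 then show ?case by (metis graft_exp_Node)
qed simp_all

section \<open>Multilinearity\<close>

lemma tree_lin_same:
 assumes "tree_lin s a b t1 t2 t3"
 shows "tdeg t2 = tdeg t1" "tdeg t3 = tdeg t1" "leaves t2 = leaves t1" "leaves t3 = leaves t1"
  "root t2 = root t1" "root t3 = root t1" using assms by (induction) auto

lemma fgraft_Cons_append:
 "length xs = nleaves u ==> fgraft (u # us) (xs @ ys) = graft u xs # fgraft us ys" by simp

lemma tree_lin_graft_left:
 "tree_lin s a b t1 t2 t3 ==> length ts = nleaves t1 ==>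
 tree_lin s a b (graft t1 ts) (graft t2 ts) (graft t3 ts) \<and>
 graft_exp t2 ts = graft_exp t1 ts \<and> graft_exp t3 ts = graft_exp t1 ts"
proof (induction arbitrary: ts rule: tree_lin.induct)
 case (here p q n v us w)
 then show ?case by (auto intro: tree_lin.here)
next
 case (below t1 t2 t3 x l r)
 note same = tree_lin_same[OF below.hyps]
 define c where "c = take (length (fleaves l)) ts"
 define d where "d = take (nleaves t1) (drop (length (fleaves l)) ts)"
 define e where "e = drop (nleaves t1) (drop (length (fleaves l)) ts)"
 have ts: "ts = c @ d @ e" unfolding c_def d_def e_def by (simp only: append_take_drop_id)
 have len: "length c = length (fleaves l)" "length d = nleaves t1" using below.prems by (auto simp: c_def d_def)
 have "length d = nleaves t2" "length d = nleaves t3" using len same by auto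
 then show ?case
  using below.IH[OF len(2)] len by (auto simp: ts fgraft_append fgraft_exp_append same intro: tree_lin.below)
qed

lemma tree_lin_graft_right:
 assumes "tree_lin s a b t1 t2 t3"
 shows "Suc (length ls + length rs) = nleaves T ==>
  tree_lin s a b (graft T (ls @ t1 # rs)) (graft T (ls @ t2 # rs)) (graft T (ls @ t3 # rs))"
  and "Suc (length ls + length rs) = length (fleaves us) ==>
  \<exists>ls' rs' u1 u2 u3. tree_lin s a b u1 u2 u3 \<and>
   fgraft us (ls @ t1 # rs) = ls' @ u1 # rs' \<and>
   fgraft us (ls @ t2 # rs) = ls' @ u2 # rs' \<and>
   fgraft us (ls @ t3 # rs) = ls' @ u3 # rs'"
proof (induction T and us arbitrary: ls rs and ls rs rule: tree_induct)
 case (Leaf a)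
 then show ?case using assms by simp
next
 case (Node x us)
 then obtain ls' rs' u1 u2 u3 where
  "tree_lin s a b u1 u2 u3" "fgraft us (ls @ t1 # rs) = ls' @ u1 # rs'"
  "fgraft us (ls @ t2 # rs) = ls' @ u2 # rs'"
  "fgraft us (ls @ t3 # rs) = ls' @ u3 # rs'" by (metis leaves.simps(2))
 then show ?case by (auto intro: tree_lin.below)
next
 case (Cons u us)
 show ?case proof (cases "length ls < nleaves u")
  case True
  define c where "c = take (nleaves u - Suc (length ls)) rs"
  define d where "d = drop (nleaves u - Suc (length ls)) rs"
  have rs: "rs = c @ d" by (simp add: c_def d_def)
  have len: "Suc (length ls + length c) = nleaves u" using True Cons.prems by (auto simp: c_def)
  have g: "fgraft (u # us) ((ls @ t # c) @ d) = graft u (ls @ t # c) # fgraft us d" for t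
   using len by (intro fgraft_Cons_append) simp
  have g': "fgraft (u # us) (ls @ t # rs) = [] @ graft u (ls @ t # c) # fgraft us d" for t using g[of t] by (simp add: rs)
  show ?thesis using Cons.IH(1)[OF len] g' by blast
 next
  case False
  define c where "c = take (nleaves u) ls"
  define d where "d = drop (nleaves u) ls"
  have ls: "ls = c @ d" and lc: "length c = nleaves u" using False by (auto simp: c_def d_def)
  have len: "Suc (length d + length rs) = length (fleaves us)" using Cons.prems by (auto simp: ls lc)
  have g: "fgraft (u # us) (c @ (d @ t # rs)) = graft u c # fgraft us (d @ t # rs)" for t
   using lc by (intro fgraft_Cons_append) simp
  obtain ls' rs' u1 u2 u3 where *:
   "tree_lin s a b u1 u2 u3" "fgraft us (d @ t1 # rs) = ls' @ u1 # rs'"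
   "fgraft us (d @ t2 # rs) = ls' @ u2 # rs'"
   "fgraft us (d @ t3 # rs) = ls' @ u3 # rs'" using Cons.IH(2)[OF len] by blast
  show ?thesis
   apply (rule exI[of _ "graft u c # ls'"], rule exI[of _ rs']) using * g by (auto simp: ls)
 qed
qed simp

section \<open>Finite combinations of evaluations\<close>

text \<open>The functionals that represent tensors: on the test functions in \<open>F\<close> they only see finitely
 many pure tensors.\<close>

definition fcomb :: "'a set => ('a => 'k::field) set => (('a => 'k) => 'k) => bool" where
 "fcomb S F x \<longleftrightarrow>
  (\<exists>L. (\<forall>(a, s)\<in>set L. s \<in> S) \<and> (\<forall>phi\<in>F. x phi = (\<Sum>(a, s)\<leftarrow>L. a * phi s)))"

lemma fcombE:
 assumes "fcomb S F x"
 obtains L where "\<And>a s. (a, s) \<in> set L ==> s \<in> S" "\<And>phi. phi \<in> F ==> x phi = (\<Sum>(a, s)\<leftarrow>L. a * phi s)"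
 using assms unfolding fcomb_def by fast

lemma fcombI:
 assumes "\<And>a s. (a, s) \<in> set L ==> s \<in> S" "\<And>phi. phi \<in> F ==> x phi = (\<Sum>(a, s)\<leftarrow>L. a * phi s)"
 shows "fcomb S F x" unfolding fcomb_def using assms by (intro exI[of _ L]) auto

lemma fcomb_mono:
 "fcomb S F x ==> S \<subseteq> S' ==> F' \<subseteq> F ==> fcomb S' F' x" unfolding fcomb_def by (blast dest: subsetD)

lemma fcomb_cong:
 assumes "fcomb S F x" "phi \<in> F" "psi \<in> F" "\<And>s. s \<in> S ==> phi s = psi s"
 shows "x phi = x psi"
proof -
 obtain L where L: "\<And>a s. (a, s) \<in> set L ==> s \<in> S" "\<And>phi. phi \<in> F ==> x phi = (\<Sum>(a, s)\<leftarrow>L. a * phi s)"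
  using assms(1) by (rule fcombE) blast
 show ?thesis
  unfolding L(2)[OF assms(2)] L(2)[OF assms(3)] using L(1) assms(4) by (intro arg_cong[of _ _ sum_list] map_cong) auto
qed

text \<open>A tensor is linear only on the functions in \<open>F\<close>: \<open>ptens\<close> is
  set to zero at functions that are not multilinear, and two such functions may have a multilinear
  sum. This is why the rules for computing under a functional carry membership conditions.\<close>

lemma fcomb_lin:
 assumes "fcomb S F x" "phi \<in> F" "psi \<in> F" "chi \<in> F"
  and "\<And>s. s \<in> S ==> chi s = a * phi s + b * psi s"
 shows "x chi = a * x phi + b * x psi"
proof -
 obtain L where L: "\<And>a s. (a, s) \<in> set L ==> s \<in> S" "\<And>phi. phi \<in> F ==> x phi = (\<Sum>(a, s)\<leftarrow>L. a * phi s)"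
  using assms(1) by (rule fcombE) blast
 have *: "\<forall>p\<in>set L. snd p \<in> S" using L(1) by auto
 have "(\<Sum>(a, s)\<leftarrow>L. a * chi s) = a * (\<Sum>(a, s)\<leftarrow>L. a * phi s) + b * (\<Sum>(a, s)\<leftarrow>L. a * psi s)"
  using * by (induction L) (auto simp: algebra_simps assms(5))
 then show ?thesis using L(2) assms by simp
qed

lemma fcomb_mult:
 assumes "fcomb S F x" "phi \<in> F" "chi \<in> F" "\<And>s. s \<in> S ==> chi s = a * phi s"
 shows "x chi = a * x phi" using fcomb_lin[OF assms(1,2,2,3), of a 0] assms(4) by simp

lemma fcomb_add:
 assumes "fcomb S F x" "phi \<in> F" "psi \<in> F" "chi \<in> F" "\<And>s. s \<in> S ==> chi s = phi s + psi s"
 shows "x chi = x phi + x psi" using fcomb_lin[OF assms(1-4), of 1 1] assms(5) by simp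

lemma fcomb_zero:
 assumes "fcomb S F x" "chi \<in> F" "\<And>s. s \<in> S ==> chi s = 0"
 shows "x chi = 0" using fcomb_lin[OF assms(1,2,2,2), of 0 0] assms(3) by simp

lemma fcomb_point: "s \<in> S ==> fcomb S F (%phi. phi s)" by (rule fcombI[of "[(1, s)]"]) auto

lemma fcomb_0: "fcomb S F (%phi. 0)" by (rule fcombI[of "[]"]) auto

lemma fcomb_plus:
 assumes "fcomb S F x" "fcomb S F y"
 shows "fcomb S F (%phi. x phi + y phi)"
proof -
 obtain L where L: "\<And>a s. (a, s) \<in> set L ==> s \<in> S" "\<And>phi. phi \<in> F ==> x phi = (\<Sum>(a, s)\<leftarrow>L. a * phi s)"
  using assms(1) by (rule fcombE) blast
 obtain M where M: "\<And>a s. (a, s) \<in> set M ==> s \<in> S" "\<And>phi. phi \<in> F ==> y phi = (\<Sum>(a, s)\<leftarrow>M. a * phi s)"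
  using assms(2) by (rule fcombE) blast
 show ?thesis by (rule fcombI[of "L @ M"]) (auto simp: L M)
qed

lemma fcomb_scale:
 assumes "fcomb S F x"
 shows "fcomb S F (%phi. r * x phi)"
proof -
 obtain L where L: "\<And>a s. (a, s) \<in> set L ==> s \<in> S" "\<And>phi. phi \<in> F ==> x phi = (\<Sum>(a, s)\<leftarrow>L. a * phi s)"
  using assms(1) by (rule fcombE) blast
 have "r * (\<Sum>(a, s)\<leftarrow>L. a * phi s) = (\<Sum>(a, s)\<leftarrow>map (map_prod ((*) r) id) L. a * phi s)" for phi
  by (induction L) (auto simp: algebra_simps)
 then show ?thesis by (intro fcombI[of "map (map_prod ((*) r) id) L"]) (auto simp: L)
qed

text \<open>The linear extension of \<open>g\<close>, evaluated at \<open>x\<close>. All operations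
  on free objects have this shape.\<close>

lemma fcomb_bind:
 assumes "fcomb S F x" "\<And>s. s \<in> S ==> fcomb S' F' (g s)"
  and "\<And>phi. phi \<in> F' ==> (%s. g s phi) \<in> F"
 shows "fcomb S' F' (%phi. x (%s. g s phi))"
proof -
 obtain L where L: "\<And>a s. (a, s) \<in> set L ==> s \<in> S" "\<And>phi. phi \<in> F ==> x phi = (\<Sum>(a, s)\<leftarrow>L. a * phi s)"
  using assms(1) by (rule fcombE) blast
 have "fcomb S' F' (%phi. \<Sum>(a, s)\<leftarrow>L. a * g s phi)"
  using L(1)
 proof (induction L)
  case (Cons p L)
  obtain a s where p: "p = (a, s)" by force
  have "s \<in> S" using Cons.prems p by auto
  then have "fcomb S' F' (%phi. a * g s phi + (\<Sum>(a, s)\<leftarrow>L. a * g s phi))"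
   using Cons.IH Cons.prems by (intro fcomb_plus fcomb_scale assms(2)) auto
  then show ?case by (simp add: p)
 qed (simp add: fcomb_0)
 moreover have "x (%s. g s phi) = (\<Sum>(a, s)\<leftarrow>L. a * g s phi)" if "phi \<in> F'" for phi
  using L(2) assms(3) that by blast
 ultimately show ?thesis unfolding fcomb_def by auto
qed

lemma fcomb_image:
 assumes "fcomb S F x" "\<And>s. s \<in> S ==> h s \<in> S'" "\<And>phi. phi \<in> F' ==> (%s. c s * phi (h s)) \<in> F"
 shows "fcomb S' F' (%phi. x (%s. c s * phi (h s)))"
 using assms by (intro fcomb_bind[OF assms(1)] fcomb_scale fcomb_point) auto

text \<open>Interchange of two finite sums. Each functional is a finite sum only on its own class of
  functions, so the integrands must lie there both before and after the other functional has been
  applied.\<close>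

lemma fcomb_swap:
 assumes x: "fcomb S F x" and y: "fcomb S' F' y"
  and "\<And>s. s \<in> S ==> psi s \<in> F'" "\<And>s'. s' \<in> S' ==> (%s. psi s s') \<in> F"
  and "(%s. y (psi s)) \<in> F" "(%s'. x (%s. psi s s')) \<in> F'"
 shows "x (%s. y (psi s)) = y (%s'. x (%s. psi s s'))"
proof -
 obtain L where L: "\<And>a s. (a, s) \<in> set L ==> s \<in> S" "\<And>phi. phi \<in> F ==> x phi = (\<Sum>(a, s)\<leftarrow>L. a * phi s)"
  using x by (rule fcombE) blast
 obtain M where M: "\<And>a s. (a, s) \<in> set M ==> s \<in> S'" "\<And>phi. phi \<in> F' ==> y phi = (\<Sum>(a, s)\<leftarrow>M. a * phi s)"
  using y by (rule fcombE) blast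
 have "x (%s. y (psi s)) = (\<Sum>(a, s)\<leftarrow>L. a * y (psi s))" using L(2) assms(5) by blast
 also have "\<dots> = (\<Sum>(a, s)\<leftarrow>L. a * (\<Sum>(b, s')\<leftarrow>M. b * psi s s'))"
  using L(1) M(2) assms(3) by (intro arg_cong[of _ _ sum_list] map_cong) auto
 also have "\<dots> = (\<Sum>(b, s')\<leftarrow>M. b * (\<Sum>(a, s)\<leftarrow>L. a * psi s s'))" proof (induction L)
  case (Cons p L)
  have "(\<Sum>(b, s')\<leftarrow>M. b * (a * psi s s' + r s')) =
    a * (\<Sum>(b, s')\<leftarrow>M. b * psi s s') + (\<Sum>(b, s')\<leftarrow>M. b * r s')" for a s r
   by (induction M) (auto simp: algebra_simps)
  then show ?case using Cons by (cases p) simp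
 qed (simp add: case_prod_unfold)
 also have "\<dots> = (\<Sum>(b, s')\<leftarrow>M. b * x (%s. psi s s'))"
 proof (intro arg_cong[of _ _ sum_list] map_cong refl)
  fix q assume q: "q \<in> set M"
  obtain b s' where q': "q = (b, s')" by force
  then have "(%s. psi s s') \<in> F" using M(1) assms(4) q by blast
  then show "(case q of (b, s') => b * (\<Sum>(a, s)\<leftarrow>L. a * psi s s')) = (case q of (b, s') => b * x (%s. psi s s'))"
   using L(2) by (simp add: q')
 qed
 also have "\<dots> = y (%s'. x (%s. psi s s'))" using M(2) assms(6) by simp
 finally show ?thesis .
qed

lemma fcomb_sum:
 assumes "fcomb S F x" "finite I" "\<And>i. i \<in> I ==> phi i \<in> F" "(%s. \<Sum>i\<in>I. phi i s) \<in> F"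
 shows "x (%s. \<Sum>i\<in>I. phi i s) = (\<Sum>i\<in>I. x (phi i))"
proof -
 obtain L where L: "\<And>a s. (a, s) \<in> set L ==> s \<in> S" "\<And>phi. phi \<in> F ==> x phi = (\<Sum>(a, s)\<leftarrow>L. a * phi s)"
  using assms(1) by (rule fcombE) blast
 have "(\<Sum>(a, s)\<leftarrow>L. a * (\<Sum>i\<in>I. phi i s)) = (\<Sum>i\<in>I. \<Sum>(a, s)\<leftarrow>L. a * phi i s)"
  by (induction L) (auto simp: sum.distrib sum_distrib_left)
 then show ?thesis using L(2) assms(3,4) by simp
qed

section \<open>Trees and forests over a collection\<close>

abbreviation tcell :: "('i, 'e, 'v) dtree => ('i, 'e) cell" where
 "tcell T \<equiv> (leaves T, root T)"

definition forests :: "('k, 'i, 'e, 'v, 'z) coll_scheme => ('i, 'e) cell list => ('i, 'e, 'v) dtree list set"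
 where "forests V cs = {ts. set ts \<subseteq> trees V \<and> map tcell ts = cs}"

definition Mlin :: "('k::field, 'i, 'e, 'v::plus, 'z) coll_scheme => ('i, 'e) cell => (('i, 'e, 'v) dtree => 'k) set"
 where "Mlin V c = {phi. multilin (*) V c phi}"

text \<open>The test functions for the tensor product of the free complexes at the cells
  \<open>cs\<close>: a list of trees varies in one vertex of one member at a time.\<close>

definition FMlin ::
 "('k::field, 'i, 'e, 'v::plus, 'z) coll_scheme => ('i, 'e) cell list => (('i, 'e, 'v) dtree list => 'k) set"
 where "FMlin V cs = {psi. \<forall>ls t1 t2 t3 rs a b. ls @ t1 # rs \<in> forests V cs \<and> ls @ t2 # rs \<in> forests V cs \<and>
  ls @ t3 # rs \<in> forests V cs \<and> tree_lin (scl V) a b t1 t2 t3 \<longrightarrow>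
  psi (ls @ t3 # rs) = a * psi (ls @ t1 # rs) + b * psi (ls @ t2 # rs)}"

definition trdeg :: "('k, 'i, 'e, 'v, 'z) coll_scheme => ('i, 'e) cell => int => ('i, 'e, 'v) dtree set"
 where "trdeg V c n = {T \<in> trees_of V c. tdeg T = n}"

definition forests_deg :: "('k, 'i, 'e, 'v, 'z) coll_scheme => ('i, 'e) cell list => int => ('i, 'e, 'v) dtree list set"
 where "forests_deg V cs n = {ts \<in> forests V cs. deg_sum ts = n}"

lemma map_tcell_eqD:
 assumes "map tcell ss = map tcell ts"
 shows "map root ss = map root ts" "map leaves ss = map leaves ts"
 using arg_cong[OF assms, of "map snd"] arg_cong[OF assms, of "map fst"] by (simp_all add: o_def)

lemma trees_Node_iff [simp]:
 "Node x ts \<in> trees V \<longleftrightarrow> x \<in> elems V \<and> set ts \<subseteq> trees V \<and> map root ts = etop x"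
 by (auto elim: trees.cases intro: trees.node)

lemma trees_Leaf_iff: "Leaf a \<in> trees V \<longleftrightarrow> (\<exists>i\<in>objs V. \<exists>j\<in>objs V. a \<in> arrows V i j)"
 by (auto intro: trees.leaf) (erule trees.cases, auto)

lemma trees_of_iff [simp]: "T \<in> trees_of V c \<longleftrightarrow> T \<in> trees V \<and> tcell T = c"
 by (simp add: trees_of_def)

lemma trdeg_iff [simp]: "T \<in> trdeg V c n \<longleftrightarrow> T \<in> trees V \<and> tcell T = c \<and> tdeg T = n"
 by (auto simp: trdeg_def)

lemma forests_Nil [simp]: "[] \<in> forests V cs \<longleftrightarrow> cs = []" by (auto simp: forests_def)

lemma forests_Cons [simp]: "t # ts \<in> forests V (c # cs) \<longleftrightarrow> t \<in> trees V \<and> tcell t = c \<and> ts \<in> forests V cs"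
 by (auto simp: forests_def)

lemma forests_append: "as \<in> forests V ca ==> as @ bs \<in> forests V (ca @ cb) \<longleftrightarrow> bs \<in> forests V cb"
 by (auto simp: forests_def)

lemma Mlin_D:
 "phi \<in> Mlin V c ==> tree_lin (scl V) a b t1 t2 t3 ==> t1 \<in> trees V ==> t2 \<in> trees V ==> t3 \<in> trees V ==>
 tcell t1 = c ==> phi t3 = a * phi t1 + b * phi t2"
 using tree_lin_same[of "scl V" a b t1 t2 t3] by (auto simp: Mlin_def multilin_def)

lemma Mlin_I:
 assumes "\<And>a b t1 t2 t3. tree_lin (scl V) a b t1 t2 t3 ==> t1 \<in> trees V ==> t2 \<in> trees V ==> t3 \<in> trees V ==>
  tcell t1 = c ==> tcell t2 = c ==> tcell t3 = c ==> phi t3 = a * phi t1 + b * phi t2"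
 shows "phi \<in> Mlin V c" using assms by (auto simp: Mlin_def multilin_def)

lemma FMlin_D:
 "psi \<in> FMlin V cs ==> tree_lin (scl V) a b t1 t2 t3 ==> ls @ t1 # rs \<in> forests V cs ==>
 ls @ t2 # rs \<in> forests V cs ==> ls @ t3 # rs \<in> forests V cs ==>
 psi (ls @ t3 # rs) = a * psi (ls @ t1 # rs) + b * psi (ls @ t2 # rs)" by (auto simp: FMlin_def)

lemma FMlin_I:
 assumes "\<And>ls t1 t2 t3 rs a b. tree_lin (scl V) a b t1 t2 t3 ==> ls @ t1 # rs \<in> forests V cs ==>
 ls @ t2 # rs \<in> forests V cs ==> ls @ t3 # rs \<in> forests V cs ==>
 psi (ls @ t3 # rs) = a * psi (ls @ t1 # rs) + b * psi (ls @ t2 # rs)"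
 shows "psi \<in> FMlin V cs" using assms by (auto simp: FMlin_def)

lemma Mlin_0 [simp]: "(%T. 0) \<in> Mlin V c" and FMlin_0 [simp]: "(%T. 0) \<in> FMlin V cs"
 by (auto intro: Mlin_I FMlin_I)

lemma Mlin_plus: "phi \<in> Mlin V c ==> psi \<in> Mlin V c ==> (%T. phi T + psi T) \<in> Mlin V c"
 by (rule Mlin_I) (auto simp: Mlin_D algebra_simps)

lemma Mlin_deg: "phi \<in> Mlin V c ==> (%T. f (tdeg T) * phi T) \<in> Mlin V c"
 by (rule Mlin_I) (auto simp: Mlin_D algebra_simps tree_lin_same)

lemma FMlin_deg: "phi \<in> FMlin V c ==> (%ts. f (map tdeg ts) * phi ts) \<in> FMlin V c"
 by (rule FMlin_I) (simp add: FMlin_D algebra_simps tree_lin_same)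

lemma Mlin_scale: "phi \<in> Mlin V c ==> (%T. r * phi T) \<in> Mlin V c"
 using Mlin_deg[of phi V c "%_. r"] .

lemma Mlin_sum: "(\<And>i. i \<in> I ==> phi i \<in> Mlin V c) ==> (%T. \<Sum>i\<in>I. phi i T) \<in> Mlin V c"
 by (induction I rule: infinite_finite_induct) (auto intro: Mlin_plus)

lemma FMlin_append1:
 assumes "psi \<in> FMlin V (ca @ cb)" "bs \<in> forests V cb"
 shows "(%as. psi (as @ bs)) \<in> FMlin V ca"
proof (rule FMlin_I)
 fix ls t1 t2 t3 rs a b
 assume *: "tree_lin (scl V) a b t1 t2 t3" "ls @ t1 # rs \<in> forests V ca" "ls @ t2 # rs \<in> forests V ca"
  "ls @ t3 # rs \<in> forests V ca"
 show "psi ((ls @ t3 # rs) @ bs) = a * psi ((ls @ t1 # rs) @ bs) + b * psi ((ls @ t2 # rs) @ bs)"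
  using FMlin_D[OF assms(1) *(1), of ls "rs @ bs"] *(2-4)[THEN forests_append, THEN iffD2, OF assms(2)] by simp
qed

lemma FMlin_append2:
 assumes "psi \<in> FMlin V (ca @ cb)" "as \<in> forests V ca"
 shows "(%bs. psi (as @ bs)) \<in> FMlin V cb"
proof (rule FMlin_I)
 fix ls t1 t2 t3 rs a b
 assume *: "tree_lin (scl V) a b t1 t2 t3" "ls @ t1 # rs \<in> forests V cb" "ls @ t2 # rs \<in> forests V cb"
  "ls @ t3 # rs \<in> forests V cb"
 show "psi (as @ ls @ t3 # rs) = a * psi (as @ ls @ t1 # rs) + b * psi (as @ ls @ t2 # rs)"
  using FMlin_D[OF assms(1) *(1), of "as @ ls" rs] *(2-4) forests_append[OF assms(2), of _ cb] by simp
qed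

lemma FMlin_Cons1: "psi \<in> FMlin V (c # cs) ==> ts \<in> forests V cs ==> (%t. psi (t # ts)) \<in> Mlin V c"
 by (rule Mlin_I) (use FMlin_D[of psi V "c # cs" _ _ _ _ _ "[]"] in simp)

lemma FMlin_Cons2: "psi \<in> FMlin V (c # cs) ==> t \<in> trees V ==> tcell t = c ==> (%ts. psi (t # ts)) \<in> FMlin V cs"
 using FMlin_append2[of psi V "[c]" cs "[t]"] by simp

lemma FMlin_Node:
 assumes "phi \<in> Mlin V (concat (map fst cs), ebot x)" "x \<in> elems V" "map snd cs = etop x"
 shows "(%ts. phi (Node x ts)) \<in> FMlin V cs"
proof (rule FMlin_I)
 fix ls t1 t2 t3 rs a b
 assume *: "tree_lin (scl V) a b t1 t2 t3" "ls @ t1 # rs \<in> forests V cs"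
  "ls @ t2 # rs \<in> forests V cs" "ls @ t3 # rs \<in> forests V cs"
 have **: "set ts \<subseteq> trees V" "map root ts = map snd cs" "fleaves ts = concat (map fst cs)"
  if "ts \<in> forests V cs" for ts using that by (auto simp: forests_def o_def)
 show "phi (Node x (ls @ t3 # rs)) = a * phi (Node x (ls @ t1 # rs)) + b * phi (Node x (ls @ t2 # rs))"
  by (rule Mlin_D[OF assms(1) tree_lin.below[OF *(1)]])
   (use **[OF *(2)] **[OF *(3)] **[OF *(4)] assms in "simp_all del: map_append list.map concat_append set_append")
qed

lemma graft_trees:
 shows "T \<in> trees V ==> set ts \<subseteq> trees V ==> map root ts = leaves T ==> graft T ts \<in> trees V"
  and "set us \<subseteq> trees V ==> set ts \<subseteq> trees V ==> map root ts = fleaves us ==>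
    set (fgraft us ts) \<subseteq> trees V"
proof (induction T and us arbitrary: ts and ts rule: tree_induct)
 case (Leaf a)
 then show ?case by (cases ts) auto
next
 case (Cons u us)
 have "map root (take (nleaves u) ts) = leaves u" "map root (drop (nleaves u) ts) = fleaves us"
  using Cons.prems by (simp_all add: take_map[symmetric] drop_map[symmetric])
 moreover have "set (take (nleaves u) ts) \<subseteq> trees V" "set (drop (nleaves u) ts) \<subseteq> trees V"
  using Cons.prems by (meson order_trans set_take_subset set_drop_subset)+
 ultimately show ?case
  using Cons.IH(1)[of "take (nleaves u) ts"] Cons.IH(2)[of "drop (nleaves u) ts"] Cons.prems(1) by simp
qed simp_all

lemma map_root_length: "map root ts = leaves T ==> length ts = nleaves T" by (metis length_map)

lemma Mlin_graft:
 assumes "phi \<in> Mlin V (fleaves ts, t)" "set ts \<subseteq> trees V"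
 shows "(%T. sg (graft_exp T ts) * phi (graft T ts)) \<in> Mlin V (map root ts, t)"
proof (rule Mlin_I)
 fix a b t1 t2 t3
 assume *: "tree_lin (scl V) a b t1 t2 t3" "t1 \<in> trees V" "t2 \<in> trees V" "t3 \<in> trees V"
  "tcell t1 = (map root ts, t)" "tcell t2 = (map root ts, t)" "tcell t3 = (map root ts, t)"
 have r: "map root ts = leaves t1" "map root ts = leaves t2" "map root ts = leaves t3"
  and rt: "root t1 = t" "root t2 = t" "root t3 = t" using * by auto
 note len = r[THEN map_root_length]
 note g = tree_lin_graft_left[OF *(1) len(1)]
 have gt: "graft t1 ts \<in> trees V" "graft t2 ts \<in> trees V" "graft t3 ts \<in> trees V"
  using graft_trees(1) *(2-4) assms(2) r by metis+
 have gc: "tcell (graft t1 ts) = (fleaves ts, t)" using r(1) rt(1) len(1) by simp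
 have "phi (graft t3 ts) = a * phi (graft t1 ts) + b * phi (graft t2 ts)"
  by (rule Mlin_D[OF assms(1) g[THEN conjunct1] gt gc])
 then show "sg (graft_exp t3 ts) * phi (graft t3 ts) =
   a * (sg (graft_exp t1 ts) * phi (graft t1 ts)) + b * (sg (graft_exp t2 ts) * phi (graft t2 ts))"
  using g by (simp add: algebra_simps)
qed

lemma FMlin_graft:
 assumes "phi \<in> Mlin V (concat (map fst cs), root T)" "T \<in> trees V" "map snd cs = leaves T"
 shows "(%ts. sg (graft_exp T ts) * phi (graft T ts)) \<in> FMlin V cs"
proof (rule FMlin_I)
 fix ls t1 t2 t3 rs a b
 assume *: "tree_lin (scl V) a b t1 t2 t3" "ls @ t1 # rs \<in> forests V cs"
  "ls @ t2 # rs \<in> forests V cs" "ls @ t3 # rs \<in> forests V cs"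
 have **: "set ts \<subseteq> trees V" "map root ts = leaves T" "fleaves ts = concat (map fst cs)"
  "length ts = nleaves T"
  if "ts \<in> forests V cs" for ts using that assms(3) map_root_length[of ts T] by (auto simp: forests_def o_def)
 have e: "graft_exp T (ls @ t2 # rs) = graft_exp T (ls @ t1 # rs)"
  "graft_exp T (ls @ t3 # rs) = graft_exp T (ls @ t1 # rs)" by (rule graft_exp_deg_cong, simp add: tree_lin_same[OF *(1)])+
 have "phi (graft T (ls @ t3 # rs)) = a * phi (graft T (ls @ t1 # rs)) + b * phi (graft T (ls @ t2 # rs))"
  by (rule Mlin_D[OF assms(1) tree_lin_graft_right(1)[OF *(1)]])
   (use **[OF *(2)] **[OF *(3)] **[OF *(4)] assms graft_trees(1)[of T V] in
    \<open>simp_all del: map_append list.map concat_append set_append\<close>)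
 then show "sg (graft_exp T (ls @ t3 # rs)) * phi (graft T (ls @ t3 # rs)) =
  a * (sg (graft_exp T (ls @ t1 # rs)) * phi (graft T (ls @ t1 # rs))) +
  b * (sg (graft_exp T (ls @ t2 # rs)) * phi (graft T (ls @ t2 # rs)))" by (simp add: e algebra_simps)
qed

lemma Mlin_ptens: "ptens V T phi = (if phi \<in> Mlin V (tcell T) then phi T else 0)" by (simp add: ptens_def Mlin_def)

lemma on_cell_Mlin: "on_cell V c g phi = (if phi \<in> Mlin V c then g phi else 0)" by (simp add: on_cell_def Mlin_def)

lemma sum_list_fun: "(\<Sum>x\<leftarrow>xs. f x) y = (\<Sum>x\<leftarrow>xs. f x y)" for f :: "'a => 'b => 'c::ab_group_add"
 by (induction xs) auto

text \<open>This removes the linear algebra from what follows: membership in a span of pure tensors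
  becomes a finite sum formula on multilinear functions together with the value zero elsewhere. From
  such a formula the combination of pure tensors is read off, since the two functionals then agree
  at every function.\<close>

lemma ptens_span_iff:
 fixes V :: "('k::field, 'i, 'e, 'v::ab_group_add, 'z) coll_scheme"
 assumes S: "S \<subseteq> trees_of V c"
 shows "x \<in> module.span tscale (ptens V ` S) \<longleftrightarrow>
  fcomb S (Mlin V c) x \<and> (\<forall>phi. phi \<notin> Mlin V c \<longrightarrow> x phi = 0)"
proof -
 interpret M: vector_space "tscale :: 'k => ('k, 'i, 'e, 'v) tens => _" by (rule vector_space_tscale)
 let ?P = "ptens V ` S"
 show ?thesis proof
  assume "x \<in> M.span ?P"
  then show "fcomb (S) (Mlin V c) x \<and> (\<forall>phi. phi \<notin> Mlin V c \<longrightarrow> x phi = 0)"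
  proof (induction rule: M.span_induct_alt)
   case base
   then show ?case using fcomb_0 by (simp add: zero_fun_def)
  next
   case (step r y z)
   then obtain T where T: "y = ptens V T" "T \<in> S" "tcell T = c" using S by auto
   have "fcomb (S) (Mlin V c) (%phi. r * phi T + z phi)"
    using T step by (intro fcomb_plus fcomb_scale fcomb_point) auto
   then have 1: "fcomb (S) (Mlin V c) (tscale r y + z)" using T by (simp add: fcomb_def tscale_def Mlin_ptens)
   have 2: "(tscale r y + z) phi = 0" if "phi \<notin> Mlin V c" for phi
    using step T that by (auto simp: tscale_def Mlin_ptens)
   show ?case using 1 2 by blast
  qed
 next
  assume *: "fcomb (S) (Mlin V c) x \<and> (\<forall>phi. phi \<notin> Mlin V c \<longrightarrow> x phi = 0)"
  then have "fcomb (S) (Mlin V c) x" by blast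
  then obtain L where L: "\<And>a T. (a, T) \<in> set L ==> T \<in> S"
   "\<And>phi. phi \<in> Mlin V c ==> x phi = (\<Sum>(a, s)\<leftarrow>L. a * phi s)" by (rule fcombE) blast
  have c: "tcell T = c" if "(a, T) \<in> set L" for a T using L(1)[OF that] S by (auto dest: subsetD)
  have "x phi = (\<Sum>(a, T)\<leftarrow>L. tscale a (ptens V T)) phi" for phi proof (cases "phi \<in> Mlin V c")
   case True
   have "(\<Sum>(a, T)\<leftarrow>L. tscale a (ptens V T)) phi = (\<Sum>(a, s)\<leftarrow>L. a * phi s)"
    using c True unfolding sum_list_fun by (intro arg_cong[of _ _ sum_list] map_cong) (auto simp: tscale_def Mlin_ptens)
   then show ?thesis using L(2) True by simp
  next
   case False
   have "(\<Sum>(a, T)\<leftarrow>L. tscale a (ptens V T)) phi = (\<Sum>(a, s)\<leftarrow>L. 0)"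
    using c False unfolding sum_list_fun by (intro arg_cong[of _ _ sum_list] map_cong) (fastforce simp: tscale_def Mlin_ptens)+
   then show ?thesis using * False by (simp add: case_prod_unfold)
  qed
  then have x: "x = (\<Sum>(a, T)\<leftarrow>L. tscale a (ptens V T))" by blast
  have "(\<Sum>(a, T)\<leftarrow>L. tscale a (ptens V T)) \<in> M.span ?P"
   using L(1)
  proof (induction L)
   case (Cons p L)
   obtain a T where p: "p = (a, T)" by force
   have "ptens V T \<in> M.span ?P" using Cons.prems p by (intro M.span_base imageI) auto
   moreover have "(\<Sum>(a, T)\<leftarrow>L. tscale a (ptens V T)) \<in> M.span ?P" by (rule Cons.IH) (use Cons.prems in auto)
   ultimately have "tscale a (ptens V T) + (\<Sum>(a, T)\<leftarrow>L. tscale a (ptens V T)) \<in> M.span ?P"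
    by (intro M.span_add M.span_scale)
   then show ?case unfolding p by (simp only: list.map sum_list.Cons prod.case)
  qed (simp add: M.span_zero)
  then show "x \<in> M.span ?P" by (simp add: x)
 qed
qed

lemma free_cx_span: "free_cx V c n = module.span tscale (ptens V ` trdeg V c n)"
 unfolding free_cx_def by (rule arg_cong[of _ _ "module.span tscale"]) (auto simp: trdeg_def)

lemma free_cx_iff:
 fixes V :: "('k::field, 'i, 'e, 'v::ab_group_add, 'z) coll_scheme"
 shows "x \<in> free_cx V c n \<longleftrightarrow>
  fcomb (trdeg V c n) (Mlin V c) x \<and> (\<forall>phi. phi \<notin> Mlin V c \<longrightarrow> x phi = 0)"
 unfolding free_cx_span by (rule ptens_span_iff) (auto simp: trdeg_def)

lemma free_cx_fcomb:
 fixes V :: "('k::field, 'i, 'e, 'v::ab_group_add, 'z) coll_scheme"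
 shows "x \<in> free_cx V c n ==> fcomb (trdeg V c n) (Mlin V c) x" by (simp add: free_cx_iff)

lemma on_cell_free_cx:
 fixes V :: "('k::field, 'i, 'e, 'v::ab_group_add, 'z) coll_scheme"
 shows "fcomb (trdeg V c n) (Mlin V c) x ==> on_cell V c x \<in> free_cx V c n" by (auto simp: free_cx_iff fcomb_def on_cell_Mlin)

lemma ptens_free_cx:
 fixes V :: "('k::field, 'i, 'e, 'v::ab_group_add, 'z) coll_scheme"
 shows "T \<in> trees V ==> tcell T = c ==> tdeg T = n ==> ptens V T \<in> free_cx V c n"
 using on_cell_free_cx[of V c n "%phi. phi T"] fcomb_point[of T "trdeg V c n"]
 by (auto simp: on_cell_Mlin[abs_def] Mlin_ptens[abs_def])

lemma free_cx_subspace: "module.subspace tscale (free_cx V c n)"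
proof -
 interpret M: vector_space "tscale :: 'a::field => ('a, 'b, 'c, 'd) tens => _" by (rule vector_space_tscale)
 show "M.subspace (free_cx V c n)" by (simp add: free_cx_def)
qed

section \<open>Local operators\<close>

text \<open>The inner sum of \<open>at_vertices\<close>, made a notion of its own: the derivation of
  degree 1 on lists of trees, with the sign of passing the trees on the left. Trees and lists then
  satisfy a mutual recursion.\<close>

definition forest_at ::
 "(('i, 'e, 'v) el => ('i, 'e, 'v) dtree list => ('k::field, 'i, 'e, 'v) tens) =>
 ('i, 'e, 'v) dtree list => (('i, 'e, 'v) dtree list => 'k) => 'k" where
 "forest_at rho ts psi = (\<Sum>l<length ts. sg (deg_sum (take l ts)) *
  at_vertices rho (ts ! l) (%T. psi (ts[l := T])))"

lemma forest_at_Nil [simp]: "forest_at rho [] psi = 0" by (simp add: forest_at_def)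

lemma forest_at_Cons [simp]:
 "forest_at rho (t # ts) psi =
  at_vertices rho t (%t'. psi (t' # ts)) + sg (tdeg t) * forest_at rho ts (%ts'. psi (t # ts'))"
 by (simp add: forest_at_def sum.lessThan_Suc_shift sg_add sum_distrib_left algebra_simps del: sum.lessThan_Suc)

lemma at_vertices_Node:
 "at_vertices rho (Node x ts) phi = rho x ts phi + sg (edeg x) * forest_at rho ts (%ts'. phi (Node x ts'))"
 by (simp add: forest_at_def sg_add sum_distrib_left algebra_simps)

declare at_vertices.simps(2) [simp del]
declare at_vertices_Node [simp]

lemma forest_at_append:
 "forest_at rho (as @ bs) psi =
  forest_at rho as (%as'. psi (as' @ bs)) + sg (deg_sum as) * forest_at rho bs (%bs'. psi (as @ bs'))"
 by (induction as arbitrary: psi) (auto simp: sg_add algebra_simps)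

lemma forest_at_Leaf [simp]: "forest_at rho (map Leaf as) psi = 0" by (induction as arbitrary: psi) auto

text \<open>A modification at single vertices that raises the degree by one and respects
  multilinearity. It covers the derivations of free objects, where \<open>rho\<close> is
  \<open>insert_at \<theta>\<close>, and the bar differential, where \<open>rho\<close>
  differentiates a vertex or contracts a chord above it.\<close>

locale local_op =
 fixes V :: "('k::field, 'i, 'e, 'v::ab_group_add, 'z) coll_scheme"
  and rho :: "('i, 'e, 'v) el => ('i, 'e, 'v) dtree list => ('k, 'i, 'e, 'v) tens"
 assumes op_comb: "x \<in> elems V ==> set ts \<subseteq> trees V ==> map root ts = etop x ==>
   fcomb (trdeg V (fleaves ts, ebot x) (edeg x + deg_sum ts + 1))
    (Mlin V (fleaves ts, ebot x)) (rho x ts)"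
  and op_Mlin: "phi \<in> Mlin V c ==> (%T. case T of Leaf a => 0 | Node x ts => rho x ts phi) \<in> Mlin V c"
begin

lemma at_comb_aux:
 "T \<in> trees V ==>
  fcomb (trdeg V (tcell T) (tdeg T + 1)) (Mlin V (tcell T)) (at_vertices rho T)"
 "set ts \<subseteq> trees V ==>
  fcomb (forests_deg V (map tcell ts) (deg_sum ts + 1)) (FMlin V (map tcell ts)) (forest_at rho ts)"
proof (induction T and ts rule: tree_induct)
 case (Leaf a)
 then show ?case by (simp add: fcomb_0)
next
 case (Node x ts)
 let ?c = "(fleaves ts, ebot x)"
 have x: "x \<in> elems V" "set ts \<subseteq> trees V" "map root ts = etop x" using Node.prems by auto
 have 1: "fcomb (trdeg V ?c (edeg x + deg_sum ts + 1)) (Mlin V ?c)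
   (%phi. forest_at rho ts (%ts'. 1 * phi (Node x ts')))"
 proof (rule fcomb_image[OF Node.IH[OF x(2)]])
  show "Node x ts' \<in> trdeg V ?c (edeg x + deg_sum ts + 1)"
   if "ts' \<in> forests_deg V (map tcell ts) (deg_sum ts + 1)" for ts'
  proof -
   have "map root ts' = map root ts" "map leaves ts' = map leaves ts" "set ts' \<subseteq> trees V"
    using that by (auto simp: forests_deg_def forests_def dest: map_tcell_eqD)
   then show ?thesis using that x by (auto simp: forests_deg_def)
  qed
  show "(%ts'. 1 * phi (Node x ts')) \<in> FMlin V (map tcell ts)" if "phi \<in> Mlin V ?c" for phi
   using that x by (auto simp: o_def intro!: FMlin_Node)
 qed
 have "fcomb (trdeg V ?c (edeg x + deg_sum ts + 1)) (Mlin V ?c)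
   (%phi. rho x ts phi + sg (edeg x) * forest_at rho ts (%ts'. phi (Node x ts')))"
  using 1 by (intro fcomb_plus fcomb_scale op_comb x) simp
 then show ?case by (simp add: at_vertices_Node[abs_def])
next
 case Nil
 then show ?case by (simp add: fcomb_0)
next
 case (Cons t ts)
 let ?c = "tcell t" and ?cs = "map tcell ts"
 have ts: "t \<in> trees V" "set ts \<subseteq> trees V" "ts \<in> forests V ?cs" using Cons.prems by (auto simp: forests_def)
 have 1: "fcomb (forests_deg V (?c # ?cs) (tdeg t + deg_sum ts + 1)) (FMlin V (?c # ?cs))
   (%psi. at_vertices rho t (%t'. 1 * psi (t' # ts)))"
  by (rule fcomb_image[OF Cons.IH(1)]) (use ts in "auto simp: forests_deg_def intro: FMlin_Cons1")
 have 2: "fcomb (forests_deg V (?c # ?cs) (tdeg t + deg_sum ts + 1)) (FMlin V (?c # ?cs))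
   (%psi. forest_at rho ts (%ts'. 1 * psi (t # ts')))"
  by (rule fcomb_image[OF Cons.IH(2)]) (use ts in "auto simp: forests_deg_def intro: FMlin_Cons2")
 have "fcomb (forests_deg V (?c # ?cs) (tdeg t + deg_sum ts + 1)) (FMlin V (?c # ?cs))
   (%psi. at_vertices rho t (%t'. psi (t' # ts)) + sg (tdeg t) * forest_at rho ts (%ts'. psi (t # ts')))"
  using 1 2 by (intro fcomb_plus fcomb_scale) simp_all
 then show ?case by (simp add: forest_at_Cons[abs_def])
qed

lemmas at_comb = at_comb_aux(1) and forest_at_comb = at_comb_aux(2)

text \<open>The sum splits into the modifications to the left of the varying tree, inside it and to
  its right. In the outer groups linearity comes from \<open>psi\<close>, in the middle one from the
  hypothesis \<open>IH\<close>.\<close>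

lemma forest_at_step:
 assumes IH: "\<And>phi. phi \<in> Mlin V (tcell t1) ==>
   at_vertices rho t3 phi = a * at_vertices rho t1 phi + b * at_vertices rho t2 phi"
  and lin: "tree_lin (scl V) a b t1 t2 t3"
  and mem: "ls @ t1 # rs \<in> forests V cs" "ls @ t2 # rs \<in> forests V cs" "ls @ t3 # rs \<in> forests V cs"
  and psi: "psi \<in> FMlin V cs"
 shows "forest_at rho (ls @ t3 # rs) psi =
  a * forest_at rho (ls @ t1 # rs) psi + b * forest_at rho (ls @ t2 # rs) psi"
proof -
 let ?cl = "map tcell ls" and ?cr = "map tcell rs" and ?c = "tcell t1"
 note same = tree_lin_same[OF lin]
 have t: "t1 \<in> trees V" "t2 \<in> trees V" "t3 \<in> trees V" "ls \<in> forests V ?cl" "rs \<in> forests V ?cr"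
  and cs: "cs = ?cl @ ?c # ?cr" and lr: "set ls \<subseteq> trees V" "set rs \<subseteq> trees V"
  using mem by (auto simp: forests_def)
 have tr: "t1 # rs \<in> forests V (?c # ?cr)" "t2 # rs \<in> forests V (?c # ?cr)" "t3 # rs \<in> forests V (?c # ?cr)"
  using t same by auto
 have psi': "psi \<in> FMlin V (?cl @ ?c # ?cr)" using psi cs by simp
 have 1: "forest_at rho ls (%l. psi (l @ t3 # rs)) =
   a * forest_at rho ls (%l. psi (l @ t1 # rs)) + b * forest_at rho ls (%l. psi (l @ t2 # rs))"
 proof (rule fcomb_lin[OF forest_at_comb[OF lr(1)]])
  show "(%l. psi (l @ t1 # rs)) \<in> FMlin V ?cl" "(%l. psi (l @ t2 # rs)) \<in> FMlin V ?cl"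
   "(%l. psi (l @ t3 # rs)) \<in> FMlin V ?cl"
   using psi' tr by (auto intro!: FMlin_append1[of psi V ?cl "?c # ?cr"])
  show "psi (s @ t3 # rs) = a * psi (s @ t1 # rs) + b * psi (s @ t2 # rs)"
   if "s \<in> forests_deg V ?cl (deg_sum ls + 1)" for s
   by (rule FMlin_D[OF psi' lin]) (use that tr in "simp_all add: forests_deg_def forests_append")
 qed
 have m: "(%t. psi (ls @ t # rs)) \<in> Mlin V ?c"
  using FMlin_Cons1[OF FMlin_append2[OF psi' t(4)] t(5)] .
 have 2: "at_vertices rho t3 (%t. psi (ls @ t # rs)) =
  a * at_vertices rho t1 (%t. psi (ls @ t # rs)) + b * at_vertices rho t2 (%t. psi (ls @ t # rs))"
  by (rule IH[OF m])
 have 3: "forest_at rho rs (%r. psi (ls @ t3 # r)) =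
   a * forest_at rho rs (%r. psi (ls @ t1 # r)) + b * forest_at rho rs (%r. psi (ls @ t2 # r))"
 proof (rule fcomb_lin[OF forest_at_comb[OF lr(2)]])
  have "(%r. psi (ls @ t # r)) \<in> FMlin V ?cr" if "t \<in> trees V" "tcell t = ?c" for t
   using FMlin_Cons2[OF FMlin_append2[OF psi' t(4)] that] .
  then show "(%r. psi (ls @ t1 # r)) \<in> FMlin V ?cr" "(%r. psi (ls @ t2 # r)) \<in> FMlin V ?cr"
   "(%r. psi (ls @ t3 # r)) \<in> FMlin V ?cr" using t same by auto
  show "psi (ls @ t3 # s) = a * psi (ls @ t1 # s) + b * psi (ls @ t2 # s)"
   if "s \<in> forests_deg V ?cr (deg_sum rs + 1)" for s
   by (rule FMlin_D[OF psi' lin]) (use that t same in "simp_all add: forests_deg_def forests_append")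
 qed
 show ?thesis by (simp add: forest_at_append 1 2 3 same algebra_simps)
qed

lemma at_Mlin: 
 assumes "phi \<in> Mlin V c"
 shows "(%T. at_vertices rho T phi) \<in> Mlin V c"
proof (rule Mlin_I)
 fix a b t1 t2 t3
 assume "tree_lin (scl V) a b t1 t2 t3" "t1 \<in> trees V" "t2 \<in> trees V" "t3 \<in> trees V"
  "tcell t1 = c" "tcell t2 = c" "tcell t3 = c"
 then show "at_vertices rho t3 phi = a * at_vertices rho t1 phi + b * at_vertices rho t2 phi"
  using assms
 proof (induction arbitrary: c phi rule: tree_lin.induct)
  case (here p q n v ts w)
  let ?z = "scl V a v + scl V b w"
  have 1: "rho (El p q n ?z) ts phi = a * rho (El p q n v) ts phi + b * rho (El p q n w) ts phi"
   using Mlin_D[OF op_Mlin[OF here.prems(7)] tree_lin.here here.prems(1-4)] by simp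
  have ts: "set ts \<subseteq> trees V" using here.prems by auto
  have m: "(%ts'. phi (Node (El p q n u) ts')) \<in> FMlin V (map tcell ts)"
   if "Node (El p q n u) ts \<in> trees V" for u using that here.prems by (auto simp: o_def intro!: FMlin_Node)
  have 2: "forest_at rho ts (%ts'. phi (Node (El p q n ?z) ts')) =
   a * forest_at rho ts (%ts'. phi (Node (El p q n v) ts')) +
   b * forest_at rho ts (%ts'. phi (Node (El p q n w) ts'))"
  proof (rule fcomb_lin[OF forest_at_comb[OF ts]])
   fix s assume "s \<in> forests_deg V (map tcell ts) (deg_sum ts + 1)"
   then have s: "set s \<subseteq> trees V" "map root s = map root ts" "map leaves s = map leaves ts"
    by (auto simp: forests_deg_def forests_def dest: map_tcell_eqD)
   show "phi (Node (El p q n ?z) s) = a * phi (Node (El p q n v) s) + b * phi (Node (El p q n w) s)"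
    by (rule Mlin_D[OF here.prems(7) tree_lin.here]) (use s here.prems in auto)
  qed (use m here.prems in auto)
  show ?case by (simp add: 1 2 algebra_simps)
 next
  case (below t1 t2 t3 x l r)
  note same = tree_lin_same[OF below.hyps]
  let ?cs = "map tcell (l @ t1 # r)"
  have 1: "rho x (l @ t3 # r) phi = a * rho x (l @ t1 # r) phi + b * rho x (l @ t2 # r) phi"
   using Mlin_D[OF op_Mlin[OF below.prems(7)] tree_lin.below[OF below.hyps] below.prems(1-4)] by simp
  have m: "(%ts. phi (Node x ts)) \<in> FMlin V ?cs" using below.prems by (auto simp: o_def intro!: FMlin_Node)
  have 2: "forest_at rho (l @ t3 # r) (%ts. phi (Node x ts)) =
   a * forest_at rho (l @ t1 # r) (%ts. phi (Node x ts)) + b * forest_at rho (l @ t2 # r) (%ts. phi (Node x ts))"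
   by (rule forest_at_step[OF below.IH below.hyps _ _ _ m])
    (use below.prems same in "auto simp: forests_def")
  show ?case by (simp add: 1 2 algebra_simps)
 qed
qed

lemma forest_at_FMlin: 
 assumes "psi \<in> FMlin V cs"
 shows "(%ts. forest_at rho ts psi) \<in> FMlin V cs"
proof (rule FMlin_I)
 fix ls t1 t2 t3 rs a b
 assume *: "tree_lin (scl V) a b t1 t2 t3" "ls @ t1 # rs \<in> forests V cs" "ls @ t2 # rs \<in> forests V cs"
  "ls @ t3 # rs \<in> forests V cs"
 show "forest_at rho (ls @ t3 # rs) psi = a * forest_at rho (ls @ t1 # rs) psi + b * forest_at rho (ls @ t2 # rs) psi"
  by (rule forest_at_step[OF _ * assms], rule Mlin_D[OF at_Mlin *(1)])
   (use * tree_lin_same[OF *(1)] in "auto simp: forests_def")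
qed

end

section \<open>Multilinearity under a functional and in grafted forests\<close>

lemma fcomb_Mlin:
 assumes "fcomb S F x" "\<And>t. t \<in> trees V ==> tcell t = c ==> psi t \<in> F"
  and "\<And>s. s \<in> S ==> (%t. psi t s) \<in> Mlin V c"
 shows "(%t. x (psi t)) \<in> Mlin V c"
 by (rule Mlin_I, rule fcomb_lin[OF assms(1)]) (auto intro: assms(2) Mlin_D[OF assms(3)])

lemma fcomb_FMlin:
 assumes "fcomb S F x" "\<And>ts. ts \<in> forests V cs ==> psi ts \<in> F"
  and "\<And>s. s \<in> S ==> (%ts. psi ts s) \<in> FMlin V cs"
 shows "(%ts. x (psi ts)) \<in> FMlin V cs"
 by (rule FMlin_I, rule fcomb_lin[OF assms(1)]) (auto intro: assms(2) FMlin_D[OF assms(3)])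

lemma forests_rootD:
 "ts \<in> forests V cs ==> map root ts = map snd cs \<and> map leaves ts = map fst cs \<and>
  length ts = length cs \<and> set ts \<subseteq> trees V" by (auto simp: forests_def)

lemma fgraft_cells:
 "length ts = length (fleaves us) ==> map root ts = fleaves us ==>
 length us' = length us ==> map tcell us' = map tcell us ==> map tcell ts' = map tcell ts ==>
 map tcell (fgraft us' ts') = map tcell (fgraft us ts)"
proof (induction us arbitrary: us' ts ts')
 case (Cons u us)
 obtain v vs where us': "us' = v # vs" "tcell v = tcell u" "map tcell vs = map tcell us"
  "length vs = length us" using Cons.prems by (cases us') auto
 let ?n = "nleaves u"
 have c: "map tcell (take n ts') = map tcell (take n ts)"
  "map tcell (drop n ts') = map tcell (drop n ts)" for n
  using arg_cong[OF Cons.prems(5), of "take n"] arg_cong[OF Cons.prems(5), of "drop n"] by (simp_all add: take_map drop_map)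
 have r: "map root (take ?n ts) = leaves u" "map root (drop ?n ts) = fleaves us"
  using Cons.prems(2) by (simp_all add: take_map[symmetric] drop_map[symmetric])
 have l: "length (take ?n ts) = ?n" "length (take ?n ts') = ?n" using Cons.prems map_eq_imp_length_eq[OF Cons.prems(5)] by auto
 have "map tcell (fgraft vs (drop ?n ts')) = map tcell (fgraft us (drop ?n ts))"
  by (rule Cons.IH[OF _ r(2) us'(4,3) c(2)]) (use Cons.prems in auto)
 moreover have "map root (take ?n ts') = leaves u" using map_tcell_eqD(1)[OF c(1)[of ?n]] r(1) by simp
 moreover have "map leaves (take ?n ts') = map leaves (take ?n ts)"
  using map_tcell_eqD(2)[OF c(1)] .
 ultimately show ?case using us' r l by simp
qed simp

lemma FMlin_fgraft_left:
 assumes psi: "psi \<in> FMlin V (map tcell (fgraft us ts))"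
  and us: "set us \<subseteq> trees V" and ts: "set ts \<subseteq> trees V" "map root ts = fleaves us"
 shows "(%us'. sg (fgraft_exp us' ts) * psi (fgraft us' ts)) \<in> FMlin V (map tcell us)"
proof (rule FMlin_I)
 fix ls t1 t2 t3 rs a b
 assume *: "tree_lin (scl V) a b t1 t2 t3" "ls @ t1 # rs \<in> forests V (map tcell us)"
  "ls @ t2 # rs \<in> forests V (map tcell us)" "ls @ t3 # rs \<in> forests V (map tcell us)"
 note same = tree_lin_same[OF *(1)]
 have len: "length ts = length (fleaves us)" using ts(2) by (metis length_map)
 have lv: "map leaves (ls @ t1 # rs) = map leaves us" using *(2) by (intro map_tcell_eqD(2)) (simp add: forests_def)
 have len2: "length ts = length (fleaves ls) + (nleaves t1 + length (fleaves rs))" unfolding len lv[symmetric] by simp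
 define c where "c = take (length (fleaves ls)) ts"
 define d where "d = take (nleaves t1) (drop (length (fleaves ls)) ts)"
 define e where "e = drop (nleaves t1) (drop (length (fleaves ls)) ts)"
 have ts': "ts = c @ d @ e" unfolding c_def d_def e_def by (simp only: append_take_drop_id)
 have lens: "length c = length (fleaves ls)" "length d = nleaves t1" using len2 by (auto simp: c_def d_def)
 note g = tree_lin_graft_left[OF *(1) lens(2)]
 have gf: "fgraft (ls @ t # rs) ts = fgraft ls c @ graft t d # fgraft rs e"
  "fgraft_exp (ls @ t # rs) ts = fgraft_exp ls c + deg_sum c * (tdeg t + deg_sum rs) +
   (deg_sum d * deg_sum rs + graft_exp t d + fgraft_exp rs e)" if "nleaves t = nleaves t1" for t
  using lens that by (simp_all add: ts' fgraft_append fgraft_exp_append)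
 have mem: "fgraft us' ts \<in> forests V (map tcell (fgraft us ts))"
  if "us' \<in> forests V (map tcell us)" for us'
 proof -
  have "map tcell us' = map tcell us" "set us' \<subseteq> trees V" using that by (auto simp: forests_def)
  then have "map leaves us' = map leaves us" "length us' = length us"
   using map_tcell_eqD(2)[of us' us] map_eq_imp_length_eq by blast+
  then have "map root ts = fleaves us'" using ts by simp
  then show ?thesis
   using graft_trees(2)[OF \<open>set us' \<subseteq> trees V\<close> ts(1)] 
    fgraft_cells[OF len ts(2) \<open>length us' = length us\<close> \<open>map tcell us' = _\<close> refl]
   by (simp add: forests_def)
 qed
 have m: "fgraft ls c @ graft t d # fgraft rs e \<in> forests V (map tcell (fgraft us ts))"
  if "nleaves t = nleaves t1" "ls @ t # rs \<in> forests V (map tcell us)" for t using mem[OF that(2)] gf(1)[OF that(1)] by simp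
 have lc: "nleaves t2 = nleaves t1" "nleaves t3 = nleaves t1" using same by auto
 note m = m[OF refl *(2)] m[OF lc(1) *(3)] m[OF lc(2) *(4)]
 note gf = gf[of t1, OF refl] gf[OF lc(1)] gf[OF lc(2)]
 show "sg (fgraft_exp (ls @ t3 # rs) ts) * psi (fgraft (ls @ t3 # rs) ts) =
  a * (sg (fgraft_exp (ls @ t1 # rs) ts) * psi (fgraft (ls @ t1 # rs) ts)) +
  b * (sg (fgraft_exp (ls @ t2 # rs) ts) * psi (fgraft (ls @ t2 # rs) ts))"
  unfolding gf same g[THEN conjunct2, THEN conjunct1] g[THEN conjunct2, THEN conjunct2]
   FMlin_D[OF psi g[THEN conjunct1] m]
  by (simp only: distrib_left mult.left_commute)
qed

lemma FMlin_fgraft_right: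
 assumes psi: "psi \<in> FMlin V (map tcell (fgraft us ts))"
  and us: "set us \<subseteq> trees V" and ts: "set ts \<subseteq> trees V" "map root ts = fleaves us"
 shows "(%ts'. sg (fgraft_exp us ts') * psi (fgraft us ts')) \<in> FMlin V (map tcell ts)"
proof (rule FMlin_I)
 fix ls t1 t2 t3 rs a b
 assume *: "tree_lin (scl V) a b t1 t2 t3" "ls @ t1 # rs \<in> forests V (map tcell ts)"
  "ls @ t2 # rs \<in> forests V (map tcell ts)" "ls @ t3 # rs \<in> forests V (map tcell ts)"
 have len: "length ts = length (fleaves us)" using ts(2) by (metis length_map)
 have "length (ls @ t1 # rs) = length ts" using *(2) by (intro map_eq_imp_length_eq[of tcell _ tcell]) (simp add: forests_def)
 then have "Suc (length ls + length rs) = length (fleaves us)" using len by simp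
 from tree_lin_graft_right(2)[OF *(1) this] obtain ls' rs' u1 u2 u3 where g:
  "tree_lin (scl V) a b u1 u2 u3" "fgraft us (ls @ t1 # rs) = ls' @ u1 # rs'"
  "fgraft us (ls @ t2 # rs) = ls' @ u2 # rs'" "fgraft us (ls @ t3 # rs) = ls' @ u3 # rs'" by blast
 have mem: "fgraft us ts' \<in> forests V (map tcell (fgraft us ts))"
  if "ts' \<in> forests V (map tcell ts)" for ts'
 proof -
  have ts': "map tcell ts' = map tcell ts" "set ts' \<subseteq> trees V" using that by (auto simp: forests_def)
  have "map root ts' = fleaves us" using map_tcell_eqD(1)[OF ts'(1)] ts by simp
  then show ?thesis
   using graft_trees(2)[OF us ts'(2)] fgraft_cells[OF len ts(2) refl refl ts'(1)] by (simp add: forests_def)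
 qed
 have e: "fgraft_exp us (ls @ t2 # rs) = fgraft_exp us (ls @ t1 # rs)"
  "fgraft_exp us (ls @ t3 # rs) = fgraft_exp us (ls @ t1 # rs)" by (rule graft_exp_deg_cong, simp add: tree_lin_same[OF *(1)])+
 have "psi (ls' @ u3 # rs') = a * psi (ls' @ u1 # rs') + b * psi (ls' @ u2 # rs')"
  using mem[OF *(2)] mem[OF *(3)] mem[OF *(4)] by (intro FMlin_D[OF psi g(1)]) (simp_all add: g)
 then show "sg (fgraft_exp us (ls @ t3 # rs)) * psi (fgraft us (ls @ t3 # rs)) =
  a * (sg (fgraft_exp us (ls @ t1 # rs)) * psi (fgraft us (ls @ t1 # rs))) +
  b * (sg (fgraft_exp us (ls @ t2 # rs)) * psi (fgraft us (ls @ t2 # rs)))" by (simp add: e g algebra_simps)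
qed

lemma insert_at_exp: "insert_at \<theta> x ts phi = \<theta> x (%S. sg (graft_exp S ts) * phi (graft S ts))"
 by (simp add: insert_at_def graft_sign_exp)

section \<open>The free object\<close>

text \<open>\<open>\<theta> x\<close> is the value on the generator \<open>x\<close> of a derivation
  of degree 1 of the free object. That it squares to zero is added in
  \<open>differential_data\<close>.\<close>

locale derivation_data =
 fixes V :: "('k::field, 'i, 'e, 'v::ab_group_add) coll"
  and \<theta> :: "('i, 'e, 'v) el => ('k, 'i, 'e, 'v) tens"
 assumes \<theta>_comb: "x \<in> elems V ==>
   fcomb (trdeg V (etop x, ebot x) (edeg x + 1)) (Mlin V (etop x, ebot x)) (\<theta> x)"
  and \<theta>_lin: "phi \<in> Mlin V (s, t) ==> El s t n v \<in> elems V ==> El s t n w \<in> elems V ==>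
   El s t n (scl V a v + scl V b w) \<in> elems V ==>
   \<theta> (El s t n (scl V a v + scl V b w)) phi = a * \<theta> (El s t n v) phi + b * \<theta> (El s t n w) phi"
begin

abbreviation "D \<equiv> at_vertices (insert_at \<theta>)"
abbreviation "FD \<equiv> forest_at (insert_at \<theta>)"

lemma graft_term_Mlin:
 assumes "phi \<in> Mlin V (fleaves ts, t)" "set ts \<subseteq> trees V" "map root ts = s"
 shows "(%T. sg (graft_exp T ts) * phi (graft T ts)) \<in> Mlin V (s, t)"
 using Mlin_graft[OF assms(1,2)] assms(3) by simp

sublocale local_op V "insert_at \<theta>"
proof
 fix x ts
 assume x: "x \<in> elems V" "set ts \<subseteq> trees V" "map root ts = etop x"
 show "fcomb (trdeg V (fleaves ts, ebot x) (edeg x + deg_sum ts + 1))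
    (Mlin V (fleaves ts, ebot x)) (insert_at \<theta> x ts)"
  unfolding insert_at_exp[abs_def]
 proof (rule fcomb_image[OF \<theta>_comb[OF x(1)]])
  fix S assume S: "S \<in> trdeg V (etop x, ebot x) (edeg x + 1)"
  then have "map root ts = leaves S" using x by simp
  then show "graft S ts \<in> trdeg V (fleaves ts, ebot x) (edeg x + deg_sum ts + 1)"
   using S x(2) graft_trees(1)[of S V ts] map_root_length[of ts S] by simp
 qed (use x graft_term_Mlin in auto)
next
 fix phi c assume phi: "phi \<in> Mlin V c"
 show "(%T. case T of Leaf a => 0 | Node x ts => insert_at \<theta> x ts phi) \<in> Mlin V c" proof (rule Mlin_I)
  fix a b t1 t2 t3
  assume *: "tree_lin (scl V) a b t1 t2 t3" "t1 \<in> trees V" "t2 \<in> trees V" "t3 \<in> trees V"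
   "tcell t1 = c" "tcell t2 = c" "tcell t3 = c"
  show "(case t3 of Leaf a => 0 | Node x ts => insert_at \<theta> x ts phi) =
    a * (case t1 of Leaf a => 0 | Node x ts => insert_at \<theta> x ts phi) +
    b * (case t2 of Leaf a => 0 | Node x ts => insert_at \<theta> x ts phi)"
   using *(1)
  proof cases
   case (here p q n v ts w)
   then show ?thesis using * phi by (auto simp: insert_at_exp intro!: \<theta>_lin graft_term_Mlin)
  next
   case (below u1 u2 u3 x l r)
   let ?cs = "map tcell (l @ u1 # r)"
   note same = tree_lin_same[OF below(4)]
   have x: "x \<in> elems V" "map root (l @ u1 # r) = etop x" using below *(2) by auto
   have c: "c = (concat (map fst ?cs), ebot x)" using *(5) below by (auto simp: o_def)
   have fc: "l @ u \<in> forests V ?cs" if "u = u1 # r \<or> u = u2 # r \<or> u = u3 # r" for u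
    using that * below same by (auto simp: forests_def)
   have s: "fleaves (l @ u # r) = concat (map fst ?cs)" "set (l @ u # r) \<subseteq> trees V"
    "map root (l @ u # r) = etop x" if "u = u1 \<or> u = u2 \<or> u = u3" for u using that x * below same by (auto simp: o_def)
   have m: "(%S. sg (graft_exp S (l @ u # r)) * phi (graft S (l @ u # r))) \<in> Mlin V (etop x, ebot x)"
    if "u = u1 \<or> u = u2 \<or> u = u3" for u using s[OF that] phi c by (intro graft_term_Mlin) simp_all
   have "insert_at \<theta> x (l @ u3 # r) phi = a * insert_at \<theta> x (l @ u1 # r) phi + b * insert_at \<theta> x (l @ u2 # r) phi"
    unfolding insert_at_exp
   proof (rule fcomb_lin[OF \<theta>_comb[OF x(1)]])
    fix S assume "S \<in> trdeg V (etop x, ebot x) (edeg x + 1)"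
    then have "(%ts. sg (graft_exp S ts) * phi (graft S ts)) \<in> FMlin V ?cs"
     using phi x c by (intro FMlin_graft) (auto simp: o_def)
    from FMlin_D[OF this below(4)] fc
    show "sg (graft_exp S (l @ u3 # r)) * phi (graft S (l @ u3 # r)) =
      a * (sg (graft_exp S (l @ u1 # r)) * phi (graft S (l @ u1 # r))) +
      b * (sg (graft_exp S (l @ u2 # r)) * phi (graft S (l @ u2 # r)))" by blast
   qed (use m in blast)+
   then show ?thesis by (simp add: below)
  qed
 qed
qed

text \<open>Each vertex of a grafted tree comes from \<open>T\<close> or from one of
  \<open>ts\<close>, and in the second case the derivation has to pass all of \<open>T\<close>. This
  is the Leibniz rule of the free object on pure tensors.\<close>

lemma Leibniz_graft:
 "T \<in> trees V ==> set ts \<subseteq> trees V ==> map root ts = leaves T ==> phi \<in> Mlin V (fleaves ts, root T) ==>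
 sg (graft_exp T ts) * D (graft T ts) phi =
  D T (%S. sg (graft_exp S ts) * phi (graft S ts)) +
  sg (tdeg T) * FD ts (%ts'. sg (graft_exp T ts') * phi (graft T ts'))"
 "set us \<subseteq> trees V ==> set ts \<subseteq> trees V ==> map root ts = fleaves us ==>
 psi \<in> FMlin V (map tcell (fgraft us ts)) ==>
 sg (fgraft_exp us ts) * FD (fgraft us ts) psi =
  FD us (%us'. sg (fgraft_exp us' ts) * psi (fgraft us' ts)) +
  sg (deg_sum us) * FD ts (%ts'. sg (fgraft_exp us ts') * psi (fgraft us ts'))"
proof (induction T and us arbitrary: ts phi and ts psi rule: tree_induct)
 case (Leaf a)
 then obtain t where ts: "ts = [t]" "t \<in> trees V" "root t = a" by auto
 have 1: "D t phi = D t (%t'. (phi \<circ> hd) [t'])" by (simp add: o_def)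
 then show ?case by (simp add: ts)
next
 case (Node x us)
 let ?gs = "fgraft us ts"
 have x: "x \<in> elems V" "set us \<subseteq> trees V" "map root us = etop x" and r: "map root ts = fleaves us"
  using Node.prems by auto
 have len: "length ts = length (fleaves us)" using r by (metis length_map)
 have gs: "set ?gs \<subseteq> trees V" "map root ?gs = etop x" "fleaves ?gs = fleaves ts"
  using graft_trees(2)[OF x(2) Node.prems(2) r] r x len by auto
 have phi: "phi \<in> Mlin V (fleaves ts, ebot x)" using Node.prems by simp
 have m: "(%gs. phi (Node x gs)) \<in> FMlin V (map tcell ?gs)"
  using phi x gs by (intro FMlin_Node) (auto simp: o_def)
 \<comment> \<open>Replacing \<open>x\<close> by \<open>S\<close> before or after grafting
   \<open>ts\<close> gives the same tree, by associativity of grafting; the signs match by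
   \<open>graft_exp_assoc\<close>.\<close>
 have "insert_at \<theta> x us (%S. sg (graft_exp S ts) * phi (graft S ts)) =
   sg (fgraft_exp us ts) * insert_at \<theta> x ?gs phi"
  unfolding insert_at_exp
 proof (rule fcomb_mult[OF \<theta>_comb[OF x(1)]])
  show "(%S. sg (graft_exp S ?gs) * phi (graft S ?gs)) \<in> Mlin V (etop x, ebot x)"
   using phi gs by (intro graft_term_Mlin) simp_all
  have "(%S. sg (graft_exp S ts) * phi (graft S ts)) \<in> Mlin V (fleaves us, ebot x)"
   using phi r Node.prems(2) by (intro graft_term_Mlin)
  from graft_term_Mlin[OF this x(2,3)]
  show "(%S. sg (graft_exp S us) * (sg (graft_exp (graft S us) ts) * phi (graft (graft S us) ts)))
    \<in> Mlin V (etop x, ebot x)" .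
  fix S assume S: "S \<in> trdeg V (etop x, ebot x) (edeg x + 1)"
  have "length us = nleaves S" using S x by (intro map_root_length) simp
  note a = graft_assoc[OF this len] graft_exp_assoc[OF this len]
  have e: "sg (graft_exp S us) * (sg (graft_exp (graft S us) ts) * r) =
   sg (fgraft_exp us ts) * (sg (graft_exp S ?gs) * r)" for r :: 'k
   unfolding mult.assoc[symmetric] sg_add[symmetric] a(2) by (simp add: add.commute)
  show "sg (graft_exp S us) * (sg (graft_exp (graft S us) ts) * phi (graft (graft S us) ts)) =
   sg (fgraft_exp us ts) * (sg (graft_exp S ?gs) * phi (graft S ?gs))" by (simp only: a(1) e)
 qed
 then show ?case using Node.IH[OF x(2) Node.prems(2) r m] by (simp add: sg_add algebra_simps)
next
 case Nil
 then show ?case by simp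
next
 case (Cons u us)
 define a where "a = take (nleaves u) ts"
 define b where "b = drop (nleaves u) ts"
 have ts: "ts = a @ b" by (simp add: a_def b_def)
 have mem: "u \<in> trees V" "set us \<subseteq> trees V" "set a \<subseteq> trees V" "set b \<subseteq> trees V"
  using Cons.prems by (auto simp: ts)
 have r: "map root a = leaves u" "map root b = fleaves us"
  using Cons.prems by (simp_all add: a_def b_def take_map[symmetric] drop_map[symmetric])
 have la: "length a = nleaves u" using r by (metis length_map)
 have lb: "length b = length (fleaves us)" using r by (metis length_map)
 let ?g = "graft u a" and ?h = "fgraft us b"
 have gh: "fgraft (u # us) ts = ?g # ?h" using la by (simp add: ts)
 have ghm: "?g \<in> trees V" "set ?h \<subseteq> trees V" "?h \<in> forests V (map tcell ?h)"
  using graft_trees(1)[OF mem(1,3) r(1)] graft_trees(2)[OF mem(2,4) r(2)] by (simp_all add: forests_def)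
 have gc: "tcell ?g = (fleaves a, root u)" using r la by simp
 have psi: "psi \<in> FMlin V (tcell ?g # map tcell ?h)" using Cons.prems(4) unfolding gh by simp
 have left: "(%us'. sg (fgraft_exp us' ts) * psi (fgraft us' ts)) \<in>
   FMlin V (tcell u # map tcell us)" using FMlin_fgraft_left[OF Cons.prems(4,1,2,3)] by simp
 have right: "(%ts'. sg (fgraft_exp (u # us) ts') * psi (fgraft (u # us) ts')) \<in>
   FMlin V (map tcell a @ map tcell b)" using FMlin_fgraft_right[OF Cons.prems(4,1,2,3)] by (simp add: ts)
 have m1: "(%g. psi (g # ?h)) \<in> Mlin V (fleaves a, root u)" using FMlin_Cons1[OF psi ghm(3)] gc by simp
 have m2: "(%h. psi (?g # h)) \<in> FMlin V (map tcell ?h)" using FMlin_Cons2[OF psi ghm(1)] by simp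
 note IH1 = Cons.IH(1)[OF mem(1,3) r(1) m1] and IH2 = Cons.IH(2)[OF mem(2,4) r(2) m2]
 have usf: "us \<in> forests V (map tcell us)" "b \<in> forests V (map tcell b)" "a \<in> forests V (map tcell a)"
  using mem by (auto simp: forests_def)
 \<comment> \<open>The derivation acts on \<open>u\<close>, \<open>us\<close>, \<open>a\<close> or
   \<open>b\<close>. On the trees it produces the degree is raised by one, whence the shifted
   degrees in \<open>2\<close> and \<open>3\<close>, where it acts on one of the two factors of the
   exponent \<open>deg_sum a * deg_sum us\<close>.\<close>
 have 1: "D u (%u'. sg (fgraft_exp (u' # us) ts) * psi (fgraft (u' # us) ts)) =
   sg (deg_sum a * deg_sum us + fgraft_exp us b) * D u (%S. sg (graft_exp S a) * psi (graft S a # ?h))"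
 proof (rule fcomb_mult[OF at_comb[OF mem(1)]])
  show "(%S. sg (graft_exp S a) * psi (graft S a # ?h)) \<in> Mlin V (tcell u)"
   using m1 mem r by (intro graft_term_Mlin)
  show "(%u'. sg (fgraft_exp (u' # us) ts) * psi (fgraft (u' # us) ts)) \<in> Mlin V (tcell u)"
   by (rule FMlin_Cons1[OF left usf(1)])
 qed (use la in "auto simp: ts sg_add")
 have 2: "FD us (%us'. sg (fgraft_exp (u # us') ts) * psi (fgraft (u # us') ts)) =
   sg (deg_sum a * (deg_sum us + 1) + graft_exp u a) *
   FD us (%us'. sg (fgraft_exp us' b) * psi (?g # fgraft us' b))"
 proof (rule fcomb_mult[OF forest_at_comb[OF mem(2)]])
  show "(%us'. sg (fgraft_exp us' b) * psi (?g # fgraft us' b)) \<in> FMlin V (map tcell us)"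
   by (rule FMlin_fgraft_left[OF m2 mem(2,4) r(2)])
  show "(%us'. sg (fgraft_exp (u # us') ts) * psi (fgraft (u # us') ts)) \<in> FMlin V (map tcell us)"
   by (rule FMlin_Cons2[OF left mem(1) refl])
 qed (use la in "auto simp: ts forests_deg_def sg_add")
 have 3: "FD a (%a'. sg (fgraft_exp (u # us) (a' @ b)) * psi (fgraft (u # us) (a' @ b))) =
   sg ((deg_sum a + 1) * deg_sum us + fgraft_exp us b) *
   FD a (%a'. sg (graft_exp u a') * psi (graft u a' # ?h))"
 proof (rule fcomb_mult[OF forest_at_comb[OF mem(3)]])
  show "(%a'. sg (graft_exp u a') * psi (graft u a' # ?h)) \<in> FMlin V (map tcell a)"
   using m1 mem r by (intro FMlin_graft) (auto simp: o_def)
  show "(%a'. sg (fgraft_exp (u # us) (a' @ b)) * psi (fgraft (u # us) (a' @ b))) \<in> FMlin V (map tcell a)"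
   by (rule FMlin_append1[OF right usf(2)])
  fix s assume "s \<in> forests_deg V (map tcell a) (deg_sum a + 1)"
  then have "length s = nleaves u" "deg_sum s = deg_sum a + 1" using la forests_rootD[of s V] by (auto simp: forests_deg_def)
  then show "sg (fgraft_exp (u # us) (s @ b)) * psi (fgraft (u # us) (s @ b)) =
   sg ((deg_sum a + 1) * deg_sum us + fgraft_exp us b) * (sg (graft_exp u s) * psi (graft u s # ?h))" by (simp add: sg_add)
 qed
 have 4: "FD b (%b'. sg (fgraft_exp (u # us) (a @ b')) * psi (fgraft (u # us) (a @ b'))) =
   sg (deg_sum a * deg_sum us + graft_exp u a) *
   FD b (%b'. sg (fgraft_exp us b') * psi (?g # fgraft us b'))"
 proof (rule fcomb_mult[OF forest_at_comb[OF mem(4)]])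
  show "(%b'. sg (fgraft_exp us b') * psi (?g # fgraft us b')) \<in> FMlin V (map tcell b)"
   by (rule FMlin_fgraft_right[OF m2 mem(2,4) r(2)])
  show "(%b'. sg (fgraft_exp (u # us) (a @ b')) * psi (fgraft (u # us) (a @ b'))) \<in> FMlin V (map tcell b)"
   by (rule FMlin_append2[OF right usf(3)])
 qed (use la in "auto simp: sg_add")
 have e: "fgraft_exp (u # us) ts = deg_sum a * deg_sum us + graft_exp u a + fgraft_exp us b" using la by (simp add: ts)
 have tdg: "tdeg ?g = tdeg u + deg_sum a" using la by simp
 define X1 where "X1 = D u (%S. sg (graft_exp S a) * psi (graft S a # ?h))"
 define X2 where "X2 = FD us (%us'. sg (fgraft_exp us' b) * psi (?g # fgraft us' b))"
 define X3 where "X3 = FD a (%a'. sg (graft_exp u a') * psi (graft u a' # ?h))"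
 define X4 where "X4 = FD b (%b'. sg (fgraft_exp us b') * psi (?g # fgraft us b'))"
 have "sg (fgraft_exp (u # us) ts) * FD (fgraft (u # us) ts) psi =
  sg (deg_sum a * deg_sum us + fgraft_exp us b) * (sg (graft_exp u a) * D ?g (%g. psi (g # ?h))) +
  sg (tdeg u + deg_sum a + deg_sum a * deg_sum us + graft_exp u a) *
   (sg (fgraft_exp us b) * FD ?h (%h. psi (?g # h)))"
  unfolding gh by (simp only: forest_at_Cons e tdg) (simp add: sg_add algebra_simps)
 also have "\<dots> = sg (deg_sum a * deg_sum us + fgraft_exp us b) * (X1 + sg (tdeg u) * X3) +
  sg (tdeg u + deg_sum a + deg_sum a * deg_sum us + graft_exp u a) * (X2 + sg (deg_sum us) * X4)"
  unfolding IH1 IH2 X1_def X2_def X3_def X4_def ..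
 also have "\<dots> = sg (deg_sum a * deg_sum us + fgraft_exp us b) * X1 +
   sg (tdeg u) * (sg (deg_sum a * (deg_sum us + 1) + graft_exp u a) * X2) +
   sg (tdeg u + deg_sum us) * (sg ((deg_sum a + 1) * deg_sum us + fgraft_exp us b) * X3 +
    sg (deg_sum a) * (sg (deg_sum a * deg_sum us + graft_exp u a) * X4))" by (simp add: sg_add algebra_simps)
 also have "\<dots> = FD (u # us) (%us'. sg (fgraft_exp us' ts) * psi (fgraft us' ts)) +
   sg (tdeg u + deg_sum us) * FD (a @ b) (%ts'. sg (fgraft_exp (u # us) ts') * psi (fgraft (u # us) ts'))"
  unfolding forest_at_Cons forest_at_append 1 2 3 4 X1_def X2_def X3_def X4_def ..
 finally show ?case by (simp only: ts list.map sum_list.Cons)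
qed

end

lemma free_cx_lin:
 fixes V :: "('k::field, 'i, 'e, 'v::plus, 'z) coll_scheme"
 assumes "v \<in> free_cx V c n" "w \<in> free_cx V c n"
 shows "tscale a v + tscale b w \<in> free_cx V c n"
proof -
 interpret M: vector_space "tscale :: 'k => ('k, 'i, 'e, 'v) tens => _" by (rule vector_space_tscale)
 show ?thesis using assms unfolding free_cx_def by (intro M.span_add M.span_scale)
qed

section \<open>Cells\<close>

lemma is_path_append:
 "i \<in> objs V ==> is_path V i (s @ s') j \<longleftrightarrow> (\<exists>l\<in>objs V. is_path V i s l \<and> is_path V l s' j)"
 by (induction s arbitrary: i) auto

lemma cells_iff:
 "(s, t) \<in> cells V \<longleftrightarrow> s \<noteq> [] \<and> (\<exists>i\<in>objs V. \<exists>j\<in>objs V. is_path V i s j \<and> t \<in> arrows V i j)"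
proof -
 have "(\<exists>n\<in>{1..}. length s = n) \<longleftrightarrow> s \<noteq> []" by (cases s) auto
 then show ?thesis unfolding cells_def Path_def by auto
qed

lemma arrows_unique: "t \<in> arrows V i j ==> t \<in> arrows V i' j' ==> i' = i \<and> j' = j" by (auto simp: arrows_def)

text \<open>The end points are part of an arrow, so a cell whose bottom is an arrow of the path has
  a top that starts and ends where this arrow does.\<close>

lemma path_concat:
 "i \<in> objs V ==> is_path V i (map snd cs) j ==> set cs \<subseteq> cells V ==>
 is_path V i (concat (map fst cs)) j \<and> (cs \<noteq> [] \<longrightarrow> concat (map fst cs) \<noteq> [])"
proof (induction cs arbitrary: i)
 case (Cons c cs)
 obtain s t where c: "c = (s, t)" by (cases c)
 obtain l where l: "l \<in> objs V" "t \<in> arrows V i l" "is_path V l (map snd cs) j" using Cons.prems by (auto simp: c)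
 obtain i' l' where "s \<noteq> []" "is_path V i' s l'" "t \<in> arrows V i' l'" using Cons.prems by (auto simp: c cells_iff)
 then have "s \<noteq> []" "is_path V i s l" using arrows_unique l(2) by metis+
 then show ?case using Cons.IH[OF l(1,3)] Cons.prems l(1) by (auto simp: c is_path_append)
qed simp

lemma cells_concat:
 assumes "(map snd cs, t) \<in> cells V" "set cs \<subseteq> cells V"
 shows "(concat (map fst cs), t) \<in> cells V" using assms path_concat[of _ V cs] unfolding cells_iff by fastforce

lemma cells_Leaf: "i \<in> objs V ==> j \<in> objs V ==> a \<in> arrows V i j ==> ([a], a) \<in> cells V" by (auto simp: cells_iff)

lemma trees_cells: "T \<in> trees V ==> tcell T \<in> cells V"
proof (induction rule: trees.induct)
 case (node x ts)
 have "(concat (map fst (map tcell ts)), ebot x) \<in> cells V" using node by (intro cells_concat) (auto simp: o_def elems_def)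
 then show ?case by (simp add: o_def)
qed (auto intro: cells_Leaf)

lemma is_path_cong:
 assumes "objs V = objs W" "onemor V = onemor W"
 shows "is_path V i s j \<longleftrightarrow> is_path W i s j" "arrows V = arrows W"
 using assms by (induction s arbitrary: i) (auto simp: arrows_def fun_eq_iff)

lemma cells_cong:
 assumes "objs V = objs W" "onemor V = onemor W"
 shows "cells V = cells W" using is_path_cong[OF assms] assms by (auto simp: cells_iff)

section \<open>The free object is an object of 2-Cat\<close>

text \<open>The two mixed terms, in which one operator acts on \<open>t\<close> and the other on
  \<open>ts\<close>, cancel: if \<open>t\<close> is modified first, its degree has grown by one when
  \<open>ts\<close> is reached, which reverses the sign of passing \<open>t\<close>.\<close>

lemma (in local_op) square_Cons:
 assumes "t \<in> trees V" "set ts \<subseteq> trees V" "psi \<in> FMlin V (map tcell (t # ts))"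
  and "\<And>phi. phi \<in> Mlin V (tcell t) ==> at_vertices rho t (%S. at_vertices rho S phi) = 0"
  and "\<And>psi. psi \<in> FMlin V (map tcell ts) ==> forest_at rho ts (%ts'. forest_at rho ts' psi) = 0"
 shows "forest_at rho (t # ts) (%ts'. forest_at rho ts' psi) = 0"
proof -
 let ?c = "tcell t" and ?cs = "map tcell ts"
 have t: "t \<in> trees V" and ts: "set ts \<subseteq> trees V" and tsf: "ts \<in> forests V ?cs"
  using assms(1,2) by (auto simp: forests_def)
 have psi: "psi \<in> FMlin V (?c # ?cs)" using assms(3) by simp
 note ft = at_comb[OF t] and fts = forest_at_comb[OF ts]
 have a1: "(%t'. psi (t' # us)) \<in> Mlin V ?c" if "us \<in> forests V ?cs" for us
  by (rule FMlin_Cons1[OF psi that])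
 have a2: "(%us. psi (t' # us)) \<in> FMlin V ?cs" if "t' \<in> trees V" "tcell t' = ?c" for t'
  by (rule FMlin_Cons2[OF psi that])
 note F = forest_at_FMlin[OF psi]
 have b1: "(%t'. forest_at rho ts (%us. psi (t' # us))) \<in> Mlin V ?c"
  by (rule fcomb_Mlin[OF fts]) (auto simp: forests_deg_def intro: a1 a2)
 have b2: "(%us. at_vertices rho t (%t'. psi (t' # us))) \<in> FMlin V ?cs"
  by (rule fcomb_FMlin[OF ft]) (use a1 a2 in auto)
 have 1: "at_vertices rho t (%t'. forest_at rho (t' # ts) psi) = 1 * at_vertices rho t (%t'. at_vertices rho t' (%t''. psi (t'' # ts))) +
   sg (tdeg t + 1) * at_vertices rho t (%t'. forest_at rho ts (%us. psi (t' # us)))"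
  by (rule fcomb_lin[OF ft at_Mlin[OF a1[OF tsf]] b1 FMlin_Cons1[OF F tsf]]) simp
 have 2: "forest_at rho ts (%ts'. forest_at rho (t # ts') psi) = 1 * forest_at rho ts (%us. at_vertices rho t (%t'. psi (t' # us))) +
   sg (tdeg t) * forest_at rho ts (%ts'. forest_at rho ts' (%us. psi (t # us)))"
  by (rule fcomb_lin[OF fts b2 forest_at_FMlin[OF a2[OF t refl]] FMlin_Cons2[OF F t refl]]) simp
 have 3: "at_vertices rho t (%t'. forest_at rho ts (%us. psi (t' # us))) = forest_at rho ts (%us. at_vertices rho t (%t'. psi (t' # us)))"
  by (rule fcomb_swap[OF ft fts]) (use a1 a2 b1 b2 in "auto simp: forests_deg_def")
 have "forest_at rho (t # ts) (%ts'. forest_at rho ts' psi) = at_vertices rho t (%t'. forest_at rho (t' # ts) psi) + sg (tdeg t) * forest_at rho ts (%ts'. forest_at rho (t # ts') psi)"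
  by (rule forest_at_Cons)
 also have "\<dots> = 0"
  unfolding 1 2 3 assms(4)[OF a1[OF tsf]] assms(5)[OF a2[OF t refl]] by (simp add: sg_add) (simp add: sg_def)
 finally show ?thesis .
qed

text \<open>The square of a derivation of degree 1 is again a derivation, so it vanishes once it
  does on generators, which is \<open>\<theta>_sq\<close>.\<close>

locale differential_data = derivation_data +
 assumes vs: "vector_space (scl V)"
  and \<theta>_sq: "x \<in> elems V ==> phi \<in> Mlin V (etop x, ebot x) ==>
   \<theta> x (%S. at_vertices (insert_at \<theta>) S phi) = 0"
begin

lemma D_square:
 "T \<in> trees V ==> phi \<in> Mlin V (tcell T) ==> D T (%S. D S phi) = 0"
 "set ts \<subseteq> trees V ==> psi \<in> FMlin V (map tcell ts) ==> FD ts (%ts'. FD ts' psi) = 0"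
proof (induction T and ts arbitrary: phi and psi rule: tree_induct)
 case (Node x ts)
 let ?c = "(etop x, ebot x)" and ?cs = "map tcell ts"
 have x: "x \<in> elems V" "set ts \<subseteq> trees V" "map root ts = etop x" using Node.prems by auto
 have phi: "phi \<in> Mlin V (fleaves ts, ebot x)" using Node.prems by simp
 \<comment> \<open>The test function with \<open>x\<close> replaced by \<open>S\<close> and the
   subtrees by \<open>ts'\<close>. The two mixed terms, first \<open>x\<close> and then the subtrees
   or conversely, both reduce to \<open>FD ts\<close> of \<open>\<theta> x\<close> of this function,
   with opposite signs.\<close>
 define H where "H S ts' = sg (graft_exp S ts') * phi (graft S ts')" for S ts'
 have H1: "H S \<in> FMlin V ?cs" if "S \<in> trees V" "tcell S = ?c" for S
  unfolding H_def[abs_def] using that x phi by (intro FMlin_graft) (auto simp: o_def)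
 have H2: "(%S. H S ts') \<in> Mlin V ?c" if "ts' \<in> forests V ?cs" for ts' proof -
  have "map root ts' = etop x" "fleaves ts' = fleaves ts" "set ts' \<subseteq> trees V"
   using that x map_tcell_eqD[of ts' ts] by (auto simp: forests_def)
  then show ?thesis unfolding H_def using phi by (intro graft_term_Mlin) simp_all
 qed
 have tsf: "ts \<in> forests V ?cs" using x by (simp add: forests_def)
 note fts = forest_at_comb[OF x(2)] and tx = \<theta>_comb[OF x(1)]
 have m1: "(%S. FD ts (H S)) \<in> Mlin V ?c" by (rule fcomb_Mlin[OF fts]) (auto simp: forests_deg_def intro: H1 H2)
 have m2: "(%ts'. \<theta> x (%S. H S ts')) \<in> FMlin V ?cs" by (rule fcomb_FMlin[OF tx]) (use H1 H2 in auto)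
 have m3: "(%ts'. phi (Node x ts')) \<in> FMlin V ?cs" using phi x by (intro FMlin_Node) (auto simp: o_def)
 have DM: "(%S. D S phi) \<in> Mlin V (fleaves ts, ebot x)" by (rule at_Mlin[OF phi])
 have m4: "(%ts'. D (Node x ts') phi) \<in> FMlin V ?cs"
  by (rule FMlin_Node[of "%S. D S phi"]) (use DM x in "auto simp: o_def")
 have "insert_at \<theta> x ts (%S. D S phi) = \<theta> x (%S. sg (graft_exp S ts) * D (graft S ts) phi)"
  by (rule insert_at_exp)
 also have "\<dots> = 1 * \<theta> x (%S. D S (%S. H S ts)) + sg (edeg x + 1) * \<theta> x (%S. FD ts (H S))"
  by (rule fcomb_lin[OF tx at_Mlin[OF H2[OF tsf]] m1 graft_term_Mlin[OF DM x(2,3)]])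
   (use Leibniz_graft(1)[of _ ts phi] x phi in "simp add: H_def[abs_def]")
 also have "\<theta> x (%S. D S (%S. H S ts)) = 0" by (rule \<theta>_sq[OF x(1) H2[OF tsf]])
 also have "\<theta> x (%S. FD ts (H S)) = FD ts (%ts'. \<theta> x (%S. H S ts'))"
  by (rule fcomb_swap[OF tx fts]) (use H1 H2 m1 m2 in "auto simp: forests_deg_def")
 finally have 1: "insert_at \<theta> x ts (%S. D S phi) = sg (edeg x + 1) * FD ts (%ts'. \<theta> x (%S. H S ts'))"
  by simp
 have "FD ts (%ts'. D (Node x ts') phi) =
   1 * FD ts (%ts'. \<theta> x (%S. H S ts')) + sg (edeg x) * FD ts (%ts'. FD ts' (%ts''. phi (Node x ts'')))"
  by (rule fcomb_lin[OF fts m2 forest_at_FMlin[OF m3] m4]) (simp add: insert_at_exp H_def)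
 also have "FD ts (%ts'. FD ts' (%ts''. phi (Node x ts''))) = 0" by (rule Node.IH[OF x(2) m3])
 finally show ?case unfolding at_vertices_Node[of _ x ts] 1 by (simp add: sg_add)  (simp add: sg_def)
next
 case (Cons t ts)
 show ?case by (rule square_Cons) (use Cons in simp_all)
qed auto

section \<open>The free object and its complexes\<close>

abbreviation "F \<equiv> free_obj V \<theta>"

abbreviation el_cell :: "('i, 'e, 'u) el => ('i, 'e) cell" where
 "el_cell x \<equiv> (etop x, ebot x)"

lemma F_simps [simp]: "objs F = objs V" "onemor F = onemor V" "scl F = tscale" "cx F = free_cx V"
  "ident F = (%a. ptens V (Leaf a))" by (simp_all add: free_obj_def free_coll_def coll.defs twocat.defs)

lemma F_cells [simp]: "cells F = cells V" "arrows F = arrows V" by (rule cells_cong is_path_cong; simp)+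

lemma F_elems: "x \<in> elems F \<longleftrightarrow> el_cell x \<in> cells V \<and> evec x \<in> free_cx V (el_cell x) (edeg x)"
 by (simp add: elems_def)

lemma F_diff: "diff F x phi = (if phi \<in> Mlin V (el_cell x) then evec x (%T. D T phi) else 0)"
 by (simp add: free_obj_def free_coll_def coll.defs twocat.defs on_cell_Mlin)

lemma F_opcomp: "opcomp F x ys phi = (if phi \<in> Mlin V (concat (map etop ys), ebot x) then
  evec x (%T. bind_list (map evec ys) (%ts. sg (graft_exp T ts) * phi (graft T ts))) else 0)"
 by (simp add: free_obj_def free_coll_def coll.defs twocat.defs on_cell_Mlin graft_sign_exp)

lemma F_diff_free_cx:
 assumes "v \<in> free_cx V (s, t) n"
 shows "diff F (El s t n v) \<in> free_cx V (s, t) (n + 1)"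
proof -
 have "fcomb (trdeg V (s, t) (n + 1)) (Mlin V (s, t)) (%phi. v (%T. D T phi))"
  by (rule fcomb_bind[OF free_cx_fcomb[OF assms]]) (use at_comb at_Mlin in "fastforce+")
 from on_cell_free_cx[OF this] show ?thesis
  by (rule back_subst[of "%x. x \<in> free_cx V (s, t) (n + 1)"]) (auto simp: F_diff on_cell_Mlin)
qed

lemma F_diff_diff:
 assumes "v \<in> free_cx V (s, t) n"
 shows "diff F (dE F (El s t n v)) = 0"
proof -
 have "v (%T. D T (%S. D S phi)) = 0" if "phi \<in> Mlin V (s, t)" for phi
  by (rule fcomb_zero[OF free_cx_fcomb[OF assms]]) (use that in "auto intro: at_Mlin D_square(1)")
 then show ?thesis by (auto simp: F_diff dE_def at_Mlin fun_eq_iff)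
qed

lemma F_complexes: "complexes F"
 unfolding complexes_def
proof (clarsimp simp: vector_space_tscale free_cx_subspace F_diff_free_cx F_diff_diff)
 fix s t n
 show "lin_on tscale tscale (free_cx V (s, t) n) (%v. diff F (El s t n v))"
  by (auto simp: lin_on_def fun_eq_iff F_diff tscale_def)
qed

text \<open>In contrast to \<open>forests_deg\<close>, which fixes the total degree, each tree has
  its own degree here. This is the support of a tensor product of homogeneous elements.\<close>

definition forests_degs where
 "forests_degs cs ns = {ts \<in> forests V cs. map tdeg ts = ns}"

lemma bind_comb:
 assumes "set ys \<subseteq> elems F"
 shows "fcomb (forests_degs (map el_cell ys) (map edeg ys)) (FMlin V (map el_cell ys)) (bind_list (map evec ys))"
 using assms
proof (induction ys)
 case Nil
 show ?case using fcomb_point[of "[]" "forests_degs [] []"] by (simp add: forests_degs_def)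
next
 case (Cons y ys)
 let ?c = "el_cell y" and ?cs = "map el_cell ys"
 have y: "fcomb (trdeg V ?c (edeg y)) (Mlin V ?c) (evec y)" using Cons.prems by (intro free_cx_fcomb) (simp add: F_elems)
 have ys: "fcomb (forests_degs ?cs (map edeg ys)) (FMlin V ?cs) (bind_list (map evec ys))" using Cons by simp
 have "fcomb (forests_degs (?c # ?cs) (edeg y # map edeg ys)) (FMlin V (?c # ?cs))
  (%psi. evec y (%t. bind_list (map evec ys) (%ts. psi (t # ts))))"
 proof (rule fcomb_bind[OF y])
  fix t assume t: "t \<in> trdeg V ?c (edeg y)"
  have "fcomb (forests_degs (?c # ?cs) (edeg y # map edeg ys)) (FMlin V (?c # ?cs))
  (%psi. bind_list (map evec ys) (%ts. 1 * psi (t # ts)))"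
   by (rule fcomb_image[OF ys]) (use t in "auto simp: forests_degs_def intro: FMlin_Cons2")
  then show "fcomb (forests_degs (?c # ?cs) (edeg y # map edeg ys)) (FMlin V (?c # ?cs))
  (%psi. bind_list (map evec ys) (%ts. psi (t # ts)))" by simp
 next
  fix psi assume "psi \<in> FMlin V (?c # ?cs)"
  then show "(%t. bind_list (map evec ys) (%ts. psi (t # ts))) \<in> Mlin V ?c"
   by (intro fcomb_Mlin[OF ys]) (auto simp: forests_degs_def intro: FMlin_Cons1 FMlin_Cons2)
 qed
 then show ?case by (simp add: bind_list.simps(2)[abs_def])
qed

lemma bind_append:
 "bind_list (as @ bs) psi = bind_list as (%ts. bind_list bs (%us. psi (ts @ us)))"
 by (induction as arbitrary: psi) auto

section \<open>Composition in the free object\<close>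

lemma comp_term_FMlin:
 assumes "phi \<in> Mlin V (concat (map fst cs), t)" "T \<in> trees V" "tcell T = (map snd cs, t)"
 shows "(%ts. sg (graft_exp T ts) * phi (graft T ts)) \<in> FMlin V cs" using assms by (intro FMlin_graft) auto

lemma comp_term_Mlin:
 assumes "phi \<in> Mlin V (concat (map fst cs), t)" "ts \<in> forests V cs"
 shows "(%T. sg (graft_exp T ts) * phi (graft T ts)) \<in> Mlin V (map snd cs, t)"
 using assms forests_rootD[OF assms(2)] by (intro graft_term_Mlin) auto

lemma composableD:
 assumes "composable F x ys"
 shows "x \<in> elems F" "set ys \<subseteq> elems F" "map ebot ys = etop x" "map snd (map el_cell ys) = etop x"
  "concat (map fst (map el_cell ys)) = concat (map etop ys)"
  "fcomb (trdeg V (etop x, ebot x) (edeg x)) (Mlin V (etop x, ebot x)) (evec x)"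
 using assms free_cx_fcomb[of "evec x" V "el_cell x" "edeg x"] by (auto simp: composable_def F_elems o_def)

lemma bind_term_Mlin:
 assumes "composable F x ys" "phi \<in> Mlin V (concat (map etop ys), ebot x)"
 shows "(%T. bind_list (map evec ys) (%ts. sg (graft_exp T ts) * phi (graft T ts))) \<in> Mlin V (el_cell x)"
proof -
 note c = composableD[OF assms(1)]
 show ?thesis proof (rule fcomb_Mlin[OF bind_comb[OF c(2)]])
  show "(%ts. sg (graft_exp T ts) * phi (graft T ts)) \<in> FMlin V (map el_cell ys)"
   if "T \<in> trees V" "tcell T = el_cell x" for T
   using that assms(2) c(4,5) by (intro comp_term_FMlin[where t="ebot x"]) simp_all
  show "(%T. sg (graft_exp T ts) * phi (graft T ts)) \<in> Mlin V (el_cell x)"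
   if "ts \<in> forests_degs (map el_cell ys) (map edeg ys)" for ts
   using that assms(2) c(4,5) comp_term_Mlin[of phi "map el_cell ys" "ebot x" ts] by (simp add: forests_degs_def)
 qed
qed

lemma F_comp_elems:
 assumes "composable F x ys"
 shows "compE F x ys \<in> elems F"
proof -
 note c = composableD[OF assms]
 let ?c = "(concat (map etop ys), ebot x)"
 have "set (map el_cell ys) \<subseteq> cells V" using c(2) by (auto simp: F_elems subset_iff)
 then have "?c \<in> cells V" using cells_concat[of "map el_cell ys" "ebot x" V] c(1,4,5) by (simp add: F_elems)
 moreover have "opcomp F x ys \<in> free_cx V ?c (edeg x + sum_list (map edeg ys))"
 proof -
  have "fcomb (trdeg V ?c (edeg x + sum_list (map edeg ys))) (Mlin V ?c)
   (%phi. evec x (%T. bind_list (map evec ys) (%ts. sg (graft_exp T ts) * phi (graft T ts))))"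
  proof (rule fcomb_bind[OF c(6)])
   fix T assume T: "T \<in> trdeg V (etop x, ebot x) (edeg x)"
   show "fcomb (trdeg V ?c (edeg x + sum_list (map edeg ys))) (Mlin V ?c)
    (%phi. bind_list (map evec ys) (%ts. sg (graft_exp T ts) * phi (graft T ts)))"
   proof (rule fcomb_image[OF bind_comb[OF c(2)]])
    fix ts assume "ts \<in> forests_degs (map el_cell ys) (map edeg ys)"
    then have ts: "map root ts = leaves T" "map leaves ts = map etop ys" "set ts \<subseteq> trees V"
     "deg_sum ts = sum_list (map edeg ys)" "length ts = nleaves T"
     using T c(3) forests_rootD[of ts V "map el_cell ys"] map_root_length[of ts T] by (auto simp: forests_degs_def o_def)
    show "graft T ts \<in> trdeg V ?c (edeg x + sum_list (map edeg ys))" using T ts graft_trees(1)[of T V ts] by simp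
   qed (use T c comp_term_FMlin[of _ "map el_cell ys" "ebot x" T] in auto)
  qed (rule bind_term_Mlin[OF assms])
  from on_cell_free_cx[OF this] show ?thesis
   by (rule back_subst[of "%v. v \<in> free_cx V ?c (edeg x + sum_list (map edeg ys))"])
    (auto simp: F_opcomp on_cell_Mlin)
 qed
 ultimately show ?thesis by (simp add: F_elems compE_def)
qed

lemma F_comp_linear:
 assumes "composable F x (ls @ El s t n v # rs)" "composable F x (ls @ El s t n w # rs)"
 shows "opcomp F x (ls @ El s t n (tscale a v + tscale b w) # rs) =
  tscale a (opcomp F x (ls @ El s t n v # rs)) + tscale b (opcomp F x (ls @ El s t n w # rs))"
proof
 fix phi
 let ?z = "tscale a v + tscale b w"
 have els: "El s t n v \<in> elems F" "El s t n w \<in> elems F" using assms by (auto simp: composable_def)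
 have "?z \<in> free_cx V (s, t) n" using els by (intro free_cx_lin) (simp_all add: F_elems)
 then have z: "composable F x (ls @ El s t n ?z # rs)" using assms els by (auto simp: composable_def F_elems)
 show "opcomp F x (ls @ El s t n ?z # rs) phi =
  (tscale a (opcomp F x (ls @ El s t n v # rs)) + tscale b (opcomp F x (ls @ El s t n w # rs))) phi"
 proof (cases "phi \<in> Mlin V (concat (map etop (ls @ El s t n v # rs)), ebot x)")
  case True
  have phi: "phi \<in> Mlin V (concat (map etop (ls @ El s t n u # rs)), ebot x)" for u using True by simp
  note c = composableD[OF assms(1)]
  let ?cl = "map el_cell ls" and ?cr = "map el_cell (El s t n v # rs)"
  have cs: "map el_cell (ls @ El s t n v # rs) = ?cl @ ?cr" by simp
  have "bind_list (map evec (ls @ El s t n ?z # rs)) psi =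
    a * bind_list (map evec (ls @ El s t n v # rs)) psi + b * bind_list (map evec (ls @ El s t n w # rs)) psi"
   if psi: "psi \<in> FMlin V (?cl @ ?cr)" for psi
  proof -
   have ls: "set ls \<subseteq> elems F" using assms by (auto simp: composable_def)
   have m: "(%ts. bind_list (map evec (El s t n u # rs)) (%us. psi (ts @ us))) \<in> FMlin V ?cl"
    if "composable F x (ls @ El s t n u # rs)" for u
   proof -
    have "set (El s t n u # rs) \<subseteq> elems F" using that by (auto simp: composable_def)
    from bind_comb[OF this]
    have fc: "fcomb (forests_degs ?cr (map edeg (El s t n v # rs))) (FMlin V ?cr) (bind_list (map evec (El s t n u # rs)))"
     by simp
    show ?thesis by (rule fcomb_FMlin[OF fc])
      (use FMlin_append1[OF psi] FMlin_append2[OF psi] in "simp_all add: forests_degs_def")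
   qed
   show ?thesis
    unfolding map_append bind_append by (rule fcomb_lin[OF bind_comb[OF ls] m[OF assms(1)] m[OF assms(2)] m[OF z]])
     (simp add: tscale_def)
  qed
  note * = this
  have "evec x (%T. bind_list (map evec (ls @ El s t n ?z # rs)) (%ts. sg (graft_exp T ts) * phi (graft T ts))) =
   a * evec x (%T. bind_list (map evec (ls @ El s t n v # rs)) (%ts. sg (graft_exp T ts) * phi (graft T ts))) +
   b * evec x (%T. bind_list (map evec (ls @ El s t n w # rs)) (%ts. sg (graft_exp T ts) * phi (graft T ts)))"
  proof (rule fcomb_lin[OF c(6)])
   fix T assume T: "T \<in> trdeg V (etop x, ebot x) (edeg x)"
   show "bind_list (map evec (ls @ El s t n ?z # rs)) (%ts. sg (graft_exp T ts) * phi (graft T ts)) =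
    a * bind_list (map evec (ls @ El s t n v # rs)) (%ts. sg (graft_exp T ts) * phi (graft T ts)) +
    b * bind_list (map evec (ls @ El s t n w # rs)) (%ts. sg (graft_exp T ts) * phi (graft T ts))"
    by (rule *, unfold cs[symmetric], rule comp_term_FMlin[where t="ebot x"])
     (use T True c(4,5) in auto)
  qed (rule bind_term_Mlin[OF assms(1) phi] bind_term_Mlin[OF assms(2) phi] bind_term_Mlin[OF z phi])+
  then show ?thesis using True by (simp add: F_opcomp tscale_def)
 next
  case False
  then show ?thesis by (simp add: F_opcomp tscale_def)
 qed
qed

end

text \<open>A given forest supplies the typing facts, such as matching roots and leaves, from which
  membership is derived; if there is no forest at the cells \<open>cs\<close>, membership holds
  trivially.\<close>

lemma FMlin_if_forest: "(\<And>ts. ts \<in> forests V cs ==> psi \<in> FMlin V cs) ==> psi \<in> FMlin V cs"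
 by (auto simp: FMlin_def)

lemma sum_apply: "(\<Sum>i\<in>I. f i) x = (\<Sum>i\<in>I. f i x)" for f :: "'a => 'b => 'c::ab_group_add"
 by (induction I rule: infinite_finite_induct) auto

lemma sg_mult_cong: "a + b = c + d ==> sg a * (sg b * r) = sg c * (sg d * r)"
 by (simp only: mult.assoc[symmetric] sg_add[symmetric])

lemma compE_simps [simp]:
 "etop (compE A x ys) = concat (map etop ys)" "ebot (compE A x ys) = ebot x"
 "edeg (compE A x ys) = edeg x + sum_list (map edeg ys)" "evec (compE A x ys) = opcomp A x ys" by (simp_all add: compE_def)

lemma Leaf_cells: "Leaf a \<in> trees V ==> ([a], a) \<in> cells V" using trees_cells[of "Leaf a" V] by simp

lemma path_Leaf: "i \<in> objs V ==> is_path V i s j ==> a \<in> set s ==> Leaf a \<in> trees V"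
 by (induction s arbitrary: i) (auto simp: trees_Leaf_iff)

lemma cell_Leaf_trees: "(s, t) \<in> cells V ==> a \<in> set s \<or> a = t ==> Leaf a \<in> trees V"
 by (auto simp: cells_iff intro: path_Leaf) (auto simp: trees_Leaf_iff)

context differential_data
begin

lemma F_ident_elems: "Leaf a \<in> trees V ==> idE F a \<in> elems F"
 using ptens_free_cx[of "Leaf a" V "([a], a)" 0] by (simp add: F_elems idE_def Leaf_cells)

lemma F_ident:
 assumes "i \<in> objs V" "j \<in> objs V" "a \<in> arrows V i j"
 shows "idE F a \<in> elems F" "diff F (idE F a) = 0"
proof -
 show "idE F a \<in> elems F" using assms by (intro F_ident_elems) (auto simp: trees_Leaf_iff)
 show "diff F (idE F a) = 0" by (auto simp: fun_eq_iff F_diff idE_def Mlin_ptens)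
qed

lemma dE_elems: "y \<in> elems F ==> dE F y \<in> elems F" by (cases y) (auto simp: F_elems dE_def F_diff_free_cx)

lemma el_cell_dE [simp]: "el_cell (dE A x) = el_cell x" by (simp add: dE_def)

lemma bind_step_Mlin:
 assumes "set ys \<subseteq> elems F" "psi \<in> FMlin V (c # map el_cell ys)"
 shows "(%t. bind_list (map evec ys) (%ts. psi (t # ts))) \<in> Mlin V c"
 by (rule fcomb_Mlin[OF bind_comb[OF assms(1)]])
  (use assms(2) in "auto simp: forests_degs_def intro: FMlin_Cons1 FMlin_Cons2")

text \<open>The passage between two forms of the differential of a tensor product: the derivation on
  lists of trees, as produced by \<open>Leibniz_graft\<close>, and the sum over the factors, as in
  the definition of an object of 2-Cat.\<close>

lemma bind_forest_at:
 assumes "set ys \<subseteq> elems F" "psi \<in> FMlin V (map el_cell ys)"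
 shows "bind_list (map evec ys) (%ts. FD ts psi) =
  (\<Sum>l<length ys. sg (sum_list (map edeg (take l ys))) *
   bind_list (map evec (ys[l := dE F (ys ! l)])) psi)"
 using assms
proof (induction ys arbitrary: psi)
 case (Cons y ys)
 let ?c = "el_cell y" and ?cs = "map el_cell ys"
 let ?B = "bind_list (map evec ys)"
 have y: "y \<in> elems F" and ys: "set ys \<subseteq> elems F" using Cons.prems by auto
 have psi: "psi \<in> FMlin V (?c # ?cs)" using Cons.prems by simp
 have fy: "fcomb (trdeg V ?c (edeg y)) (Mlin V ?c) (evec y)" using y by (intro free_cx_fcomb) (simp add: F_elems)
 note fb = bind_comb[OF ys]
 have a1: "(%t'. psi (t' # us)) \<in> Mlin V ?c" if "us \<in> forests V ?cs" for us
  by (rule FMlin_Cons1[OF psi that])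
 have a2: "(%us. psi (t' # us)) \<in> FMlin V ?cs" if "t' \<in> trees V" "tcell t' = ?c" for t'
  by (rule FMlin_Cons2[OF psi that])
 note B = bind_step_Mlin[OF ys psi]
 have inner: "?B (%ts. FD (t # ts) psi) = 1 * D t (%t'. ?B (%ts. psi (t' # ts))) +
   sg (edeg y) * ?B (%ts. FD ts (%us. psi (t # us)))" if t: "t \<in> trdeg V ?c (edeg y)" for t
 proof -
  have t': "t \<in> trees V" "tcell t = ?c" using t by auto
  have ft: "fcomb (trdeg V ?c (tdeg t + 1)) (Mlin V ?c) (D t)" using at_comb[OF t'(1)] t'(2) by simp
  have m: "(%us. D t (%t'. psi (t' # us))) \<in> FMlin V ?cs" by (rule fcomb_FMlin[OF ft]) (use a1 a2 in auto)
  have "?B (%ts. FD (t # ts) psi) = 1 * ?B (%ts. D t (%t'. psi (t' # ts))) +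
   sg (edeg y) * ?B (%ts. FD ts (%us. psi (t # us)))"
   by (rule fcomb_lin[OF fb m forest_at_FMlin[OF a2[OF t']] FMlin_Cons2[OF forest_at_FMlin[OF psi] t']])
    (use t in simp)
  also have "?B (%ts. D t (%t'. psi (t' # ts))) = D t (%t'. ?B (%ts. psi (t' # ts)))"
   by (rule fcomb_swap[where psi="%ts t'. psi (t' # ts)", OF fb ft _ _ m B]) (use a1 a2 in "auto simp: forests_degs_def")
  finally show ?thesis .
 qed
 have elsl: "set (ys[l := dE F (ys ! l)]) \<subseteq> elems F" if "l < length ys" for l
  using that ys dE_elems by (intro set_update_subsetI) (auto simp: subset_iff)
 have cel: "map el_cell (ys[l := dE F (ys ! l)]) = ?cs" if "l < length ys" for l
  using that by (simp add: map_update list_update_same_conv)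
 let ?T = "%l t. sg (sum_list (map edeg (take l ys))) * bind_list (map evec (ys[l := dE F (ys ! l)])) (%us. psi (t # us))"
 have T: "?T l \<in> Mlin V ?c" if "l < length ys" for l
  using bind_step_Mlin[OF elsl[OF that], unfolded cel[OF that], OF psi] by (rule Mlin_scale)
 have M1: "(%t. ?B (%ts. FD (t # ts) psi)) \<in> Mlin V ?c"
  by (rule bind_step_Mlin[OF ys forest_at_FMlin[OF psi]])
 have M2: "(%t. \<Sum>l<length ys. ?T l t) \<in> Mlin V ?c" by (rule Mlin_sum) (use T in simp)
 have "evec y (%t. ?B (%ts. FD (t # ts) psi)) =
   1 * evec y (%t. D t (%t'. ?B (%ts. psi (t' # ts)))) + sg (edeg y) * evec y (%t. \<Sum>l<length ys. ?T l t)"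
  by (rule fcomb_lin[OF fy at_Mlin[OF B] M2 M1]) (use inner Cons.IH[OF ys a2] in auto)
 also have "evec y (%t. \<Sum>l<length ys. ?T l t) = (\<Sum>l<length ys. evec y (?T l))"
  by (rule fcomb_sum[OF fy _ _ M2]) (use T in auto)
 also have "\<dots> = (\<Sum>l<length ys. sg (sum_list (map edeg (take l ys))) *
   evec y (%t. bind_list (map evec (ys[l := dE F (ys ! l)])) (%us. psi (t # us))))"
 proof (rule sum.cong[OF refl])
  fix l assume "l \<in> {..<length ys}"
  then have l: "l < length ys" by simp
  show "evec y (?T l) = sg (sum_list (map edeg (take l ys))) *
   evec y (%t. bind_list (map evec (ys[l := dE F (ys ! l)])) (%us. psi (t # us)))"
   using bind_step_Mlin[OF elsl[OF l], unfolded cel[OF l], OF psi] T[OF l] by (rule fcomb_mult[OF fy]) simp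
 qed
 also have "evec y (%t. D t (%t'. ?B (%ts. psi (t' # ts)))) = evec (dE F y) (%t'. ?B (%ts. psi (t' # ts)))"
  using B by (simp add: dE_def F_diff)
 finally show ?case by (simp add: sum.lessThan_Suc_shift sg_add sum_distrib_left mult.assoc del: sum.lessThan_Suc)
qed simp

text \<open>On pure tensors this is \<open>Leibniz_graft\<close>. The functional of \<open>x\<close>
  is applied outside and those of \<open>ys\<close> inside, so the term with the derivation on the
  tree of \<open>x\<close> takes an interchange; the other terms are collected by
  \<open>bind_forest_at\<close>.\<close>

lemma F_Leibniz:
 assumes "composable F x ys"
 shows "diff F (compE F x ys) = opcomp F (dE F x) ys +
  (\<Sum>l<length ys. tscale (sg (edeg x + sum_list (map edeg (take l ys)))) (opcomp F x (ys[l := dE F (ys ! l)])))"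
proof
 fix phi
 note c = composableD[OF assms]
 let ?c = "(concat (map etop ys), ebot x)" and ?cs = "map el_cell ys"
 let ?B = "bind_list (map evec ys)"
 have elsl: "set (ys[l := dE F (ys ! l)]) \<subseteq> elems F" if "l < length ys" for l
  using that c(2) dE_elems by (intro set_update_subsetI) (auto simp: subset_iff)
 have cel: "map el_cell (ys[l := dE F (ys ! l)]) = ?cs" if "l < length ys" for l
  using that by (simp add: map_update list_update_same_conv)
 have top: "map etop (ys[l := dE F (ys ! l)]) = map etop ys" "map ebot (ys[l := dE F (ys ! l)]) = map ebot ys"
  if "l < length ys" for l using that by (simp_all add: map_update list_update_same_conv dE_def)
 have cl: "composable F x (ys[l := dE F (ys ! l)])" if "l < length ys" for l
  using assms elsl[OF that] top[OF that] by (simp add: composable_def)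
 show "diff F (compE F x ys) phi = (opcomp F (dE F x) ys +
  (\<Sum>l<length ys. tscale (sg (edeg x + sum_list (map edeg (take l ys)))) (opcomp F x (ys[l := dE F (ys ! l)])))) phi"
 proof (cases "phi \<in> Mlin V ?c")
  case True
  define G where "G T ts = sg (graft_exp T ts) * phi (graft T ts)" for T ts
  have G1: "G T \<in> FMlin V ?cs" if "T \<in> trees V" "tcell T = el_cell x" for T
   unfolding G_def[abs_def] using that True c(4,5) by (intro comp_term_FMlin[where t="ebot x"]) simp_all
  have G2: "(%T. G T ts) \<in> Mlin V (el_cell x)" if "ts \<in> forests V ?cs" for ts
   unfolding G_def using that True c(4,5) comp_term_Mlin[of phi ?cs "ebot x" ts] by simp
  note fb = bind_comb[OF c(2)]
  have BG: "(%T. bind_list (map evec zs) (G T)) \<in> Mlin V (el_cell x)"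
   if "map el_cell zs = ?cs" "set zs \<subseteq> elems F" for zs
   by (rule fcomb_Mlin[OF bind_comb[OF that(2)]]) (use that G1 G2 in "auto simp: forests_degs_def")
  have Dphi: "(%S. D S phi) \<in> Mlin V ?c" by (rule at_Mlin[OF True])
  have M3: "(%T. ?B (%ts. FD ts (G T))) \<in> Mlin V (el_cell x)" proof (rule fcomb_Mlin[OF fb])
   show "(%T. FD ts (G T)) \<in> Mlin V (el_cell x)" if "ts \<in> forests_degs ?cs (map edeg ys)" for ts proof -
    have ts: "set ts \<subseteq> trees V" "map tcell ts = ?cs" using that by (auto simp: forests_degs_def forests_def)
    show ?thesis by (rule fcomb_Mlin[OF forest_at_comb[OF ts(1)]])
      (use ts(2) G1 G2 in "auto simp: forests_deg_def")
   qed
  qed (use G1 forest_at_FMlin in blast)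
  have inner: "?B (%ts. sg (graft_exp T ts) * D (graft T ts) phi) = 1 * D T (%S. ?B (G S)) +
   sg (edeg x) * ?B (%ts. FD ts (G T))" if T: "T \<in> trdeg V (el_cell x) (edeg x)" for T
  proof -
   have T': "T \<in> trees V" "tcell T = el_cell x" using T by auto
   have ft: "fcomb (trdeg V (el_cell x) (tdeg T + 1)) (Mlin V (el_cell x)) (D T)" using at_comb[OF T'(1)] T'(2) by simp
   have m: "(%ts. D T (%S. G S ts)) \<in> FMlin V ?cs" by (rule fcomb_FMlin[OF ft]) (use G1 G2 in auto)
   have m': "(%ts. sg (graft_exp T ts) * D (graft T ts) phi) \<in> FMlin V ?cs"
    using T' Dphi c(4,5) by (intro comp_term_FMlin[where t="ebot x"]) simp_all
   have "?B (%ts. sg (graft_exp T ts) * D (graft T ts) phi) = 1 * ?B (%ts. D T (%S. G S ts)) +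
    sg (edeg x) * ?B (%ts. FD ts (G T))"
   proof (rule fcomb_lin[OF fb m forest_at_FMlin[OF G1[OF T']] m'])
    fix ts assume ts: "ts \<in> forests_degs ?cs (map edeg ys)"
    then have "set ts \<subseteq> trees V" "map root ts = leaves T" "fleaves ts = concat (map etop ys)"
     using forests_rootD[of ts V ?cs] T' c(4,5) by (auto simp: forests_degs_def)
    then show "sg (graft_exp T ts) * D (graft T ts) phi = 1 * D T (%S. G S ts) + sg (edeg x) * FD ts (G T)"
     using Leibniz_graft(1)[OF T'(1), of ts phi] True T by (simp add: G_def[abs_def])
   qed
   also have "?B (%ts. D T (%S. G S ts)) = D T (%S. ?B (G S))"
    by (rule fcomb_swap[where psi="%ts S. G S ts", OF fb ft _ _ m BG[OF refl c(2)]]) (use G1 G2 in "auto simp: forests_degs_def")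
   finally show ?thesis .
  qed
  let ?T = "%l T. sg (sum_list (map edeg (take l ys))) * bind_list (map evec (ys[l := dE F (ys ! l)])) (G T)"
  have T: "?T l \<in> Mlin V (el_cell x)" if "l < length ys" for l by (rule Mlin_scale[OF BG[OF cel[OF that] elsl[OF that]]])
  have M2: "(%T. \<Sum>l<length ys. ?T l T) \<in> Mlin V (el_cell x)" by (rule Mlin_sum) (use T in simp)
  have "evec x (%T. ?B (%ts. sg (graft_exp T ts) * D (graft T ts) phi)) =
    1 * evec x (%T. D T (%S. ?B (G S))) + sg (edeg x) * evec x (%T. \<Sum>l<length ys. ?T l T)"
   by (rule fcomb_lin[OF c(6) at_Mlin[OF BG[OF refl c(2)]] M2 bind_term_Mlin[OF assms Dphi]])
    (use inner bind_forest_at[OF c(2) G1] in auto)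
  also have "evec x (%T. \<Sum>l<length ys. ?T l T) = (\<Sum>l<length ys. evec x (?T l))"
   by (rule fcomb_sum[OF c(6) _ _ M2]) (use T in auto)
  also have "\<dots> = (\<Sum>l<length ys. sg (sum_list (map edeg (take l ys))) * opcomp F x (ys[l := dE F (ys ! l)]) phi)"
  proof (rule sum.cong[OF refl])
   fix l assume "l \<in> {..<length ys}"
   then have l: "l < length ys" by simp
   have "evec x (?T l) = sg (sum_list (map edeg (take l ys))) *
    evec x (%T. bind_list (map evec (ys[l := dE F (ys ! l)])) (G T))"
    by (rule fcomb_mult[OF c(6) BG[OF cel[OF l] elsl[OF l]] T[OF l]]) simp
   then show "evec x (?T l) = sg (sum_list (map edeg (take l ys))) * opcomp F x (ys[l := dE F (ys ! l)]) phi"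
    using True by (simp add: F_opcomp top[OF l] G_def[abs_def])
  qed
  also have "evec x (%T. D T (%S. ?B (G S))) = opcomp F (dE F x) ys phi"
   using True BG[OF refl c(2)] by (simp add: F_opcomp F_diff dE_def G_def[abs_def])
  finally show ?thesis
   using True Dphi by (simp add: compE_def F_diff F_opcomp sum_apply tscale_def sg_add sum_distrib_left mult.assoc)
 next
  case False
  then have "opcomp F x (ys[l := dE F (ys ! l)]) phi = 0" if "l < length ys" for l using top[OF that] by (simp add: F_opcomp)
  moreover have "opcomp F (dE F x) ys phi = 0" "diff F (compE F x ys) phi = 0"
   using False by (simp_all add: F_opcomp F_diff dE_def)
  ultimately show ?thesis by (simp add: sum_apply tscale_def)
 qed
qed

lemma list_all2_composable:
 assumes "list_all2 (composable F) ys zss"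
 shows "set (map2 (compE F) ys zss) \<subseteq> elems F" "set (concat zss) \<subseteq> elems F" "length zss = length ys"
  "map ebot (concat zss) = concat (map etop ys)" "map ebot (map2 (compE F) ys zss) = map ebot ys"
  "concat (map etop (map2 (compE F) ys zss)) = concat (map etop (concat zss))"
 using assms
proof (induction ys zss rule: list_all2_induct)
 case (Cons y ys zs zss)
 {
  case 1 show ?case using Cons F_comp_elems by auto
 next
  case 2 show ?case using Cons by (auto simp: composable_def)
 next
  case 3 show ?case using Cons by simp
 next
  case 4 show ?case using Cons by (simp add: composable_def)
 next
  case 5 show ?case using Cons by (simp add: compE_def)
 next
  case 6 show ?case using Cons by (simp add: compE_def)
 }
qed simp_all

lemma fgraft_el_cells:
 assumes "list_all2 (composable F) ys zss"
  and "ts \<in> forests V (map el_cell ys)" "us \<in> forests V (map el_cell (concat zss))"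
 shows "map tcell (fgraft ts us) = map el_cell (map2 (compE F) ys zss)"
  "set ts \<subseteq> trees V" "set us \<subseteq> trees V" "map root us = fleaves ts"
proof -
 have "map tcell (fgraft ts us) = map el_cell (map2 (compE F) ys zss)"
  using assms
 proof (induction ys zss arbitrary: ts us rule: list_all2_induct)
  case (Cons y ys zs zss)
  obtain t ts' where ts: "ts = t # ts'" "t \<in> trees V" "tcell t = el_cell y" "ts' \<in> forests V (map el_cell ys)"
   using Cons.prems(1) by (cases ts) auto
  have us: "map tcell us = map el_cell zs @ map el_cell (concat zss)" "set us \<subseteq> trees V"
   using Cons.prems(2) by (auto simp: forests_def)
  define a where "a = take (length zs) us"
  define b where "b = drop (length zs) us"
  have ab: "us = a @ b" "map tcell a = map el_cell zs" "map tcell b = map el_cell (concat zss)"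
   using arg_cong[OF us(1), of "take (length zs)"] arg_cong[OF us(1), of "drop (length zs)"]
   by (simp_all add: a_def b_def take_map drop_map)
  have la: "length a = length zs"
   using map_eq_imp_length_eq[OF ab(2)] .
  have lz: "length zs = nleaves t" "map ebot zs = etop y"
   using Cons.hyps(1) ts(3) by (auto simp: composable_def dest: arg_cong[of _ _ length])
  have ra: "map root a = leaves t" "map leaves a = map etop zs"
   using arg_cong[OF ab(2), of "map snd"] arg_cong[OF ab(2), of "map fst"] lz ts(3) by (auto simp: o_def)
  have "b \<in> forests V (map el_cell (concat zss))" using us(2) ab by (auto simp: forests_def)
  note IH = Cons.IH[OF ts(4) this]
  have "root t = ebot y" using ts(3) by simp
  with IH show ?case using ra la lz(1) by (simp add: ts(1) ab(1))
 qed (auto simp: forests_def)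
 then show "map tcell (fgraft ts us) = map el_cell (map2 (compE F) ys zss)" .
 show "set ts \<subseteq> trees V" "set us \<subseteq> trees V" using assms by (auto simp: forests_def)
 have "map root us = map ebot (concat zss)" "fleaves ts = concat (map etop ys)"
  using forests_rootD[OF assms(2)] forests_rootD[OF assms(3)] by (simp_all add: o_def)
 then show "map root us = fleaves ts" using list_all2_composable(4)[OF assms(1)] by simp
qed

lemma comp_forest_left:
 assumes "list_all2 (composable F) ys zss" "psi \<in> FMlin V (map el_cell (map2 (compE F) ys zss))"
  "us \<in> forests V (map el_cell (concat zss))"
 shows "(%ts. sg (fgraft_exp ts us) * psi (fgraft ts us)) \<in> FMlin V (map el_cell ys)"
proof (rule FMlin_if_forest)
 fix ts assume ts: "ts \<in> forests V (map el_cell ys)"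
 note * = fgraft_el_cells[OF assms(1) ts assms(3)]
 have "map el_cell ys = map tcell ts" using ts by (simp add: forests_def)
 then show "(%ts. sg (fgraft_exp ts us) * psi (fgraft ts us)) \<in> FMlin V (map el_cell ys)"
  using FMlin_fgraft_left[of psi V ts us] * assms(2) by simp
qed

lemma comp_forest_right:
 assumes "list_all2 (composable F) ys zss" "psi \<in> FMlin V (map el_cell (map2 (compE F) ys zss))"
  "ts \<in> forests V (map el_cell ys)"
 shows "(%us. sg (fgraft_exp ts us) * psi (fgraft ts us)) \<in> FMlin V (map el_cell (concat zss))"
proof (rule FMlin_if_forest)
 fix us assume us: "us \<in> forests V (map el_cell (concat zss))"
 note * = fgraft_el_cells[OF assms(1,3) us]
 have "map el_cell (concat zss) = map tcell us" using us by (simp add: forests_def)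
 then show "(%us. sg (fgraft_exp ts us) * psi (fgraft ts us)) \<in> FMlin V (map el_cell (concat zss))"
  using FMlin_fgraft_right[of psi V ts us] * assms(2) by simp
qed

lemma bind_FMlin:
 assumes "set zs \<subseteq> elems F" "\<And>ts. ts \<in> forests V cs ==> K ts \<in> FMlin V (map el_cell zs)"
  and "\<And>us. us \<in> forests V (map el_cell zs) ==> (%ts. K ts us) \<in> FMlin V cs"
 shows "(%ts. bind_list (map evec zs) (K ts)) \<in> FMlin V cs"
 by (rule fcomb_FMlin[OF bind_comb[OF assms(1)]]) (use assms in "auto simp: forests_degs_def")

text \<open>Composing \<open>ys\<close> with \<open>zss\<close> factor by factor lists the tensors
  as y1, z1, y2, z2 and so on, while on the right all of \<open>ys\<close> come before all of
  \<open>concat zss\<close>. The sign is that of this reordering.\<close>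

lemma bind_comp:
 assumes "list_all2 (composable F) ys zss" "psi \<in> FMlin V (map el_cell (map2 (compE F) ys zss))"
 shows "sg (shuffle_exp (map edeg ys) (map (sum_list \<circ> map edeg) zss)) *
   bind_list (map evec (map2 (compE F) ys zss)) psi =
  bind_list (map evec ys) (%ts. bind_list (map evec (concat zss))
   (%us. sg (fgraft_exp ts us) * psi (fgraft ts us)))"
 using assms
proof (induction ys zss arbitrary: psi rule: list_all2_induct)
 case (Cons y ys zs zss)
 let ?c = "el_cell y" and ?cs = "map el_cell ys" and ?g = "compE F y zs"
 let ?gs = "map2 (compE F) ys zss"
 let ?cz = "map el_cell zs" and ?cZ = "map el_cell (concat zss)"
 \<comment> \<open>The exponent for the longer lists is \<open>m * N + \<kappa>\<close>: the block
   \<open>zs\<close> of degree \<open>m\<close> passes \<open>ys\<close> of degree \<open>N\<close>,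
   and \<open>\<kappa>\<close> is the exponent of the induction hypothesis.\<close>
 define N where "N = sum_list (map edeg ys)"
 define m where "m = sum_list (map edeg zs)"
 define \<kappa> where "\<kappa> = shuffle_exp (map edeg ys) (map (sum_list \<circ> map edeg) zss)"
 have all: "list_all2 (composable F) (y # ys) (zs # zss)" using Cons.hyps by simp
 note y = composableD[OF Cons.hyps(1)]
 note la = list_all2_composable[OF Cons.hyps(2)]
 have ysE: "set ys \<subseteq> elems F" using Cons.hyps(2) by (induction ys zss rule: list_all2_induct) (auto simp: composable_def)
 have psi: "psi \<in> FMlin V (el_cell ?g # map el_cell ?gs)" using Cons.prems by simp
 \<comment> \<open>The test function with its four arguments separated: \<open>us\<close> is grafted
   onto \<open>t\<close> and \<open>vs\<close> onto \<open>ts\<close>. What follows is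
   multilinearity in each argument, also after some of the others have been summed out.\<close>
 define K where "K t ts us vs = sg (fgraft_exp (t # ts) (us @ vs)) * psi (fgraft (t # ts) (us @ vs))"
  for t ts us vs
 have K1: "(%ts. K t ts us vs) \<in> FMlin V ?cs"
  if "t \<in> trees V" "tcell t = ?c" "us \<in> forests V ?cz" "vs \<in> forests V ?cZ" for t us vs
 proof -
  have "us @ vs \<in> forests V (map el_cell (concat (zs # zss)))" using that(3,4) by (simp add: forests_append)
  from comp_forest_left[OF all Cons.prems this]
  have "(%ts. sg (fgraft_exp ts (us @ vs)) * psi (fgraft ts (us @ vs))) \<in> FMlin V (?c # ?cs)" by simp
  from FMlin_Cons2[OF this that(1,2)] show ?thesis by (simp only: K_def)
 qed
 have K0: "(%t. K t ts us vs) \<in> Mlin V ?c"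
  if "ts \<in> forests V ?cs" "us \<in> forests V ?cz" "vs \<in> forests V ?cZ" for ts us vs
 proof -
  have "us @ vs \<in> forests V (map el_cell (concat (zs # zss)))" using that(2,3) by (simp add: forests_append)
  from comp_forest_left[OF all Cons.prems this]
  have "(%ts. sg (fgraft_exp ts (us @ vs)) * psi (fgraft ts (us @ vs))) \<in> FMlin V (?c # ?cs)" by simp
  from FMlin_Cons1[OF this that(1)] show ?thesis by (simp only: K_def)
 qed
 have KR: "(%ws. sg (fgraft_exp (t # ts) ws) * psi (fgraft (t # ts) ws)) \<in> FMlin V (?cz @ ?cZ)"
  if "t \<in> trees V" "tcell t = ?c" "ts \<in> forests V ?cs" for t ts
  using comp_forest_right[OF all Cons.prems, of "t # ts"] that by simp
 have K2: "(%us. K t ts us vs) \<in> FMlin V ?cz"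
  if "t \<in> trees V" "tcell t = ?c" "ts \<in> forests V ?cs" "vs \<in> forests V ?cZ" for t ts vs
  using FMlin_append1[OF KR[OF that(1-3)] that(4)] by (simp only: K_def)
 have K3: "K t ts us \<in> FMlin V ?cZ"
  if "t \<in> trees V" "tcell t = ?c" "ts \<in> forests V ?cs" "us \<in> forests V ?cz" for t ts us
  using FMlin_append2[OF KR[OF that(1-3)] that(4)] by (simp only: K_def[abs_def])
 have Z1: "(%ts. bind_list (map evec (concat zss)) (K t ts us)) \<in> FMlin V ?cs"
  if "t \<in> trees V" "tcell t = ?c" "us \<in> forests V ?cz" for t us by (rule bind_FMlin[OF la(2)]) (use that K3 K1 in auto)
 have Z2: "(%us. bind_list (map evec (concat zss)) (K t ts us)) \<in> FMlin V ?cz"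
  if "t \<in> trees V" "tcell t = ?c" "ts \<in> forests V ?cs" for t ts by (rule bind_FMlin[OF la(2)]) (use that K3 K2 in auto)
 have Z0: "(%t. bind_list (map evec (concat zss)) (K t ts us)) \<in> Mlin V ?c"
  if "ts \<in> forests V ?cs" "us \<in> forests V ?cz" for ts us
  by (rule fcomb_Mlin[OF bind_comb[OF la(2)]]) (use that K3 K0 in "auto simp: forests_degs_def")
 let ?Z = "bind_list (map evec (concat zss))" and ?Y = "bind_list (map evec ys)" and ?z = "bind_list (map evec zs)"
 have Y2: "(%us. ?Y (%ts. ?Z (K t ts us))) \<in> FMlin V ?cz" if "t \<in> trees V" "tcell t = ?c" for t
  by (rule bind_FMlin[OF ysE]) (use that Z1 Z2 in auto)
 have zY: "(%ts. ?z (%us. ?Z (K t ts us))) \<in> FMlin V ?cs" if "t \<in> trees V" "tcell t = ?c" for t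
  by (rule bind_FMlin[OF y(2)]) (use that Z1 Z2 in auto)
 have Yz0: "(%t. ?Y (%ts. ?z (%us. ?Z (K t ts us)))) \<in> Mlin V ?c"
 proof (rule fcomb_Mlin[OF bind_comb[OF ysE] zY])
  fix ts assume "ts \<in> forests_degs ?cs (map edeg ys)"
  then have ts: "ts \<in> forests V ?cs" by (simp add: forests_degs_def)
  show "(%t. ?z (%us. ?Z (K t ts us))) \<in> Mlin V ?c"
   by (rule fcomb_Mlin[OF bind_comb[OF y(2)]]) (use ts Z0 Z2 in "auto simp: forests_degs_def")
 qed auto
 define chi where "chi g = bind_list (map evec ?gs) (%gs. psi (g # gs))" for g
 have chi: "chi \<in> Mlin V (el_cell ?g)" unfolding chi_def[abs_def] by (rule bind_step_Mlin[OF la(1) psi])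
 have chi': "chi \<in> Mlin V (concat (map etop zs), ebot y)" using chi by (simp add: compE_def)
 have tu: "sg (m * N + \<kappa>) * (sg (graft_exp t us) * chi (graft t us)) = ?Y (%ts. ?Z (K t ts us))"
  if t: "t \<in> trdeg V ?c (edeg y)" and us: "us \<in> forests_degs ?cz (map edeg zs)" for t us
 proof -
  have usf: "us \<in> forests V ?cz" and usd: "deg_sum us = m" using us by (auto simp: forests_degs_def m_def)
  have ust: "set us \<subseteq> trees V" "map root us = leaves t" "map leaves us = map etop zs"
   using forests_rootD[OF usf] t y(4) by (auto simp: o_def)
  have lu: "length us = nleaves t" by (rule map_root_length[OF ust(2)])
  have gc: "graft t us \<in> trees V" "tcell (graft t us) = el_cell ?g"
   using t ust lu by (auto intro: graft_trees(1) simp: compE_def)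
  have psig: "(%gs. psi (graft t us # gs)) \<in> FMlin V (map el_cell ?gs)" by (rule FMlin_Cons2[OF psi gc])
  note IH = Cons.IH[OF psig]
  let ?K' = "%ts vs. sg (fgraft_exp ts vs) * psi (graft t us # fgraft ts vs)"
  have k1: "?K' ts \<in> FMlin V ?cZ" if "ts \<in> forests V ?cs" for ts by (rule comp_forest_right[OF Cons.hyps(2) psig that])
  have k2: "(%ts. ?K' ts vs) \<in> FMlin V ?cs" if "vs \<in> forests V ?cZ" for vs
   by (rule comp_forest_left[OF Cons.hyps(2) psig that])
  have kY: "(%ts. ?Z (?K' ts)) \<in> FMlin V ?cs" by (rule bind_FMlin[OF la(2)]) (use k1 k2 in auto)
  have tt: "t \<in> trees V" "tcell t = ?c" using t by auto
  have "?Y (%ts. ?Z (K t ts us)) = sg (m * N + graft_exp t us) * ?Y (%ts. ?Z (?K' ts))"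
  proof (rule fcomb_mult[OF bind_comb[OF ysE] kY Z1[OF tt usf]])
   fix ts assume "ts \<in> forests_degs ?cs (map edeg ys)"
   then have ts: "ts \<in> forests V ?cs" "deg_sum ts = N" by (auto simp: forests_degs_def N_def)
   show "?Z (K t ts us) = sg (m * N + graft_exp t us) * ?Z (?K' ts)"
    by (rule fcomb_mult[OF bind_comb[OF la(2)] k1[OF ts(1)] K3[OF tt ts(1) usf]])
     (use lu usd ts(2) in "simp add: K_def sg_add mult.assoc")
  qed
  also have "\<dots> = sg (m * N + graft_exp t us) * (sg \<kappa> * chi (graft t us))"
   unfolding IH[symmetric] \<kappa>_def chi_def ..
  finally show ?thesis by (simp add: sg_add mult.assoc mult.left_commute)
 qed
 have "sg (m * N + \<kappa>) * bind_list (map evec (?g # ?gs)) psi = sg (m * N + \<kappa>) * opcomp F y zs chi"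
  by (simp add: chi_def[abs_def])
 also have "\<dots> = sg (m * N + \<kappa>) * evec y (%t. ?z (%us. sg (graft_exp t us) * chi (graft t us)))"
  using chi' by (simp add: F_opcomp)
 also have "\<dots> = evec y (%t. ?Y (%ts. ?z (%us. ?Z (K t ts us))))"
 proof (rule fcomb_mult[OF y(6) bind_term_Mlin[OF Cons.hyps(1) chi'] Yz0, symmetric])
  fix t assume t: "t \<in> trdeg V ?c (edeg y)"
  then have tt: "t \<in> trees V" "tcell t = ?c" by auto
  \<comment> \<open>\<open>us\<close> is composed with \<open>t\<close> before \<open>ts\<close>
    comes into play, so its functional has to move outwards.\<close>
  have "?Y (%ts. ?z (%us. ?Z (K t ts us))) = ?z (%us. ?Y (%ts. ?Z (K t ts us)))"
   by (rule fcomb_swap[where psi="%ts us. ?Z (K t ts us)", OF bind_comb[OF ysE] bind_comb[OF y(2)] _ _ zY[OF tt] Y2[OF tt]])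
    (use Z1[OF tt] Z2[OF tt] in "auto simp: forests_degs_def")
  also have "\<dots> = sg (m * N + \<kappa>) * ?z (%us. sg (graft_exp t us) * chi (graft t us))"
  proof (rule fcomb_mult[OF bind_comb[OF y(2)] _ Y2[OF tt]])
   show "(%us. sg (graft_exp t us) * chi (graft t us)) \<in> FMlin V ?cz"
    using chi' tt y(4,5) by (intro comp_term_FMlin[where t="ebot y"]) simp_all
  qed (use tu[OF t] in simp)
  finally show "?Y (%ts. ?z (%us. ?Z (K t ts us))) =
   sg (m * N + \<kappa>) * ?z (%us. sg (graft_exp t us) * chi (graft t us))" .
 qed
 finally show ?case by (simp add: m_def N_def \<kappa>_def bind_append K_def[abs_def] o_def del: fgraft_exp.simps fgraft.simps)
qed simp

text \<open>Associativity of grafting settles the trees; what remains is the order of the tensor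
  factors, which is \<open>bind_comp\<close>.\<close>

lemma F_assoc:
 assumes "composable F x ys" "list_all2 (composable F) ys zss"
 shows "opcomp F (compE F x ys) (concat zss) =
  tscale (shuffle_sign (map edeg ys) (map (sum_list \<circ> map edeg) zss)) (opcomp F x (map2 (compE F) ys zss))"
proof
 fix phi
 note c = composableD[OF assms(1)] and la = list_all2_composable[OF assms(2)]
 let ?c = "(concat (map etop (concat zss)), ebot x)" and ?gs = "map2 (compE F) ys zss"
 have cg: "composable F x ?gs" using c la by (simp add: composable_def)
 have cz: "composable F (compE F x ys) (concat zss)" using la F_comp_elems[OF assms(1)] by (simp add: composable_def compE_def)
 show "opcomp F (compE F x ys) (concat zss) phi =
  tscale (shuffle_sign (map edeg ys) (map (sum_list \<circ> map edeg) zss)) (opcomp F x ?gs) phi"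
 proof (cases "phi \<in> Mlin V ?c")
  case True
  let ?Y = "bind_list (map evec ys)" and ?Z = "bind_list (map evec (concat zss))"
  have mz: "(%T. ?Z (%us. sg (graft_exp T us) * phi (graft T us))) \<in> Mlin V (concat (map etop ys), ebot x)"
   using bind_term_Mlin[OF cz, of phi] True by (simp add: compE_def)
  have phig: "phi \<in> Mlin V (concat (map etop ?gs), ebot x)" using True la by simp
  have "opcomp F (compE F x ys) (concat zss) phi =
    evec x (%T. ?Y (%ts. sg (graft_exp T ts) * ?Z (%us. sg (graft_exp (graft T ts) us) * phi (graft (graft T ts) us))))"
   using True mz by (simp add: F_opcomp compE_def)
  also have "\<dots> = sg (shuffle_exp (map edeg ys) (map (sum_list \<circ> map edeg) zss)) *
   evec x (%T. bind_list (map evec ?gs) (%gs. sg (graft_exp T gs) * phi (graft T gs)))"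
  proof (rule fcomb_mult[OF c(6) bind_term_Mlin[OF cg phig] bind_term_Mlin[OF assms(1) mz]])
   fix T assume T: "T \<in> trdeg V (el_cell x) (edeg x)"
   let ?psi = "%gs. sg (graft_exp T gs) * phi (graft T gs)"
   have psi: "?psi \<in> FMlin V (map el_cell ?gs)"
    using T phig composableD(4,5)[OF cg] by (intro comp_term_FMlin[where t="ebot x"]) simp_all
   have "?Y (%ts. sg (graft_exp T ts) * ?Z (%us. sg (graft_exp (graft T ts) us) * phi (graft (graft T ts) us))) =
     ?Y (%ts. ?Z (%us. sg (fgraft_exp ts us) * ?psi (fgraft ts us)))"
   proof (rule fcomb_cong[OF bind_comb[OF c(2)]])
    show "(%ts. sg (graft_exp T ts) * ?Z (%us. sg (graft_exp (graft T ts) us) * phi (graft (graft T ts) us)))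
      \<in> FMlin V (map el_cell ys)"
     using T mz c(4,5) comp_term_FMlin[of "%T. ?Z (%us. sg (graft_exp T us) * phi (graft T us))"
      "map el_cell ys" "ebot x" T] by simp
    show "(%ts. ?Z (%us. sg (fgraft_exp ts us) * ?psi (fgraft ts us))) \<in> FMlin V (map el_cell ys)"
     by (rule bind_FMlin[OF la(2)])
      (use comp_forest_left[OF assms(2) psi] comp_forest_right[OF assms(2) psi] in auto)
    fix ts assume "ts \<in> forests_degs (map el_cell ys) (map edeg ys)"
    then have ts: "ts \<in> forests V (map el_cell ys)" by (simp add: forests_degs_def)
    have tst: "set ts \<subseteq> trees V" "map root ts = leaves T" "fleaves ts = concat (map etop ys)"
     using forests_rootD[OF ts] T c(4,5) by auto
    have lt: "length ts = nleaves T" by (rule map_root_length[OF tst(2)])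
    show "sg (graft_exp T ts) * ?Z (%us. sg (graft_exp (graft T ts) us) * phi (graft (graft T ts) us)) =
     ?Z (%us. sg (fgraft_exp ts us) * ?psi (fgraft ts us))"
    proof (rule fcomb_mult[OF bind_comb[OF la(2)] _ comp_forest_right[OF assms(2) psi ts], symmetric])
     have g: "graft T ts \<in> trees V" "tcell (graft T ts) = (concat (map etop ys), ebot x)"
      using T tst lt by (auto intro: graft_trees(1))
     show "(%us. sg (graft_exp (graft T ts) us) * phi (graft (graft T ts) us)) \<in> FMlin V (map el_cell (concat zss))"
      using g True composableD(4,5)[OF cz] by (intro comp_term_FMlin[where t="ebot x"]) (simp_all add: compE_def)
     fix us assume "us \<in> forests_degs (map el_cell (concat zss)) (map edeg (concat zss))"
     then have us: "us \<in> forests V (map el_cell (concat zss))" by (simp add: forests_degs_def)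
     have lu: "length us = length (fleaves ts)" using fgraft_el_cells(4)[OF assms(2) ts us] by (metis length_map)
     have e: "fgraft_exp ts us + graft_exp T (fgraft ts us) =
       graft_exp T ts + graft_exp (graft T ts) us" using graft_exp_assoc[OF lt lu] by simp
     show "sg (fgraft_exp ts us) * ?psi (fgraft ts us) =
      sg (graft_exp T ts) * (sg (graft_exp (graft T ts) us) * phi (graft (graft T ts) us))"
      by (simp only: sg_mult_cong[OF e] graft_assoc[OF lt lu])
    qed
   qed
   also have "\<dots> = sg (shuffle_exp (map edeg ys) (map (sum_list \<circ> map edeg) zss)) * bind_list (map evec ?gs) ?psi"
    by (rule bind_comp[OF assms(2) psi, symmetric])
   finally show "?Y (%ts. sg (graft_exp T ts) * ?Z (%us. sg (graft_exp (graft T ts) us) * phi (graft (graft T ts) us))) =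
    sg (shuffle_exp (map edeg ys) (map (sum_list \<circ> map edeg) zss)) * bind_list (map evec ?gs) ?psi" .
  qed
  finally show ?thesis using phig by (simp add: F_opcomp tscale_def shuffle_sign_exp)
 next
  case False
  then have "phi \<notin> Mlin V (concat (map etop ?gs), ebot x)" using la by simp
  with False show ?thesis by (simp add: F_opcomp tscale_def compE_def)
 qed
qed

lemma bind_ident: 
 "psi \<in> FMlin V (map (%a. ([a], a)) as) ==> \<forall>a\<in>set as. Leaf a \<in> trees V ==>
 bind_list (map (%a. ptens V (Leaf a)) as) psi = psi (map Leaf as)"
proof (induction as arbitrary: psi)
 case (Cons a as)
 have f: "map Leaf as \<in> forests V (map (%a. ([a], a)) as)" using Cons.prems by (auto simp: forests_def)
 have els: "set (map (%a. El [a] a 0 (ptens V (Leaf a))) as) \<subseteq> elems F"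
  using Cons.prems(2) by (auto simp: F_elems intro!: ptens_free_cx Leaf_cells)
 have m: "(%t. bind_list (map (%a. ptens V (Leaf a)) as) (%ts. psi (t # ts))) \<in> Mlin V ([a], a)"
  using bind_step_Mlin[OF els, of psi "([a], a)"] Cons.prems(1) by (simp add: o_def)
 have "bind_list (map (%a. ptens V (Leaf a)) (a # as)) psi = bind_list (map (%a. ptens V (Leaf a)) as) (%ts. psi (Leaf a # ts))"
  using m by (simp add: Mlin_ptens)
 also have "\<dots> = psi (Leaf a # map Leaf as)" using Cons.prems by (intro Cons.IH FMlin_Cons2[where c="([a], a)"]) auto
 finally show ?case by simp
qed simp

lemma F_unit:
 assumes "x \<in> elems F"
 shows "opcomp F x (map (idE F) (etop x)) = evec x" "opcomp F (idE F (ebot x)) [x] = evec x"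
proof -
 have x: "evec x \<in> free_cx V (el_cell x) (edeg x)" "el_cell x \<in> cells V" using assms by (auto simp: F_elems)
 note fx = free_cx_fcomb[OF x(1)]
 have lf: "\<forall>a\<in>set (etop x). Leaf a \<in> trees V" using cell_Leaf_trees[OF x(2)] by blast
 have 0: "evec x phi = 0" if "phi \<notin> Mlin V (el_cell x)" for phi using x(1) that by (simp add: free_cx_iff)
 have cx: "composable F x (map (idE F) (etop x))" using assms lf F_ident_elems by (auto simp: composable_def o_def idE_def[of F])
 have top: "concat (map etop (map (idE F) as)) = as" for as by (simp add: idE_def o_def)
 show "opcomp F x (map (idE F) (etop x)) = evec x" proof
  fix phi
  show "opcomp F x (map (idE F) (etop x)) phi = evec x phi" proof (cases "phi \<in> Mlin V (el_cell x)")
   case True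
   have "evec x (%T. bind_list (map evec (map (idE F) (etop x))) (%ts. sg (graft_exp T ts) * phi (graft T ts))) = evec x phi"
   proof (rule fcomb_cong[OF fx bind_term_Mlin[OF cx] True])
    show "phi \<in> Mlin V (concat (map etop (map (idE F) (etop x))), ebot x)" using True by (simp only: top)
    fix T assume T: "T \<in> trdeg V (el_cell x) (edeg x)"
    have "(%ts. sg (graft_exp T ts) * phi (graft T ts)) \<in> FMlin V (map (%a. ([a], a)) (etop x))"
     using T True by (intro comp_term_FMlin[where t="ebot x"]) (simp_all add: o_def)
    from bind_ident[OF this lf]
    show "bind_list (map evec (map (idE F) (etop x))) (%ts. sg (graft_exp T ts) * phi (graft T ts)) = phi T"
     using T graft_unit[of T] graft_exp_unit[of T] by (simp add: idE_def o_def)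
   qed
   then show ?thesis using True by (simp add: F_opcomp top del: map_map)
  next
   case False
   then show ?thesis by (simp add: F_opcomp top 0 del: map_map)
  qed
 qed
 show "opcomp F (idE F (ebot x)) [x] = evec x" proof
  fix phi
  have c1: "composable F (idE F (ebot x)) [x]"
   using assms F_ident_elems[OF cell_Leaf_trees[OF x(2), of "ebot x"]] by (simp add: composable_def idE_def)
  show "opcomp F (idE F (ebot x)) [x] phi = evec x phi" proof (cases "phi \<in> Mlin V (el_cell x)")
   case True
   have "(%T. bind_list (map evec [x]) (%ts. sg (graft_exp T ts) * phi (graft T ts))) \<in> Mlin V ([ebot x], ebot x)"
    using bind_term_Mlin[OF c1, of phi] True by (simp add: idE_def)
   then show ?thesis using True by (simp add: F_opcomp idE_def Mlin_ptens)
  next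
   case False
   then show ?thesis by (simp add: F_opcomp idE_def 0)
  qed
 qed
qed

theorem two_cat_free_obj: "two_cat (objs V) F"
 unfolding two_cat_def
proof (intro conjI allI ballI impI)
 show "opcomp F (El s t n (scl F a v + scl F b w)) ys =
   scl F a (opcomp F (El s t n v) ys) + scl F b (opcomp F (El s t n w) ys)" for s t n v w ys a b
  by (simp add: F_opcomp fun_eq_iff tscale_def)
 show "opcomp F x (ls @ El s t n (scl F a v + scl F b w) # rs) =
   scl F a (opcomp F x (ls @ El s t n v # rs)) + scl F b (opcomp F x (ls @ El s t n w # rs))"
  if "composable F x (ls @ El s t n v # rs) \<and> composable F x (ls @ El s t n w # rs)" for x ls s t n v w rs a b
  using F_comp_linear[of x ls s t n v rs w] that by simp
 show "diff F (compE F x ys) = opcomp F (dE F x) ys +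
   (\<Sum>l<length ys. scl F (sg (edeg x + sum_list (map edeg (take l ys)))) (opcomp F x (ys[l := dE F (ys ! l)])))"
  if "composable F x ys" for x ys using F_Leibniz[OF that] by simp
 show "opcomp F (compE F x ys) (concat zss) =
   scl F (shuffle_sign (map edeg ys) (map (sum_list \<circ> map edeg) zss)) (opcomp F x (map2 (compE F) ys zss))"
  if "composable F x ys \<and> list_all2 (composable F) ys zss" for x ys zss using F_assoc[of x ys zss] that by simp
 show "complexes F" by (rule F_complexes)
qed (simp_all add: F_ident F_comp_elems F_unit)

end

section \<open>Contraction of edges\<close>

text \<open>Sums over the chords directly above a vertex whose inputs carry the trees
  \<open>ts\<close>. The sign is that of moving the decoration \<open>y\<close> alone to the front,
  past the trees on its left; the subtrees \<open>us\<close> of \<open>y\<close> keep their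
  place.\<close>

definition pick ::
 "('i, 'e, 'v) dtree list =>
 (('i, 'e, 'v) dtree list => ('i, 'e, 'v) el => ('i, 'e, 'v) dtree list => ('i, 'e, 'v) dtree list => 'k::field) => 'k"
where
 "pick ts psi = (\<Sum>l<length ts. case ts ! l of Leaf a => 0 | Node y us =>
  sg (edeg y * deg_sum (take l ts)) * psi (take l ts) y us (drop (Suc l) ts))"

lemma pick_Nil [simp]: "pick [] psi = 0" by (simp add: pick_def)

lemma pick_Leaf [simp]: "pick (Leaf a # ts) psi = pick ts (%as y us bs. psi (Leaf a # as) y us bs)"
 unfolding pick_def by (simp add: sum.lessThan_Suc_shift del: sum.lessThan_Suc)
  (intro sum.cong refl, auto split: dtree.splits)

lemma pick_Node [simp]:
 "pick (Node x vs # ts) psi = psi [] x vs ts +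
  pick ts (%as y us bs. sg (edeg y * (edeg x + deg_sum vs)) * psi (Node x vs # as) y us bs)"
 unfolding pick_def by (simp add: sum.lessThan_Suc_shift del: sum.lessThan_Suc)
  (intro sum.cong refl, auto simp: sg_add distrib_left distrib_right mult.assoc split: dtree.splits)

lemma pick_Cons:
 "pick (t # ts) psi = (case t of Leaf a => 0 | Node y us => psi [] y us ts) +
  pick ts (%as y us bs. sg (edeg y * tdeg t) * psi (t # as) y us bs)" by (cases t) auto

lemma pick_cong:
 assumes "\<And>as y us bs. ts = as @ Node y us # bs ==> psi as y us bs = chi as y us bs"
 shows "pick ts psi = pick ts chi"
 using assms
proof (induction ts arbitrary: psi chi)
 case (Cons t ts)
 show ?case by (cases t) (auto simp: Cons.prems[of "[]"] intro!: Cons.IH Cons.prems)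
qed simp

lemma pick_lin:
 assumes "\<And>as y us bs. ts = as @ Node y us # bs ==> \<theta> as y us bs = a * psi as y us bs + b * chi as y us bs"
 shows "pick ts \<theta> = a * pick ts psi + b * pick ts chi"
 using assms
proof (induction ts arbitrary: psi chi \<theta>)
 case (Cons t ts)
 have "pick ts (%as y us bs. sg (edeg y * tdeg t) * \<theta> (t # as) y us bs) =
  a * pick ts (%as y us bs. sg (edeg y * tdeg t) * psi (t # as) y us bs) +
  b * pick ts (%as y us bs. sg (edeg y * tdeg t) * chi (t # as) y us bs)"
  by (rule Cons.IH) (simp add: Cons.prems algebra_simps)
 then show ?case by (auto simp: pick_Cons Cons.prems[of "[]"] algebra_simps split: dtree.splits)
qed simp

lemma pick_add: "pick ts (%as y us bs. psi as y us bs + chi as y us bs) = pick ts psi + pick ts chi"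
 using pick_lin[of ts _ 1 psi 1 chi] by simp

lemma pick_mult: "pick ts (%as y us bs. r * psi as y us bs) = r * pick ts psi"
 using pick_lin[of ts _ r psi 0 psi] by simp

lemma pick_0 [simp]: "pick ts (%as y us bs. 0) = 0" using pick_mult[of ts 0 "%_ _ _ _. 0"] by simp

lemma pick_append:
 "pick (as @ bs) psi = pick as (%p y us q. psi p y us (q @ bs)) +
  pick bs (%p y us q. sg (edeg y * deg_sum as) * psi (as @ p) y us q)"
proof (induction as arbitrary: psi)
 case (Cons t ts)
 show ?case
  unfolding append_Cons pick_Cons Cons.IH by (cases t) (simp_all add: distrib_left sg_add mult_ac)
qed simp

text \<open>Both sides run over the pairs of members with vertices, \<open>z\<close> standing to the
  left of \<open>y\<close>. The explicit sign on the right is what \<open>y\<close> lacks when it is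
  picked from the part \<open>cs\<close> behind \<open>z\<close>.\<close>

lemma pick_exchange:
 "pick ts (%as y us bs. pick as (%as1 z vs as2. F as1 z vs as2 y us bs)) =
 pick ts (%as1 z vs cs. pick cs (%as2 y us bs.
  sg (edeg y * (deg_sum as1 + edeg z + deg_sum vs)) * F as1 z vs as2 y us bs))"
proof (induction ts arbitrary: F)
 case (Cons t ts)
 have 1: "pick ts (%as y us bs. pick as (%p z vs q. sg (edeg y * tdeg t) * (sg (edeg z * tdeg t) * F (t # p) z vs q y us bs))) =
  pick ts (%as1 z vs cs. sg (edeg z * tdeg t) * pick cs (%as2 y us bs.
    sg (edeg y * (deg_sum (t # as1) + edeg z + deg_sum vs)) * F (t # as1) z vs as2 y us bs))"
  unfolding Cons.IH pick_mult[symmetric] by (intro pick_cong) (simp add: sg_add distrib_left mult_ac)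
 show ?case proof (cases t)
  case (Leaf a)
  then show ?thesis using 1 by (simp add: pick_mult)
 next
  case (Node z vs)
  then show ?thesis using 1 by (simp add: pick_add pick_mult distrib_left)
 qed
qed simp

lemma pick_comb:
 assumes "\<And>as y us bs. ts = as @ Node y us # bs ==> fcomb S F (g as y us bs)"
 shows "fcomb S F (%phi. pick ts (%as y us bs. g as y us bs phi))"
 using assms
proof (induction ts arbitrary: g)
 case (Cons t ts)
 have "fcomb S F (%phi. pick ts (%as y us bs. (%phi. sg (edeg y * tdeg t) * g (t # as) y us bs phi) phi))"
  by (rule Cons.IH, rule fcomb_scale, rule Cons.prems) simp
 moreover have "fcomb S F (%phi. case t of Leaf a => 0 | Node y us => g [] y us ts phi)"
  using Cons.prems[of "[]"] by (cases t) (auto intro: fcomb_0)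
 ultimately show ?case unfolding pick_Cons by (intro fcomb_plus) simp_all
qed (simp add: fcomb_0)

lemma fcomb_pick:
 assumes "fcomb S UNIV x"
 shows "x (%s. pick ts (%as y us bs. psi s as y us bs)) = pick ts (%as y us bs. x (%s. psi s as y us bs))"
proof (induction ts arbitrary: psi)
 case Nil
 then show ?case using fcomb_zero[OF assms, of "%_. 0"] by simp
next
 case (Cons t ts)
 have 1: "x (%s. (case t of Leaf a => 0 | Node y us => psi s [] y us ts) +
   pick ts (%as y us bs. sg (edeg y * tdeg t) * psi s (t # as) y us bs)) =
   x (%s. case t of Leaf a => 0 | Node y us => psi s [] y us ts) +
   x (%s. pick ts (%as y us bs. sg (edeg y * tdeg t) * psi s (t # as) y us bs))"
  by (rule fcomb_add[OF assms]) auto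
 have 2: "x (%s. case t of Leaf a => 0 | Node y us => psi s [] y us ts) =
   (case t of Leaf a => 0 | Node y us => x (%s. psi s [] y us ts))"
  using fcomb_zero[OF assms, of "%_. 0"] by (cases t) auto
 have 3: "x (%s. r * f s) = r * x f" for r f by (rule fcomb_mult[OF assms]) auto
 show ?case
  unfolding pick_Cons 1 2 Cons.IH 3 ..
qed

text \<open>The pure tensors of the trees with at least one vertex span the coaugmentation coideal
  of the bar construction.\<close>

definition trees_node :: "('k, 'i, 'e, 'v, 'z) coll_scheme => ('i, 'e) cell => int => ('i, 'e, 'v) dtree set" where
 "trees_node V c n = {T \<in> trdeg V c n. \<forall>a. T \<noteq> Leaf a}"

lemma trees_node_Node [simp]:
 "Node x ts \<in> trees_node V c n \<longleftrightarrow> Node x ts \<in> trdeg V c n" by (auto simp: trees_node_def)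

primrec vcount :: "('i, 'e, 'v) dtree => nat" where
 "vcount (Leaf a) = 0"
| "vcount (Node x ts) = Suc (sum_list (map vcount ts))"

text \<open>The relation \<open>R\<close> compares the numbers of vertices before and after. It will
  be the trivial relation, equality, or the loss of exactly one vertex. The class of test functions
  is \<open>UNIV\<close> because the bar operators are explicit finite sums of trees.\<close>

lemma at_comb_vcount:
 assumes R: "\<And>a b c. R a b ==> R (a + c) (b + c)"
  and "\<And>x ts. Node x ts \<in> trees V ==>
   fcomb {S \<in> trees_node V (fleaves ts, ebot x) (edeg x + deg_sum ts + 1). R (vcount S) (vcount (Node x ts))} UNIV (rho x ts)"
 shows "T \<in> trees V ==>
   fcomb {S \<in> trees_node V (tcell T) (tdeg T + 1). R (vcount S) (vcount T)} UNIV (at_vertices rho T)"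
  and "set ts \<subseteq> trees V ==>
   fcomb {ss \<in> forests_deg V (map tcell ts) (deg_sum ts + 1). R (sum_list (map vcount ss)) (sum_list (map vcount ts))}
    UNIV (forest_at rho ts)"
proof (induction T and ts rule: tree_induct)
 case (Leaf a)
 then show ?case by (simp add: fcomb_0)
next
 case (Node x ts)
 let ?S = "{S \<in> trees_node V (fleaves ts, ebot x) (edeg x + deg_sum ts + 1). R (vcount S) (vcount (Node x ts))}"
 have x: "set ts \<subseteq> trees V" "map root ts = etop x" "x \<in> elems V" using Node.prems by auto
 have 1: "fcomb ?S UNIV (%phi. forest_at rho ts (%ts'. 1 * phi (Node x ts')))"
 proof (rule fcomb_image[OF Node.IH[OF x(1)]])
  fix ts' assume "ts' \<in> {ss \<in> forests_deg V (map tcell ts) (deg_sum ts + 1). R (sum_list (map vcount ss)) (sum_list (map vcount ts))}"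
  then show "Node x ts' \<in> ?S"
   using x R[of "sum_list (map vcount ts')" "sum_list (map vcount ts)" 1]
   by (auto simp: forests_deg_def forests_def dest: map_tcell_eqD)
 qed simp
 have "fcomb ?S UNIV (%phi. rho x ts phi + sg (edeg x) * forest_at rho ts (%ts'. phi (Node x ts')))"
  using 1 assms(2)[OF Node.prems] by (intro fcomb_plus fcomb_scale) simp_all
 then show ?case by (simp add: at_vertices_Node[abs_def])
next
 case Nil
 then show ?case by (simp add: fcomb_0)
next
 case (Cons t ts)
 let ?S = "{ss \<in> forests_deg V (tcell t # map tcell ts) (tdeg t + deg_sum ts + 1).
  R (sum_list (map vcount ss)) (vcount t + sum_list (map vcount ts))}"
 have 1: "fcomb ?S UNIV (%psi. at_vertices rho t (%t'. 1 * psi (t' # ts)))"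
  by (rule fcomb_image[OF Cons.IH(1)]) (use Cons.prems R in "auto simp: forests_deg_def trees_node_def forests_def")
 have 2: "fcomb ?S UNIV (%psi. forest_at rho ts (%ts'. 1 * psi (t # ts')))"
  by (rule fcomb_image[OF Cons.IH(2)]) (use Cons.prems R[of _ _ "vcount t", unfolded add.commute[of _ "vcount t"]] in "auto simp: forests_deg_def forests_def")
 have "fcomb ?S UNIV
   (%psi. at_vertices rho t (%t'. psi (t' # ts)) + sg (tdeg t) * forest_at rho ts (%ts'. psi (t # ts')))"
  using 1 2 by (intro fcomb_plus fcomb_scale) simp_all
 then show ?case by (simp add: forest_at_Cons[abs_def])
qed

text \<open>The properties of partial composition on the shifted augmentation ideal that make the
  bar differential square to zero, with the signs caused by the shift. The coefficient
  \<open>\<kappa>\<close> of the contractions will be 1 for the bar differential and 0 for its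
  internal part, so that both squares vanish by one argument.\<close>

locale contraction_data =
 fixes V :: "('k::field, 'i, 'e, 'v::ab_group_add) coll"
  and g :: "('i, 'e, 'v) el => nat => ('i, 'e, 'v) el => ('i, 'e, 'v) el"
  and \<kappa> :: 'k
 assumes cV: "complexes V"
  and g_simps: "etop (g x l y) = take l (etop x) @ etop y @ drop (Suc l) (etop x)" "ebot (g x l y) = ebot x"
   "edeg (g x l y) = edeg x + edeg y + 1"
  and g_elems: "x \<in> elems V ==> y \<in> elems V ==> l < length (etop x) ==> ebot y = etop x ! l ==> g x l y \<in> elems V"
  and g_lin1: "El s t n v \<in> elems V ==> El s t n w \<in> elems V ==> y \<in> elems V ==> l < length s ==> ebot y = s ! l ==>
   evec (g (El s t n (scl V a v + scl V b w)) l y) =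
   scl V a (evec (g (El s t n v) l y)) + scl V b (evec (g (El s t n w) l y))"
  and g_lin2: "El s t n v \<in> elems V ==> El s t n w \<in> elems V ==> x \<in> elems V ==> l < length (etop x) ==> t = etop x ! l ==>
   evec (g x l (El s t n (scl V a v + scl V b w))) =
   scl V a (evec (g x l (El s t n v))) + scl V b (evec (g x l (El s t n w)))"
  and g_Leibniz: "x \<in> elems V ==> y \<in> elems V ==> l < length (etop x) ==> ebot y = etop x ! l ==>
   diff V (g x l y) = scl V 1 (evec (g (dE V x) l y)) + scl V (- sg (edeg x)) (evec (g x l (dE V y)))"
  and g_seq: "x \<in> elems V ==> y \<in> elems V ==> z \<in> elems V ==> l < length (etop x) ==> ebot y = etop x ! l ==>
   m < length (etop y) ==> ebot z = etop y ! m ==> g (g x l y) (l + m) z = g x l (g y m z)"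
  and g_par: "x \<in> elems V ==> y \<in> elems V ==> z \<in> elems V ==> l < m ==> m < length (etop x) ==>
   ebot y = etop x ! l ==> ebot z = etop x ! m ==>
   evec (g (g x l y) (m - 1 + length (etop y)) z) =
   scl V (sg ((edeg y + 1) * (edeg z + 1))) (evec (g (g x m z) l y))"
begin

text \<open>The exponent \<open>edeg x + 1\<close> is the degree of \<open>x\<close> before
  suspension.\<close>

definition rho :: "('i, 'e, 'v) el => ('i, 'e, 'v) dtree list => ('k, 'i, 'e, 'v) tens" where
 "rho x ts = (%phi. phi (Node (dE V x) ts) +
  \<kappa> * (sg (edeg x + 1) * pick ts (%as y us bs. phi (Node (g x (length as) y) (as @ us @ bs)))))"

lemma dE_elems: "x \<in> elems V ==> dE V x \<in> elems V" using cV by (cases x) (auto simp: complexes_def elems_def dE_def)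

lemma dE_simps [simp]: "etop (dE V x) = etop x" "ebot (dE V x) = ebot x" "edeg (dE V x) = edeg x + 1"
 "evec (dE V x) = diff V x" by (simp_all add: dE_def)

lemma split_facts:
 assumes "Node x (as @ Node y us # bs) \<in> trees V"
 shows "x \<in> elems V" "y \<in> elems V" "length as < length (etop x)" "ebot y = etop x ! length as"
  "length us = length (etop y)" "set as \<subseteq> trees V" "set us \<subseteq> trees V" "set bs \<subseteq> trees V"
  "take (length as) (etop x) = map root as" "drop (Suc (length as)) (etop x) = map root bs" "map root us = etop y"
proof -
 have "map root as @ ebot y # map root bs = etop x" "map root us = etop y" and
  m: "x \<in> elems V" "y \<in> elems V" "set as \<subseteq> trees V" "set us \<subseteq> trees V" "set bs \<subseteq> trees V"
  using assms by auto
 then have e: "etop x = map root as @ ebot y # map root bs" and u: "map root us = etop y" by simp_all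
 show "length as < length (etop x)" "ebot y = etop x ! length as"
  "take (length as) (etop x) = map root as" "drop (Suc (length as)) (etop x) = map root bs" by (simp_all add: e nth_append)
 show "length us = length (etop y)" "map root us = etop y" using u by (auto dest: arg_cong[of _ _ length])
qed (use assms in auto)

lemma contract_trees:
 assumes "Node x (as @ Node y us # bs) \<in> trees V"
 shows "Node (g x (length as) y) (as @ us @ bs) \<in> trees V" using split_facts[OF assms] by (auto simp: g_simps intro: g_elems)

lemma rho_comb:
 assumes "Node x ts \<in> trees V"
 shows "fcomb (trees_node V (fleaves ts, ebot x) (edeg x + deg_sum ts + 1)) UNIV (rho x ts)"
 unfolding rho_def
proof (intro fcomb_plus fcomb_scale pick_comb fcomb_point)
 show "Node (dE V x) ts \<in> trees_node V (fleaves ts, ebot x) (edeg x + deg_sum ts + 1)" using assms by (auto simp: dE_elems)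
 fix as y us bs
 assume ts: "ts = as @ Node y us # bs"
 show "Node (g x (length as) y) (as @ us @ bs) \<in> trees_node V (fleaves ts, ebot x) (edeg x + deg_sum ts + 1)"
  using contract_trees[of x as y us bs] assms by (simp add: ts g_simps)
qed

abbreviation "B \<equiv> at_vertices rho"
abbreviation "FB \<equiv> forest_at rho"

lemma B_comb: "T \<in> trees V ==> fcomb (trees_node V (tcell T) (tdeg T + 1)) UNIV (B T)"
 using at_comb_vcount(1)[of "%_ _. True" V rho] rho_comb by simp

lemma FB_comb: "set ts \<subseteq> trees V ==> fcomb (forests_deg V (map tcell ts) (deg_sum ts + 1)) UNIV (FB ts)"
 using at_comb_vcount(2)[of "%_ _. True" V rho] rho_comb by simp

lemma Node_lin:
 assumes "phi \<in> Mlin V c" "Node x ts \<in> trees V" "Node y ts \<in> trees V" "Node z ts \<in> trees V"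
  and "(etop x, ebot x, edeg x) = (etop z, ebot z, edeg z)" "(etop y, ebot y, edeg y) = (etop z, ebot z, edeg z)"
  and "evec z = scl V a (evec x) + scl V b (evec y)" "tcell (Node z ts) = c"
 shows "phi (Node z ts) = a * phi (Node x ts) + b * phi (Node y ts)"
proof (rule Mlin_D[OF assms(1) _ assms(2-4)])
 show "tree_lin (scl V) a b (Node x ts) (Node y ts) (Node z ts)"
  using assms(5-7) tree_lin.here[of "scl V" a b "etop z" "ebot z" "edeg z" "evec x" ts "evec y"]
  by (cases x; cases y; cases z) simp
qed (use assms in simp)

lemma diff_lin:
 assumes "El s t n v \<in> elems V" "El s t n w \<in> elems V"
 shows "diff V (El s t n (scl V a v + scl V b w)) = scl V a (diff V (El s t n v)) + scl V b (diff V (El s t n w))"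
 using assms cV unfolding complexes_def elems_def lin_on_def by fastforce

sublocale bar: local_op V rho
proof
 fix x ts
 assume "x \<in> elems V" "set ts \<subseteq> trees V" "map root ts = etop x"
 then have "fcomb (trees_node V (fleaves ts, ebot x) (edeg x + deg_sum ts + 1)) UNIV (rho x ts)" by (intro rho_comb) simp
 then show "fcomb (trdeg V (fleaves ts, ebot x) (edeg x + deg_sum ts + 1))
   (Mlin V (fleaves ts, ebot x)) (rho x ts)" by (rule fcomb_mono) (auto simp: trees_node_def)
next
 fix phi c assume phi: "phi \<in> Mlin V c"
 show "(%T. case T of Leaf a => 0 | Node x ts => rho x ts phi) \<in> Mlin V c" proof (rule Mlin_I)
  fix a b t1 t2 t3
  assume *: "tree_lin (scl V) a b t1 t2 t3" "t1 \<in> trees V" "t2 \<in> trees V" "t3 \<in> trees V"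
   "tcell t1 = c" "tcell t2 = c" "tcell t3 = c"
  show "(case t3 of Leaf a => 0 | Node x ts => rho x ts phi) =
    a * (case t1 of Leaf a => 0 | Node x ts => rho x ts phi) +
    b * (case t2 of Leaf a => 0 | Node x ts => rho x ts phi)"
   using *(1)
  proof cases
   case (here p q n v ts w)
   let ?x = "%u. El p q n u" and ?z = "scl V a v + scl V b w"
   have els: "?x v \<in> elems V" "?x w \<in> elems V" "?x ?z \<in> elems V" using here * by auto
   have 1: "phi (Node (dE V (?x ?z)) ts) = a * phi (Node (dE V (?x v)) ts) + b * phi (Node (dE V (?x w)) ts)"
    by (rule Node_lin[OF phi]) (use here * els in "simp_all add: dE_elems diff_lin")
   have 2: "pick ts (%as y us bs. phi (Node (g (?x ?z) (length as) y) (as @ us @ bs))) =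
    a * pick ts (%as y us bs. phi (Node (g (?x v) (length as) y) (as @ us @ bs))) +
    b * pick ts (%as y us bs. phi (Node (g (?x w) (length as) y) (as @ us @ bs)))"
   proof (rule pick_lin)
    fix as y us bs assume ts: "ts = as @ Node y us # bs"
    have sf: "Node (?x u) (as @ Node y us # bs) \<in> trees V" if "?x u \<in> elems V" for u
     using that here * by (auto simp: ts)
    show "phi (Node (g (?x ?z) (length as) y) (as @ us @ bs)) =
     a * phi (Node (g (?x v) (length as) y) (as @ us @ bs)) + b * phi (Node (g (?x w) (length as) y) (as @ us @ bs))"
     by (rule Node_lin[OF phi])
      (use contract_trees[OF sf[OF els(1)]] contract_trees[OF sf[OF els(2)]] contract_trees[OF sf[OF els(3)]]
       split_facts[OF sf[OF els(1)]] g_lin1[OF els(1,2)] here *(7) in "simp_all add: g_simps ts")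
   qed
   show ?thesis by (simp add: here rho_def 1 2 algebra_simps)
  next
   case (below u1 u2 u3 x l r)
   note same = tree_lin_same[OF below(4)]
   let ?f = "%as y us bs. phi (Node (g x (length as) y) (as @ us @ bs))"
   have N: "Node x (l @ u # r) \<in> trees V" "tcell (Node x (l @ u # r)) = c" if "u = u1 \<or> u = u2 \<or> u = u3" for u
    using that below * by auto
   have x: "x \<in> elems V" using N by auto
   have 1: "phi (Node (dE V x) (l @ u3 # r)) = a * phi (Node (dE V x) (l @ u1 # r)) + b * phi (Node (dE V x) (l @ u2 # r))"
    by (rule Mlin_D[OF phi tree_lin.below[OF below(4)]]) (use N[of u1] N[of u2] N[of u3] in "auto simp: dE_elems")
   \<comment> \<open>The contracted chord leads to a tree on the left of the varying one
     (\<open>2\<close>), on its right (\<open>3\<close>), or to the varying tree itself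
     (\<open>4\<close>). In the last case the varying vertex either is the one glued to
     \<open>x\<close> or lies above it.\<close>
   have 2: "pick l (%p y us q. ?f p y us (q @ u3 # r)) =
    a * pick l (%p y us q. ?f p y us (q @ u1 # r)) + b * pick l (%p y us q. ?f p y us (q @ u2 # r))"
   proof (rule pick_lin)
    fix p y us q assume l: "l = p @ Node y us # q"
    have M: "Node (g x (length p) y) ((p @ us @ q) @ u # r) \<in> trees V"
     "tcell (Node (g x (length p) y) ((p @ us @ q) @ u # r)) = c" if "u = u1 \<or> u = u2 \<or> u = u3" for u
     using contract_trees[of x p y us "q @ u # r"] N[OF that] by (simp_all add: l g_simps)
    have "phi (Node (g x (length p) y) ((p @ us @ q) @ u3 # r)) =
     a * phi (Node (g x (length p) y) ((p @ us @ q) @ u1 # r)) + b * phi (Node (g x (length p) y) ((p @ us @ q) @ u2 # r))"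
     by (rule Mlin_D[OF phi tree_lin.below[OF below(4)]]) (use M in blast)+
    then show "?f p y us (q @ u3 # r) = a * ?f p y us (q @ u1 # r) + b * ?f p y us (q @ u2 # r)" by simp
   qed
   have 3: "pick r (%p y us q. sg (edeg y * deg_sum l) * (sg (edeg y * tdeg u1) * ?f (l @ u3 # p) y us q)) =
    a * pick r (%p y us q. sg (edeg y * deg_sum l) * (sg (edeg y * tdeg u1) * ?f (l @ u1 # p) y us q)) +
    b * pick r (%p y us q. sg (edeg y * deg_sum l) * (sg (edeg y * tdeg u1) * ?f (l @ u2 # p) y us q))"
   proof (rule pick_lin)
    fix p y us q assume r: "r = p @ Node y us # q"
    let ?n = "length (l @ u1 # p)"
    have M: "Node (g x ?n y) (l @ u # p @ us @ q) \<in> trees V"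
     "tcell (Node (g x ?n y) (l @ u # p @ us @ q)) = c" if "u = u1 \<or> u = u2 \<or> u = u3" for u
     using contract_trees[of x "l @ u # p" y us q] N[OF that] by (simp_all add: r g_simps)
    have "phi (Node (g x ?n y) (l @ u3 # p @ us @ q)) =
     a * phi (Node (g x ?n y) (l @ u1 # p @ us @ q)) + b * phi (Node (g x ?n y) (l @ u2 # p @ us @ q))"
     by (rule Mlin_D[OF phi tree_lin.below[OF below(4)]]) (use M in blast)+
    then show "sg (edeg y * deg_sum l) * (sg (edeg y * tdeg u1) * ?f (l @ u3 # p) y us q) =
     a * (sg (edeg y * deg_sum l) * (sg (edeg y * tdeg u1) * ?f (l @ u1 # p) y us q)) +
     b * (sg (edeg y * deg_sum l) * (sg (edeg y * tdeg u1) * ?f (l @ u2 # p) y us q))" by (simp add: algebra_simps)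
   qed
   let ?h = "%u. case u of Leaf a => 0 | Node y us => sg (edeg y * deg_sum l) * ?f l y us r"
   have 4: "?h u3 = a * ?h u1 + b * ?h u2"
    using below(4)
   proof cases
    case (here p q n v ts w)
    let ?y = "%u. El p q n u" and ?z = "scl V a v + scl V b w"
    have M: "Node x (l @ Node (?y u) ts # r) \<in> trees V" if "u = v \<or> u = w \<or> u = ?z" for u using N that here by blast
    have "phi (Node (g x (length l) (?y ?z)) (l @ ts @ r)) = a * phi (Node (g x (length l) (?y v)) (l @ ts @ r)) +
     b * phi (Node (g x (length l) (?y w)) (l @ ts @ r))" by (rule Node_lin[OF phi])
      (use contract_trees[OF M[of v]] contract_trees[OF M[of w]] contract_trees[OF M[of ?z]]
       split_facts[OF M[of v]] split_facts(2)[OF M[of w]] N(2)[of u1] here in "simp_all add: g_simps g_lin2")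
    then show ?thesis by (simp add: here algebra_simps)
   next
    case (below w1 w2 w3 y l' r')
    have M: "Node (g x (length l) y) ((l @ l') @ w # r' @ r) \<in> trees V"
     "tcell (Node (g x (length l) y) ((l @ l') @ w # r' @ r)) = c" if "w = w1 \<or> w = w2 \<or> w = w3" for w
     using contract_trees[of x l y "l' @ w # r'" r] N[of "Node y (l' @ w # r')"] that below by (auto simp: g_simps)
    have "phi (Node (g x (length l) y) ((l @ l') @ w3 # r' @ r)) = a * phi (Node (g x (length l) y) ((l @ l') @ w1 # r' @ r)) +
     b * phi (Node (g x (length l) y) ((l @ l') @ w2 # r' @ r))"
     by (rule Mlin_D[OF phi tree_lin.below[OF below(4)]]) (use M in blast)+
    then show ?thesis by (simp add: below algebra_simps)
   qed
   have p: "pick (l @ u # r) ?f = pick l (%p y us q. ?f p y us (q @ u # r)) + (?h u +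
    pick r (%p y us q. sg (edeg y * deg_sum l) * (sg (edeg y * tdeg u1) * ?f (l @ u # p) y us q)))"
    if "tdeg u = tdeg u1" for u
    unfolding pick_append pick_Cons that by (cases u; simp; rule pick_cong; simp add: mult.left_commute)
   show ?thesis
    unfolding below(1-3) dtree.case rho_def p[OF same(1)] p[OF same(2)] p[OF refl] 1 2 3 4 by (simp add: algebra_simps)
  qed
 qed
qed

text \<open>An operator that acts before \<open>pick\<close> either hits the chosen vertex
  \<open>y\<close> itself, or a vertex that is still present in \<open>as @ us @ bs\<close>, and
  then the two operations can be exchanged. In the first term the exponent replaces the sign of
  \<open>y\<close> by that of the new root \<open>y'\<close> and adds the sign of moving the
  operator past \<open>as\<close>. The value at a leaf is a default, as \<open>rho\<close> produces
  trees with vertices.\<close>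

lemma FB_pick:
 "set ts \<subseteq> trees V ==>
 FB ts (%ts'. pick ts' (%as y us bs. psi (length as) y (as @ us @ bs))) =
  pick ts (%as y us bs. rho y us (%S. case S of Leaf a => 0 | Node y' us' =>
    sg ((edeg y' + edeg y + 1) * deg_sum as) * psi (length as) y' (as @ us' @ bs))) +
  pick ts (%as y us bs. sg (edeg y) * FB (as @ us @ bs) (psi (length as) y))"
proof (induction ts arbitrary: psi)
 case (Cons t ts)
 have t: "t \<in> trees V" and ts: "set ts \<subseteq> trees V" using Cons.prems by auto
 note ct = B_comb[OF t] and cts = FB_comb[OF ts]
 let ?P = "%ts psi. pick ts (%as y us bs. psi (length as) y (as @ us @ bs))"
 let ?hd = "%t ts. case t of Leaf a => 0 | Node y us => psi 0 y (us @ ts)"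
 define psi' where "psi' l y zs = sg (edeg y * tdeg t) * psi (Suc l) y (t # zs)" for l y zs
 define R where "R as y us bs = rho y us (%S. case S of Leaf a => 0 | Node y' us' =>
    sg ((edeg y' + edeg y + 1) * deg_sum as) * psi (length as) y' (as @ us' @ bs))" for as y us bs
 have exp: "?P (t' # ts') psi = ?hd t' ts' + pick ts' (%as y us bs. sg (edeg y * tdeg t') * psi (Suc (length as)) y (t' # as @ us @ bs))"
  for t' ts' by (cases t') (simp_all add: pick_Cons)
 have 1: "B t (%t'. ?P (t' # ts) psi) = B t (%t'. ?hd t' ts) +
   B t (%t'. pick ts (%as y us bs. sg (edeg y * (tdeg t + 1)) * psi (Suc (length as)) y (t' # as @ us @ bs)))"
  by (rule fcomb_add[OF ct]) (auto simp: exp trees_node_def)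
 have 2: "B t (%t'. pick ts (%as y us bs. sg (edeg y * (tdeg t + 1)) * psi (Suc (length as)) y (t' # as @ us @ bs))) =
   pick ts (%as y us bs. sg (edeg y * (tdeg t + 1)) * B t (%t'. psi (Suc (length as)) y (t' # as @ us @ bs)))"
  unfolding fcomb_pick[OF ct] by (intro pick_cong fcomb_mult[OF ct]) auto
 have 3: "FB ts (%ts'. ?P (t # ts') psi) = FB ts (%ts'. ?hd t ts') + FB ts (%ts'. ?P ts' psi')"
  by (rule fcomb_add[OF cts]) (auto simp: exp psi'_def)
 have 4: "FB ts (%ts'. ?P ts' psi') =
  pick ts (%as y us bs. rho y us (%S. case S of Leaf a => 0 | Node y' us' =>
    sg ((edeg y' + edeg y + 1) * deg_sum as) * psi' (length as) y' (as @ us' @ bs))) +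
  pick ts (%as y us bs. sg (edeg y) * FB (as @ us @ bs) (psi' (length as) y))" by (rule Cons.IH[OF ts])
 have split: "Node y us \<in> trees V" "set (as @ us @ bs) \<subseteq> trees V" if "ts = as @ Node y us # bs" for as y us bs
  using ts that by auto
 have 5: "sg (tdeg t) * pick ts (%as y us bs. rho y us (%S. case S of Leaf a => 0 | Node y' us' =>
    sg ((edeg y' + edeg y + 1) * deg_sum as) * psi' (length as) y' (as @ us' @ bs))) =
   pick ts (%as y us bs. sg (edeg y * tdeg t) * R (t # as) y us bs)"
  unfolding pick_mult[symmetric]
 proof (rule pick_cong)
  fix as y us bs assume *: "ts = as @ Node y us # bs"
  note cr = rho_comb[OF split(1)[OF *]]
  have "R (t # as) y us bs = sg (edeg y * tdeg t + tdeg t) * rho y us (%S. case S of Leaf a => 0 | Node y' us' =>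
    sg ((edeg y' + edeg y + 1) * deg_sum as) * psi' (length as) y' (as @ us' @ bs))"
   unfolding R_def by (rule fcomb_mult[OF cr])
    (auto simp: psi'_def sg_add distrib_left distrib_right mult_ac split: dtree.split)
  then show "sg (tdeg t) * rho y us (%S. case S of Leaf a => 0 | Node y' us' =>
    sg ((edeg y' + edeg y + 1) * deg_sum as) * psi' (length as) y' (as @ us' @ bs)) =
   sg (edeg y * tdeg t) * R (t # as) y us bs" by (simp add: sg_add mult.assoc)
 qed
 have 6: "sg (tdeg t) * pick ts (%as y us bs. sg (edeg y) * FB (as @ us @ bs) (psi' (length as) y)) +
   pick ts (%as y us bs. sg (edeg y * (tdeg t + 1)) * B t (%t'. psi (Suc (length as)) y (t' # as @ us @ bs))) =
  pick ts (%as y us bs. sg (edeg y * tdeg t) * (sg (edeg y) * FB ((t # as) @ us @ bs) (psi (length (t # as)) y)))"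
  unfolding pick_mult[symmetric] pick_add[symmetric]
 proof (rule pick_cong)
  fix as y us bs assume *: "ts = as @ Node y us # bs"
  have "FB (as @ us @ bs) (psi' (length as) y) = sg (edeg y * tdeg t) * FB (as @ us @ bs) (%zs. psi (Suc (length as)) y (t # zs))"
   by (rule fcomb_mult[OF FB_comb[OF split(2)[OF *]]]) (auto simp: psi'_def)
  then show "sg (tdeg t) * (sg (edeg y) * FB (as @ us @ bs) (psi' (length as) y)) +
    sg (edeg y * (tdeg t + 1)) * B t (%t'. psi (Suc (length as)) y (t' # as @ us @ bs)) =
   sg (edeg y * tdeg t) * (sg (edeg y) * FB ((t # as) @ us @ bs) (psi (length (t # as)) y))"
   by (simp add: sg_add algebra_simps)
 qed
 have 7: "B t (%t'. ?hd t' ts) + sg (tdeg t) * FB ts (%ts'. ?hd t ts') =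
   (case t of Leaf a => 0 | Node y us => R [] y us ts) +
   (case t of Leaf a => 0 | Node y us => sg (edeg y) * FB (us @ ts) (psi 0 y))"
 proof (cases t)
  case (Leaf a)
  then show ?thesis using fcomb_zero[OF cts, of "%_. 0"] by simp
 next
  case (Node y us)
  then show ?thesis by (simp add: R_def forest_at_append sg_add algebra_simps)
 qed
 have "FB (t # ts) (%ts'. ?P ts' psi) =
   (B t (%t'. ?hd t' ts) + sg (tdeg t) * FB ts (%ts'. ?hd t ts')) +
   sg (tdeg t) * pick ts (%as y us bs. rho y us (%S. case S of Leaf a => 0 | Node y' us' =>
    sg ((edeg y' + edeg y + 1) * deg_sum as) * psi' (length as) y' (as @ us' @ bs))) +
   (sg (tdeg t) * pick ts (%as y us bs. sg (edeg y) * FB (as @ us @ bs) (psi' (length as) y)) +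
   pick ts (%as y us bs. sg (edeg y * (tdeg t + 1)) * B t (%t'. psi (Suc (length as)) y (t' # as @ us @ bs))))"
  unfolding forest_at_Cons 1 2 3 4 by (simp only: distrib_left add_ac)
 also have "\<dots> = pick (t # ts) R + pick (t # ts) (%as y us bs. sg (edeg y) * FB (as @ us @ bs) (psi (length as) y))"
  unfolding 5 6 7 pick_Cons by (cases t) (simp_all add: add_ac)
 finally show ?case by (simp add: R_def[abs_def])
qed simp

lemma Mlin_Node_zero:
 assumes "phi \<in> Mlin V c" "Node x ts \<in> trees V" "tcell (Node x ts) = c" "evec x = 0"
 shows "phi (Node x ts) = 0"
proof -
 interpret vector_space "scl V" using cV by (simp add: complexes_def)
 show ?thesis using Node_lin[OF assms(1,2,2,2), of 0 0] assms by simp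
qed

lemma diff_diff: "x \<in> elems V ==> diff V (dE V x) = 0" using cV by (cases x) (auto simp: complexes_def elems_def)

text \<open>If both contracted chords start at \<open>x\<close>, the two orders cancel by
  \<open>g_par\<close>. Otherwise the second chord lies above the vertex glued first, and by
  \<open>g_seq\<close> one may contract it beforehand.\<close>

lemma contract_twice:
 assumes T: "Node x ts \<in> trees V" and phi: "phi \<in> Mlin V (tcell (Node x ts))"
 shows "pick ts (%as y us bs. sg (edeg y) * pick (as @ us @ bs)
   (%ps z vs qs. phi (Node (g (g x (length as) y) (length ps) z) (ps @ vs @ qs)))) =
  pick ts (%as y us bs. sg (edeg y) * pick us (%cs z vs ds. sg (edeg z * deg_sum as) *
   phi (Node (g x (length as) (g y (length cs) z)) (as @ cs @ vs @ ds @ bs))))"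
proof -
 let ?psi = "%as y. %ps z vs qs. phi (Node (g (g x (length as) y) (length ps) z) (ps @ vs @ qs))"
 \<comment> \<open>The vertex \<open>z\<close> contracted second is an input of \<open>x\<close> to
   the left of \<open>y\<close> in \<open>L\<close> and to the right of \<open>y\<close> in
   \<open>R\<close>; the remaining case, \<open>z\<close> above \<open>y\<close>, is
   \<open>mid\<close>.\<close>
 define L where "L = pick ts (%as y us bs. pick as (%p z vs q. sg (edeg y) * ?psi as y p z vs (q @ us @ bs)))"
 define R where "R = pick ts (%as y us bs. pick bs (%p z vs q. sg (edeg y) *
   (sg (edeg z * (deg_sum as + deg_sum us)) * ?psi as y (as @ us @ p) z vs q)))"
 have mid: "pick us (%cs z vs ds. sg (edeg z * deg_sum as) * ?psi as y (as @ cs) z vs (ds @ bs)) =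
   pick us (%cs z vs ds. sg (edeg z * deg_sum as) *
    phi (Node (g x (length as) (g y (length cs) z)) (as @ cs @ vs @ ds @ bs)))"
  if ts: "ts = as @ Node y us # bs" for as y us bs
 proof (rule pick_cong)
  fix cs z vs ds assume us: "us = cs @ Node z vs # ds"
  have N: "Node x (as @ Node y us # bs) \<in> trees V" "Node y (cs @ Node z vs # ds) \<in> trees V" using T by (auto simp: ts us)
  note f = split_facts[OF N(1)] and h = split_facts[OF N(2)]
  have "g (g x (length as) y) (length as + length cs) z = g x (length as) (g y (length cs) z)"
   by (rule g_seq[OF f(1,2) h(2) f(3,4) h(3,4)])
  then show "sg (edeg z * deg_sum as) * ?psi as y (as @ cs) z vs (ds @ bs) =
   sg (edeg z * deg_sum as) * phi (Node (g x (length as) (g y (length cs) z)) (as @ cs @ vs @ ds @ bs))" by simp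
 qed
 \<comment> \<open>After the exchange the left one of the two vertices is picked first, as in
   \<open>R\<close>, and the sums can be compared term by term.\<close>
 have L: "L = pick ts (%as1 z vs cs. pick cs (%as2 y us bs.
  sg (edeg y * (deg_sum as1 + edeg z + deg_sum vs)) * (sg (edeg y) *
   ?psi (as1 @ Node z vs # as2) y as1 z vs (as2 @ us @ bs))))"
  unfolding L_def pick_exchange[symmetric] by (intro pick_cong) simp
 have "L + R = 0"
  unfolding L R_def pick_add[symmetric]
 proof (rule trans[OF pick_cong pick_0])
  fix as1 z vs cs assume ts: "ts = as1 @ Node z vs # cs"
  show "pick cs (%as2 y us bs. sg (edeg y * (deg_sum as1 + edeg z + deg_sum vs)) * (sg (edeg y) *
    ?psi (as1 @ Node z vs # as2) y as1 z vs (as2 @ us @ bs)) +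
   sg (edeg z) * (sg (edeg y * (deg_sum as1 + deg_sum vs)) * ?psi as1 z (as1 @ vs @ as2) y us bs)) = 0"
  proof (rule trans[OF pick_cong pick_0])
   fix as2 y us bs assume cs: "cs = as2 @ Node y us # bs"
   \<comment> \<open>Positions of the two vertices among the inputs of \<open>x\<close>. Once
     \<open>z\<close> is glued, its one input of \<open>x\<close> becomes
     \<open>length (etop z)\<close> inputs, which shifts the position of \<open>y\<close>.\<close>
   let ?l = "length as1" and ?m = "Suc (length as1 + length as2)"
   have N: "Node x (as1 @ Node z vs # (as2 @ Node y us # bs)) \<in> trees V" using T by (simp add: ts cs)
   then have N': "Node x ((as1 @ Node z vs # as2) @ Node y us # bs) \<in> trees V" by simp
   note f = split_facts[OF N] and h = split_facts[OF N']
   have m: "?m < length (etop x)" "ebot y = etop x ! ?m" using h(3,4) by simp_all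
   have e: "evec (g (g x ?l z) (?m - 1 + length (etop z)) y) =
    scl V (sg ((edeg z + 1) * (edeg y + 1))) (evec (g (g x ?m y) ?l z))" by (rule g_par[OF f(1,2) h(2) _ m(1) f(4) m(2)]) simp
   have idx: "length (as1 @ vs @ as2) = ?m - 1 + length (etop z)" using f(5) by simp
   have M1: "Node (g (g x ?l z) (length (as1 @ vs @ as2)) y) (as1 @ vs @ as2 @ us @ bs) \<in> trees V"
    using contract_trees[of "g x ?l z" "as1 @ vs @ as2" y us bs] contract_trees[OF N] by simp
   have "Node (g x ?m y) ((as1 @ Node z vs # as2) @ us @ bs) \<in> trees V" using contract_trees[OF N'] by simp
   then have M2: "Node (g (g x ?m y) ?l z) (as1 @ vs @ as2 @ us @ bs) \<in> trees V"
    using contract_trees[of "g x ?m y" as1 z vs "as2 @ us @ bs"] by simp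
   interpret vector_space "scl V" using cV by (simp add: complexes_def)
   have tops: "etop (g (g x ?l z) (length (as1 @ vs @ as2)) y) = etop (g (g x ?m y) ?l z)" using M1 M2 by (metis trees_Node_iff)
   have "phi (Node (g (g x ?l z) (length (as1 @ vs @ as2)) y) (as1 @ vs @ as2 @ us @ bs)) =
    sg ((edeg z + 1) * (edeg y + 1)) * phi (Node (g (g x ?m y) ?l z) (as1 @ vs @ as2 @ us @ bs)) +
    0 * phi (Node (g (g x ?m y) ?l z) (as1 @ vs @ as2 @ us @ bs))" by (rule Node_lin[OF phi M2 M2 M1])
     (use tops e[folded idx] M1 f(5) in "simp_all add: g_simps(2,3) ts cs")
   then show "sg (edeg y * (deg_sum as1 + edeg z + deg_sum vs)) * (sg (edeg y) *
     ?psi (as1 @ Node z vs # as2) y as1 z vs (as2 @ us @ bs)) +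
    sg (edeg z) * (sg (edeg y * (deg_sum as1 + deg_sum vs)) * ?psi as1 z (as1 @ vs @ as2) y us bs) = 0"
    by (auto simp: sg_def)
  qed
 qed
 have "pick ts (%as y us bs. sg (edeg y) * pick (as @ us @ bs) (?psi as y)) =
  L + pick ts (%as y us bs. sg (edeg y) * pick us (%cs z vs ds. sg (edeg z * deg_sum as) * ?psi as y (as @ cs) z vs (ds @ bs))) + R"
  unfolding L_def R_def pick_add[symmetric] pick_append pick_mult by (intro pick_cong)
   (simp add: pick_mult[symmetric] pick_add[symmetric] sg_add distrib_left mult_ac)
 also have "\<dots> = pick ts (%as y us bs. sg (edeg y) * pick us (%cs z vs ds. sg (edeg z * deg_sum as) *
   phi (Node (g x (length as) (g y (length cs) z)) (as @ cs @ vs @ ds @ bs)))) + (L + R)"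
 proof -
  have "pick ts (%as y us bs. sg (edeg y) * pick us (%cs z vs ds. sg (edeg z * deg_sum as) * ?psi as y (as @ cs) z vs (ds @ bs))) =
   pick ts (%as y us bs. sg (edeg y) * pick us (%cs z vs ds. sg (edeg z * deg_sum as) *
    phi (Node (g x (length as) (g y (length cs) z)) (as @ cs @ vs @ ds @ bs))))" by (rule pick_cong) (simp only: mid)
  then show ?thesis by (simp only: add_ac)
 qed
 finally show ?thesis using \<open>L + R = 0\<close> by simp
qed

lemma B_square:
 "T \<in> trees V ==> phi \<in> Mlin V (tcell T) ==> B T (%S. B S phi) = 0"
 "set ts \<subseteq> trees V ==> psi \<in> FMlin V (map tcell ts) ==> FB ts (%ts'. FB ts' psi) = 0"
proof (induction T and ts arbitrary: phi and psi rule: tree_induct)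
 case (Node x ts)
 have x: "x \<in> elems V" "set ts \<subseteq> trees V" "map root ts = etop x" using Node.prems by auto
 let ?P = "%ts psi. pick ts (%as y us bs. psi (length as) y (as @ us @ bs))"
 let ?f = "%x ts. phi (Node x ts)"
 define chi where "chi l y zs = ?f (g x l y) zs" for l y zs
 note fts = FB_comb[OF x(2)]
 have Nd: "Node (dE V x) ts \<in> trees V" using x by (simp add: dE_elems)
 have m: "(%ts. ?f x ts) \<in> FMlin V (map tcell ts)" using Node.prems x by (intro FMlin_Node) (auto simp: o_def)
 \<comment> \<open>\<open>d1\<close>, \<open>d2\<close>, \<open>d3\<close>: one contraction at
   \<open>x\<close> and one internal differential, before or after, related by
   \<open>g_Leibniz\<close>. \<open>f1\<close>, \<open>f2\<close>: the second operator acts in the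
   subtrees. \<open>p1\<close>, \<open>p2\<close>: two contractions, equal by
   \<open>contract_twice\<close>. These are all the terms of the square, and they cancel in
   pairs.\<close>
 define d1 where "d1 = ?P ts (%l y zs. ?f (g (dE V x) l y) zs)"
 define d2 where "d2 = ?P ts (%l y zs. ?f (dE V (g x l y)) zs)"
 define d3 where "d3 = ?P ts (%l y zs. ?f (g x l (dE V y)) zs)"
 define f1 where "f1 = FB ts (%zs. ?f (dE V x) zs)"
 define f2 where "f2 = ?P ts (%l y zs. sg (edeg y) * FB zs (chi l y))"
 define p1 where "p1 = pick ts (%as y us bs. sg (edeg y) * pick (as @ us @ bs)
   (%ps z vs qs. ?f (g (g x (length as) y) (length ps) z) (ps @ vs @ qs)))"
 define p2 where "p2 = pick ts (%as y us bs. sg (edeg y) * pick us (%cs z vs ds. sg (edeg z * deg_sum as) *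
   ?f (g x (length as) (g y (length cs) z)) (as @ cs @ vs @ ds @ bs)))"
 have p: "p1 = p2" unfolding p1_def p2_def by (rule contract_twice[OF Node.prems])
 have dd: "?f (dE V (dE V x)) ts = 0" by (rule Mlin_Node_zero[OF Node.prems(2)]) (use x in "auto simp: diff_diff dE_elems")
 have d: "d2 = 1 * d1 + (- sg (edeg x)) * d3"
  unfolding d1_def d2_def d3_def
 proof (rule pick_lin)
  fix as y us bs assume ts: "ts = as @ Node y us # bs"
  have N: "Node x (as @ Node y us # bs) \<in> trees V" "Node (dE V x) (as @ Node y us # bs) \<in> trees V"
   "Node x (as @ Node (dE V y) us # bs) \<in> trees V" using Node.prems(1) Nd by (auto simp: ts dE_elems)
  note sf = split_facts[OF N(1)]
  have M: "Node (dE V (g x (length as) y)) (as @ us @ bs) \<in> trees V" using contract_trees[OF N(1)] by (simp add: dE_elems)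
  show "?f (dE V (g x (length as) y)) (as @ us @ bs) =
   1 * ?f (g (dE V x) (length as) y) (as @ us @ bs) + (- sg (edeg x)) * ?f (g x (length as) (dE V y)) (as @ us @ bs)"
   by (rule Node_lin[OF Node.prems(2) contract_trees[OF N(2)] contract_trees[OF N(3)] M])
    (use g_Leibniz[OF sf(1-4)] in "simp_all add: g_simps ts")
 qed
 have FBP: "FB ts (%ts'. ?P ts' chi) = (d3 - \<kappa> * p2) + f2" proof -
  have "pick ts (%as y us bs. rho y us (%S. case S of Leaf a => 0 | Node y' us' =>
    sg ((edeg y' + edeg y + 1) * deg_sum as) * chi (length as) y' (as @ us' @ bs))) = 1 * d3 + (- \<kappa>) * p2"
   unfolding d3_def p2_def by (rule pick_lin)
    (simp add: rho_def chi_def g_simps pick_mult[symmetric] sg_add distrib_left distrib_right mult_ac, simp add: sg_def)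
  then show ?thesis unfolding FB_pick[OF x(2)] f2_def by simp
 qed
 have 1: "B (Node (dE V x) ts) phi = \<kappa> * (sg (edeg x) * d1) - sg (edeg x) * f1"
  by (simp add: rho_def dd d1_def f1_def sg_add) (simp add: sg_def)
 define q where "q = pick ts (%as y us bs. (- sg (edeg x)) * (sg (edeg y) * FB (as @ us @ bs) (chi (length as) y)) +
   \<kappa> * sg (edeg x) * (sg (edeg y) * pick (as @ us @ bs)
    (%ps z vs qs. ?f (g (g x (length as) y) (length ps) z) (ps @ vs @ qs))))"
 have q: "q = (- sg (edeg x)) * f2 + \<kappa> * sg (edeg x) * p1" unfolding q_def f2_def p1_def by (rule pick_lin) (rule refl)
 have 2: "pick ts (%as y us bs. B (Node (g x (length as) y) (as @ us @ bs)) phi) = 1 * d2 + 1 * q"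
  unfolding d2_def q_def by (rule pick_lin) (simp add: rho_def chi_def[abs_def] g_simps sg_add mult_ac, simp add: sg_def)
 have 3: "FB ts (%ts'. B (Node x ts') phi) =
   1 * FB ts (%zs. ?f (dE V x) zs + \<kappa> * (sg (edeg x + 1) * ?P zs chi)) + sg (edeg x) * FB ts (%ts'. FB ts' (%ts. ?f x ts))"
  by (rule fcomb_lin[OF fts]) (auto simp: rho_def chi_def)
 have 4: "FB ts (%zs. ?f (dE V x) zs + \<kappa> * (sg (edeg x + 1) * ?P zs chi)) = 1 * f1 + (\<kappa> * sg (edeg x + 1)) * FB ts (%ts'. ?P ts' chi)"
  unfolding f1_def by (rule fcomb_lin[OF fts]) (auto simp: mult.assoc)
 have "B (Node x ts) (%S. B S phi) = B (Node (dE V x) ts) phi +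
   \<kappa> * (sg (edeg x + 1) * pick ts (%as y us bs. B (Node (g x (length as) y) (as @ us @ bs)) phi)) +
   sg (edeg x) * FB ts (%ts'. B (Node x ts') phi)"
  unfolding at_vertices_Node[of _ x ts] rho_def[of x ts] ..
 also have "\<dots> = 0" unfolding 1 2 3 4 FBP d q p Node.IH[OF x(2) m] by (simp add: sg_def algebra_simps)
 finally show ?case .
next
 case (Cons t ts)
 show ?case by (rule bar.square_Cons) (use Cons in simp_all)
qed auto

end

section \<open>Cutting along chords\<close>

text \<open>\<open>cut_sum\<close> takes curried functions of three arguments; these are the rules
  for \<open>fcomb\<close> in that form.\<close>

context
 fixes S :: "('a \<times> 'b \<times> 'c) set" and x :: "('a => 'b => 'c => 'k::field) => 'k"
 assumes fc: "fcomb S UNIV (%Psi. x (%a b c. Psi (a, b, c)))"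
begin

lemma comb3_lin:
 assumes "\<And>a b c. (a, b, c) \<in> S ==> \<theta> a b c = r * psi a b c + s * chi a b c"
 shows "x \<theta> = r * x psi + s * x chi"
 using fcomb_lin[OF fc, of "%(a, b, c). psi a b c" "%(a, b, c). chi a b c" "%(a, b, c). \<theta> a b c" r s] assms
 by fastforce

lemma comb3_add:
 assumes "\<And>a b c. (a, b, c) \<in> S ==> \<theta> a b c = psi a b c + chi a b c"
 shows "x \<theta> = x psi + x chi" using comb3_lin[of \<theta> 1 psi 1 chi] assms by simp

lemma comb3_mult:
 assumes "\<And>a b c. (a, b, c) \<in> S ==> \<theta> a b c = r * psi a b c"
 shows "x \<theta> = r * x psi" using comb3_lin[of \<theta> r psi 0 psi] assms by simp

lemma comb3_cong:
 assumes "\<And>a b c. (a, b, c) \<in> S ==> \<theta> a b c = psi a b c"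
 shows "x \<theta> = x psi" using comb3_mult[of \<theta> 1 psi] assms by simp

lemma comb3_zero:
 assumes "\<And>a b c. (a, b, c) \<in> S ==> \<theta> a b c = 0"
 shows "x \<theta> = 0" using comb3_mult[of \<theta> 0 \<theta>] assms by simp

lemma comb3_swap:
 assumes "fcomb S' UNIV y"
 shows "x (%a b c. y (psi a b c)) = y (%s. x (%a b c. psi a b c s))"
 using fcomb_swap[OF fc assms, of "%(a, b, c). psi a b c"] by simp

lemma comb3_pick: "x (%a b c. pick ts (psi a b c)) = pick ts (%as y us bs. x (%a b c. psi a b c as y us bs))"
 using fcomb_pick[OF fc, of ts "%(a, b, c). psi a b c"] by simp

end

text \<open>\<open>cut_sum\<close> for a list of trees, playing the role that
  \<open>forest_at\<close> has for \<open>at_vertices\<close>. The sign moves the piece cut off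
  behind the trees on its right.\<close>

definition fcut ::
 "('i, 'e, 'v) dtree list => (('i, 'e, 'v) dtree list => nat => ('i, 'e, 'v) dtree => 'k::field) => 'k" where
 "fcut ts psi = (\<Sum>l<length ts.
  let p0 = length (fleaves (take l ts)); d = deg_sum (drop (Suc l) ts)
  in (case ts ! l of Leaf a => 0 | Node y us =>
     sg (tdeg (ts ! l) * d) * psi (ts[l := Leaf (root (ts ! l))]) p0 (ts ! l)) +
    cut_sum (ts ! l) (%T' p U. sg (tdeg U * d) * psi (ts[l := T']) (p0 + p) U))"

definition edge_cut :: "('i, 'e, 'v) dtree => 'k::zero => 'k" where
 "edge_cut t r = (case t of Leaf a => 0 | Node y us => r)"

lemma edge_cut_simps [simp]: "edge_cut (Leaf a) r = 0" "edge_cut (Node y us) r = r" by (simp_all add: edge_cut_def)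

lemma cut_sum_Node: "cut_sum (Node x ts) psi = fcut ts (%ts' p U. psi (Node x ts') p U)"
 by (simp add: fcut_def Let_def cong: dtree.case_cong)

declare cut_sum.simps(2) [simp del]
declare cut_sum_Node [simp]

lemma fcut_Nil [simp]: "fcut [] psi = 0" by (simp add: fcut_def)

lemma fcut_Cons [simp]:
 "fcut (t # ts) psi = edge_cut t (sg (tdeg t * deg_sum ts) * psi (Leaf (root t) # ts) 0 t) +
  cut_sum t (%t' p U. sg (tdeg U * deg_sum ts) * psi (t' # ts) p U) +
  fcut ts (%ts' p U. psi (t # ts') (nleaves t + p) U)"
 by (simp add: fcut_def sum.lessThan_Suc_shift Let_def edge_cut_def add.assoc
   del: sum.lessThan_Suc cong: dtree.case_cong)

text \<open>Both pieces have vertices and the total number of vertices is kept, so each piece has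
  fewer vertices than \<open>T\<close>. This makes cutting lower the filtration.\<close>

definition cuts ::
 "('k, 'i, 'e, 'v, 'z) coll_scheme => ('i, 'e, 'v) dtree => (('i, 'e, 'v) dtree \<times> nat \<times> ('i, 'e, 'v) dtree) set" where
 "cuts V T = {(T', p, U). T' \<in> trees V \<and> U \<in> trees V \<and> (\<forall>a. T' \<noteq> Leaf a) \<and> (\<forall>a. U \<noteq> Leaf a) \<and>
  root T' = root T \<and> p < nleaves T' \<and> root U = leaves T' ! p \<and>
  leaves T = take p (leaves T') @ leaves U @ drop (Suc p) (leaves T') \<and> tdeg T' + tdeg U = tdeg T \<and>
  vcount T' + vcount U = vcount T}"

definition fcuts ::
 "('k, 'i, 'e, 'v, 'z) coll_scheme => ('i, 'e, 'v) dtree list => (('i, 'e, 'v) dtree list \<times> nat \<times> ('i, 'e, 'v) dtree) set" where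
 "fcuts V ts = {(ts', p, U). set ts' \<subseteq> trees V \<and> U \<in> trees V \<and> (\<forall>a. U \<noteq> Leaf a) \<and>
  map root ts' = map root ts \<and> p < length (fleaves ts') \<and> root U = fleaves ts' ! p \<and>
  fleaves ts = take p (fleaves ts') @ leaves U @ drop (Suc p) (fleaves ts') \<and>
  deg_sum ts' + tdeg U = deg_sum ts \<and> sum_list (map vcount ts') + vcount U = sum_list (map vcount ts)}"

lemma not_Leaf: "\<forall>a. T \<noteq> Leaf a ==> \<exists>x ts. T = Node x ts" by (cases T) blast+

lemma cutsD:
 assumes "(T', p, U) \<in> cuts V T"
 shows "T' \<in> trees V" "U \<in> trees V" "\<exists>x ts. T' = Node x ts" "\<exists>x ts. U = Node x ts" "root T' = root T"
  "p < nleaves T'" "root U = leaves T' ! p"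
  "leaves T = take p (leaves T') @ leaves U @ drop (Suc p) (leaves T')" "tdeg T = tdeg T' + tdeg U"
  "Suc (nleaves T) = nleaves T' + nleaves U" "vcount T = vcount T' + vcount U"
proof -
 have "\<forall>a. T' \<noteq> Leaf a" "\<forall>a. U \<noteq> Leaf a" using assms unfolding cuts_def by blast+
 then show "\<exists>x ts. T' = Node x ts" "\<exists>x ts. U = Node x ts" by (blast intro: not_Leaf)+
 have l: "leaves T = take p (leaves T') @ leaves U @ drop (Suc p) (leaves T')" "p < nleaves T'"
  using assms unfolding cuts_def by blast+
 then show "Suc (nleaves T) = nleaves T' + nleaves U" by simp
 show "tdeg T = tdeg T' + tdeg U" "vcount T = vcount T' + vcount U" using assms by (simp_all add: cuts_def)
qed (use assms[unfolded cuts_def mem_Collect_eq prod.case] in blast)+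

lemma fcutsD:
 assumes "(ts', p, U) \<in> fcuts V ts"
 shows "set ts' \<subseteq> trees V" "U \<in> trees V" "\<exists>x ts. U = Node x ts" "p < length (fleaves ts')"
  "deg_sum ts = deg_sum ts' + tdeg U"
proof -
 have "\<forall>a. U \<noteq> Leaf a" using assms unfolding fcuts_def by blast
 then show "\<exists>x ts. U = Node x ts" by (rule not_Leaf)
 show "deg_sum ts = deg_sum ts' + tdeg U" using assms by (simp add: fcuts_def)
qed (use assms[unfolded fcuts_def mem_Collect_eq prod.case] in blast)+

lemma Leaf_root_trees: "T \<in> trees V ==> Leaf (root T) \<in> trees V"
 using trees_cells[of T V] by (auto simp: cells_iff trees_Leaf_iff)

lemma cut_comb:
 shows "T \<in> trees V ==> fcomb (cuts V T) UNIV (%Psi. cut_sum T (%a b c. Psi (a, b, c)) :: 'c::field)"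
  and "set ts \<subseteq> trees V ==>
   fcomb (fcuts V ts) UNIV (%Psi. fcut ts (%a b c. Psi (a, b, c)) :: 'c)"
proof (induction T and ts rule: tree_induct)
 case (Node x ts)
 then have x: "set ts \<subseteq> trees V" "map root ts = etop x" "x \<in> elems V" by auto
 let ?h = "%(ts', p, U). (Node x ts', p, U)"
 have "fcomb (cuts V (Node x ts)) UNIV (%Psi. (%Psi. fcut ts (%a b c. Psi (a, b, c))) (%s. 1 * Psi (?h s)) :: 'c)"
  by (rule fcomb_image[OF Node.IH[OF x(1)], where c="%_. 1" and h="?h"]) (use x in "auto simp: cuts_def fcuts_def")
 then show ?case by simp
next
 case (Cons t ts)
 have t: "t \<in> trees V" "set ts \<subseteq> trees V" using Cons.prems by auto
 have 1: "fcomb (fcuts V (t # ts)) UNIV (%Psi. edge_cut t (sg (tdeg t * deg_sum ts) * Psi (Leaf (root t) # ts, 0, t)) :: 'c)"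
 proof (cases t)
  case (Node y us)
  have "(Leaf (root t) # ts, 0, t) \<in> fcuts V (t # ts)" using t Leaf_root_trees[OF t(1)] by (auto simp: fcuts_def Node)
  then show ?thesis using fcomb_scale[OF fcomb_point] by (simp add: Node)
 qed (simp add: fcomb_0)
 let ?h = "%(t', p, U). (t' # ts, p, U)"
 have "fcomb (fcuts V (t # ts)) UNIV (%Psi. (%Psi. cut_sum t (%a b c. Psi (a, b, c)))
   (%s. (case s of (t', p, U) => sg (tdeg U * deg_sum ts)) * Psi (?h s)) :: 'c)"
  by (rule fcomb_image[OF Cons.IH(1)[OF t(1)], where c="%s. case s of (t', p, U) => sg (tdeg U * deg_sum ts)" and h="?h"]) (use t in "auto simp: cuts_def fcuts_def nth_append")
 then have 2: "fcomb (fcuts V (t # ts)) UNIV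
   (%Psi. cut_sum t (%t' p U. sg (tdeg U * deg_sum ts) * Psi (t' # ts, p, U)) :: 'c)" by simp
 let ?h = "%(ts', p, U). (t # ts', nleaves t + p, U)"
 have "fcomb (fcuts V (t # ts)) UNIV (%Psi. (%Psi. fcut ts (%a b c. Psi (a, b, c))) (%s. 1 * Psi (?h s)) :: 'c)"
  by (rule fcomb_image[OF Cons.IH(2)[OF t(2)], where c="%_. 1" and h="?h"]) (use t in "auto simp: fcuts_def nth_append")
 then have 3: "fcomb (fcuts V (t # ts)) UNIV (%Psi. fcut ts (%ts' p U. Psi (t # ts', nleaves t + p, U)) :: 'c)"
  by simp
 show ?case unfolding fcut_Cons by (intro fcomb_plus 1 2 3)
qed (simp_all add: fcomb_0)

lemma fcut_append:
 "set as \<subseteq> trees V ==> set bs \<subseteq> trees V ==>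
 fcut (as @ bs) psi = fcut as (%as' p U. sg (tdeg U * deg_sum bs) * psi (as' @ bs) p U) +
  fcut bs (%bs' p U. psi (as @ bs') (length (fleaves as) + p) U)"
proof (induction as arbitrary: psi)
 case (Cons t ts)
 have t: "t \<in> trees V" "set ts \<subseteq> trees V" using Cons.prems by auto
 show ?case
  unfolding append_Cons fcut_Cons Cons.IH[OF t(2) Cons.prems(2)]
  by (cases t) (simp_all add: sg_add distrib_left distrib_right mult_ac add_ac)
qed simp

text \<open>One chord at the bottom vertex is contracted and another chord is cut, in either order.
  A chord that is cut leaves a leaf behind, which \<open>pick\<close> skips, so the two chords are
  always different.\<close>

lemma pick_cut_commute:
 fixes V :: "('k::field, 'i, 'e, 'v::ab_group_add, 'z) coll_scheme"
 assumes "set ts \<subseteq> trees V"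
 shows "pick ts (%as y us bs. fcut (as @ us @ bs) (chi (length as) y)) =
  fcut ts (%ts1 p U. pick ts1 (%as y us bs. chi (length as) y (as @ us @ bs) p U))"
 using assms
proof (induction ts arbitrary: chi)
 case (Cons t ts)
 have t: "t \<in> trees V" and ts: "set ts \<subseteq> trees V" using Cons.prems by auto
 note cts = cut_comb(2)[OF ts]
 show ?case proof (cases t)
  case (Leaf a)
  then show ?thesis using Cons.IH[OF ts, of "%l y zs p U. chi (Suc l) y (Leaf a # zs) (Suc p) U"] by simp
 next
  case (Node x vs)
  have vs: "set vs \<subseteq> trees V" using t by (simp add: Node)
  note cvs = cut_comb(2)[OF vs]
  let ?Q = "%c. pick ts (%as y us bs. c (length as) y (as @ us @ bs))"
  \<comment> \<open>The contracted chord and the cut one are: a root chord in \<open>ts\<close> and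
    the root chord of \<open>t\<close> (\<open>e1\<close>), the root chord of \<open>t\<close> and
    one in \<open>vs\<close> (\<open>e2\<close>), a root chord in \<open>ts\<close> and one in
    \<open>vs\<close> (\<open>e3\<close>), the root chord of \<open>t\<close> and one in
    \<open>ts\<close> (\<open>e4\<close>), both in \<open>ts\<close> (\<open>e5\<close>).\<close>
  define e1 where "e1 = sg (tdeg t * deg_sum ts) * ?Q (%l y zs. chi (Suc l) y (Leaf (root t) # zs) 0 t)"
  define e2 where "e2 = fcut vs (%vs' p U. sg (tdeg U * deg_sum ts) * chi 0 x (vs' @ ts) p U)"
  define e3 where "e3 = pick ts (%as y us bs. fcut vs (%vs' p U. sg (tdeg U * deg_sum ts) *
    (sg (edeg y * (edeg x + deg_sum vs')) * chi (Suc (length as)) y (Node x vs' # as @ us @ bs) p U)))"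
  define e4 where "e4 = fcut ts (%ts' p U. chi 0 x (vs @ ts') (length (fleaves vs) + p) U)"
  define e5 where "e5 = pick ts (%as y us bs. fcut (as @ us @ bs) (%ts' p U. sg (edeg y * tdeg t) *
    chi (Suc (length as)) y (t # ts') (nleaves t + p) U))"
  have "pick ts (%as y us bs. sg (edeg y * tdeg t) * fcut (t # as @ us @ bs) (chi (Suc (length as)) y)) = e1 + e3 + e5"
   unfolding e1_def e3_def e5_def pick_mult[symmetric] pick_add[symmetric]
  proof (rule pick_cong)
   fix as y us bs assume s: "ts = as @ Node y us # bs"
   have m: "set (as @ us @ bs) \<subseteq> trees V" using ts by (auto simp: s)
   note c = cut_comb(2)[OF m]
   have 1: "fcut (as @ us @ bs) (%ts' p U. sg (edeg y * tdeg t) * chi (Suc (length as)) y (t # ts') (nleaves t + p) U) =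
    sg (edeg y * tdeg t) * fcut (as @ us @ bs) (%ts' p U. chi (Suc (length as)) y (t # ts') (nleaves t + p) U)"
    by (rule comb3_mult[OF c]) simp
   have 2: "fcut vs (%vs' p U. sg (tdeg U * deg_sum ts) *
     (sg (edeg y * (edeg x + deg_sum vs')) * chi (Suc (length as)) y (Node x vs' # as @ us @ bs) p U)) =
    sg (edeg y * tdeg t) * fcut vs (%vs' p U. sg (tdeg U * deg_sum (as @ us @ bs)) *
     chi (Suc (length as)) y (Node x vs' # as @ us @ bs) p U)" by (rule comb3_mult[OF cvs])
     (auto simp: Node s sg_add distrib_left distrib_right mult_ac dest!: fcutsD(5))
   show "sg (edeg y * tdeg t) * fcut (t # as @ us @ bs) (chi (Suc (length as)) y) =
    sg (tdeg t * deg_sum ts) * chi (Suc (length as)) y (Leaf (root t) # as @ us @ bs) 0 t +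
    fcut vs (%vs' p U. sg (tdeg U * deg_sum ts) *
     (sg (edeg y * (edeg x + deg_sum vs')) * chi (Suc (length as)) y (Node x vs' # as @ us @ bs) p U)) +
    fcut (as @ us @ bs) (%ts' p U. sg (edeg y * tdeg t) * chi (Suc (length as)) y (t # ts') (nleaves t + p) U)"
    unfolding 1 2 by (simp add: Node s sg_add distrib_left distrib_right mult_ac)
  qed
  moreover have "fcut (vs @ ts) (chi 0 x) = e2 + e4" unfolding e2_def e4_def by (rule fcut_append[OF vs ts])
  ultimately have l: "pick (t # ts) (%as y us bs. fcut (as @ us @ bs) (chi (length as) y)) = e1 + e2 + e3 + e4 + e5"
   by (simp add: Node del: fcut_Cons)
  have 3: "fcut vs (%vs' p U. sg (tdeg U * deg_sum ts) *
    pick (Node x vs' # ts) (%as y us bs. chi (length as) y (as @ us @ bs) p U)) = e2 + e3"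
   unfolding e2_def e3_def comb3_pick[OF cvs, symmetric] by (rule comb3_add[OF cvs]) (simp add: pick_mult distrib_left)
  have 4: "e5 = fcut ts (%ts' p U. pick ts' (%as y us bs. sg (edeg y * tdeg t) *
    chi (Suc (length as)) y (t # as @ us @ bs) (nleaves t + p) U))"
   unfolding e5_def by (rule Cons.IH[OF ts, of "%l y zs p U. sg (edeg y * tdeg t) * chi (Suc l) y (t # zs) (nleaves t + p) U"])
  have 5: "fcut ts (%ts' p U. pick (t # ts') (%as y us bs. chi (length as) y (as @ us @ bs) (nleaves t + p) U)) = e4 + e5"
   unfolding 4 e4_def by (rule comb3_add[OF cts]) (simp add: Node)
  have "fcut (t # ts) (%ts1 p U. pick ts1 (%as y us bs. chi (length as) y (as @ us @ bs) p U)) =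
    e1 + (e2 + e3) + (e4 + e5)" unfolding fcut_Cons 5 3[symmetric] by (simp add: Node e1_def)
  with l show ?thesis by (simp add: add_ac)
 qed
qed simp

context contraction_data
begin

text \<open>The bar differential is a coderivation of the cofree coalgebra: a contracted chord
  differs from the one that is cut, so the modification takes place within one of the two pieces,
  and for the upper piece it has to pass the lower one.\<close>

lemma B_cut:
 "T \<in> trees V ==> B T (%T'. cut_sum T' psi) =
  cut_sum T (%T1 p U. B T1 (%T1'. psi T1' p U) + sg (tdeg T1) * B U (%U'. psi T1 p U'))"
 "set ts \<subseteq> trees V ==> FB ts (%ts'. fcut ts' chi) =
  fcut ts (%ts1 p U. FB ts1 (%ts1'. chi ts1' p U) + sg (deg_sum ts1) * B U (%U'. chi ts1 p U'))"
proof (induction T and ts arbitrary: psi and chi rule: tree_induct)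
 case (Node x ts)
 have ts: "set ts \<subseteq> trees V" using Node.prems by simp
 note c = cut_comb(2)[OF ts]
 let ?chi = "%ts' p U. psi (Node x ts') p U"
 define a where "a = fcut ts (%ts' p U. psi (Node (dE V x) ts') p U)"
 define b where "b = fcut ts (%ts1 p U. pick ts1 (%as y us bs. psi (Node (g x (length as) y) (as @ us @ bs)) p U))"
 define d where "d = fcut ts (%ts1 p U. FB ts1 (%ts1'. ?chi ts1' p U) + sg (deg_sum ts1) * B U (%U'. ?chi ts1 p U'))"
 have "B (Node x ts) (%T'. cut_sum T' psi) = a + \<kappa> * (sg (edeg x + 1) * b) + sg (edeg x) * d"
  using pick_cut_commute[OF ts, of "%l y ts' p U. psi (Node (g x l y) ts') p U"]
  by (simp add: rho_def[of x] a_def b_def d_def Node.IH[OF ts])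
 also have "\<dots> = cut_sum (Node x ts) (%T1 p U. B T1 (%T1'. psi T1' p U) + sg (tdeg T1) * B U (%U'. psi T1 p U'))"
 proof -
  have 1: "fcut ts (%ts1 p U. psi (Node (dE V x) ts1) p U +
    \<kappa> * (sg (edeg x + 1) * pick ts1 (%as y us bs. psi (Node (g x (length as) y) (as @ us @ bs)) p U))) =
    1 * a + (\<kappa> * sg (edeg x + 1)) * b" unfolding a_def b_def by (rule comb3_lin[OF c]) (simp add: mult.assoc)
  have "cut_sum (Node x ts) (%T1 p U. B T1 (%T1'. psi T1' p U) + sg (tdeg T1) * B U (%U'. psi T1 p U')) =
    1 * fcut ts (%ts1 p U. psi (Node (dE V x) ts1) p U +
    \<kappa> * (sg (edeg x + 1) * pick ts1 (%as y us bs. psi (Node (g x (length as) y) (as @ us @ bs)) p U))) + sg (edeg x) * d"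
   unfolding cut_sum_Node d_def by (rule comb3_lin[OF c]) (simp add: rho_def[of x] sg_add algebra_simps)
  then show ?thesis unfolding 1 by (simp add: mult.assoc)
 qed
 finally show ?case .
next
 case (Cons t ts)
 have t: "t \<in> trees V" and ts: "set ts \<subseteq> trees V" using Cons.prems by auto
 note ct = cut_comb(1)[OF t] and cts = cut_comb(2)[OF ts]
 note bt = B_comb[OF t] and bts = FB_comb[OF ts]
 let ?L = "Leaf (root t)" and ?n = "nleaves t" and ?d = "deg_sum ts"
 \<comment> \<open>The letter tells which chord is cut: the root chord of \<open>t\<close>
   (\<open>a\<close>), one inside \<open>t\<close> (\<open>b\<close>), one in \<open>ts\<close>
   (\<open>c\<close>). The number distinguishes where the differential acts.\<close>
 define a1 where "a1 = B t (%t'. chi (?L # ts) 0 t')"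
 define a2 where "a2 = FB ts (%ts'. chi (?L # ts') 0 t)"
 define b1 where "b1 = cut_sum t (%T1 p U. sg (tdeg U * ?d) * B T1 (%t''. chi (t'' # ts) p U))"
 define b2 where "b2 = cut_sum t (%T1 p U. sg (tdeg T1) * (sg ((tdeg U + 1) * ?d) * B U (%U'. chi (T1 # ts) p U')))"
 define b3 where "b3 = cut_sum t (%T1 p U. sg (tdeg U * (?d + 1)) * FB ts (%ts'. chi (T1 # ts') p U))"
 define c1 where "c1 = fcut ts (%ts' p U. B t (%t'. chi (t' # ts') (?n + p) U))"
 define c2 where "c2 = fcut ts (%ts1 p U. FB ts1 (%ts'. chi (t # ts') (?n + p) U) +
   sg (deg_sum ts1) * B U (%U'. chi (t # ts1) (?n + p) U'))"
 have 0: "B t (%t'. edge_cut t' (sg (tdeg t' * ?d) * chi (Leaf (root t') # ts) 0 t')) = edge_cut t (sg ((tdeg t + 1) * ?d) * a1)"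
 proof (cases t)
  case (Node y us)
  have "B t (%t'. edge_cut t' (sg (tdeg t' * ?d) * chi (Leaf (root t') # ts) 0 t')) = sg ((tdeg t + 1) * ?d) * a1"
   unfolding a1_def by (rule fcomb_mult[OF bt]) (auto simp: trees_node_def edge_cut_def split: dtree.split)
  then show ?thesis by (simp add: Node)
 qed simp
 have 1: "B t (%t'. fcut (t' # ts) chi) = edge_cut t (sg ((tdeg t + 1) * ?d) * a1) + (b1 + b2) + c1" proof -
  have "B t (%t'. fcut (t' # ts) chi) =
    B t (%t'. edge_cut t' (sg (tdeg t' * ?d) * chi (Leaf (root t') # ts) 0 t') + cut_sum t' (%t'' p U. sg (tdeg U * ?d) * chi (t'' # ts) p U)) +
    B t (%t'. fcut ts (%ts' p U. chi (t' # ts') (?n + p) U))"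
   by (rule fcomb_add[OF bt]) (auto simp: trees_node_def)
  also have "B t (%t'. fcut ts (%ts' p U. chi (t' # ts') (?n + p) U)) = c1"
   unfolding c1_def by (rule comb3_swap[OF cts bt, symmetric])
  also have "B t (%t'. edge_cut t' (sg (tdeg t' * ?d) * chi (Leaf (root t') # ts) 0 t') + cut_sum t' (%t'' p U. sg (tdeg U * ?d) * chi (t'' # ts) p U)) =
    edge_cut t (sg ((tdeg t + 1) * ?d) * a1) + B t (%t'. cut_sum t' (%t'' p U. sg (tdeg U * ?d) * chi (t'' # ts) p U))"
   unfolding 0[symmetric] by (rule fcomb_add[OF bt]) auto
  also have "B t (%t'. cut_sum t' (%t'' p U. sg (tdeg U * ?d) * chi (t'' # ts) p U)) = b1 + b2"
   unfolding Cons.IH(1)[OF t] b1_def b2_def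
  proof (rule comb3_add[OF ct])
   fix T1 p U assume "(T1, p, U) \<in> cuts V t"
   note cD = cutsD[OF this]
   have "B T1 (%T1'. sg (tdeg U * ?d) * chi (T1' # ts) p U) = sg (tdeg U * ?d) * B T1 (%t''. chi (t'' # ts) p U)"
    by (rule fcomb_mult[OF B_comb[OF cD(1)]]) auto
   moreover have "B U (%U'. sg (tdeg U' * ?d) * chi (T1 # ts) p U') = sg ((tdeg U + 1) * ?d) * B U (%U'. chi (T1 # ts) p U')"
    by (rule fcomb_mult[OF B_comb[OF cD(2)]]) (auto simp: trees_node_def)
   ultimately show "B T1 (%T1'. sg (tdeg U * ?d) * chi (T1' # ts) p U) + sg (tdeg T1) * B U (%U'. sg (tdeg U' * ?d) * chi (T1 # ts) p U') =
    sg (tdeg U * ?d) * B T1 (%t''. chi (t'' # ts) p U) + sg (tdeg T1) * (sg ((tdeg U + 1) * ?d) * B U (%U'. chi (T1 # ts) p U'))"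
    by simp
  qed
  finally show ?thesis .
 qed
 have 2: "FB ts (%ts'. fcut (t # ts') chi) = edge_cut t (sg (tdeg t * (?d + 1)) * a2) + b3 + c2" proof -
  have "FB ts (%ts'. fcut (t # ts') chi) =
    FB ts (%ts'. edge_cut t (sg (tdeg t * (?d + 1)) * chi (?L # ts') 0 t) + cut_sum t (%t' p U. sg (tdeg U * (?d + 1)) * chi (t' # ts') p U)) +
    FB ts (%ts'. fcut ts' (%ts'' p U. chi (t # ts'') (?n + p) U))"
   by (rule fcomb_add[OF bts]) (auto simp: forests_deg_def)
  also have "FB ts (%ts'. fcut ts' (%ts'' p U. chi (t # ts'') (?n + p) U)) = c2"
   unfolding c2_def by (rule Cons.IH(2)[OF ts])
  also have "FB ts (%ts'. edge_cut t (sg (tdeg t * (?d + 1)) * chi (?L # ts') 0 t) + cut_sum t (%t' p U. sg (tdeg U * (?d + 1)) * chi (t' # ts') p U)) =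
    FB ts (%ts'. edge_cut t (sg (tdeg t * (?d + 1)) * chi (?L # ts') 0 t)) + FB ts (%ts'. cut_sum t (%t' p U. sg (tdeg U * (?d + 1)) * chi (t' # ts') p U))"
   by (rule fcomb_add[OF bts]) auto
  also have "FB ts (%ts'. edge_cut t (sg (tdeg t * (?d + 1)) * chi (?L # ts') 0 t)) = edge_cut t (sg (tdeg t * (?d + 1)) * a2)"
  proof (cases t)
   case (Leaf a)
   then show ?thesis using fcomb_zero[OF bts, of "%_. 0"] by simp
  next
   case (Node y us)
   have "FB ts (%ts'. sg (tdeg t * (?d + 1)) * chi (?L # ts') 0 t) = sg (tdeg t * (?d + 1)) * a2"
    unfolding a2_def by (rule fcomb_mult[OF bts]) auto
   then show ?thesis by (simp add: Node)
  qed
  also have "FB ts (%ts'. cut_sum t (%t' p U. sg (tdeg U * (?d + 1)) * chi (t' # ts') p U)) = b3"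
   unfolding b3_def comb3_swap[OF ct bts, symmetric] by (rule comb3_cong[OF ct], rule fcomb_mult[OF bts]) auto
  finally show ?thesis .
 qed
 have 3: "cut_sum t (%t' p U. sg (tdeg U * ?d) * (FB (t' # ts) (%ts1'. chi ts1' p U) + sg (deg_sum (t' # ts)) * B U (%U'. chi (t' # ts) p U'))) =
   1 * b1 + 1 * (1 * b2 + sg (tdeg t) * b3)"
 proof -
  have "1 * b2 + sg (tdeg t) * b3 = cut_sum t (%T1 p U.
    1 * (sg (tdeg T1) * (sg ((tdeg U + 1) * ?d) * B U (%U'. chi (T1 # ts) p U'))) +
    sg (tdeg t) * (sg (tdeg U * (?d + 1)) * FB ts (%ts'. chi (T1 # ts') p U)))"
   unfolding b2_def b3_def by (rule comb3_lin[OF ct, symmetric]) simp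
  then show ?thesis
   unfolding b1_def by (simp only:) (rule comb3_lin[OF ct],
    auto dest!: cutsD(9) simp: sg_add distrib_left distrib_right mult_ac add_ac)
 qed
 have 4: "fcut ts (%ts' p U. FB (t # ts') (%ts1'. chi ts1' (?n + p) U) + sg (deg_sum (t # ts')) * B U (%U'. chi (t # ts') (?n + p) U')) =
   1 * c1 + sg (tdeg t) * c2" unfolding c1_def c2_def by (rule comb3_lin[OF cts]) (simp add: sg_add algebra_simps)
 have 5: "edge_cut t (sg (tdeg t * ?d) * (FB (?L # ts) (%ts1'. chi ts1' 0 t) + sg (deg_sum (?L # ts)) * B t (%U'. chi (?L # ts) 0 U'))) =
   edge_cut t (sg ((tdeg t + 1) * ?d) * a1) + sg (tdeg t) * edge_cut t (sg (tdeg t * (?d + 1)) * a2)"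
  by (cases t) (simp_all add: a1_def a2_def sg_add distrib_left distrib_right mult_ac add_ac)
 show ?case
  unfolding forest_at_Cons[of _ t ts] 1 2 unfolding fcut_Cons[of t ts] 3 4 5 by (simp add: distrib_left add_ac)
qed simp_all

end

text \<open>In the iterated cut, the second tree is either cut off the trunk and independent of the first one
 (the hypothesis says that these terms cancel in pairs), or it is the tree between the trunk and the
 tree that was cut off first.\<close>

lemma cut_cut:
 fixes V :: "('k::field, 'i, 'e, 'v::ab_group_add, 'z) coll_scheme"
 shows "T \<in> trees V ==>
  (\<And>T0 a b W1 W2. a < b ==> b < nleaves T0 ==>
   F T0 a W1 (b + nleaves W1 - 1) W2 = - (sg (tdeg W1 * tdeg W2) * F T0 b W2 a W1)) ==>
  cut_sum T (%T1 p U. cut_sum T1 (%T0 q W. F T0 q W p U)) =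
  cut_sum T (%T0 q Z. cut_sum Z (%W p U. F T0 q W (q + p) U :: 'k))"
  and "set ts \<subseteq> trees V ==>
  (\<And>ts0 a b W1 W2. a < b ==> b < length (fleaves ts0) ==>
   G ts0 a W1 (b + nleaves W1 - 1) W2 = - (sg (tdeg W1 * tdeg W2) * G ts0 b W2 a W1)) ==>
  fcut ts (%ts1 p U. fcut ts1 (%ts0 q W. G ts0 q W p U)) =
  fcut ts (%ts0 q Z. cut_sum Z (%W p U. G ts0 q W (q + p) U :: 'k))"
proof (induction T and ts arbitrary: F and G rule: tree_induct)
 case (Node x ts)
 have ts: "set ts \<subseteq> trees V" using Node.prems by simp
 have "fcut ts (%ts1 p U. fcut ts1 (%ts0 q W. F (Node x ts0) q W p U)) =
  fcut ts (%ts0 q Z. cut_sum Z (%W p U. F (Node x ts0) q W (q + p) U))"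
  by (rule Node.IH[OF ts, of "%ts0 q W p U. F (Node x ts0) q W p U"]) (rule Node.prems(2), simp_all)
 then show ?case by simp
next
 case (Cons t ts)
 have t: "t \<in> trees V" and ts: "set ts \<subseteq> trees V" using Cons.prems by auto
 note ct = cut_comb(1)[OF t] and cts = cut_comb(2)[OF ts]
 let ?L = "Leaf (root t)" and ?n = "nleaves t" and ?d = "deg_sum ts"
 \<comment> \<open>The two chords are the root chord of \<open>t\<close> and one in
   \<open>ts\<close> (\<open>i\<close>, \<open>v\<close>), one inside \<open>t\<close> and one in
   \<open>ts\<close> (\<open>iv\<close>, \<open>vi\<close>), one inside \<open>t\<close> and the
   root chord of \<open>t\<close> (\<open>ii\<close>), both inside \<open>t\<close>
   (\<open>iii\<close>), both in \<open>ts\<close> (\<open>vii\<close>). The first two pairs are the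
   two orders of independent cuts and cancel. In \<open>ii\<close> the tree cut off last lies
   between the trunk and the one cut off first, as on the other side of the claim;
   \<open>iii\<close> and \<open>vii\<close> are left to the induction hypotheses.\<close>
 define i where "i = edge_cut t (sg (tdeg t * ?d) * fcut ts (%ts0 q W. G (?L # ts0) (Suc q) W 0 t))"
 define ii where "ii = edge_cut t (sg (tdeg t * ?d) * cut_sum t (%W p U. G (?L # ts) 0 W p U))"
 define iii where "iii = cut_sum t (%t' p U. cut_sum t' (%t'' q W. sg ((tdeg U + tdeg W) * ?d) * G (t'' # ts) q W p U))"
 define iv where "iv = cut_sum t (%t' p U. sg (tdeg U * ?d) * fcut ts (%ts' q W. G (t' # ts') (nleaves t' + q) W p U))"
 define v where "v = fcut ts (%ts' p U. edge_cut t (sg (tdeg t * deg_sum ts') * G (?L # ts') 0 t (?n + p) U))"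
 define vi where "vi = fcut ts (%ts' p U. cut_sum t (%t' q W. sg (tdeg W * deg_sum ts') * G (t' # ts') q W (?n + p) U))"
 define vii where "vii = fcut ts (%ts' p U. fcut ts' (%ts0 q W. G (t # ts0) (?n + q) W (?n + p) U))"
 have e0: "edge_cut t (sg (tdeg t * ?d) * fcut (?L # ts) (%ts0 q W. G ts0 q W 0 t)) = i" unfolding i_def by simp
 have e1: "cut_sum t (%t' p U. sg (tdeg U * ?d) * fcut (t' # ts) (%ts0 q W. G ts0 q W p U)) =
   1 * ii + 1 * (1 * iii + 1 * iv)"
 proof -
  have ii: "ii = cut_sum t (%t' p U. sg (tdeg U * ?d) * (sg (tdeg t' * ?d) * G (?L # ts) 0 t' p U))" proof (cases t)
   case (Node y us)
   have "sg (tdeg t * ?d) * cut_sum t (%W p U. G (?L # ts) 0 W p U) =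
    cut_sum t (%t' p U. sg (tdeg U * ?d) * (sg (tdeg t' * ?d) * G (?L # ts) 0 t' p U))"
    by (rule comb3_mult[OF ct, symmetric]) (auto dest!: cutsD(9) simp: sg_add distrib_left distrib_right mult_ac)
   then show ?thesis by (simp add: ii_def Node)
  qed (simp add: ii_def)
  have "1 * iii + 1 * iv = cut_sum t (%t' p U.
    1 * cut_sum t' (%t'' q W. sg ((tdeg U + tdeg W) * ?d) * G (t'' # ts) q W p U) +
    1 * (sg (tdeg U * ?d) * fcut ts (%ts' q W. G (t' # ts') (nleaves t' + q) W p U)))"
   unfolding iii_def iv_def by (rule comb3_lin[OF ct, symmetric]) simp
  then show ?thesis
   unfolding ii
  proof (simp only:, intro comb3_lin[OF ct])
   fix t' p U assume "(t', p, U) \<in> cuts V t"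
   note cD = cutsD[OF this]
   have "cut_sum t' (%t'' q W. sg ((tdeg U + tdeg W) * ?d) * G (t'' # ts) q W p U) =
    sg (tdeg U * ?d) * cut_sum t' (%t'' q W. sg (tdeg W * ?d) * G (t'' # ts) q W p U)"
    by (rule comb3_mult[OF cut_comb(1)[OF cD(1)]]) (simp add: sg_add distrib_left distrib_right mult_ac)
   then show "sg (tdeg U * ?d) * fcut (t' # ts) (%ts0 q W. G ts0 q W p U) =
    1 * (sg (tdeg U * ?d) * (sg (tdeg t' * ?d) * G (?L # ts) 0 t' p U)) +
    1 * (1 * cut_sum t' (%t'' q W. sg ((tdeg U + tdeg W) * ?d) * G (t'' # ts) q W p U) +
     1 * (sg (tdeg U * ?d) * fcut ts (%ts' q W. G (t' # ts') (nleaves t' + q) W p U)))"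
    using cD(3,5) by (auto simp: distrib_left add_ac)
  qed
 qed
 have e2: "fcut ts (%ts' p U. fcut (t # ts') (%ts0 q W. G ts0 q W (?n + p) U)) = 1 * v + 1 * (1 * vi + 1 * vii)"
 proof -
  have "1 * vi + 1 * vii = fcut ts (%ts' p U. 
    1 * cut_sum t (%t' q W. sg (tdeg W * deg_sum ts') * G (t' # ts') q W (?n + p) U) +
    1 * fcut ts' (%ts0 q W. G (t # ts0) (?n + q) W (?n + p) U))"
   unfolding vi_def vii_def by (rule comb3_lin[OF cts, symmetric]) simp
  then show ?thesis unfolding v_def by (simp only:) (rule comb3_lin[OF cts], simp add: add_ac)
 qed
 have vii': "vii = fcut ts (%ts0 q Z. cut_sum Z (%W p U. G (t # ts0) (?n + q) W (?n + q + p) U))" proof -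
  have "vii = fcut ts (%ts0 q Z. cut_sum Z (%W p U. G (t # ts0) (?n + q) W (?n + (q + p)) U))"
   unfolding vii_def
  proof (rule Cons.IH(2)[OF ts])
   fix ts0 :: "('i, 'e, 'v) dtree list" and a b and W1 W2 :: "('i, 'e, 'v) dtree"
   assume "a < b" "b < length (fleaves ts0)"
   moreover have "?n + (b + nleaves W1 - 1) = (?n + b) + nleaves W1 - 1" using \<open>a < b\<close> by simp
   ultimately show "G (t # ts0) (?n + a) W1 (?n + (b + nleaves W1 - 1)) W2 =
     - (sg (tdeg W1 * tdeg W2) * G (t # ts0) (?n + b) W2 (?n + a) W1)"
    using Cons.prems(2)[of "?n + a" "?n + b" "t # ts0" W1 W2] by simp
  qed
  then show ?thesis by (simp add: add.assoc)
 qed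
 have iii': "iii = cut_sum t (%t0 q Z. sg (tdeg Z * ?d) * cut_sum Z (%W p U. G (t0 # ts) q W (q + p) U))" proof -
  have "iii = cut_sum t (%t0 q Z. cut_sum Z (%W p U. sg ((tdeg U + tdeg W) * ?d) * G (t0 # ts) q W (q + p) U))"
   unfolding iii_def
  proof (rule Cons.IH(1)[OF t])
   fix T0 W1 W2 :: "('i, 'e, 'v) dtree" and a b
   assume "a < b" "b < nleaves T0"
   then show "sg ((tdeg W2 + tdeg W1) * ?d) * G (T0 # ts) a W1 (b + nleaves W1 - 1) W2 =
     - (sg (tdeg W1 * tdeg W2) * (sg ((tdeg W1 + tdeg W2) * ?d) * G (T0 # ts) b W2 a W1))"
    using Cons.prems(2)[of a b "T0 # ts" W1 W2] by (simp add: add.commute mult.left_commute)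
  qed
  also have "\<dots> = cut_sum t (%t0 q Z. sg (tdeg Z * ?d) * cut_sum Z (%W p U. G (t0 # ts) q W (q + p) U))"
  proof (rule comb3_cong[OF ct])
   fix t0 q Z assume "(t0, q, Z) \<in> cuts V t"
   note cD = cutsD[OF this]
   show "cut_sum Z (%W p U. sg ((tdeg U + tdeg W) * ?d) * G (t0 # ts) q W (q + p) U) =
     sg (tdeg Z * ?d) * cut_sum Z (%W p U. G (t0 # ts) q W (q + p) U)"
    by (rule comb3_mult[OF cut_comb(1)[OF cD(2)]]) (auto dest!: cutsD(9) simp: add.commute)
  qed
  finally show ?thesis .
 qed
 have iv_v: "i + v = 0" proof (cases t)
  case (Node y us)
  have "v = (- sg (tdeg t * ?d)) * fcut ts (%ts0 q W. G (?L # ts0) (Suc q) W 0 t)"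
   unfolding v_def
  proof (rule comb3_mult[OF cts])
   fix ts' p U assume "(ts', p, U) \<in> fcuts V ts"
   note cD = fcutsD[OF this]
   have "G (?L # ts') 0 t (Suc p + ?n - 1) U = - (sg (tdeg t * tdeg U) * G (?L # ts') (Suc p) U 0 t)"
    using cD(4) by (intro Cons.prems(2)) simp_all
   then show "edge_cut t (sg (tdeg t * deg_sum ts') * G (?L # ts') 0 t (?n + p) U) =
     (- sg (tdeg t * ?d)) * G (?L # ts') (Suc p) U 0 t"
    by (simp add: Node cD(5) sg_add distrib_left add.commute mult_ac del: tdeg.simps)
  qed
  then show ?thesis by (simp add: i_def Node)
 qed (use comb3_zero[OF cts, of "%_ _ _. 0"] in "simp add: i_def v_def")
 have iv_vi: "iv + vi = 0" proof -
  have "vi = fcut ts (%ts' p U. cut_sum t (%t' q W. - (sg (tdeg W * ?d) * G (t' # ts') (nleaves t' + p) U q W)))"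
   unfolding vi_def
  proof (rule comb3_cong[OF cts], rule comb3_cong[OF ct])
   fix ts' p U t' q W assume "(ts', p, U) \<in> fcuts V ts" "(t', q, W) \<in> cuts V t"
   note fD = fcutsD[OF this(1)] and cD = cutsD[OF this(2)]
   have "nleaves t' + p + nleaves W - 1 = ?n + p" using cD(10) by simp
   then have "G (t' # ts') q W (?n + p) U = - (sg (tdeg W * tdeg U) * G (t' # ts') (nleaves t' + p) U q W)"
    using Cons.prems(2)[of q "nleaves t' + p" "t' # ts'" W U] cD(6) fD(4) by simp
   then show "sg (tdeg W * deg_sum ts') * G (t' # ts') q W (?n + p) U =
     - (sg (tdeg W * ?d) * G (t' # ts') (nleaves t' + p) U q W)" by (simp add: fD(5) sg_add distrib_left mult_ac)
  qed
  also have "\<dots> = cut_sum t (%t' q W. fcut ts (%ts' p U. - (sg (tdeg W * ?d) * G (t' # ts') (nleaves t' + p) U q W)))"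
   using comb3_swap[OF cts ct, of "%ts' p U (t', q, W). - (sg (tdeg W * ?d) * G (t' # ts') (nleaves t' + p) U q W)"]
   by simp
  also have "\<dots> = (- 1) * iv"
   unfolding iv_def by (rule comb3_mult[OF ct], simp add: minus_mult_left del: minus_mult_left[symmetric], rule comb3_mult[OF cts], simp)
  finally show ?thesis by simp
 qed
 have "fcut (t # ts) (%ts1 p U. fcut ts1 (%ts0 q W. G ts0 q W p U)) =
   i + (1 * ii + 1 * (1 * iii + 1 * iv)) + (1 * v + 1 * (1 * vi + 1 * vii))"
  unfolding fcut_Cons[of t ts] e0 e1 e2 ..
 also have "\<dots> = ii + iii + vii + (i + v) + (iv + vi)" by simp
 also have "\<dots> = fcut (t # ts) (%ts0 q Z. cut_sum Z (%W p U. G ts0 q W (q + p) U))"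
  unfolding iv_v iv_vi iii' vii' fcut_Cons[of t ts] by (simp add: ii_def)
 finally show ?case .
qed simp_all

section \<open>The bar construction of an augmented object\<close>

lemma map_ebot_update: "l < length ys ==> map ebot (ys[l := dE A (ys ! l)]) = map ebot ys"
 by (simp add: map_update list_update_same_conv dE_def)

locale two_category =
 fixes I :: "'i set" and A :: "('k::field, 'i, 'e, 'v::ab_group_add) twocat"
 assumes two_cat: "two_cat I A"
begin

lemma cA: "complexes A" and objs_A: "objs A = I" using two_cat by (simp_all add: two_cat_def)

sublocale vector_space "scl A" using cA by (simp add: complexes_def)

lemma idE_elems: "i \<in> I ==> j \<in> I ==> a \<in> arrows A i j ==> idE A a \<in> elems A \<and> diff A (idE A a) = 0"
 using two_cat by (simp add: two_cat_def)

lemma idE_Leaf: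
 assumes "Leaf a \<in> trees A"
 shows "idE A a \<in> elems A" "diff A (idE A a) = 0" using assms idE_elems unfolding trees_Leaf_iff objs_A by blast+

lemma compE_elems: "composable A x ys ==> compE A x ys \<in> elems A" using two_cat unfolding two_cat_def by (elim conjE) blast

lemma comp_lin1: "composable A (El s t n v) ys ==> composable A (El s t n w) ys ==>
  opcomp A (El s t n (scl A a v + scl A b w)) ys =
   scl A a (opcomp A (El s t n v) ys) + scl A b (opcomp A (El s t n w) ys)"
 using two_cat unfolding two_cat_def by (elim conjE) blast

lemma comp_lin2: "composable A x (ls @ El s t n v # rs) ==> composable A x (ls @ El s t n w # rs) ==>
  opcomp A x (ls @ El s t n (scl A a v + scl A b w) # rs) =
   scl A a (opcomp A x (ls @ El s t n v # rs)) + scl A b (opcomp A x (ls @ El s t n w # rs))"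
 by (rule two_cat[unfolded two_cat_def, THEN conjunct2, THEN conjunct2, THEN conjunct2, THEN conjunct2, THEN conjunct2, THEN conjunct1, rule_format]) simp

lemma comp_Leibniz: "composable A x ys ==> diff A (compE A x ys) = opcomp A (dE A x) ys +
  (\<Sum>l<length ys. scl A (sg (edeg x + sum_list (map edeg (take l ys)))) (opcomp A x (ys[l := dE A (ys ! l)])))"
 by (rule two_cat[unfolded two_cat_def, THEN conjunct2, THEN conjunct2, THEN conjunct2, THEN conjunct2, THEN conjunct2, THEN conjunct2, THEN conjunct1, rule_format])

lemma comp_assoc: "composable A x ys ==> list_all2 (composable A) ys zss ==>
  opcomp A (compE A x ys) (concat zss) =
   scl A (shuffle_sign (map edeg ys) (map (sum_list \<circ> map edeg) zss)) (opcomp A x (map2 (compE A) ys zss))"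
 by (rule two_cat[unfolded two_cat_def, THEN conjunct2, THEN conjunct2, THEN conjunct2, THEN conjunct2, THEN conjunct2, THEN conjunct2, THEN conjunct2, THEN conjunct1, rule_format]) simp

lemma comp_unit:
 "x \<in> elems A ==> opcomp A x (map (idE A) (etop x)) = evec x"
 "x \<in> elems A ==> opcomp A (idE A (ebot x)) [x] = evec x" using two_cat unfolding two_cat_def by (elim conjE, blast)+

lemma dE_elems: "x \<in> elems A ==> dE A x \<in> elems A" using cA by (cases x) (auto simp: complexes_def elems_def dE_def)

lemma diff_lin:
 assumes "El s t n v \<in> elems A" "El s t n w \<in> elems A"
 shows "diff A (El s t n (scl A a v + scl A b w)) = scl A a (diff A (El s t n v)) + scl A b (diff A (El s t n w))"
 using assms cA unfolding complexes_def elems_def lin_on_def by fastforce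

lemma diff_diff: "x \<in> elems A ==> diff A (dE A x) = 0" using cA by (cases x) (auto simp: complexes_def elems_def)

lemma cx_subspace: "c \<in> cells A ==> subspace (cx A c n)" using cA by (cases c) (auto simp: complexes_def)

lemma elems_zero: "(s, t) \<in> cells A ==> El s t n 0 \<in> elems A"
 using cx_subspace[of "(s, t)" n] by (simp add: elems_def subspace_0)

lemma diff_zero: "(s, t) \<in> cells A ==> diff A (El s t n 0) = 0"
 using diff_lin[where s=s and t=t and n=n and v=0 and w=0 and a=0 and b=0] elems_zero by simp

lemma comp_zero:
 assumes "composable A x (ls @ El s t n 0 # rs)"
 shows "opcomp A x (ls @ El s t n 0 # rs) = 0" using comp_lin2[OF assms assms, of 0 0] by simp

lemma elems_Leaf: "x \<in> elems A ==> a \<in> set (etop x) \<or> a = ebot x ==> Leaf a \<in> trees A"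
 by (rule cell_Leaf_trees[of "etop x" "ebot x"]) (auto simp: elems_def)

abbreviation "ids as \<equiv> map (idE A) as"

lemma idE_simps [simp]: "etop (idE A a) = [a]" "ebot (idE A a) = a" "edeg (idE A a) = 0"
 "map etop (ids as) = map (%a. [a]) as" "map ebot (ids as) = as" "map edeg (ids as) = map (%_. 0) as"
 by (simp_all add: idE_def o_def)

lemma comp_idE [simp]: "etop \<circ> idE A = (%a. [a])" "ebot \<circ> idE A = (%a. a)" by auto

lemma sum_edeg_ids [simp]: "sum_list (map (edeg \<circ> idE A) as) = 0" by (induction as) auto

lemma ids_elems: "\<forall>a\<in>set as. Leaf a \<in> trees A ==> set (ids as) \<subseteq> elems A" using idE_Leaf by auto

section \<open>Partial compositions, with identities in the other inputs\<close>

lemma partial_composable: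
 assumes "x \<in> elems A" "y \<in> elems A" "etop x = P @ ebot y # Q"
 shows "composable A x (ids P @ y # ids Q)" using assms elems_Leaf[OF assms(1)] idE_Leaf(1) by (auto simp: composable_def o_def)

lemma compE_unit:
 assumes "x \<in> elems A"
 shows "compE A x (ids (etop x)) = x" "compE A (idE A (ebot x)) [x] = x"
 using comp_unit[OF assms] by (cases x; simp add: compE_def o_def)+

lemma composable_ids: "x \<in> elems A ==> composable A x (ids (etop x))"
 using ids_elems[of "etop x"] elems_Leaf by (auto simp: composable_def o_def)

lemma composable_id: "x \<in> elems A ==> composable A (idE A (ebot x)) [x]"
 using idE_Leaf(1) elems_Leaf by (auto simp: composable_def)

lemma map2_ids:
 assumes "\<forall>a\<in>set as. Leaf a \<in> trees A"
 shows "map2 (compE A) (ids as) (map (%a. [idE A a]) as) = ids as"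
  "list_all2 (composable A) (ids as) (map (%a. [idE A a]) as)"
proof -
 have *: "compE A (idE A a) [idE A a] = idE A a" "composable A (idE A a) [idE A a]" if "a \<in> set as" for a
  using compE_unit(2)[of "idE A a"] composable_id[of "idE A a"] idE_Leaf(1)[of a] assms that by simp_all
 then show "map2 (compE A) (ids as) (map (%a. [idE A a]) as) = ids as" by (induction as) auto
 from * show "list_all2 (composable A) (ids as) (map (%a. [idE A a]) as)" by (induction as) auto
qed

lemma concat_ids [simp]: "concat (map (%a. [idE A a]) as) = ids as" by (induction as) auto

lemma shuffle_exp_zero:
 "length as = length bs ==> shuffle_exp (map (%_. 0) as @ ys) (map (%_. z) bs @ zs) =
  int (length as) * (z * sum_list ys) + shuffle_exp ys zs"
proof (induction as bs rule: list_induct2)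
 case (Cons a as b bs)
 then show ?case by (simp add: algebra_simps map_replicate_const sum_list_replicate)
qed simp

lemma shuffle_exp_replicate [simp]: "shuffle_exp (replicate n 0) zs = 0"
proof (induction n arbitrary: zs)
 case (Suc n)
 then show ?case by (cases zs) (simp_all add: sum_list_replicate)
qed simp

lemma list_all2_append3:
 "list_all2 R P P' ==> R y y' ==> list_all2 R Q Q' ==> list_all2 R (P @ y # Q) (P' @ y' # Q')" by (simp add: list_all2_appendI)

text \<open>Full associativity, applied to lists padded with identities; the unit laws absorb the
  padding. Only one factor of positive position is not an identity in each list, so no degrees are
  interchanged and the sign is 1.\<close>

lemma comp_seq:
 assumes "x \<in> elems A" "y \<in> elems A" "z \<in> elems A" "etop x = P @ ebot y # Q" "etop y = R @ ebot z # S"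
 shows "opcomp A (compE A x (ids P @ y # ids Q)) (ids (P @ R) @ z # ids (S @ Q)) =
  opcomp A x (ids P @ compE A y (ids R @ z # ids S) # ids Q)"
proof -
 let ?ys = "ids P @ y # ids Q" and ?w = "ids R @ z # ids S"
 let ?zss = "map (%a. [idE A a]) P @ ?w # map (%a. [idE A a]) Q"
 have lf: "\<forall>a\<in>set P. Leaf a \<in> trees A" "\<forall>a\<in>set Q. Leaf a \<in> trees A"
  using elems_Leaf[OF assms(1)] assms(4) by auto
 have l2: "list_all2 (composable A) ?ys ?zss" by (intro list_all2_append3 map2_ids lf partial_composable assms)
 have m2: "map2 (compE A) ?ys ?zss = ids P @ compE A y ?w # ids Q" by (simp add: map2_ids lf del: map_map)
 have s: "shuffle_exp (map edeg ?ys) (map (sum_list \<circ> map edeg) ?zss) = 0"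
  using shuffle_exp_zero[of P P "[edeg y] @ map (%_. 0) Q" 0 "edeg z # map (%_. 0) Q"]
  by (simp add: o_def map_replicate_const sum_list_replicate)
 have c: "concat ?zss = ids (P @ R) @ z # ids (S @ Q)" by simp
 show ?thesis using comp_assoc[OF partial_composable[OF assms(1,2,4)] l2] unfolding m2 c shuffle_sign_exp s by simp
qed

text \<open>Both orders are compared with the composition of \<open>y\<close> and \<open>z\<close>
  at once, again by padding with identities. Composing \<open>z\<close> first and \<open>y\<close>
  second interchanges the two elements, hence the sign in the second part.\<close>

lemma comp_par:
 assumes "x \<in> elems A" "y \<in> elems A" "z \<in> elems A" "etop x = P @ ebot y # Q @ ebot z # R"
 shows "opcomp A (compE A x (ids P @ y # ids (Q @ ebot z # R))) (ids (P @ etop y @ Q) @ z # ids R) =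
   opcomp A x (ids P @ y # ids Q @ z # ids R)"
  and "opcomp A (compE A x (ids (P @ ebot y # Q) @ z # ids R)) (ids P @ y # ids (Q @ etop z @ R)) =
   scl A (sg (edeg y * edeg z)) (opcomp A x (ids P @ y # ids Q @ z # ids R))"
proof -
 have lf: "\<forall>a\<in>set P. Leaf a \<in> trees A" "\<forall>a\<in>set Q. Leaf a \<in> trees A" "\<forall>a\<in>set R. Leaf a \<in> trees A"
  using elems_Leaf[OF assms(1)] assms(4) by auto
 let ?s = "map (%a. [idE A a])"
 let ?ys = "ids P @ y # ids Q @ idE A (ebot z) # ids R" and ?zss = "?s P @ ids (etop y) # ?s Q @ [z] # ?s R"
 have l2: "list_all2 (composable A) ?ys ?zss" by (intro list_all2_append3 map2_ids lf composable_ids composable_id assms)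
 have m2: "map2 (compE A) ?ys ?zss = ids P @ y # ids Q @ z # ids R" by (simp add: map2_ids lf compE_unit assms del: map_map)
 have s: "shuffle_exp (map edeg ?ys) (map (sum_list \<circ> map edeg) ?zss) = 0"
  using shuffle_exp_zero[of P P "edeg y # map (%_. 0) Q @ 0 # map (%_. 0) R" 0
    "0 # map (%_. 0) Q @ edeg z # map (%_. 0) R"]
   shuffle_exp_zero[of Q Q "0 # map (%_. 0) R" 0 "edeg z # map (%_. 0) R"]
  by (simp add: o_def map_replicate_const sum_list_replicate)
 have e: "etop x = P @ ebot y # (Q @ ebot z # R)" using assms(4) by simp
 have "opcomp A (compE A x (ids P @ y # ids (Q @ ebot z # R))) (concat ?zss) =
   scl A (sg 0) (opcomp A x (ids P @ y # ids Q @ z # ids R))"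
  using comp_assoc[OF partial_composable[OF assms(1,2) e], of ?zss] l2 m2 s by (simp add: shuffle_sign_exp)
 then show "opcomp A (compE A x (ids P @ y # ids (Q @ ebot z # R))) (ids (P @ etop y @ Q) @ z # ids R) =
   opcomp A x (ids P @ y # ids Q @ z # ids R)" by simp
 let ?ys = "ids P @ idE A (ebot y) # ids Q @ z # ids R" and ?zss = "?s P @ [y] # ?s Q @ ids (etop z) # ?s R"
 have l2: "list_all2 (composable A) ?ys ?zss" by (intro list_all2_append3 map2_ids lf composable_ids composable_id assms)
 have m2: "map2 (compE A) ?ys ?zss = ids P @ y # ids Q @ z # ids R" by (simp add: map2_ids lf compE_unit assms del: map_map)
 have s: "shuffle_exp (map edeg ?ys) (map (sum_list \<circ> map edeg) ?zss) = edeg y * edeg z"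
  using shuffle_exp_zero[of P P "0 # map (%_. 0) Q @ edeg z # map (%_. 0) R" 0
    "edeg y # map (%_. 0) Q @ 0 # map (%_. 0) R"]
   shuffle_exp_zero[of Q Q "edeg z # map (%_. 0) R" 0 "0 # map (%_. 0) R"]
  by (simp add: o_def map_replicate_const sum_list_replicate)
 have e: "etop x = (P @ ebot y # Q) @ ebot z # R" using assms(4) by simp
 have "opcomp A (compE A x (ids (P @ ebot y # Q) @ z # ids R)) (concat ?zss) =
   scl A (sg (edeg y * edeg z)) (opcomp A x (ids P @ y # ids Q @ z # ids R))"
  using comp_assoc[OF partial_composable[OF assms(1,3) e], of ?zss] l2 m2 s by (simp add: shuffle_sign_exp)
 then show "opcomp A (compE A x (ids (P @ ebot y # Q) @ z # ids R)) (ids P @ y # ids (Q @ etop z @ R)) =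
   scl A (sg (edeg y * edeg z)) (opcomp A x (ids P @ y # ids Q @ z # ids R))" by simp
qed

text \<open>Identities are closed, so in the general Leibniz rule only the terms of \<open>x\<close>
  and of \<open>y\<close> survive.\<close>

lemma partial_Leibniz:
 assumes "x \<in> elems A" "y \<in> elems A" "etop x = P @ ebot y # Q"
 shows "diff A (compE A x (ids P @ y # ids Q)) = opcomp A (dE A x) (ids P @ y # ids Q) +
  scl A (sg (edeg x)) (opcomp A x (ids P @ dE A y # ids Q))"
proof -
 let ?ys = "ids P @ y # ids Q" and ?l = "length P"
 let ?f = "%l. scl A (sg (edeg x + sum_list (map edeg (take l ?ys)))) (opcomp A x (?ys[l := dE A (?ys ! l)]))"
 note c = partial_composable[OF assms]
 \<comment> \<open>The differential of an identity is a zero vector in degree 1, and composition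
   vanishes there by linearity in that input.\<close>
 have z: "?f l = 0" if l: "l < length ?ys" "l \<noteq> ?l" for l proof -
  obtain a where a: "?ys ! l = idE A a" "Leaf a \<in> trees A"
  proof -
   have "?ys ! l \<in> set (ids P) \<union> set (ids Q)"
    using l by (cases "l < length P") (auto simp: nth_append nth_Cons split: nat.splits)
   then show ?thesis using that elems_Leaf[OF assms(1)] assms(3) by auto
  qed
  have d: "dE A (?ys ! l) = El [a] a 1 0" using idE_Leaf(2)[OF a(2)] by (simp add: a dE_def)
  have e: "?ys[l := dE A (?ys ! l)] = take l ?ys @ El [a] a 1 0 # drop (Suc l) ?ys"
   unfolding d by (rule upd_conv_take_nth_drop[OF l(1)])
  have "map ebot (take l ?ys @ El [a] a 1 0 # drop (Suc l) ?ys) = map ebot ?ys"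
   unfolding e[symmetric] by (rule map_ebot_update[OF l(1)])
  moreover have "set (take l ?ys @ El [a] a 1 0 # drop (Suc l) ?ys) \<subseteq> elems A"
  proof -
   have "set ?ys \<subseteq> elems A" using c by (simp only: composable_def)
   then show ?thesis
    using set_take_subset[of l ?ys] set_drop_subset[of "Suc l" ?ys] elems_zero[of "[a]" a 1] Leaf_cells[OF a(2)]
    unfolding set_append list.set by blast
  qed
  ultimately have "composable A x (take l ?ys @ El [a] a 1 0 # drop (Suc l) ?ys)" using c by (simp only: composable_def)
  from comp_zero[OF this] show ?thesis by (simp only: e scale_zero_right)
 qed
 have "(\<Sum>l<length ?ys. ?f l) = (\<Sum>l\<in>{?l}. ?f l)" by (rule sum.mono_neutral_right) (use z in auto)
 then have S: "(\<Sum>l<length ?ys. ?f l) = ?f ?l"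
  by (simp only: sum.insert finite.emptyI empty_iff sum.empty add_0_right not_False_eq_True)
 have "?ys[?l := dE A (?ys ! ?l)] = ids P @ dE A y # ids Q" "take ?l ?ys = ids P" by (simp_all add: list_update_append nth_append)
 then show ?thesis using comp_Leibniz[OF c] unfolding S by (simp add: o_def)
qed

end

locale augmented = two_category I A
 for I :: "'i set" and A :: "('k::field, 'i, 'e, 'v::ab_group_add) twocat" +
 fixes \<epsilon> :: "('i, 'e, 'e, 'v, 'k) mor"
 assumes aug: "augmentation A \<epsilon>"
begin

lemma \<epsilon>_mor: "is_mor A (unit_obj (objs A) (onemor A)) \<epsilon>" using aug by (simp add: augmentation_def)

lemma \<epsilon>_lin: "El s t n v \<in> elems A ==> El s t n w \<in> elems A ==>
 mor2 \<epsilon> (El s t n (scl A a v + scl A b w)) = a * mor2 \<epsilon> (El s t n v) + b * mor2 \<epsilon> (El s t n w)"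
 using \<epsilon>_mor by (fastforce simp: is_mor_def lin_on_def elems_def unit_obj_def)

lemma \<epsilon>_diff: "x \<in> elems A ==> mor2 \<epsilon> (dE A x) = 0"
 using \<epsilon>_mor by (auto simp: is_mor_def unit_obj_def)

lemma \<epsilon>_comp: "composable A x ys ==> mor2 \<epsilon> x = 0 ==> mor2 \<epsilon> (compE A x ys) = 0"
 using \<epsilon>_mor by (auto simp: is_mor_def unit_obj_def mE_def)

definition V where "V = shift 1 (kernel A (mor2 \<epsilon>))"

lemma V_simps [simp]: "objs V = objs A" "onemor V = onemor A" "scl V = scl A"
 "cx V c n = {v \<in> cx A c (n + 1). mor2 \<epsilon> (El (fst c) (snd c) (n + 1) v) = 0}"
 "diff V x = - diff A (up 1 x)" by (simp_all add: V_def shift_def kernel_def sg_def)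

lemma V_cells [simp]: "cells V = cells A" by (rule cells_cong) simp_all

lemma up_simps [simp]: "etop (up p x) = etop x" "ebot (up p x) = ebot x" "edeg (up p x) = edeg x + p"
 "evec (up p x) = evec x" by (simp_all add: up_def)

lemma up_El [simp]: "up p (El s t n v) = El s t (n + p) v" by (simp add: up_def)

lemma up_up [simp]: "up p (up q x) = up (p + q) x" and up_0 [simp]: "up 0 x = x" by (cases x; simp add: up_def)+

lemma V_elems: "x \<in> elems V \<longleftrightarrow> up 1 x \<in> elems A \<and> mor2 \<epsilon> (up 1 x) = 0"
 by (cases x) (auto simp: elems_def up_def)

lemma up_dE: "up 1 (dE V x) = El (etop x) (ebot x) (edeg x + 2) (- diff A (up 1 x))" by (simp add: dE_def up_def)

lemma glue_decomp:
 assumes "etop x = P @ b # Q" "length P = l"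
 shows "glue A x l y = up (- 1) (compE A (up 1 x) (ids P @ up 1 y # ids Q))" using assms by (simp add: glue_def)

lemma etop_decomp:
 assumes "l < length (etop x)" "ebot y = etop x ! l"
 obtains P Q where "etop x = P @ ebot y # Q" "length P = l"
 using assms id_take_nth_drop[OF assms(1)] by (metis length_take min.absorb4)

lemma V_complexes: "complexes V"
 unfolding complexes_def
proof (intro conjI ballI, unfold case_prod_unfold V_cells V_simps(3), goal_cases)
 case 1
 show ?case by (rule vector_space_axioms)
next
 case (2 c)
 obtain s t where c: "c = (s, t)" by (cases c)
 have cell: "(s, t) \<in> cells A" using 2 c by simp
 note sub = cx_subspace[OF cell]
 have e: "El s t m v \<in> elems A \<longleftrightarrow> v \<in> cx A (s, t) m" for m v using cell by (simp add: elems_def)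
 show ?case
  unfolding c fst_conv snd_conv
 proof (intro allI conjI ballI)
  fix n
  show "subspace (cx V (s, t) n)" proof (rule subspaceI)
   show "0 \<in> cx V (s, t) n" using subspace_0[OF sub] \<epsilon>_lin[of s t "n + 1" 0 0 0 0] by (simp add: e)
   show "x + y \<in> cx V (s, t) n" if "x \<in> cx V (s, t) n" "y \<in> cx V (s, t) n" for x y
    using that subspace_add[OF sub] \<epsilon>_lin[of s t "n + 1" x y 1 1] by (simp add: e)
   show "scl A c x \<in> cx V (s, t) n" if "x \<in> cx V (s, t) n" for c x
    using that subspace_scale[OF sub] \<epsilon>_lin[of s t "n + 1" x x c 0] by (simp add: e)
  qed
  show "lin_on (scl A) (scl A) (cx V (s, t) n) (%v. diff V (El s t n v))"
   using diff_lin[of s t "n + 1"] by (auto simp: lin_on_def e up_def)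
  fix v assume v: "v \<in> cx V (s, t) n"
  have v': "El s t (n + 1) v \<in> elems A" using v by (simp add: e)
  have d: "El s t (n + 1 + 1) (diff A (El s t (n + 1) v)) \<in> elems A" using dE_elems[OF v'] by (simp add: dE_def)
  have "El s t (n + 1 + 1) (- diff A (El s t (n + 1) v)) \<in> elems A" using d subspace_neg[OF sub] by (simp add: e)
  moreover have "mor2 \<epsilon> (El s t (n + 1 + 1) (- diff A (El s t (n + 1) v))) = 0"
   using \<epsilon>_lin[OF d d, of "- 1" 0] \<epsilon>_diff[OF v'] by (simp add: dE_def)
  ultimately show "diff V (El s t n v) \<in> cx V (s, t) (n + 1)" by (simp add: e up_def)
  show "diff V (dE V (El s t n v)) = 0" using diff_lin[OF d d, of "- 1" 0] diff_diff[OF v'] by (simp add: dE_def up_def add.assoc)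
 qed
qed

lemma compose_neg1:
 assumes "composable A (El s t n v) ys"
 shows "opcomp A (El s t n (- v)) ys = - opcomp A (El s t n v) ys" using comp_lin1[OF assms assms, of "- 1" 0] by simp

lemma compose_neg2:
 assumes "composable A x (ls @ El s t n v # rs)"
 shows "opcomp A x (ls @ El s t n (- v) # rs) = - opcomp A x (ls @ El s t n v # rs)"
 using comp_lin2[OF assms assms, of "- 1" 0] by simp

text \<open>These are \<open>partial_Leibniz\<close>, \<open>comp_seq\<close> and
  \<open>comp_par\<close>, rewritten for degrees lowered by one. The signs change because the
  differential of \<open>V\<close> is minus that of \<open>A\<close> and because degrees in
  \<open>A\<close> are larger by one. Gluing stays in the kernel of the augmentation by
  \<open>\<epsilon>_comp\<close>.\<close>

lemma contraction_data: "contraction_data V (glue A)"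
proof
 show "complexes V" by (rule V_complexes)
next
 fix x y :: "('i, 'e, 'v) el" and l
 show "etop (glue A x l y) = take l (etop x) @ etop y @ drop (Suc l) (etop x)"
  "ebot (glue A x l y) = ebot x" "edeg (glue A x l y) = edeg x + edeg y + 1" by (simp_all add: glue_def o_def sum_list_0)
next
 fix x y :: "('i, 'e, 'v) el" and l
 assume *: "x \<in> elems V" "y \<in> elems V" "l < length (etop x)" "ebot y = etop x ! l"
 obtain P Q where P: "etop x = P @ ebot y # Q" "length P = l"
  using etop_decomp[OF *(3,4)] .
 have c: "composable A (up 1 x) (ids P @ up 1 y # ids Q)" using *(1,2) P by (intro partial_composable) (simp_all add: V_elems)
 then show "glue A x l y \<in> elems V"
  using \<epsilon>_comp[OF c] compE_elems[OF c] *(1,2) by (simp add: V_elems glue_decomp[OF P])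
 have cd: "composable A (dE A (up 1 x)) (ids P @ up 1 y # ids Q)" "composable A (up 1 x) (ids P @ dE A (up 1 y) # ids Q)" proof -
  have "dE A (up 1 x) \<in> elems A" "dE A (up 1 y) \<in> elems A" "up 1 x \<in> elems A" "up 1 y \<in> elems A"
   using *(1,2) dE_elems by (simp_all add: V_elems)
  moreover have "etop (dE A (up 1 x)) = P @ ebot (up 1 y) # Q" "etop (up 1 x) = P @ ebot (dE A (up 1 y)) # Q"
   using P(1) by (simp_all add: dE_def)
  ultimately show "composable A (dE A (up 1 x)) (ids P @ up 1 y # ids Q)"
    "composable A (up 1 x) (ids P @ dE A (up 1 y) # ids Q)" by (blast intro: partial_composable)+
 qed
 have "diff V (glue A x l y) = - diff A (compE A (up 1 x) (ids P @ up 1 y # ids Q))" by (simp add: glue_decomp[OF P])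
 also have "\<dots> = - opcomp A (dE A (up 1 x)) (ids P @ up 1 y # ids Q) +
   scl A (sg (edeg x)) (opcomp A (up 1 x) (ids P @ dE A (up 1 y) # ids Q))"
  using *(1,2) P by (subst partial_Leibniz) (simp_all add: V_elems sg_def)
 also have "- opcomp A (dE A (up 1 x)) (ids P @ up 1 y # ids Q) = evec (glue A (dE V x) l y)"
  using compose_neg1[OF cd(1)[unfolded dE_def]] glue_decomp[of "dE V x" P "ebot y" Q l y] P
  by (simp add: up_dE dE_def[of A] add.assoc) (simp add: dE_def)
 also have "opcomp A (up 1 x) (ids P @ dE A (up 1 y) # ids Q) = - evec (glue A x l (dE V y))"
  using compose_neg2[OF cd(2)[unfolded dE_def]] by (simp add: glue_decomp[OF P] up_dE dE_def[of A] add.assoc)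
 finally show "diff V (glue A x l y) = scl V 1 (evec (glue A (dE V x) l y)) + scl V (- sg (edeg x)) (evec (glue A x l (dE V y)))"
  by simp
next
 fix s t n v w y l a b
 assume *: "El s t n v \<in> elems V" "El s t n w \<in> elems V" "y \<in> elems V" "l < length s" "ebot y = s ! l"
 obtain P Q where P: "etop (El s t n v) = P @ ebot y # Q" "length P = l"
  by (rule etop_decomp[of l "El s t n v" y]) (use *(4,5) in simp_all)
 have c: "composable A (El s t (n + 1) u) (ids P @ up 1 y # ids Q)" if "El s t n u \<in> elems V" for u
  using that *(3) P by (intro partial_composable) (simp_all add: V_elems up_def)
 have g: "evec (glue A (El s t n u) l y) = opcomp A (El s t (n + 1) u) (ids P @ up 1 y # ids Q)" for u
  using glue_decomp[of "El s t n u" P "ebot y" Q l y] P by simp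
 show "evec (glue A (El s t n (scl V a v + scl V b w)) l y) =
   scl V a (evec (glue A (El s t n v) l y)) + scl V b (evec (glue A (El s t n w) l y))"
  unfolding g V_simps by (rule comp_lin1[OF c[OF *(1)] c[OF *(2)]])
next
 fix s t n v w x l a b
 assume *: "El s t n v \<in> elems V" "El s t n w \<in> elems V" "x \<in> elems V" "l < length (etop x)" "t = etop x ! l"
 have "ebot (El s t n v) = etop x ! l" using *(5) by simp
 from etop_decomp[OF *(4) this] obtain P Q where "etop x = P @ ebot (El s t n v) # Q" "length P = l" .
 then have P: "etop x = P @ t # Q" "length P = l" by simp_all
 have c: "composable A (up 1 x) (ids P @ El s t (n + 1) u # ids Q)" if "El s t n u \<in> elems V" for u
  using that *(3) P by (intro partial_composable) (simp_all add: V_elems up_def)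
 have g: "evec (glue A x l (El s t n u)) = opcomp A (up 1 x) (ids P @ El s t (n + 1) u # ids Q)" for u
  using glue_decomp[OF P] by simp
 show "evec (glue A x l (El s t n (scl V a v + scl V b w))) =
   scl V a (evec (glue A x l (El s t n v))) + scl V b (evec (glue A x l (El s t n w)))"
  unfolding g V_simps by (rule comp_lin2[OF c[OF *(1)] c[OF *(2)]])
next
 fix x y z :: "('i, 'e, 'v) el" and l m
 assume *: "x \<in> elems V" "y \<in> elems V" "z \<in> elems V" "l < length (etop x)" "ebot y = etop x ! l"
  "m < length (etop y)" "ebot z = etop y ! m"
 obtain P Q where P: "etop x = P @ ebot y # Q" "length P = l"
  using etop_decomp[OF *(4,5)] .
 obtain R S where R: "etop y = R @ ebot z # S" "length R = m"
  using etop_decomp[OF *(6,7)] .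
 have 1: "etop (glue A x l y) = (P @ R) @ ebot z # (S @ Q)" "length (P @ R) = l + m" using P R by (simp_all add: glue_decomp[OF P])
 have 2: "etop x = P @ ebot (glue A y m z) # Q" using P by (simp add: glue_decomp[OF R])
 have "opcomp A (compE A (up 1 x) (ids P @ up 1 y # ids Q)) (ids (P @ R) @ up 1 z # ids (S @ Q)) =
  opcomp A (up 1 x) (ids P @ compE A (up 1 y) (ids R @ up 1 z # ids S) # ids Q)"
  using *(1-3) P R by (intro comp_seq) (simp_all add: V_elems)
 moreover have "evec (glue A (glue A x l y) (l + m) z) = opcomp A (up 1 (glue A x l y)) (ids (P @ R) @ up 1 z # ids (S @ Q))"
  by (subst glue_decomp[OF 1]) simp
 moreover have "evec (glue A x l (glue A y m z)) = opcomp A (up 1 x) (ids P @ up 1 (glue A y m z) # ids Q)"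
  by (subst glue_decomp[OF 2 P(2)]) simp
 moreover have "up 1 (glue A x l y) = compE A (up 1 x) (ids P @ up 1 y # ids Q)"
  "up 1 (glue A y m z) = compE A (up 1 y) (ids R @ up 1 z # ids S)" by (simp_all add: glue_decomp[OF P] glue_decomp[OF R])
 ultimately have "evec (glue A (glue A x l y) (l + m) z) = evec (glue A x l (glue A y m z))" by simp
 then show "glue A (glue A x l y) (l + m) z = glue A x l (glue A y m z)" by (intro el.expand) (use P R in "simp_all add: glue_def")
next
 fix x y z :: "('i, 'e, 'v) el" and l m
 assume *: "x \<in> elems V" "y \<in> elems V" "z \<in> elems V" "l < m" "m < length (etop x)" "ebot y = etop x ! l"
  "ebot z = etop x ! m"
 have "l < length (etop x)" using *(4,5) by simp
 from etop_decomp[OF this *(6)] obtain P Q' where P: "etop x = P @ ebot y # Q'" "length P = l" .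
 have "etop x ! m = Q' ! (m - Suc l)" "m - Suc l < length Q'" using *(4,5) P by (simp_all add: nth_append nth_Cons')
 then have "Q' ! (m - Suc l) = ebot z" "m - Suc l < length Q'" using *(7) by simp_all
 then obtain Q R where Q: "Q' = Q @ ebot z # R" "length Q = m - Suc l" by (metis id_take_nth_drop length_take min.absorb4)
 have x: "etop x = P @ ebot y # (Q @ ebot z # R)" "etop x = (P @ ebot y # Q) @ ebot z # R" "length (P @ ebot y # Q) = m"
  using P Q *(4) by simp_all
 have 1: "etop (glue A x l y) = (P @ etop y @ Q) @ ebot z # R" "length (P @ etop y @ Q) = m - 1 + length (etop y)"
  using P(2) Q(2) *(4) by (simp_all add: glue_decomp[OF x(1) P(2)])
 have 2: "etop (glue A x m z) = P @ ebot y # (Q @ etop z @ R)" by (simp add: glue_decomp[OF x(2,3)])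
 have els: "up 1 x \<in> elems A" "up 1 y \<in> elems A" "up 1 z \<in> elems A"
  "etop (up 1 x) = P @ ebot (up 1 y) # Q @ ebot (up 1 z) # R" using *(1-3) x(1) by (simp_all add: V_elems)
 have "evec (glue A (glue A x l y) (m - 1 + length (etop y)) z) = opcomp A (up 1 x) (ids P @ up 1 y # ids Q @ up 1 z # ids R)"
  unfolding glue_decomp[OF 1] using comp_par(1)[OF els] by (simp add: glue_decomp[OF x(1) P(2)])
 moreover have "evec (glue A (glue A x m z) l y) =
   scl A (sg ((edeg y + 1) * (edeg z + 1))) (opcomp A (up 1 x) (ids P @ up 1 y # ids Q @ up 1 z # ids R))"
  unfolding glue_decomp[OF 2 P(2)] using comp_par(2)[OF els] by (simp add: glue_decomp[OF x(2,3)])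
 ultimately show "evec (glue A (glue A x l y) (m - 1 + length (etop y)) z) =
   scl V (sg ((edeg y + 1) * (edeg z + 1))) (evec (glue A (glue A x m z) l y))" by simp
qed

end

section \<open>The generators of the cobar construction\<close>

lemma at_vertices_cong:
 assumes "\<And>x ts phi. Node x ts \<in> trees V ==> rho x ts phi = rho' x ts phi"
 shows "T \<in> trees V ==> at_vertices rho T phi = at_vertices rho' T phi"
  and "set ts \<subseteq> trees V ==> forest_at rho ts psi = forest_at rho' ts psi"
 by (induction T and ts arbitrary: phi and psi rule: tree_induct) (simp_all add: assms)

lemma Mlin_cong:
 assumes "\<And>T. T \<in> trees V ==> tcell T = c ==> phi T = psi T"
 shows "phi \<in> Mlin V c \<longleftrightarrow> psi \<in> Mlin V c" unfolding Mlin_def multilin_def using assms by simp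

text \<open>Uniqueness of linear extension, in terms of functionals: on the span, \<open>f\<close>
  is evaluation at the test function \<open>Psi\<close>. Linearity is asked on the span only,
  because maps such as \<open>mor2\<close> of a morphism are linear just on the complexes.\<close>

lemma ptens_span_linear:
 fixes V :: "('k::field, 'i, 'e, 'v::ab_group_add, 'z) coll_scheme"
 assumes S: "S \<subseteq> trees_of V c" and \<xi>: "\<xi> \<in> module.span tscale (ptens V ` S)"
  and f: "\<And>a b v w. v \<in> module.span tscale (ptens V ` S) ==> w \<in> module.span tscale (ptens V ` S) ==>
   f (tscale a v + tscale b w) = a * f v + b * f w"
  and Psi: "Psi \<in> Mlin V c" "\<And>T. T \<in> S ==> f (ptens V T) = Psi T"
 shows "f \<xi> = \<xi> Psi"
proof -
 interpret M: vector_space "tscale :: 'k => ('k, 'i, 'e, 'v) tens => _" by (rule vector_space_tscale)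
 have "\<xi> \<in> M.span (ptens V ` S) \<and> f \<xi> = \<xi> Psi"
  using \<xi>
 proof (induction rule: M.span_induct_alt)
  case base
  have "f (tscale 0 0 + tscale 0 0) = 0" using f[OF M.span_zero M.span_zero, of 0 0] by simp
  moreover have "tscale 0 0 + tscale 0 0 = (0 :: ('k, 'i, 'e, 'v) tens)" by (simp only: M.scale_zero_left add_0_right)
  ultimately show ?case using M.span_zero by (metis zero_fun_apply)
 next
  case (step r y z)
  obtain T where T: "y = ptens V T" "T \<in> S" using step by auto
  have y: "y \<in> M.span (ptens V ` S)" using T by (simp add: M.span_base)
  have "f (tscale r y + z) = f (tscale r y + tscale 1 z)" by simp
  also have "\<dots> = r * Psi T + z Psi" using f[OF y, of z r 1] step Psi(2)[OF T(2)] T by simp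
  also have "\<dots> = (tscale r y + z) Psi" using T S Psi(1) by (auto simp: tscale_def Mlin_ptens)
  finally show ?case using M.span_add[OF M.span_scale[OF y, of r] conjunct1[OF step.IH]] by blast
 qed
 then show ?thesis ..
qed

lemma ptens_tree_lin:
 assumes "tree_lin (scl V) a b T1 T2 T3" "T1 \<in> trees V" "T2 \<in> trees V" "T3 \<in> trees V"
 shows "ptens V T3 = tscale a (ptens V T1) + tscale b (ptens V T2)"
 using tree_lin_same[OF assms(1)] Mlin_D[OF _ assms] by (auto simp: fun_eq_iff Mlin_ptens tscale_def)

lemma tree_lin_Node:
 assumes "tree_lin s a b T1 T2 T3"
 obtains x1 ts1 x2 ts2 x3 ts3 where "T1 = Node x1 ts1" "T2 = Node x2 ts2" "T3 = Node x3 ts3" using assms by cases auto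

lemma tree_lin_is_Node: "tree_lin s a b T1 T2 T3 ==> T = T1 \<or> T = T2 \<or> T = T3 ==> \<exists>x ts. T = Node x ts"
 using tree_lin_Node by metis

text \<open>In contrast to \<open>cuts\<close>, this depends on the cut tree through its cell only,
  hence means the same for the three trees of a linear relation.\<close>

definition cut_typed ::
 "('k, 'i, 'e, 'v, 'z) coll_scheme => ('i, 'e) cell => ('i, 'e, 'v) dtree => nat => ('i, 'e, 'v) dtree => bool" where
 "cut_typed V c T p U \<longleftrightarrow> T \<in> trees V \<and> U \<in> trees V \<and> p < nleaves T \<and> root U = leaves T ! p \<and>
  c = (take p (leaves T) @ leaves U @ drop (Suc p) (leaves T), root T) \<and>
  (\<exists>x ts. T = Node x ts) \<and> (\<exists>x ts. U = Node x ts)"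

lemma cuts_typed: "(T', p, U) \<in> cuts V T ==> cut_typed V (tcell T) T' p U"
 using cutsD[of T' p U V T] by (simp add: cut_typed_def)

text \<open>The varying vertex lies in the lower or in the upper piece of a cut, which is the reason
  for the two linearity hypotheses on \<open>Psi\<close>.\<close>

lemma cut_sum_Mlin_aux:
 assumes "tree_lin (scl V) a b t1 t2 t3" "t1 \<in> trees V" "t2 \<in> trees V" "t3 \<in> trees V"
  and "\<And>a b T1 T2 T3 p U. tree_lin (scl V) a b T1 T2 T3 ==> cut_typed V (tcell t1) T1 p U ==>
   cut_typed V (tcell t1) T2 p U ==> cut_typed V (tcell t1) T3 p U ==> Psi T3 p U = a * Psi T1 p U + b * Psi T2 p U"
  and "\<And>a b T p U1 U2 U3. tree_lin (scl V) a b U1 U2 U3 ==> cut_typed V (tcell t1) T p U1 ==>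
   cut_typed V (tcell t1) T p U2 ==> cut_typed V (tcell t1) T p U3 ==> Psi T p U3 = a * Psi T p U1 + b * Psi T p U2"
 shows "cut_sum t3 Psi = a * cut_sum t1 Psi + b * cut_sum t2 Psi"
 using assms
proof (induction arbitrary: Psi rule: tree_lin.induct)
 case (here p q n v ts w)
 have ts: "set ts \<subseteq> trees V" using here.prems by simp
 show ?case
  unfolding cut_sum_Node
 proof (rule comb3_lin[OF cut_comb(2)[OF ts]])
  fix ts' r U assume *: "(ts', r, U) \<in> fcuts V ts"
  have ty: "cut_typed V (fleaves ts, q) (Node (El p q n u) ts') r U" if "Node (El p q n u) ts \<in> trees V" for u
   using * that fcutsD[OF *] by (auto simp: cut_typed_def fcuts_def)
  show "Psi (Node (El p q n (scl V a v + scl V b w)) ts') r U =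
    a * Psi (Node (El p q n v) ts') r U + b * Psi (Node (El p q n w) ts') r U"
   by (rule here.prems(4)[OF tree_lin.here]) (use ty here.prems(1-3) in auto)
 qed
next
 case (below t1 t2 t3 x l r)
 note same = tree_lin_same[OF below.hyps]
 let ?c = "(fleaves (l @ t1 # r), ebot x)"
 have mem: "set l \<subseteq> trees V" "set r \<subseteq> trees V" "t1 \<in> trees V" "t2 \<in> trees V" "t3 \<in> trees V" "x \<in> elems V"
  "map root l @ root t1 # map root r = etop x" using below.prems(1-3) by auto
 have N: "Node x (l @ t # r) \<in> trees V" "tcell (Node x (l @ t # r)) = ?c" if "t = t1 \<or> t = t2 \<or> t = t3" for t
  using that below.prems(1-3) same by auto
 have A1: "Psi T3 p U = a * Psi T1 p U + b * Psi T2 p U"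
  if "tree_lin (scl V) a b T1 T2 T3" "cut_typed V ?c T1 p U" "cut_typed V ?c T2 p U" "cut_typed V ?c T3 p U"
  for a b T1 T2 T3 p U using below.prems(4)[of a b T1 T2 T3 p U] that by simp
 have A2: "Psi T p U3 = a * Psi T p U1 + b * Psi T p U2"
  if "tree_lin (scl V) a b U1 U2 U3" "cut_typed V ?c T p U1" "cut_typed V ?c T p U2" "cut_typed V ?c T p U3"
  for a b T p U1 U2 U3 using below.prems(5)[of a b U1 U2 U3 T p] that by simp
 \<comment> \<open>The chord that is cut lies in \<open>l\<close> (\<open>X\<close>), is the root
   chord of the varying tree (\<open>Y\<close>), lies inside that tree (\<open>Z\<close>), or lies
   in \<open>r\<close> (\<open>W\<close>).\<close>
 define X where "X t = fcut l (%l' p U. sg (tdeg U * (tdeg t1 + deg_sum r)) * Psi (Node x (l' @ t # r)) p U)" for t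
 define Y where "Y t = sg (tdeg t1 * deg_sum r) * Psi (Node x (l @ Leaf (root t1) # r)) (length (fleaves l)) t" for t
 define Z where "Z t = cut_sum t (%t' p U. sg (tdeg U * deg_sum r) * Psi (Node x (l @ t' # r)) (length (fleaves l) + p) U)" for t
 define W where "W t = fcut r (%r' p U. Psi (Node x (l @ t # r')) (length (fleaves l) + (nleaves t1 + p)) U)" for t
 have split: "cut_sum (Node x (l @ t # r)) Psi = X t + Y t + Z t + W t" if "t = t1 \<or> t = t2 \<or> t = t3" for t proof -
  have tm: "set (t # r) \<subseteq> trees V" "tdeg t = tdeg t1" "root t = root t1" "nleaves t = nleaves t1"
   using that mem same by auto
  from tree_lin_is_Node[OF below.hyps that] obtain y us where "t = Node y us" by blast
  then have e: "edge_cut t r' = r'" for r' :: 'a by simp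
  show ?thesis
   unfolding cut_sum_Node fcut_append[OF mem(1) tm(1)] fcut_Cons[of t] e tm(2-4)
   using tm(2) by (simp add: X_def Y_def Z_def W_def add.assoc)
 qed
 have X: "X t3 = a * X t1 + b * X t2"
  unfolding X_def
 proof (rule comb3_lin[OF cut_comb(2)[OF mem(1)]])
  fix l' p U assume *: "(l', p, U) \<in> fcuts V l"
  have ty: "cut_typed V ?c (Node x (l' @ t # r)) p U" if "t = t1 \<or> t = t2 \<or> t = t3" for t
   using * N[OF that] fcutsD[OF *] by (auto simp: cut_typed_def fcuts_def nth_append)
  show "sg (tdeg U * (tdeg t1 + deg_sum r)) * Psi (Node x (l' @ t3 # r)) p U =
   a * (sg (tdeg U * (tdeg t1 + deg_sum r)) * Psi (Node x (l' @ t1 # r)) p U) +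
   b * (sg (tdeg U * (tdeg t1 + deg_sum r)) * Psi (Node x (l' @ t2 # r)) p U)"
   using A1[OF tree_lin.below[OF below.hyps, of x l' r], of p U] ty by (simp add: algebra_simps)
 qed
 have Y: "Y t3 = a * Y t1 + b * Y t2" proof -
  have "cut_typed V ?c (Node x (l @ Leaf (root t1) # r)) (length (fleaves l)) t" if "t = t1 \<or> t = t2 \<or> t = t3" for t
  proof -
   from tree_lin_is_Node[OF below.hyps that] obtain y us where "t = Node y us" by blast
   then show ?thesis using N[OF that] that same Leaf_root_trees[OF mem(3)] by (auto simp: cut_typed_def nth_append)
  qed
  then have "Psi (Node x (l @ Leaf (root t1) # r)) (length (fleaves l)) t3 =
    a * Psi (Node x (l @ Leaf (root t1) # r)) (length (fleaves l)) t1 +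
    b * Psi (Node x (l @ Leaf (root t1) # r)) (length (fleaves l)) t2" using A2[OF below.hyps] by blast
  then show ?thesis by (simp add: Y_def algebra_simps)
 qed
 have typZ: "cut_typed V ?c (Node x (l @ t' # r)) (length (fleaves l) + p) U"
  if "cut_typed V (tcell t1) t' p U" for t' p U using that mem by (auto simp: cut_typed_def nth_append)
 have Z: "Z t3 = a * Z t1 + b * Z t2"
  unfolding Z_def
 proof (rule below.IH[OF mem(3-5)])
  fix a b T1 T2 T3 p U
  assume *: "tree_lin (scl V) a b T1 T2 T3" "cut_typed V (tcell t1) T1 p U" "cut_typed V (tcell t1) T2 p U"
   "cut_typed V (tcell t1) T3 p U"
  show "sg (tdeg U * deg_sum r) * Psi (Node x (l @ T3 # r)) (length (fleaves l) + p) U =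
   a * (sg (tdeg U * deg_sum r) * Psi (Node x (l @ T1 # r)) (length (fleaves l) + p) U) +
   b * (sg (tdeg U * deg_sum r) * Psi (Node x (l @ T2 # r)) (length (fleaves l) + p) U)"
   using A1[OF tree_lin.below[OF *(1), of x l r] typZ[OF *(2)] typZ[OF *(3)] typZ[OF *(4)]] by (simp add: algebra_simps)
 next
  fix a b T p U1 U2 U3
  assume *: "tree_lin (scl V) a b U1 U2 U3" "cut_typed V (tcell t1) T p U1" "cut_typed V (tcell t1) T p U2"
   "cut_typed V (tcell t1) T p U3"
  show "sg (tdeg U3 * deg_sum r) * Psi (Node x (l @ T # r)) (length (fleaves l) + p) U3 =
   a * (sg (tdeg U1 * deg_sum r) * Psi (Node x (l @ T # r)) (length (fleaves l) + p) U1) +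
   b * (sg (tdeg U2 * deg_sum r) * Psi (Node x (l @ T # r)) (length (fleaves l) + p) U2)"
   using A2[OF *(1) typZ[OF *(2)] typZ[OF *(3)] typZ[OF *(4)]] tree_lin_same[OF *(1)] by (simp add: algebra_simps)
 qed
 have W: "W t3 = a * W t1 + b * W t2"
  unfolding W_def
 proof (rule comb3_lin[OF cut_comb(2)[OF mem(2)]])
  fix r' p U assume *: "(r', p, U) \<in> fcuts V r"
  have ty: "cut_typed V ?c (Node x (l @ t # r')) (length (fleaves l) + (nleaves t1 + p)) U"
   if "t = t1 \<or> t = t2 \<or> t = t3" for t
   using * N[OF that] that same fcutsD[OF *] by (auto simp: cut_typed_def fcuts_def nth_append)
  show "Psi (Node x (l @ t3 # r')) (length (fleaves l) + (nleaves t1 + p)) U =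
   a * Psi (Node x (l @ t1 # r')) (length (fleaves l) + (nleaves t1 + p)) U +
   b * Psi (Node x (l @ t2 # r')) (length (fleaves l) + (nleaves t1 + p)) U"
   using A1[OF tree_lin.below[OF below.hyps, of x l r']] ty by blast
 qed
 show ?case
  unfolding split[OF disjI1[OF refl]] split[OF disjI2[OF disjI1[OF refl]]] split[OF disjI2[OF disjI2[OF refl]]] X Y Z W
  by (simp add: algebra_simps)
qed

lemma cut_sum_Mlin:
 assumes "\<And>a b T1 T2 T3 p U. tree_lin (scl V) a b T1 T2 T3 ==> cut_typed V c T1 p U ==>
   cut_typed V c T2 p U ==> cut_typed V c T3 p U ==> Psi T3 p U = a * Psi T1 p U + b * Psi T2 p U"
  and "\<And>a b T p U1 U2 U3. tree_lin (scl V) a b U1 U2 U3 ==> cut_typed V c T p U1 ==>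
   cut_typed V c T p U2 ==> cut_typed V c T p U3 ==> Psi T p U3 = a * Psi T p U1 + b * Psi T p U2"
 shows "(%T. cut_sum T Psi) \<in> Mlin V c" by (rule Mlin_I, rule cut_sum_Mlin_aux) (use assms in auto)

lemma two_vertex_tree_update:
 "p < length (etop x) ==> two_vertex_tree x p y = Node x ((map Leaf (etop x))[p := corolla y])"
 by (simp add: two_vertex_tree_def upd_conv_take_nth_drop take_map drop_map)

lemma tmap_corolla: "tmap (up p) (corolla x) = corolla (up p x)" by (simp add: corolla_def up_def)

lemma tmap_two_vertex: "tmap (up q) (two_vertex_tree x p y) = two_vertex_tree (up q x) p (up q y)"
 by (simp add: two_vertex_tree_def tmap_corolla) (simp add: up_def)

context augmented
begin

sublocale full: contraction_data V "glue A" 1 by (rule contraction_data)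

sublocale internal: contraction_data V "glue A" 0 by (rule contraction_data)

lemma contract_pick:
 "contract A x ts phi = sg (edeg x + 1) * pick ts (%as y us bs. phi (Node (glue A x (length as) y) (as @ us @ bs)))"
 unfolding contract_def pick_def sum_distrib_left by (intro sum.cong refl) (auto split: dtree.split simp: mult_ac)

lemma bar_op:
 assumes "Node x ts \<in> trees V"
 shows "insert_at (diff_vertex V) x ts phi + contract A x ts phi = full.rho x ts phi"
proof -
 have "length ts = length (etop x)" using assms by (auto dest: arg_cong[of _ _ length])
 then show ?thesis by (simp add: insert_at_exp diff_vertex_def full.rho_def contract_pick dE_def)
qed

definition barcoll where
 "barcoll = free_coll V (%x ts phi. insert_at (diff_vertex V) x ts phi + contract A x ts phi)"

lemma barcoll_simps [simp]: "objs barcoll = objs A" "onemor barcoll = onemor A" "scl barcoll = tscale"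
 "cx barcoll = free_cx V" by (simp_all add: barcoll_def free_coll_def)

lemma bar_simps [simp]: "objs (bar A \<epsilon>) = objs A" "onemor (bar A \<epsilon>) = onemor A" "scl (bar A \<epsilon>) = tscale"
 "cx (bar A \<epsilon>) = free_cx V" "diff (bar A \<epsilon>) = diff barcoll" "counit (bar A \<epsilon>) = cofree_counit"
 "split (bar A \<epsilon>) = (%x. on_cell (kernel barcoll cofree_counit) (etop x, ebot x) (%phi.
  evec x (%T. cut_sum T (%T' p U. phi (two_vertex_tree (ptensE V T') p (ptensE V U))))))"
 by (simp_all add: bar_def Let_def V_def[symmetric] barcoll_def[symmetric] coll.defs coalg.defs)

definition W where "W = shift (- 1) (kernel (bar A \<epsilon>) cofree_counit)"

lemma W_simps: "objs W = objs A" "onemor W = onemor A" "scl W = tscale"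
 "cx W c n = {v \<in> free_cx V c (n - 1). cofree_counit (El (fst c) (snd c) (n - 1) v) = 0}"
 "diff W x = tscale (- 1) (diff barcoll (up (- 1) x))" by (simp_all add: W_def shift_def kernel_def sg_def)

declare W_simps(1-3) [simp]

lemma W_cells [simp]: "cells W = cells A" by (rule cells_cong) simp_all

lemma counit_Mlin: "(%T. case T of Leaf a => 1 | Node y us => 0) \<in> Mlin V c"
 by (rule Mlin_I) (erule tree_lin_Node, simp)

lemma trees_node_subset: "trees_node V c n \<subseteq> trees_of V c" by (auto simp: trees_node_def)

text \<open>The contribution of the tree without vertices to the value at a test function is a
  constant times the counit, so the vanishing of the counit removes exactly this tree.\<close>

lemma W_cx: "cx W c n = module.span tscale (ptens V ` trees_node V c (n - 1))"
proof (intro set_eqI iffI)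
 fix \<xi>
 assume "\<xi> \<in> cx W c n"
 then have \<xi>: "\<xi> \<in> free_cx V c (n - 1)" "\<xi> (%T. case T of Leaf a => 1 | Node y us => 0) = 0"
  by (simp_all add: W_simps cofree_counit_def)
 note f = free_cx_fcomb[OF \<xi>(1)]
 let ?g = "%T phi. case T of Leaf a => 0 | Node y us => phi T"
 have m: "(%T. ?g T phi) \<in> Mlin V c" if "phi \<in> Mlin V c" for phi proof (rule Mlin_I)
  fix a b t1 t2 t3
  assume *: "tree_lin (scl V) a b t1 t2 t3" "t1 \<in> trees V" "t2 \<in> trees V" "t3 \<in> trees V" "tcell t1 = c"
  show "?g t3 phi = a * ?g t1 phi + b * ?g t2 phi" proof -
   obtain x1 ts1 x2 ts2 x3 ts3 where "t1 = Node x1 ts1" "t2 = Node x2 ts2" "t3 = Node x3 ts3"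
    using tree_lin_Node[OF *(1)] .
   then show ?thesis using Mlin_D[OF that *] by simp
  qed
 qed
 have "fcomb (trees_node V c (n - 1)) (Mlin V c) (%phi. \<xi> (%T. ?g T phi))"
 proof (rule fcomb_bind[OF f _ m])
  fix T assume "T \<in> trdeg V c (n - 1)"
  then show "fcomb (trees_node V c (n - 1)) (Mlin V c) (?g T)" by (cases T) (auto intro: fcomb_0 fcomb_point)
 qed
 moreover have "\<xi> phi = \<xi> (%T. ?g T phi)" if "phi \<in> Mlin V c" for phi
 proof -
  have "\<xi> phi = phi (Leaf (snd c)) * \<xi> (%T. case T of Leaf a => 1 | Node y us => 0) + 1 * \<xi> (%T. ?g T phi)"
   by (rule fcomb_lin[OF f counit_Mlin m[OF that] that]) (auto split: dtree.split)
  then show ?thesis using \<xi>(2) by simp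
 qed
 ultimately show "\<xi> \<in> module.span tscale (ptens V ` trees_node V c (n - 1))"
  using \<xi>(1) by (auto simp: ptens_span_iff[OF trees_node_subset] free_cx_iff fcomb_def)
next
 fix \<xi> assume "\<xi> \<in> module.span tscale (ptens V ` trees_node V c (n - 1))"
 then have \<xi>: "fcomb (trees_node V c (n - 1)) (Mlin V c) \<xi>" "\<forall>phi. phi \<notin> Mlin V c \<longrightarrow> \<xi> phi = 0"
  by (simp_all add: ptens_span_iff[OF trees_node_subset])
 have "\<xi> (%T. case T of Leaf a => 1 | Node y us => 0) = 0"
  by (rule fcomb_zero[OF \<xi>(1) counit_Mlin]) (auto simp: trees_node_def split: dtree.split)
 moreover have "fcomb (trdeg V c (n - 1)) (Mlin V c) \<xi>" by (rule fcomb_mono[OF \<xi>(1)]) (auto simp: trees_node_def)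
 ultimately show "\<xi> \<in> cx W c n" using \<xi>(2) by (simp add: W_simps free_cx_iff cofree_counit_def)
qed

lemma W_cx_comb: "\<xi> \<in> cx W c n ==> fcomb (trees_node V c (n - 1)) (Mlin V c) \<xi>"
 by (simp add: W_cx ptens_span_iff[OF trees_node_subset])

text \<open>The generator of the cobar construction given by a decorated tree; the desuspension
  raises the degree by one.\<close>

definition gen :: "('i, 'e, 'v) dtree => ('i, 'e, ('k, 'i, 'e, 'v) tens) el" where
 "gen T = El (leaves T) (root T) (tdeg T + 1) (ptens V T)"

lemma gen_simps [simp]: "etop (gen T) = leaves T" "ebot (gen T) = root T" "edeg (gen T) = tdeg T + 1"
 "evec (gen T) = ptens V T" "up 1 (ptensE V T) = gen T" by (simp_all add: gen_def ptensE_def)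

lemma V_trees_cells: "T \<in> trees V ==> tcell T \<in> cells A" using trees_cells[of T V] by simp

lemma gen_elems: "T \<in> trees V ==> \<exists>x ts. T = Node x ts ==> gen T \<in> elems W"
proof -
 interpret M: vector_space "tscale :: 'k => ('k, 'i, 'e, 'v) tens => _" by (rule vector_space_tscale)
 assume *: "T \<in> trees V" "\<exists>x ts. T = Node x ts"
 then have "ptens V T \<in> ptens V ` trees_node V (tcell T) (tdeg T)" by (auto intro!: imageI)
 then show "gen T \<in> elems W" using M.span_base V_trees_cells[OF *(1)] by (simp add: elems_def W_cx)
qed

lemma gen_lin:
 assumes "tree_lin (scl V) a b T1 T2 T3" "T1 \<in> trees V" "T2 \<in> trees V" "T3 \<in> trees V"
 shows "tree_lin (scl W) a b (Node (gen T1) ts) (Node (gen T2) ts) (Node (gen T3) ts)"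
  "gen T1 \<in> elems W" "gen T2 \<in> elems W" "gen T3 \<in> elems W"
proof -
 note same = tree_lin_same[OF assms(1)]
 show "tree_lin (scl W) a b (Node (gen T1) ts) (Node (gen T2) ts) (Node (gen T3) ts)"
  unfolding gen_def same ptens_tree_lin[OF assms] W_simps by (rule tree_lin.here)
 show "gen T1 \<in> elems W" "gen T2 \<in> elems W" "gen T3 \<in> elems W"
  using assms(2-4) tree_lin_Node[OF assms(1)] gen_elems by metis+
qed

lemma W_Leaf: "Leaf a \<in> trees W \<longleftrightarrow> Leaf a \<in> trees V"
 by (simp add: trees_Leaf_iff is_path_cong(2)[of W V])

lemma leaves_trees: "T \<in> trees V ==> set (map Leaf (leaves T)) \<subseteq> trees W"
 using cell_Leaf_trees[of "leaves T" "root T" V] V_trees_cells[of T] by (auto simp: W_Leaf)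

lemma W_leaves: "x \<in> elems W ==> set (map Leaf (etop x)) \<subseteq> trees W"
 using cell_Leaf_trees[of "etop x" "ebot x" W] by (auto simp: elems_def)

lemma corolla_trees: "x \<in> elems W ==> corolla x \<in> trees W" using W_leaves[of x] by (simp add: corolla_def)

lemma gen_Mlin:
 assumes "phi \<in> Mlin W c"
 shows "(%T. phi (corolla (gen T))) \<in> Mlin V c"
proof (rule Mlin_I)
 fix a b T1 T2 T3
 assume *: "tree_lin (scl V) a b T1 T2 T3" "T1 \<in> trees V" "T2 \<in> trees V" "T3 \<in> trees V" "tcell T1 = c"
 note g = gen_lin[OF *(1-4)] and same = tree_lin_same[OF *(1)]
 have c: "corolla (gen T) = Node (gen T) (map Leaf (leaves T1))" if "T = T1 \<or> T = T2 \<or> T = T3" for T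
  using that same by (auto simp: corolla_def)
 show "phi (corolla (gen T3)) = a * phi (corolla (gen T1)) + b * phi (corolla (gen T2))"
  using Mlin_D[OF assms g(1)[of "map Leaf (leaves T1)"]] corolla_trees[OF g(2)] corolla_trees[OF g(3)]
   corolla_trees[OF g(4)] *(5) by (simp add: c)
qed

lemma upd_trees:
 assumes "p < length as" "set (map Leaf as) \<subseteq> trees V'" "T \<in> trees V'" "root T = as ! p"
 shows "set ((map Leaf as)[p := T]) \<subseteq> trees V'" "map root ((map Leaf as)[p := T]) = as"
  "fleaves ((map Leaf as)[p := T]) = take p as @ leaves T @ drop (Suc p) as"
  "deg_sum ((map Leaf as)[p := T]) = tdeg T"
proof -
 show "set ((map Leaf as)[p := T]) \<subseteq> trees V'" using assms by (intro set_update_subsetI)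
 show "map root ((map Leaf as)[p := T]) = as" using assms by (simp add: map_update o_def list_update_same_conv)
 show "fleaves ((map Leaf as)[p := T]) = take p as @ leaves T @ drop (Suc p) as"
  "deg_sum ((map Leaf as)[p := T]) = tdeg T" using assms(1) by (simp_all add: upd_conv_take_nth_drop take_map drop_map)
qed

lemma two_vertex_trees:
 assumes "x \<in> elems W" "y \<in> elems W" "p < length (etop x)" "ebot y = etop x ! p"
 shows "two_vertex_tree x p y \<in> trees W"
  "tcell (two_vertex_tree x p y) = (take p (etop x) @ etop y @ drop (Suc p) (etop x), ebot x)"
  "tdeg (two_vertex_tree x p y) = edeg x + edeg y"
proof -
 note u = upd_trees[OF assms(3) W_leaves[OF assms(1)] corolla_trees[OF assms(2)]]
 show "two_vertex_tree x p y \<in> trees W"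
  "tcell (two_vertex_tree x p y) = (take p (etop x) @ etop y @ drop (Suc p) (etop x), ebot x)"
  "tdeg (two_vertex_tree x p y) = edeg x + edeg y" using u assms by (simp_all add: two_vertex_tree_update)
qed

lemma cut_typed_gen:
 assumes "cut_typed V c T p U"
 shows "two_vertex_tree (gen T) p (gen U) \<in> trees W" "tcell (two_vertex_tree (gen T) p (gen U)) = c"
  "tdeg (two_vertex_tree (gen T) p (gen U)) = tdeg T + tdeg U + 2"
 using assms two_vertex_trees[of "gen T" "gen U" p] gen_elems[of T] gen_elems[of U] by (auto simp: cut_typed_def)

lemma tvt_Mlin:
 assumes "phi \<in> Mlin W c"
 shows "(%T. cut_sum T (%T' p U. sg (tdeg T') * phi (two_vertex_tree (gen T') p (gen U)))) \<in> Mlin V c"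
proof (rule cut_sum_Mlin)
 fix a b T1 T2 T3 p U
 assume *: "tree_lin (scl V) a b T1 T2 T3" "cut_typed V c T1 p U" "cut_typed V c T2 p U" "cut_typed V c T3 p U"
 note t = *(2-4)[unfolded cut_typed_def] and same = tree_lin_same[OF *(1)]
 have e: "two_vertex_tree (gen T) p (gen U) = Node (gen T) ((map Leaf (leaves T1))[p := corolla (gen U)])"
  if "T = T1 \<or> T = T2 \<or> T = T3" for T using that same t by (auto simp: two_vertex_tree_update)
 have "phi (two_vertex_tree (gen T3) p (gen U)) = a * phi (two_vertex_tree (gen T1) p (gen U)) + b * phi (two_vertex_tree (gen T2) p (gen U))"
  using Mlin_D[OF assms gen_lin(1)[OF *(1), of "(map Leaf (leaves T1))[p := corolla (gen U)]"]]
   cut_typed_gen[OF *(2)] cut_typed_gen[OF *(3)] cut_typed_gen[OF *(4)] t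
  by (simp add: e)
 then show "sg (tdeg T3) * phi (two_vertex_tree (gen T3) p (gen U)) =
   a * (sg (tdeg T1) * phi (two_vertex_tree (gen T1) p (gen U))) + b * (sg (tdeg T2) * phi (two_vertex_tree (gen T2) p (gen U)))"
  by (simp add: same algebra_simps)
next
 fix a b T p U1 U2 U3
 assume *: "tree_lin (scl V) a b U1 U2 U3" "cut_typed V c T p U1" "cut_typed V c T p U2" "cut_typed V c T p U3"
 note t = *(2-4)[unfolded cut_typed_def] and same = tree_lin_same[OF *(1)]
 let ?as = "map Leaf (leaves T)"
 have e: "two_vertex_tree (gen T) p (gen U) = Node (gen T) (take p ?as @ Node (gen U) (map Leaf (leaves U1)) # drop (Suc p) ?as)"
  if "U = U1 \<or> U = U2 \<or> U = U3" for U
  using that same t by (auto simp: two_vertex_tree_update upd_conv_take_nth_drop corolla_def)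
 have "phi (two_vertex_tree (gen T) p (gen U3)) = a * phi (two_vertex_tree (gen T) p (gen U1)) + b * phi (two_vertex_tree (gen T) p (gen U2))"
  using Mlin_D[OF assms tree_lin.below[OF gen_lin(1)[OF *(1), of "map Leaf (leaves U1)"], of "gen T" "take p ?as" "drop (Suc p) ?as"]]
   cut_typed_gen[OF *(2)] cut_typed_gen[OF *(3)] cut_typed_gen[OF *(4)] t
  by (simp add: e)
 then show "sg (tdeg T) * phi (two_vertex_tree (gen T) p (gen U3)) =
   a * (sg (tdeg T) * phi (two_vertex_tree (gen T) p (gen U1))) + b * (sg (tdeg T) * phi (two_vertex_tree (gen T) p (gen U2)))"
  by (simp add: algebra_simps)
qed

abbreviation "B \<equiv> at_vertices full.rho"

text \<open>The differential of the generator \<open>gen T\<close>, written in terms of the inner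
  tree \<open>T\<close>. The decorations of trees over \<open>W\<close> are themselves functionals
  on functions of trees over \<open>V\<close>; by \<open>\<theta>_eval\<close> the computations with
  them become computations with inner trees.\<close>

definition \<Theta> :: "('i, 'e, 'v) dtree => (('i, 'e, ('k, 'i, 'e, 'v) tens) dtree => 'k) => 'k" where
 "\<Theta> T phi = - B T (%S. phi (corolla (gen S))) +
  cut_sum T (%T' p U. sg (tdeg T') * phi (two_vertex_tree (gen T') p (gen U)))"

definition \<theta> :: "('i, 'e, ('k, 'i, 'e, 'v) tens) el => (('i, 'e, ('k, 'i, 'e, 'v) tens) dtree => 'k) => 'k" where
 "\<theta> x phi = diff_vertex W x phi + split (bar A \<epsilon>) (up (- 1) x)
  (%S. (case S of Leaf a => 1 | Node x' us => sg (edeg x')) * phi (tmap (up 1) S))"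

lemma cobar_bar: "cobar (bar A \<epsilon>) = free_obj W \<theta>"
 unfolding cobar_def Let_def bar_simps W_def[symmetric] \<theta>_def[abs_def] ..

lemma \<Theta>_Mlin: "phi \<in> Mlin W c ==> (%T. \<Theta> T phi) \<in> Mlin V c"
 unfolding \<Theta>_def using Mlin_scale[OF full.bar.at_Mlin[OF gen_Mlin], of phi c "- 1"] tvt_Mlin
 by (intro Mlin_plus) simp_all

lemma kernel_elems: "x \<in> elems (kernel barcoll cofree_counit) \<longleftrightarrow> up 1 x \<in> elems W"
proof -
 have "cells (kernel barcoll cofree_counit) = cells A" by (rule cells_cong) (simp_all add: kernel_def)
 moreover have "cx (kernel barcoll cofree_counit) c n = cx W c (n + 1)" for c n by (simp add: W_simps, simp add: kernel_def)
 ultimately show ?thesis by (cases x) (simp add: elems_def)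
qed

lemma tmap_kernel:
 "T \<in> trees (kernel barcoll cofree_counit) ==> tmap (up 1) T \<in> trees W \<and> leaves (tmap (up 1) T) = leaves T \<and> root (tmap (up 1) T) = root T"
 "set ts \<subseteq> trees (kernel barcoll cofree_counit) ==> set (map (tmap (up 1)) ts) \<subseteq> trees W \<and>
  map leaves (map (tmap (up 1)) ts) = map leaves ts \<and> map root (map (tmap (up 1)) ts) = map root ts"
proof (induction T and ts rule: tree_induct)
 case (Leaf a)
 have "objs (kernel barcoll cofree_counit) = objs W"
  "\<And>i j. arrows (kernel barcoll cofree_counit) i j = arrows W i j" by (simp_all add: arrows_def kernel_def)
 with Leaf show ?case by (simp add: trees_Leaf_iff)
next
 case (Node x ts)
 then have "\<forall>t\<in>set ts. leaves (tmap (up 1) t) = leaves t \<and> root (tmap (up 1) t) = root t" by simp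
 then have e: "map (leaves \<circ> tmap (up 1)) ts = map leaves ts" "map (root \<circ> tmap (up 1)) ts = map root ts" by simp_all
 show ?case using Node by (simp add: kernel_elems e)
qed simp_all

lemma tmap_tree_lin: "tree_lin s a b t1 t2 t3 ==> tree_lin s a b (tmap (up p) t1) (tmap (up p) t2) (tmap (up p) t3)"
proof (induction rule: tree_lin.induct)
 case (below t1 t2 t3 x l r)
 then show ?case by (auto intro: tree_lin.below)
qed (auto intro: tree_lin.here)

lemma split_test_Mlin:
 assumes "phi \<in> Mlin W c"
 shows "(%S. (case S of Leaf a => 1 | Node x' us => sg (edeg x')) * phi (tmap (up 1) S)) \<in> Mlin (kernel barcoll cofree_counit) c"
proof (rule Mlin_I)
 let ?K = "kernel barcoll cofree_counit"
 fix a b t1 t2 t3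
 assume *: "tree_lin (scl ?K) a b t1 t2 t3" "t1 \<in> trees ?K" "t2 \<in> trees ?K" "t3 \<in> trees ?K"
  "tcell t1 = c" "tcell t2 = c" "tcell t3 = c"
 have "tree_lin (scl W) a b (tmap (up 1) t1) (tmap (up 1) t2) (tmap (up 1) t3)"
  using tmap_tree_lin[OF *(1)] by (simp add: kernel_def)
 then have "phi (tmap (up 1) t3) = a * phi (tmap (up 1) t1) + b * phi (tmap (up 1) t2)"
  using tmap_kernel(1)[OF *(2)] tmap_kernel(1)[OF *(3)] tmap_kernel(1)[OF *(4)] *(5) by (intro Mlin_D[OF assms]) simp_all
 moreover obtain x1 x2 x3 ts1 ts2 ts3 where "t1 = Node x1 ts1" "t2 = Node x2 ts2" "t3 = Node x3 ts3"
  "edeg x1 = edeg x2" "edeg x2 = edeg x3" using *(1) by cases auto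
 ultimately show "(case t3 of Leaf a => 1 | Node x' us => sg (edeg x')) * phi (tmap (up 1) t3) =
   a * ((case t1 of Leaf a => 1 | Node x' us => sg (edeg x')) * phi (tmap (up 1) t1)) +
   b * ((case t2 of Leaf a => 1 | Node x' us => sg (edeg x')) * phi (tmap (up 1) t2))" by (simp add: algebra_simps)
qed

lemma barcoll_diff:
 assumes "evec x \<in> free_cx V (etop x, ebot x) n"
 shows "diff barcoll x phi = (if phi \<in> Mlin V (etop x, ebot x) then evec x (%T. B T phi) else 0)"
proof -
 let ?rho = "%x ts phi. insert_at (diff_vertex V) x ts phi + contract A x ts phi"
 have e: "at_vertices ?rho T phi = B T phi" if "T \<in> trees V" for T by (rule at_vertices_cong(1)[OF bar_op that])
 have "evec x (%T. at_vertices ?rho T phi) = evec x (%T. B T phi)" if "phi \<in> Mlin V (etop x, ebot x)"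
 proof (rule fcomb_cong[OF free_cx_fcomb[OF assms] _ full.bar.at_Mlin[OF that]])
  show "(%T. at_vertices ?rho T phi) \<in> Mlin V (etop x, ebot x)"
   using full.bar.at_Mlin[OF that] Mlin_cong[of V "(etop x, ebot x)" "%T. at_vertices ?rho T phi" "%T. B T phi"] e by blast
 qed (use e in simp)
 then show ?thesis by (simp add: barcoll_def free_coll_def on_cell_Mlin)
qed

lemma Node_El_lin:
 assumes "phi \<in> Mlin W c" "(s, t) \<in> cells A" "set ts \<subseteq> trees W" "map root ts = s" "c = (fleaves ts, t)"
  and "v \<in> cx W (s, t) n" "w \<in> cx W (s, t) n"
 shows "phi (Node (El s t n (tscale a v + tscale b w)) ts) = a * phi (Node (El s t n v) ts) + b * phi (Node (El s t n w) ts)"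
proof -
 interpret M: vector_space "tscale :: 'k => ('k, 'i, 'e, 'v) tens => _" by (rule vector_space_tscale)
 have "tscale a v + tscale b w \<in> cx W (s, t) n" using assms(6,7) by (simp add: W_cx M.span_add M.span_scale)
 then show ?thesis using assms Mlin_D[OF assms(1) tree_lin.here[of "scl W" a b s t n v ts w]] by (simp add: elems_def)
qed

text \<open>A multilinear \<open>phi\<close> is linear in the decoration of a corolla, so its value
  at a decoration built from a combination of trees is the combination of its values at the
  generators \<open>gen S\<close>. This is used for the whole bar differential and for its internal
  part; the minus sign is that of the desuspension.\<close>

lemma vertex_op_eval:
 assumes x: "x \<in> elems W" and P: "\<And>T. T \<in> trees V ==> fcomb (trees_node V (tcell T) (tdeg T + 1)) UNIV (P T)"
  and M: "\<And>psi. psi \<in> Mlin V (etop x, ebot x) ==> (%T. P T psi) \<in> Mlin V (etop x, ebot x)"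
  and d: "\<And>psi. \<delta> psi = (if psi \<in> Mlin V (etop x, ebot x) then - evec x (%T. P T psi) else 0)"
 shows "\<delta> \<in> cx W (etop x, ebot x) (edeg x + 1)"
  and "phi \<in> Mlin W (etop x, ebot x) ==>
   phi (corolla (El (etop x) (ebot x) (edeg x + 1) \<delta>)) = - evec x (%T. P T (%S. phi (corolla (gen S))))"
proof -
 let ?s = "etop x" and ?t = "ebot x" and ?n = "edeg x + 1"
 have xc: "evec x \<in> cx W (?s, ?t) (edeg x)" and c: "(?s, ?t) \<in> cells A" using x by (simp_all add: elems_def)
 have "fcomb (trees_node V (?s, ?t) (edeg x)) (Mlin V (?s, ?t)) (%psi. evec x (%T. P T psi))"
 proof (rule fcomb_bind[OF W_cx_comb[OF xc] _ M])
  fix T assume "T \<in> trees_node V (?s, ?t) (edeg x - 1)"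
  then show "fcomb (trees_node V (?s, ?t) (edeg x)) (Mlin V (?s, ?t)) (P T)"
   by (intro fcomb_mono[OF P[of T]]) (auto simp: trees_node_def)
 qed
 from fcomb_scale[OF this, of "- 1"]
 have "fcomb (trees_node V (?s, ?t) (edeg x)) (Mlin V (?s, ?t)) \<delta>" using d by (simp add: fcomb_def)
 then show \<delta>: "\<delta> \<in> cx W (?s, ?t) ?n" using d by (simp add: W_cx ptens_span_iff[OF trees_node_subset])
 assume phi: "phi \<in> Mlin W (?s, ?t)"
 let ?f = "%v. phi (Node (El ?s ?t ?n v) (map Leaf ?s))"
 have lin: "?f (tscale a v + tscale b w) = a * ?f v + b * ?f w" if "v \<in> cx W (?s, ?t) ?n" "w \<in> cx W (?s, ?t) ?n" for a b v w
  using Node_El_lin[OF phi c W_leaves[OF x] _ _ that] by simp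
 have "phi (corolla (El ?s ?t ?n \<delta>)) = ?f \<delta>" by (simp add: corolla_def)
 also have "\<dots> = \<delta> (%S. phi (corolla (gen S)))"
 proof (rule ptens_span_linear[OF trees_node_subset, where f="?f"])
  show "\<delta> \<in> module.span tscale (ptens V ` trees_node V (?s, ?t) (?n - 1))"
   using \<delta> unfolding W_cx .
  show "(%S. phi (corolla (gen S))) \<in> Mlin V (?s, ?t)" by (rule gen_Mlin[OF phi])
  show "?f (ptens V T) = phi (corolla (gen T))" if "T \<in> trees_node V (?s, ?t) (?n - 1)" for T
   using that by (auto simp: corolla_def gen_def trees_node_def)
 qed (use lin in "simp add: W_cx")
 also have "\<dots> = - evec x (%T. P T (%S. phi (corolla (gen S))))" using gen_Mlin[OF phi] d by simp
 finally show "phi (corolla (El ?s ?t ?n \<delta>)) = - evec x (%T. P T (%S. phi (corolla (gen S))))" .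
qed

lemma diff_vertex_eval:
 assumes "x \<in> elems W" "phi \<in> Mlin W (etop x, ebot x)"
 shows "diff_vertex W x phi = - evec x (%T. B T (%S. phi (corolla (gen S))))"
proof -
 have "evec (up (- 1) x) \<in> free_cx V (etop (up (- 1) x), ebot (up (- 1) x)) (edeg x - 1)"
  using assms(1) by (simp add: elems_def W_simps)
 note d = barcoll_diff[OF this]
 show ?thesis
  unfolding diff_vertex_def dE_def
  by (rule vertex_op_eval(2)[OF assms(1) full.B_comb full.bar.at_Mlin _ assms(2)]) (auto simp: W_simps tscale_def d)
qed

lemma \<theta>_eval:
 assumes "x \<in> elems W" "phi \<in> Mlin W (etop x, ebot x)"
 shows "\<theta> x phi = evec x (%T. \<Theta> T phi)"
proof -
 have x: "evec x \<in> cx W (etop x, ebot x) (edeg x)" using assms(1) by (simp add: elems_def)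
 let ?s = "%T. cut_sum T (%T' p U. sg (tdeg T') * phi (two_vertex_tree (gen T') p (gen U)))"
 have 1: "\<theta> x phi = - evec x (%T. B T (%S. phi (corolla (gen S)))) + evec x ?s"
  using split_test_Mlin[OF assms(2)]
  by (simp add: \<theta>_def diff_vertex_eval[OF assms] on_cell_Mlin tmap_two_vertex, simp add: two_vertex_tree_def ptensE_def)
 have "evec x (%T. \<Theta> T phi) = (- 1) * evec x (%T. B T (%S. phi (corolla (gen S)))) + 1 * evec x ?s"
  by (rule fcomb_lin[OF W_cx_comb[OF x] full.bar.at_Mlin[OF gen_Mlin[OF assms(2)]] tvt_Mlin[OF assms(2)] \<Theta>_Mlin[OF assms(2)]])
   (simp add: \<Theta>_def)
 with 1 show ?thesis by simp
qed

lemma \<Theta>_comb: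
 assumes "T \<in> trees V" "\<exists>x ts. T = Node x ts"
 shows "fcomb (trdeg W (tcell T) (tdeg T + 2)) F (\<Theta> T)"
proof -
 have 1: "fcomb (trdeg W (tcell T) (tdeg T + 2)) F (%phi. B T (%S. 1 * phi (corolla (gen S))))"
 proof (rule fcomb_image[OF full.B_comb[OF assms(1)]])
  fix S assume S: "S \<in> trees_node V (tcell T) (tdeg T + 1)"
  then have "corolla (gen S) \<in> trees W"
   using gen_elems[of S] not_Leaf[of S] by (intro corolla_trees) (auto simp: trees_node_def simp del: split_paired_All)
  then show "corolla (gen S) \<in> trdeg W (tcell T) (tdeg T + 2)" using S by (auto simp: trees_node_def)
 qed simp
 have 2: "fcomb (trdeg W (tcell T) (tdeg T + 2)) F
   (%phi. cut_sum T (%T' p U. sg (tdeg T') * phi (two_vertex_tree (gen T') p (gen U))))"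
 proof -
  have "fcomb (trdeg W (tcell T) (tdeg T + 2)) F (%phi. (%Psi. cut_sum T (%a b c. Psi (a, b, c)))
    (%s. (case s of (T', p, U) => sg (tdeg T')) * phi (case s of (T', p, U) => two_vertex_tree (gen T') p (gen U))))"
  proof (rule fcomb_image[OF cut_comb(1)[OF assms(1)], where
     c="%s. case s of (T', p, U) => sg (tdeg T')" and h="%s. case s of (T', p, U) => two_vertex_tree (gen T') p (gen U)"])
   fix s assume s: "s \<in> cuts V T"
   obtain T' p U where e: "s = (T', p, U)" by (cases s)
   show "(case s of (T', p, U) => two_vertex_tree (gen T') p (gen U)) \<in> trdeg W (tcell T) (tdeg T + 2)"
    using cut_typed_gen[OF cuts_typed[OF s[unfolded e]]] cutsD(9)[OF s[unfolded e]] by (simp add: e)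
  qed simp
  then show ?thesis by simp
 qed
 have "fcomb (trdeg W (tcell T) (tdeg T + 2)) F (%phi. (- 1) * B T (%S. phi (corolla (gen S))) +
   cut_sum T (%T' p U. sg (tdeg T') * phi (two_vertex_tree (gen T') p (gen U))))"
  using 1 2 by (intro fcomb_plus fcomb_scale) simp_all
 then show ?thesis by (simp add: \<Theta>_def[abs_def])
qed

sublocale cobar: derivation_data W \<theta>
proof
 fix x assume x: "x \<in> elems W"
 let ?c = "(etop x, ebot x)"
 have xc: "evec x \<in> cx W ?c (edeg x)" using x by (simp add: elems_def)
 have "fcomb (trdeg W ?c (edeg x + 1)) (Mlin W ?c) (%phi. evec x (%T. \<Theta> T phi))"
 proof (rule fcomb_bind[OF W_cx_comb[OF xc] _ \<Theta>_Mlin])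
  fix T assume T: "T \<in> trees_node V ?c (edeg x - 1)"
  then have "\<exists>x ts. T = Node x ts" by (intro not_Leaf) (simp add: trees_node_def del: split_paired_All)
  with T show "fcomb (trdeg W ?c (edeg x + 1)) (Mlin W ?c) (\<Theta> T)"
   using \<Theta>_comb[of T "Mlin W ?c"] by (simp add: trees_node_def add.commute del: split_paired_All)
 qed
 then show "fcomb (trdeg W ?c (edeg x + 1)) (Mlin W ?c) (\<theta> x)" using \<theta>_eval[OF x] by (simp add: fcomb_def)
next
 fix phi s t n v w a b
 assume *: "phi \<in> Mlin W (s, t)" "El s t n v \<in> elems W" "El s t n w \<in> elems W" "El s t n (scl W a v + scl W b w) \<in> elems W"
 show "\<theta> (El s t n (scl W a v + scl W b w)) phi = a * \<theta> (El s t n v) phi + b * \<theta> (El s t n w) phi"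
  using \<theta>_eval[OF *(2)] \<theta>_eval[OF *(3)] \<theta>_eval[OF *(4)] *(1) by (simp add: tscale_def)
qed

end

section \<open>The differential of the cobar construction squares to zero\<close>

lemma graft_around_corolla:
 fixes x :: "('i, 'e, 'v) el"
 assumes "length A = length P" "length M = length (etop x)" "length C = length Q"
 shows "fgraft (map Leaf P @ corolla x # map Leaf Q) (A @ M @ C) = A @ Node x M # C"
  "fgraft_exp (map Leaf P @ corolla x # map Leaf Q) (A @ M @ C) = edeg x * deg_sum A"
proof -
 show "fgraft (map Leaf P @ corolla x # map Leaf Q) (A @ M @ C) = A @ Node x M # C" using assms by (subst fgraft_append) simp_all
 show "fgraft_exp (map Leaf P @ corolla x # map Leaf Q) (A @ M @ C) = edeg x * deg_sum A"
  using assms by (subst fgraft_exp_append) (simp_all add: o_def sum_list_0 take_map[symmetric])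
qed

lemma (in derivation_data) D_corolla:
 assumes "x \<in> elems V" "phi \<in> Mlin V (etop x, ebot x)"
 shows "D (corolla x) phi = \<theta> x phi"
proof -
 have "D (corolla x) phi = \<theta> x (%S. sg (graft_exp S (map Leaf (etop x))) * phi (graft S (map Leaf (etop x))))"
  by (simp add: corolla_def insert_at_exp)
 also have "\<dots> = \<theta> x phi" proof (rule fcomb_cong[OF \<theta>_comb[OF assms(1)] _ assms(2)])
  show "(%S. sg (graft_exp S (map Leaf (etop x))) * phi (graft S (map Leaf (etop x)))) \<in> Mlin V (etop x, ebot x)"
   using cell_Leaf_trees[of "etop x" "ebot x" V] assms by (intro graft_term_Mlin) (auto simp: o_def elems_def)
 next
  fix S assume "S \<in> trdeg V (etop x, ebot x) (edeg x + 1)"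
  then have "leaves S = etop x" by simp
  then show "sg (graft_exp S (map Leaf (etop x))) * phi (graft S (map Leaf (etop x))) = phi S"
   by (simp flip: \<open>leaves S = etop x\<close>)
 qed
 finally show ?thesis .
qed

context augmented
begin

lemma \<theta>_gen:
 assumes "T \<in> trees V" "\<exists>x ts. T = Node x ts" "phi \<in> Mlin W (tcell T)"
 shows "\<theta> (gen T) phi = \<Theta> T phi"
 using \<theta>_eval[OF gen_elems[OF assms(1,2)]] \<Theta>_Mlin[OF assms(3)] assms(3) by (simp add: Mlin_ptens)

text \<open>At the lower vertex, \<open>gen U\<close> is grafted back onto the result; to reach the
  upper vertex the derivation passes \<open>gen T\<close>, which has degree
  \<open>tdeg T + 1\<close>.\<close>

lemma D_two_vertex:
 assumes "cut_typed V c T p U" "phi \<in> Mlin W c"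
 shows "cobar.D (two_vertex_tree (gen T) p (gen U)) phi =
  \<Theta> T (%R. sg (graft_exp R ((map Leaf (leaves T))[p := corolla (gen U)])) * phi (graft R ((map Leaf (leaves T))[p := corolla (gen U)]))) +
  sg (tdeg T + 1) * \<Theta> U (%t. phi (Node (gen T) ((map Leaf (leaves T))[p := t])))"
proof -
 let ?L = "map Leaf (leaves T)"
 let ?ts = "?L[p := corolla (gen U)]"
 note c = assms(1)[unfolded cut_typed_def]
 have gT: "gen T \<in> elems W" and gU: "gen U \<in> elems W" using c gen_elems by blast+
 have p: "p < length (leaves T)" using c by simp
 have ts: "set ?ts \<subseteq> trees W" "map root ?ts = leaves T" "fleaves ?ts = take p (leaves T) @ leaves U @ drop (Suc p) (leaves T)"
  using upd_trees[OF p leaves_trees[OF conjunct1[OF c]] corolla_trees[OF gU]] c by simp_all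
 have phi: "phi \<in> Mlin W (fleaves ?ts, root T)" using assms(2) c ts(3) by simp
 have h: "(%R. sg (graft_exp R ?ts) * phi (graft R ?ts)) \<in> Mlin W (tcell T)"
  by (rule cobar.graft_term_Mlin[OF phi ts(1,2)])
 have "insert_at \<theta> (gen T) ?ts phi = \<theta> (gen T) (%R. sg (graft_exp R ?ts) * phi (graft R ?ts))"
  by (rule insert_at_exp)
 also have "\<dots> = \<Theta> T (%R. sg (graft_exp R ?ts) * phi (graft R ?ts))"
  using c by (intro \<theta>_gen h) simp_all
 finally have 1: "insert_at \<theta> (gen T) ?ts phi = \<Theta> T (%R. sg (graft_exp R ?ts) * phi (graft R ?ts))" .
 have upd: "?L[p := t] = map Leaf (take p (leaves T)) @ t # map Leaf (drop (Suc p) (leaves T))" for t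
  using p by (simp add: upd_conv_take_nth_drop take_map drop_map)
 have k: "(%t. phi (Node (gen T) (?L[p := t]))) \<in> Mlin W (tcell U)" proof (rule Mlin_I)
  fix a b t1 t2 t3
  assume *: "tree_lin (scl W) a b t1 t2 t3" "t1 \<in> trees W" "t2 \<in> trees W" "t3 \<in> trees W"
   "tcell t1 = tcell U"
  have t: "Node (gen T) (?L[p := t]) \<in> trees W" "tcell (Node (gen T) (?L[p := t])) = c"
   if "t \<in> trees W" "tcell t = tcell U" for t
   using upd_trees[OF p leaves_trees[OF conjunct1[OF c]] that(1)] that(2) c gT by simp_all
  have same: "tcell t2 = tcell U" "tcell t3 = tcell U" using tree_lin_same[OF *(1)] *(5) by simp_all
  show "phi (Node (gen T) (?L[p := t3])) = a * phi (Node (gen T) (?L[p := t1])) + b * phi (Node (gen T) (?L[p := t2]))"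
   by (rule Mlin_D[OF assms(2) _ t(1)[OF *(2,5)] t(1)[OF *(3) same(1)] t(1)[OF *(4) same(2)] t(2)[OF *(2,5)]])
    (unfold upd, rule tree_lin.below[OF *(1)])
 qed
 have "forest_at (insert_at \<theta>) ?ts (%ts'. phi (Node (gen T) ts')) = cobar.D (corolla (gen U)) (%t. phi (Node (gen T) (?L[p := t])))"
  unfolding upd forest_at_append forest_at_Cons forest_at_Leaf by (simp add: o_def sum_list_0 del: at_vertices_Node)
 also have "\<dots> = \<Theta> U (%t. phi (Node (gen T) (?L[p := t])))"
  using cobar.D_corolla[OF gU] \<theta>_gen[of U] k c by simp
 finally have 2: "forest_at (insert_at \<theta>) ?ts (%ts'. phi (Node (gen T) ts')) = \<Theta> U (%t. phi (Node (gen T) (?L[p := t])))" .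
 have "two_vertex_tree (gen T) p (gen U) = Node (gen T) ?ts" using p by (simp add: two_vertex_tree_update)
 then show ?thesis by (simp add: 1 2)
qed

text \<open>The tree with three vertices in which \<open>gen R\<close> sits on leaf \<open>q\<close>
  of \<open>gen T\<close> and \<open>gen U\<close> on leaf \<open>p\<close> of the result. The
  prefactor is what the iterated cobar differential leaves after the sign of \<open>T\<close> is
  taken out, and it turns the interchange rule into the form needed for
  \<open>cut_cut\<close>.\<close>

definition triple ::
 "(('i, 'e, ('k, 'i, 'e, 'v) tens) dtree => 'k) =>
 ('i, 'e, 'v) dtree => nat => ('i, 'e, 'v) dtree => nat => ('i, 'e, 'v) dtree => 'k" where
 "triple phi T q R p U = (let S = two_vertex_tree (gen T) q (gen R);
   ts = (map Leaf (take q (leaves T) @ leaves R @ drop (Suc q) (leaves T)))[p := corolla (gen U)]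
  in sg (tdeg R) * sg (graft_exp S ts) * phi (graft S ts))"

lemma triple_seq:
 assumes "q < nleaves T" "p < nleaves R"
 shows "triple phi T q R (q + p) U =
  sg (tdeg R) * phi (Node (gen T) ((map Leaf (leaves T))[q := two_vertex_tree (gen R) p (gen U)]))"
proof -
 obtain P x Q where L: "leaves T = P @ x # Q" "length P = q"
  using id_take_nth_drop[OF assms(1)] assms(1) by (metis length_take min.absorb4)
 obtain A y C where R: "leaves R = A @ y # C" "length A = p"
  using id_take_nth_drop[OF assms(2)] assms(2) by (metis length_take min.absorb4)
 let ?ts = "map Leaf P @ (map Leaf A @ corolla (gen U) # map Leaf C) @ map Leaf Q"
 have "(map Leaf (take q (leaves T) @ leaves R @ drop (Suc q) (leaves T)))[q + p := corolla (gen U)] = ?ts"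
  using L(2) R(2) by (simp add: L(1) R(1) list_update_append)
 moreover have "two_vertex_tree (gen T) q (gen R) = Node (gen T) (map Leaf P @ corolla (gen R) # map Leaf Q)"
  using L(2) by (simp add: two_vertex_tree_def L(1))
 moreover have "(map Leaf (leaves T))[q := two_vertex_tree (gen R) p (gen U)] =
   map Leaf P @ Node (gen R) (map Leaf A @ corolla (gen U) # map Leaf C) # map Leaf Q"
  using L(2) R(2) by (simp add: two_vertex_tree_def L(1) R(1) list_update_append)
 ultimately show ?thesis
  unfolding triple_def Let_def
  by (simp only: graft_Node graft_exp_Node graft_around_corolla length_map length_append list.size gen_simps R(1))
   (simp add: o_def sum_list_0)
qed

text \<open>Grafting at leaf \<open>a\<close> moves leaf \<open>b\<close> by
  \<open>nleaves R1 - 1\<close>. The two upper generators have the degrees of \<open>R1\<close> and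
  \<open>R2\<close> raised by one; interchanging them produces the minus sign by which independent
  cuts cancel.\<close>

lemma triple_par:
 assumes "a < b" "b < nleaves T"
 shows "triple phi T a R1 (b + nleaves R1 - 1) R2 = - (sg (tdeg R1 * tdeg R2) * triple phi T b R2 a R1)"
proof -
 obtain K y R where L: "leaves T = K @ y # R" "length K = b"
  using id_take_nth_drop[OF assms(2)] assms(2) by (metis length_take min.absorb4)
 have "a < length K" using assms(1) L(2) by simp
 then obtain P x Q where K: "K = P @ x # Q" "length P = a" using id_take_nth_drop by (metis length_take min.absorb4)
 have b: "b = Suc (length P + length Q)" using L(2) K(1) by simp
 let ?R = "Node (gen T) (map Leaf P @ corolla (gen R1) # map Leaf Q @ corolla (gen R2) # map Leaf R)"
 have "(map Leaf (take a (leaves T) @ leaves R1 @ drop (Suc a) (leaves T)))[b + nleaves R1 - 1 := corolla (gen R2)] =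
   map Leaf P @ map Leaf (leaves R1) @ (map Leaf Q @ corolla (gen R2) # map Leaf R)"
  using K(2) by (simp add: L(1) K(1) b list_update_append)
 moreover have "two_vertex_tree (gen T) a (gen R1) = Node (gen T) (map Leaf P @ corolla (gen R1) # map Leaf (Q @ y # R))"
  using K(2) by (simp add: two_vertex_tree_def L(1) K(1))
 ultimately have 1: "triple phi T a R1 (b + nleaves R1 - 1) R2 = sg (tdeg R1) * phi ?R"
  unfolding triple_def Let_def
  by (simp only: graft_Node graft_exp_Node graft_around_corolla length_map length_append list.size gen_simps)
   (simp add: o_def sum_list_0, simp add: corolla_def)
 have e: "two_vertex_tree (gen T) b (gen R2) = Node (gen T) (map Leaf (P @ x # Q) @ corolla (gen R2) # map Leaf R)"
  by (simp add: two_vertex_tree_def L(1) K(1) b)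
 have "(map Leaf (take b (leaves T) @ leaves R2 @ drop (Suc b) (leaves T)))[a := corolla (gen R1)] =
   (map Leaf P @ corolla (gen R1) # map Leaf Q) @ map Leaf (leaves R2) @ map Leaf R"
  using K(2) by (simp add: L(1) K(1) b list_update_append)
 then have "triple phi T b R2 a R1 = sg (tdeg R2) * sg ((tdeg R2 + 1) * (tdeg R1 + 1)) * phi ?R"
  unfolding triple_def Let_def e graft_Node graft_exp_Node
  by (simp only: graft_around_corolla length_map length_append list.size gen_simps)
   (simp add: o_def sum_list_0, simp add: corolla_def)
 then show ?thesis unfolding 1 by (auto simp: sg_def)
qed


lemma B_cong:
 assumes "T \<in> trees V" "\<And>S. S \<in> trees V ==> tcell S = tcell T ==> tdeg S = tdeg T + 1 ==>
  \<exists>x ts. S = Node x ts ==> f S = g S"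
 shows "B T f = B T g"
proof (rule fcomb_cong[OF full.B_comb[OF assms(1)] UNIV_I UNIV_I])
 fix S assume S: "S \<in> trees_node V (tcell T) (tdeg T + 1)"
 then have "\<exists>x ts. S = Node x ts" by (intro not_Leaf) (simp add: trees_node_def del: split_paired_All)
 with S show "f S = g S" by (intro assms(2)) (simp_all add: trees_node_def del: split_paired_All)
qed

lemma cut_cong:
 assumes "T \<in> trees V" "\<And>T' p U. (T', p, U) \<in> cuts V T ==> f T' p U = g T' p U"
 shows "cut_sum T f = (cut_sum T g :: 'k)"
proof -
 have "cut_sum T (%a b c. (%(a, b, c). f a b c) (a, b, c)) = cut_sum T (%a b c. (%(a, b, c). g a b c) (a, b, c))"
  by (rule fcomb_cong[OF cut_comb(1)[OF assms(1)] UNIV_I UNIV_I]) (use assms(2) in auto)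
 then show ?thesis by simp
qed

lemma cut_lin:
 assumes "T \<in> trees V" "\<And>T' p U. (T', p, U) \<in> cuts V T ==> h T' p U = a * f T' p U + b * g T' p U"
 shows "cut_sum T h = a * cut_sum T f + b * (cut_sum T g :: 'k)" by (rule comb3_lin[OF cut_comb(1)[OF assms(1)] assms(2)])

text \<open>The square has parts on trees with one, two and three vertices. They vanish because the
  bar differential squares to zero, because it is a coderivation, and because cutting is
  coassociative.\<close>

lemma \<Theta>_square:
 assumes T: "T \<in> trees V" and phi: "phi \<in> Mlin W (tcell T)"
 shows "\<Theta> T (%S. cobar.D S phi) = 0"
proof -
 let ?c = "tcell T"
 define \<Phi> where "\<Phi> S = phi (corolla (gen S))" for S
 define Psi where "Psi T' p U = sg (tdeg T') * phi (two_vertex_tree (gen T') p (gen U))" for T' p U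
 have \<Phi>: "\<Phi> \<in> Mlin V ?c" using gen_Mlin[OF phi] by (simp add: \<Phi>_def[abs_def])
 have "B T (%S. cobar.D (corolla (gen S)) phi) = B T (%S. \<Theta> S phi)" proof (rule B_cong[OF T])
  fix S assume S: "S \<in> trees V" "tcell S = ?c" "\<exists>x ts. S = Node x ts"
  show "cobar.D (corolla (gen S)) phi = \<Theta> S phi"
   using cobar.D_corolla[OF gen_elems[OF S(1,3)]] \<theta>_gen[OF S(1,3)] phi S(2) by simp
 qed
 also have "\<dots> = - 1 * B T (%S. B S \<Phi>) + 1 * B T (%S. cut_sum S Psi)"
  by (rule fcomb_lin[OF full.B_comb[OF T]]) (simp_all add: \<Theta>_def \<Phi>_def[abs_def] Psi_def[abs_def])
 also have "\<dots> = cut_sum T (%T1 p U. B T1 (%S. Psi S p U) + sg (tdeg T1) * B U (%U'. Psi T1 p U'))"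
  using full.B_square(1)[OF T \<Phi>] full.B_cut(1)[OF T, of Psi] by simp
 finally have 1: "B T (%S. cobar.D (corolla (gen S)) phi) =
   cut_sum T (%T1 p U. B T1 (%S. Psi S p U) + sg (tdeg T1) * B U (%U'. Psi T1 p U'))" .
 \<comment> \<open>The derivation acts on the lower or on the upper generator, in each case by the
   bar differential or by another cut. The further cuts give trees with three vertices.\<close>
 have "sg (tdeg T1) * cobar.D (two_vertex_tree (gen T1) p (gen U)) phi =
   1 * (B T1 (%S. Psi S p U) + sg (tdeg T1) * B U (%U'. Psi T1 p U')) +
   1 * (1 * cut_sum T1 (%T0 q R. triple phi T0 q R p U) +
     (- 1) * cut_sum U (%R q U'. triple phi T1 p R (p + q) U'))"
  if cut: "(T1, p, U) \<in> cuts V T" for T1 p U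
 proof -
  note c = cutsD[OF cut]
  have ct: "cut_typed V ?c T1 p U" by (rule cuts_typed[OF cut])
  let ?L = "map Leaf (leaves T1)"
  let ?ts = "?L[p := corolla (gen U)]"
  let ?h = "%R. sg (graft_exp R ?ts) * phi (graft R ?ts)"
  let ?k = "%t. phi (Node (gen T1) (?L[p := t]))"
  have tv: "two_vertex_tree (gen T1) p (gen S) = Node (gen T1) (?L[p := corolla (gen S)])" for S
   using c(6) by (simp add: two_vertex_tree_update)
  have "B T1 (%S. ?h (corolla (gen S))) = - sg (tdeg T1) * B T1 (%S. Psi S p U)"
  proof (rule fcomb_mult[OF full.B_comb[OF c(1)] UNIV_I UNIV_I])
   fix S assume "S \<in> trees_node V (tcell T1) (tdeg T1 + 1)"
   then have S: "leaves S = leaves T1" "tdeg S = tdeg T1 + 1" by (simp_all add: trees_node_def)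
   have "two_vertex_tree (gen S) p (gen U) = Node (gen S) ?ts" using c(6) S(1) by (simp add: two_vertex_tree_update)
   then show "?h (corolla (gen S)) = - sg (tdeg T1) * Psi S p U" using S by (simp add: Psi_def sg_add) (simp add: sg_def)
  qed
  moreover have "cut_sum T1 (%T0 q R. sg (tdeg T0) * ?h (two_vertex_tree (gen T0) q (gen R))) =
    sg (tdeg T1) * cut_sum T1 (%T0 q R. triple phi T0 q R p U) + 0 * cut_sum T1 (%T0 q R. triple phi T0 q R p U)"
  proof (rule cut_lin[OF c(1)])
   fix T0 q R assume "(T0, q, R) \<in> cuts V T1"
   note c' = cutsD[OF this]
   have "sg (tdeg T0) = sg (tdeg T1) * (sg (tdeg R) :: 'k)" using c'(9) by (simp add: sg_add)
   then show "sg (tdeg T0) * ?h (two_vertex_tree (gen T0) q (gen R)) =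
     sg (tdeg T1) * triple phi T0 q R p U + 0 * triple phi T0 q R p U"
    unfolding triple_def Let_def c'(8)[symmetric] by simp
  qed
  ultimately have h: "\<Theta> T1 ?h = sg (tdeg T1) * (B T1 (%S. Psi S p U) + cut_sum T1 (%T0 q R. triple phi T0 q R p U))"
   unfolding \<Theta>_def by (simp add: algebra_simps)
  have "B U (%U'. ?k (corolla (gen U'))) = sg (tdeg T1) * B U (%U'. Psi T1 p U')"
   by (rule fcomb_mult[OF full.B_comb[OF c(2)] UNIV_I UNIV_I]) (simp add: Psi_def tv)
  moreover have "cut_sum U (%R q U'. sg (tdeg R) * ?k (two_vertex_tree (gen R) q (gen U'))) =
    cut_sum U (%R q U'. triple phi T1 p R (p + q) U')"
  proof (rule cut_cong[OF c(2)])
   fix R q U' assume "(R, q, U') \<in> cuts V U"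
   then show "sg (tdeg R) * ?k (two_vertex_tree (gen R) q (gen U')) = triple phi T1 p R (p + q) U'"
    using cutsD(6) by (subst triple_seq[OF c(6)]) blast+
  qed
  ultimately have k: "\<Theta> U ?k = - sg (tdeg T1) * B U (%U'. Psi T1 p U') + cut_sum U (%R q U'. triple phi T1 p R (p + q) U')"
   unfolding \<Theta>_def by simp
  have s: "sg (tdeg T1) * (sg (tdeg T1) * x) = (x :: 'k)" "sg (tdeg T1 + 1) = - (sg (tdeg T1) :: 'k)" "sg (1 + tdeg T1) = - (sg (tdeg T1) :: 'k)" for x
   by (simp_all add: sg_def)
  show ?thesis unfolding D_two_vertex[OF ct phi] h k by (simp add: algebra_simps s)
 qed
 from cut_lin[OF T this]
 have "cut_sum T (%T' p U. sg (tdeg T') * cobar.D (two_vertex_tree (gen T') p (gen U)) phi) =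
   1 * cut_sum T (%T1 p U. B T1 (%S. Psi S p U) + sg (tdeg T1) * B U (%U'. Psi T1 p U')) +
   1 * cut_sum T (%T1 p U. 1 * cut_sum T1 (%T0 q R. triple phi T0 q R p U) +
     (- 1) * cut_sum U (%R q U'. triple phi T1 p R (p + q) U'))" .
 moreover have "cut_sum T (%T1 p U. 1 * cut_sum T1 (%T0 q R. triple phi T0 q R p U) +
   (- 1) * cut_sum U (%R q U'. triple phi T1 p R (p + q) U')) =
   1 * cut_sum T (%T1 p U. cut_sum T1 (%T0 q R. triple phi T0 q R p U)) +
   (- 1) * cut_sum T (%T1 p U. cut_sum U (%R q U'. triple phi T1 p R (p + q) U'))"
  by (rule cut_lin[OF T refl])
 \<comment> \<open>Here the independent cuts cancel: \<open>triple_par\<close> is the hypothesis of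
   \<open>cut_cut\<close>.\<close>
 moreover have "cut_sum T (%T1 p U. cut_sum T1 (%T0 q R. triple phi T0 q R p U)) =
   cut_sum T (%T1 p U. cut_sum U (%R q U'. triple phi T1 p R (p + q) U'))"
  by (rule cut_cut(1)[OF T, where F="triple phi", OF triple_par])
 ultimately show ?thesis unfolding \<Theta>_def 1 by simp
qed

sublocale cobar: differential_data W \<theta>
proof (intro differential_data.intro differential_data_axioms.intro)
 show "derivation_data W \<theta>" ..
 show "vector_space (scl W)" using vector_space_tscale by simp
 fix x and phi :: "('i, 'e, ('k, 'i, 'e, 'v) tens) dtree => 'k"
 assume x: "x \<in> elems W" and phi: "phi \<in> Mlin W (etop x, ebot x)"
 then have xc: "evec x \<in> cx W (etop x, ebot x) (edeg x)" by (simp add: elems_def)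
 have m: "(%S. cobar.D S phi) \<in> Mlin W (etop x, ebot x)" by (rule cobar.at_Mlin[OF phi])
 show "\<theta> x (%S. cobar.D S phi) = 0"
  unfolding \<theta>_eval[OF x m]
  by (rule fcomb_zero[OF W_cx_comb[OF xc] \<Theta>_Mlin[OF m]]) (use phi in "auto simp: trees_node_def intro!: \<Theta>_square")
qed

lemma cobar_two_cat: "two_cat (objs A) (cobar (bar A \<epsilon>))" using cobar.two_cat_free_obj by (simp add: cobar_bar)

end

section \<open>Linear extension and evaluation of trees\<close>

text \<open>The functional \<open>x\<close> acts on scalar functions. Its value at a function with
  values in a vector space is characterised by composing with linear functionals, which separate
  points; it exists for finite combinations of evaluations by \<open>vec_sum\<close>.\<close>

definition vec :: "('k::field => 'w::ab_group_add => 'w) => (('a => 'k) => 'k) => ('a => 'w) => 'w" where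
 "vec s x g = (THE w. \<forall>l. Vector_Spaces.linear s (*) l \<longrightarrow> l w = x (%T. l (g T)))"

context vector_space
begin

lemma functional_simps:
 assumes "Vector_Spaces.linear scale (*) l"
 shows "l (v + w) = l v + l w" "l (scale r v) = r * l v" "l 0 = 0" "l (v - w) = l v - l w" "l (- v) = - l v"
  "l (sum f J) = (\<Sum>j\<in>J. l (f j))" "l (\<Sum>(a, T)\<leftarrow>L. scale a (g T)) = (\<Sum>(a, T)\<leftarrow>L. a * l (g T))"
proof -
 interpret l: Vector_Spaces.linear scale "(*)" l by fact
 show "l (v + w) = l v + l w" "l (scale r v) = r * l v" "l 0 = 0" "l (v - w) = l v - l w" "l (- v) = - l v"
  "l (sum f J) = (\<Sum>j\<in>J. l (f j))" by (rule l.add l.scale l.zero l.diff l.neg l.sum)+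
 show "l (\<Sum>(a, T)\<leftarrow>L. scale a (g T)) = (\<Sum>(a, T)\<leftarrow>L. a * l (g T))"
  by (induction L) (auto simp: l.add l.scale l.zero)
qed

lemma functionals_separate:
 assumes "\<And>l. Vector_Spaces.linear scale (*) l ==> l v = l w"
 shows "v = w"
proof (rule ccontr)
 interpret K: vector_space "(*) :: 'a => 'a => 'a" by unfold_locales (simp_all add: algebra_simps)
 interpret P: vector_space_pair scale "(*) :: 'a => 'a => 'a" ..
 assume "v \<noteq> w"
 then obtain l where "Vector_Spaces.linear scale (*) l" "l (v - w) = 1"
  using P.linear_independent_extend[of "{v - w}" "%_. 1"] by auto
 then show False using assms[of l] by (simp add: functional_simps)
qed

lemma vec_sum:
 assumes "\<And>phi. phi \<in> F ==> x phi = (\<Sum>(a, T)\<leftarrow>L. a * phi T)"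
  and "\<And>l. Vector_Spaces.linear scale (*) l ==> (%T. l (g T)) \<in> F"
 shows "vec scale x g = (\<Sum>(a, T)\<leftarrow>L. scale a (g T))"
 unfolding vec_def
proof (rule the_equality)
 show 1: "\<forall>l. Vector_Spaces.linear scale (*) l \<longrightarrow> l (\<Sum>(a, T)\<leftarrow>L. scale a (g T)) = x (%T. l (g T))"
  using assms by (simp add: functional_simps)
 show "w = (\<Sum>(a, T)\<leftarrow>L. scale a (g T))"
  if "\<forall>l. Vector_Spaces.linear scale (*) l \<longrightarrow> l w = x (%T. l (g T))" for w
 proof (rule functionals_separate)
  fix l assume "Vector_Spaces.linear scale (*) l"
  then show "l w = l (\<Sum>(a, T)\<leftarrow>L. scale a (g T))" using spec[OF 1, of l] spec[OF that, of l] by metis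
 qed
qed

lemma vec_mem_apply:
 assumes x: "fcomb S F x" and U: "subspace U" "\<And>T. T \<in> S ==> g T \<in> U"
  and F: "\<And>l. Vector_Spaces.linear scale (*) l ==> (%T. l (g T)) \<in> F"
 shows "vec scale x g \<in> U"
  and "(\<And>a b v w. v \<in> U ==> w \<in> U ==> f (scale a v + scale b w) = a * f v + b * f w) ==>
   \<Phi> \<in> F ==> (\<And>T. T \<in> S ==> f (g T) = \<Phi> T) ==> f (vec scale x g) = x \<Phi>"
proof -
 obtain L where L: "\<And>a s. (a, s) \<in> set L ==> s \<in> S" "\<And>phi. phi \<in> F ==> x phi = (\<Sum>(a, s)\<leftarrow>L. a * phi s)"
  using x by (rule fcombE) blast
 have v: "vec scale x g = (\<Sum>(a, T)\<leftarrow>L. scale a (g T))" by (rule vec_sum[OF L(2) F])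
 have s: "(\<Sum>(a, T)\<leftarrow>M. scale a (g T)) \<in> U" if "set M \<subseteq> set L" for M
  using that L(1) by (induction M) (auto intro!: subspace_add[OF U(1)] subspace_scale[OF U(1)] U(2) simp: subspace_0[OF U(1)])
 show "vec scale x g \<in> U" using s v by simp
 assume f: "\<And>a b v w. v \<in> U ==> w \<in> U ==> f (scale a v + scale b w) = a * f v + b * f w" and m: "\<Phi> \<in> F" "\<And>T. T \<in> S ==> f (g T) = \<Phi> T"
 have "f (\<Sum>(a, T)\<leftarrow>M. scale a (g T)) = (\<Sum>(a, T)\<leftarrow>M. a * \<Phi> T)" if "set M \<subseteq> set L" for M
  using that
 proof (induction M)
  case Nil
  then show ?case using f[of 0 0 0 0] subspace_0[OF U(1)] by simp
 next
  case (Cons p M)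
  obtain a T where p: "p = (a, T)" by (cases p)
  have "g T \<in> U" "f (g T) = \<Phi> T" using Cons.prems L(1) U(2) m(2) by (auto simp: p)
  then show ?case using Cons f[of "g T" "\<Sum>(a, T)\<leftarrow>M. scale a (g T)" a 1] s[of M] by (simp add: p)
 qed
 then show "f (vec scale x g) = x \<Phi>" using L(2)[OF m(1)] v by simp
qed

lemma vec_functional:
 assumes "fcomb S F x" "\<And>l. Vector_Spaces.linear scale (*) l ==> (%T. l (g T)) \<in> F"
  and "Vector_Spaces.linear scale (*) l"
 shows "l (vec scale x g) = x (%T. l (g T))" by (rule vec_mem_apply(2)[OF assms(1) subspace_UNIV _ assms(2)])
  (use assms in "auto simp: functional_simps")

end

section \<open>Evaluation of decorated trees in an object of 2-Cat\<close>

primrec decs :: "('i, 'e, 'v) dtree => ('i, 'e, 'v) el set" where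
 "decs (Leaf a) = {}"
| "decs (Node x ts) = insert x (\<Union> (set (map decs ts)))"

definition transE :: "(('i, 'e) arr => ('i, 'f) arr) => (('i, 'e, 'v) el => 'w) => ('i, 'e, 'v) el => ('i, 'f, 'w) el" where
 "transE m K x = El (map m (etop x)) (m (ebot x)) (edeg x) (K x)"

primrec evE :: "('k, 'i, 'f, 'w) twocat => (('i, 'e) arr => ('i, 'f) arr) => (('i, 'e, 'v) el => 'w) =>
  ('i, 'e, 'v) dtree => ('i, 'f, 'w) el" where
 "evE X m K (Leaf a) = idE X (m a)"
| "evE X m K (Node x ts) = compE X (transE m K x) (map (evE X m K) ts)"

lemma transE_simps [simp]: "etop (transE m K x) = map m (etop x)" "ebot (transE m K x) = m (ebot x)"
 "edeg (transE m K x) = edeg x" "evec (transE m K x) = K x" by (simp_all add: transE_def)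

lemma evE_cong: "(\<And>x. x \<in> decs T ==> K x = K' x) ==> evE X m K T = evE X m K' T"
proof (induction T)
 case (Node x ts)
 have e: "map (evE X m K) ts = map (evE X m K') ts" using Node by (intro map_cong refl) auto
 show ?case unfolding evE.simps e using Node.prems[of x] by (simp add: transE_def)
qed simp

lemma evE_simps [simp]: "etop (evE X m K T) = map m (leaves T)" "ebot (evE X m K T) = m (root T)"
 "edeg (evE X m K T) = tdeg T"
proof (induction T)
 case (Node x ts)
 have "map (etop \<circ> evE X m K) ts = map (map m \<circ> leaves) ts" "map (edeg \<circ> evE X m K) ts = map tdeg ts"
  using Node by simp_all
 then show "etop (evE X m K (Node x ts)) = map m (leaves (Node x ts))" "edeg (evE X m K (Node x ts)) = tdeg (Node x ts)"
  by (simp_all only: evE.simps compE_simps transE_simps map_map leaves.simps tdeg.simps map_concat)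
qed (simp_all add: idE_def)

lemma map_evE [simp]: "etop \<circ> evE X m K = map m \<circ> leaves" "ebot \<circ> evE X m K = m \<circ> root" "edeg \<circ> evE X m K = tdeg"
 by (simp_all add: fun_eq_iff)

lemma blocks_roots:
 "map root ts = fleaves us ==> list_all2 (%u b. map root b = leaves u) us (blocks (map (length \<circ> leaves) us) ts)"
proof (induction us arbitrary: ts)
 case (Cons u us)
 have "map root (take (nleaves u) ts) = leaves u" "map root (drop (nleaves u) ts) = fleaves us"
  using Cons.prems by (simp_all add: take_map[symmetric] drop_map[symmetric])
 with Cons.IH show ?case by simp
qed simp

locale evaluation = X: two_category I X
 for I :: "'i set" and X :: "('k::field, 'i, 'f, 'w::ab_group_add) twocat" +
 fixes V :: "('k, 'i, 'e, 'v::ab_group_add) coll" and m :: "('i, 'e) arr => ('i, 'f) arr"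
  and K :: "('i, 'e, 'v) el => 'w"
 assumes m_Leaf: "Leaf e \<in> trees V ==> Leaf (m e) \<in> trees X"
  and m_cells: "(s, t) \<in> cells V ==> (map m s, m t) \<in> cells X"
  and K_mem: "x \<in> elems V ==> K x \<in> cx X (map m (etop x), m (ebot x)) (edeg x)"
  and K_lin: "El s t n v \<in> elems V ==> El s t n w \<in> elems V ==> El s t n (scl V a v + scl V b w) \<in> elems V ==>
   K (El s t n (scl V a v + scl V b w)) = scl X a (K (El s t n v)) + scl X b (K (El s t n w))"
begin

abbreviation "KE \<equiv> transE m K"
abbreviation "E \<equiv> evE X m K"
abbreviation "ev T \<equiv> evec (E T)"
abbreviation "mc c \<equiv> (map m (fst c), m (snd c))"

lemma KE_elems: "x \<in> elems V ==> KE x \<in> elems X" using K_mem[of x] m_cells[of "etop x" "ebot x"] by (simp add: elems_def)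

lemma E_elems: "T \<in> trees V ==> E T \<in> elems X"
proof (induction rule: trees.induct)
 case (leaf i j a)
 then have "Leaf a \<in> trees V" by (rule trees.leaf)
 from X.idE_Leaf(1)[OF m_Leaf[OF this]] show ?case by simp
next
 case (node x ts)
 have "map (m \<circ> root) ts = map m (etop x)" using arg_cong[OF \<open>map root ts = etop x\<close>, of "map m"] by simp
 then show ?case using node KE_elems by (auto intro!: X.compE_elems simp: composable_def)
qed

lemma E_mem: "T \<in> trees V ==> ev T \<in> cx X (mc (tcell T)) (tdeg T)" using E_elems[of T] by (simp add: elems_def)

lemma composable_E:
 assumes "x \<in> elems X" "set ts \<subseteq> trees V" "etop x = map m (map root ts)"
 shows "composable X x (map E ts)" using assms E_elems by (auto simp: composable_def)

lemma E_El: "E T = El (map m (leaves T)) (m (root T)) (tdeg T) (ev T)" by (intro el.expand) simp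

lemma E_lin: "tree_lin (scl V) a b t1 t2 t3 ==> t1 \<in> trees V ==> t2 \<in> trees V ==> t3 \<in> trees V ==>
  ev t3 = scl X a (ev t1) + scl X b (ev t2)"
proof (induction rule: tree_lin.induct)
 case (here p q n v ts w)
 have ts: "set ts \<subseteq> trees V" "map root ts = p" "El p q n v \<in> elems V" "El p q n w \<in> elems V"
   "El p q n (scl V a v + scl V b w) \<in> elems V" using here.prems by simp_all
 have c: "composable X (KE x) (map E ts)" if "x \<in> elems V" "etop x = p" for x
  using that ts(1,2) by (intro composable_E KE_elems) simp_all
 note l = X.comp_lin1[OF c[OF ts(3), unfolded transE_def, simplified el.sel] c[OF ts(4), unfolded transE_def, simplified el.sel]]
 show ?case using l[of a b] K_lin[OF ts(3-5)] by (simp add: transE_def)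
next
 case (below t1 t2 t3 x l r)
 note same = tree_lin_same[OF below.hyps]
 have mem: "x \<in> elems V" "set l \<subseteq> trees V" "set r \<subseteq> trees V" "t1 \<in> trees V" "t2 \<in> trees V" "t3 \<in> trees V"
   "map root l @ root t1 # map root r = etop x" using below.prems by auto
 have c: "composable X (KE x) (map E l @ E t # map E r)" if "t \<in> {t1, t2}" for t proof -
  have t: "root t = root t1" "t \<in> trees V" using that same mem(4,5) by auto
  have "composable X (KE x) (map E (l @ t # r))"
   by (rule composable_E[OF KE_elems[OF mem(1)]]) (use mem(2,3) t in "simp_all flip: mem(7)")
  then show ?thesis by simp
 qed
 let ?L = "%v. El (map m (leaves t1)) (m (root t1)) (tdeg t1) v"
 have e: "?L (ev t1) = E t1" "?L (ev t2) = E t2" "E t3 = ?L (scl X a (ev t1) + scl X b (ev t2))"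
  using E_El[of t1] E_El[of t2] E_El[of t3] same below.IH[OF mem(4-6)] by simp_all
 have "opcomp X (KE x) (map E l @ ?L (scl X a (ev t1) + scl X b (ev t2)) # map E r) =
   scl X a (opcomp X (KE x) (map E l @ ?L (ev t1) # map E r)) +
   scl X b (opcomp X (KE x) (map E l @ ?L (ev t2) # map E r))" by (rule X.comp_lin2; unfold e(1,2); rule c; simp)
 from this[folded e(3), unfolded e(1,2)] show ?case by (simp only: evE.simps compE_simps map_append list.map)
qed

text \<open>\<open>f\<close> receives the degree as well, because an element of \<open>X\<close> is
  formed from a cell, a degree and a vector, and the trees at one cell have various degrees.\<close>

lemma ev_Mlin:
 assumes "\<And>n a b v w. v \<in> cx X (mc c) n ==> w \<in> cx X (mc c) n ==> f n (scl X a v + scl X b w) = a * f n v + b * f n w"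
 shows "(%T. f (tdeg T) (ev T)) \<in> Mlin V c"
proof (rule Mlin_I)
 fix a b t1 t2 t3
 assume *: "tree_lin (scl V) a b t1 t2 t3" "t1 \<in> trees V" "t2 \<in> trees V" "t3 \<in> trees V" "tcell t1 = c"
  "tcell t2 = c" "tcell t3 = c"
 have d: "tdeg t2 = tdeg t1" "tdeg t3 = tdeg t1" using tree_lin_same[OF *(1)] by simp_all
 show "f (tdeg t3) (ev t3) = a * f (tdeg t1) (ev t1) + b * f (tdeg t2) (ev t2)"
  using assms[of "ev t1" "tdeg t1" "ev t2" a b] E_mem[OF *(2)] E_mem[OF *(3)] E_lin[OF *(1-4)] d *(5,6) by simp
qed

lemma functional_ev_Mlin: "Vector_Spaces.linear (scl X) (*) l ==> (%T. l (ev T)) \<in> Mlin V c"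
 by (rule ev_Mlin) (simp add: X.functional_simps)

lemma vec_ev:
 assumes "fcomb (trdeg V c n) (Mlin V c) x" "c \<in> cells V"
 shows "vec (scl X) x ev \<in> cx X (mc c) n"
  and "(\<And>n a b v w. v \<in> cx X (mc c) n ==> w \<in> cx X (mc c) n ==> f n (scl X a v + scl X b w) = a * f n v + b * f n w) ==>
   f n (vec (scl X) x ev) = x (%T. f (tdeg T) (ev T))"
  and "Vector_Spaces.linear (scl X) (*) l ==> l (vec (scl X) x ev) = x (%T. l (ev T))"
proof -
 have c: "mc c \<in> cells X" using m_cells[of "fst c" "snd c"] assms(2) by simp
 have g: "ev T \<in> cx X (mc c) n" if "T \<in> trdeg V c n" for T using that E_mem[of T] by auto
 note v = X.vec_mem_apply[OF assms(1) X.cx_subspace[OF c], where g="ev", OF g functional_ev_Mlin]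
 show "vec (scl X) x ev \<in> cx X (mc c) n" by (rule v(1))
 assume f: "\<And>n a b v w. v \<in> cx X (mc c) n ==> w \<in> cx X (mc c) n ==> f n (scl X a v + scl X b w) = a * f n v + b * f n w"
 have "(%T. f (tdeg T) (ev T)) \<in> Mlin V c" by (rule ev_Mlin) (rule f)
 then show "f n (vec (scl X) x ev) = x (%T. f (tdeg T) (ev T))" by (intro v(2)[where f="f n"] f) auto
next
 assume "Vector_Spaces.linear (scl X) (*) l"
 then show "l (vec (scl X) x ev) = x (%T. l (ev T))"
  using X.vec_functional[OF assms(1), where g="ev"] functional_ev_Mlin by blast
qed


definition scaleE :: "'k => ('i, 'f, 'w) el => ('i, 'f, 'w) el" where
 "scaleE r y = El (etop y) (ebot y) (edeg y) (scl X r (evec y))"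

lemma scaleE_simps [simp]: "etop (scaleE r y) = etop y" "ebot (scaleE r y) = ebot y" "edeg (scaleE r y) = edeg y"
 "evec (scaleE r y) = scl X r (evec y)" by (simp_all add: scaleE_def)

lemma scaleE_elems: "y \<in> elems X ==> scaleE r y \<in> elems X"
 using X.cx_subspace[of "(etop y, ebot y)" "edeg y"] by (simp add: elems_def X.subspace_scale)

lemma comp_scaleE:
 assumes "composable X x (as @ y # bs)"
 shows "opcomp X x (as @ scaleE r y # bs) = scl X r (opcomp X x (as @ y # bs))"
 using X.comp_lin2[of x as "etop y" "ebot y" "edeg y" "evec y" bs "evec y" r 0] assms by (simp add: scaleE_def)

lemma comp_scale_list:
 "length rs = length ys ==> composable X x (as @ ys) ==>
 opcomp X x (as @ map2 scaleE rs ys) = scl X (prod_list rs) (opcomp X x (as @ ys))"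
proof (induction rs ys arbitrary: as rule: list_induct2)
 case (Cons r rs y ys)
 have "composable X x ((as @ [scaleE r y]) @ ys)" using Cons.prems scaleE_elems[of y r] by (auto simp: composable_def)
 from Cons.IH[OF this] show ?case using comp_scaleE[OF Cons.prems, of r] by (simp add: mult.commute)
qed simp

text \<open>Evaluation turns grafting into composition. At a vertex, associativity in
  \<open>X\<close> contributes the sign of sorting the blocks of \<open>ts\<close>, and the subtrees
  contribute theirs by induction; together this is \<open>graft_exp\<close>.\<close>

lemma E_graft:
 "T \<in> trees V ==> set ts \<subseteq> trees V ==> map root ts = leaves T ==>
 opcomp X (E T) (map E ts) = scl X (sg (graft_exp T ts)) (ev (graft T ts))"
proof (induction T arbitrary: ts)
 case (Leaf a)
 then obtain t where t: "ts = [t]" "root t = a" "t \<in> trees V" by auto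
 then show ?case using X.comp_unit(2)[OF E_elems[OF t(3)]] by simp
next
 case (Node x us)
 let ?bs = "blocks (map (length \<circ> leaves) us) ts"
 have x: "x \<in> elems V" "set us \<subseteq> trees V" "map root us = etop x" "map root ts = fleaves us"
  using Node.prems by simp_all
 have len: "length ts = length (fleaves us)" using arg_cong[OF x(4), of length] by simp
 then have cb: "concat ?bs = ts" by (intro concat_blocks) (simp add: length_concat o_def)
 have la: "list_all2 (%u b. map root b = leaves u) us ?bs" by (rule blocks_roots[OF x(4)])
 have ub: "us ! i \<in> trees V" "us ! i \<in> set us" "set (?bs ! i) \<subseteq> trees V" "map root (?bs ! i) = leaves (us ! i)" "i < length ?bs"
  if "i < length us" for i
 proof -
  show "us ! i \<in> trees V" "us ! i \<in> set us" using that x(2) by (auto dest: nth_mem)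
  show "map root (?bs ! i) = leaves (us ! i)" "i < length ?bs" using la that by (simp_all add: list_all2_conv_all_nth)
  then have "?bs ! i \<in> set ?bs" by (intro nth_mem)
  then have "set (?bs ! i) \<subseteq> set (concat ?bs)" by auto
  then show "set (?bs ! i) \<subseteq> trees V" using Node.prems(2) cb by auto
 qed
 have gf: "fgraft us ts = map2 graft us ?bs" by (rule fgraft_blocks)
 have c: "composable X (KE x) (map E us)" using x by (intro composable_E KE_elems) simp_all
 have c2: "list_all2 (composable X) (map E us) (map (map E) ?bs)"
  unfolding list_all2_conv_all_nth using ub by (auto intro!: composable_E E_elems)
 have m: "map2 (compE X) (map E us) (map (map E) ?bs) =
   map2 scaleE (map sg (map2 graft_exp us ?bs)) (map E (fgraft us ts))"
 proof (rule nth_equalityI)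
  fix i assume "i < length (map2 (compE X) (map E us) (map (map E) ?bs))"
  then have i: "i < length us" by simp
  note u = ub[OF i]
  have l: "length (?bs ! i) = nleaves (us ! i)" using arg_cong[OF u(4), of length] by simp
  have "compE X (E (us ! i)) (map E (?bs ! i)) =
    scaleE (sg (graft_exp (us ! i) (?bs ! i))) (E (graft (us ! i) (?bs ! i)))"
   by (intro el.expand) (use Node.IH[OF u(2,1,3,4)] l u(4) in "simp_all add: map_concat")
  then show "map2 (compE X) (map E us) (map (map E) ?bs) ! i =
   map2 scaleE (map sg (map2 graft_exp us ?bs)) (map E (fgraft us ts)) ! i" using i u(5) by (simp add: gf)
 qed (simp add: gf)
 have gt: "set (fgraft us ts) \<subseteq> trees V" "map root (fgraft us ts) = etop x"
  using graft_trees(1)[OF Node.prems] Node.prems(3) by simp_all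
 have c3: "composable X (KE x) ([] @ map E (fgraft us ts))" using x(1) gt by (simp add: composable_E KE_elems)
 have "opcomp X (E (Node x us)) (map E ts) = opcomp X (compE X (KE x) (map E us)) (concat (map (map E) ?bs))"
  by (simp add: cb flip: map_concat)
 also have "\<dots> = scl X (shuffle_sign (map edeg (map E us)) (map (sum_list \<circ> map edeg) (map (map E) ?bs)))
   (opcomp X (KE x) (map2 scaleE (map sg (map2 graft_exp us ?bs)) (map E (fgraft us ts))))"
  unfolding X.comp_assoc[OF c c2] m ..
 also have "opcomp X (KE x) (map2 scaleE (map sg (map2 graft_exp us ?bs)) (map E (fgraft us ts))) =
   scl X (prod_list (map sg (map2 graft_exp us ?bs))) (opcomp X (KE x) (map E (fgraft us ts)))"
  using comp_scale_list[OF _ c3, of "map sg (map2 graft_exp us ?bs)"] by (simp add: gf)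
 also have "prod_list (map sg (map2 graft_exp us ?bs)) = (sg (sum_list (map2 graft_exp us ?bs)) :: 'k)"
  using prod_list_sg[of id] by (simp del: map_map)
 finally show ?case using fgraft_exp_blocks[of us ts] by (simp add: sg_add shuffle_sign_exp o_def)
qed

end

lemma (in evaluation) vec_ev_apply:
 assumes "fcomb (trdeg V c n) (Mlin V c) x" "c \<in> cells V"
  and f: "\<And>n a b v w. v \<in> cx X (mc c) n ==> w \<in> cx X (mc c) n ==> f n (scl X a v + scl X b w) = a * f n v + b * f n w"
  and e: "\<And>T. T \<in> trees V ==> tcell T = c ==> f (tdeg T) (ev T) = Psi T"
 shows "f n (vec (scl X) x ev) = x Psi" "Psi \<in> Mlin V c"
proof -
 have m: "(%T. f (tdeg T) (ev T)) \<in> Mlin V c" by (rule ev_Mlin) (rule f)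
 then show Psi: "Psi \<in> Mlin V c" using Mlin_cong[of V c "%T. f (tdeg T) (ev T)" Psi] e by blast
 have "f n (vec (scl X) x ev) = x (%T. f (tdeg T) (ev T))" by (rule vec_ev(2)[OF assms(1,2), where f=f]) (rule f)
 also have "\<dots> = x Psi" proof (rule fcomb_cong[OF assms(1) m Psi])
  fix T assume "T \<in> trdeg V c n"
  then show "f (tdeg T) (ev T) = Psi T" by (intro e) simp_all
 qed
 finally show "f n (vec (scl X) x ev) = x Psi" .
qed

locale free_evaluation = evaluation I X V m K + derivation_data V \<theta>
 for I :: "'i set" and X :: "('k::field, 'i, 'f, 'w::ab_group_add) twocat" and
  V :: "('k, 'i, 'e, 'v::ab_group_add) coll" and m :: "('i, 'e) arr => ('i, 'f) arr"
  and K :: "('i, 'e, 'v) el => 'w" and \<theta> :: "('i, 'e, 'v) el => ('k, 'i, 'e, 'v) tens"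
begin

text \<open>Compatibility with the differentials is asked only for the decorations of
  \<open>T\<close>. In the recursion for the lift it is known just on a stage of the filtration, and
  the lemma is applied to trees decorated from that stage.\<close>

lemma E_diff:
 "T \<in> trees V ==> (\<And>x. x \<in> decs T ==> diff X (KE x) = vec (scl X) (\<theta> x) ev) ==>
  diff X (E T) = vec (scl X) (D T) ev"
proof (induction T)
 case (Leaf a)
 have "vec (scl X) (D (Leaf a)) ev = 0" by (rule X.functionals_separate, subst vec_ev(3)[OF at_comb[OF Leaf(1)]])
   (use Leaf_cells[OF Leaf(1)] in "auto simp: X.functional_simps")
 then show ?case using X.idE_Leaf(2)[OF m_Leaf[OF Leaf(1)]] by simp
next
 case (Node x ts)
 have x: "x \<in> elems V" "set ts \<subseteq> trees V" "map root ts = etop x" using Node.prems(1) by simp_all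
 have dx: "diff X (KE x) = vec (scl X) (\<theta> x) ev" by (rule Node.prems(2)) simp
 have c: "composable X (KE x) (map E ts)" using x by (intro composable_E KE_elems) simp_all
 have xc: "(etop x, ebot x) \<in> cells V" using x(1) by (simp add: elems_def)
 show ?case proof (rule X.functionals_separate)
  fix l assume l: "Vector_Spaces.linear (scl X) (*) l"
  define phi where "phi T = l (ev T)" for T
  have 1: "l (opcomp X (dE X (KE x)) (map E ts)) = insert_at \<theta> x ts phi" proof -
   let ?f = "%n v. l (opcomp X (El (map m (etop x)) (m (ebot x)) n v) (map E ts))"
   have "l (opcomp X (dE X (KE x)) (map E ts)) = ?f (edeg x + 1) (vec (scl X) (\<theta> x) ev)" by (simp add: dE_def dx)
   also have "\<dots> = \<theta> x (%T. sg (graft_exp T ts) * phi (graft T ts))"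
   proof (rule vec_ev_apply(1)[OF \<theta>_comb[OF x(1)] xc, where f="?f"])
    fix n a b v w
    assume *: "v \<in> cx X (mc (etop x, ebot x)) n" "w \<in> cx X (mc (etop x, ebot x)) n"
    have "composable X (El (map m (etop x)) (m (ebot x)) n u) (map E ts)" if "u \<in> cx X (mc (etop x, ebot x)) n" for u
     using that m_cells[OF xc] x(2,3) by (intro composable_E) (simp_all add: elems_def)
    from X.comp_lin1[OF this[OF *(1)] this[OF *(2)]]
    show "?f n (scl X a v + scl X b w) = a * ?f n v + b * ?f n w" by (simp add: X.functional_simps[OF l])
   next
    fix T assume T: "T \<in> trees V" "tcell T = (etop x, ebot x)"
    then have "El (map m (etop x)) (m (ebot x)) (tdeg T) (ev T) = E T" using E_El[of T] by simp
    then show "?f (tdeg T) (ev T) = sg (graft_exp T ts) * phi (graft T ts)"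
     using T E_graft[of T ts] x by (simp add: phi_def X.functional_simps[OF l])
   qed
   finally show ?thesis by (simp add: insert_at_exp)
  qed
  have 2: "l (opcomp X (KE x) ((map E ts)[i := dE X (map E ts ! i)])) = D (ts ! i) (%T. phi (Node x (ts[i := T])))"
   if i: "i < length ts" for i
  proof -
   let ?t = "ts ! i"
   have t: "?t \<in> trees V" "?t \<in> set ts" using i x(2) by auto
   have dt: "diff X (E ?t) = vec (scl X) (D ?t) ev" by (rule Node.IH[OF t(2,1)]) (use t Node.prems(2) in auto)
   let ?f = "%n v. l (opcomp X (KE x) ((map E ts)[i := El (map m (leaves ?t)) (m (root ?t)) n v]))"
   have "l (opcomp X (KE x) ((map E ts)[i := dE X (map E ts ! i)])) = ?f (tdeg ?t + 1) (vec (scl X) (D ?t) ev)"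
    using i by (simp add: dE_def dt)
   also have "\<dots> = D ?t (%T. phi (Node x (ts[i := T])))"
   proof (rule vec_ev_apply(1)[OF at_comb[OF t(1)] trees_cells[OF t(1)], where f="?f"])
    fix n a b v w
    assume *: "v \<in> cx X (mc (tcell ?t)) n" "w \<in> cx X (mc (tcell ?t)) n"
    let ?g = "%u. take i (map E ts) @ El (map m (leaves ?t)) (m (root ?t)) n u # drop (Suc i) (map E ts)"
    have up: "(map E ts)[i := El (map m (leaves ?t)) (m (root ?t)) n u] = ?g u" for u
     using i by (simp add: upd_conv_take_nth_drop)
    have "composable X (KE x) (?g u)" if "u \<in> cx X (mc (tcell ?t)) n" for u proof -
     have e: "El (map m (leaves ?t)) (m (root ?t)) n u \<in> elems X"
      using that m_cells[OF trees_cells[OF t(1)]] by (simp add: elems_def)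
     have "map ebot ((map E ts)[i := El (map m (leaves ?t)) (m (root ?t)) n u]) = map ebot (map E ts)"
      using i by (simp add: map_update list_update_same_conv)
     moreover have "set ((map E ts)[i := El (map m (leaves ?t)) (m (root ?t)) n u]) \<subseteq> elems X"
      using c e by (intro set_update_subsetI) (simp_all add: composable_def)
     ultimately show ?thesis using c unfolding up composable_def by simp
    qed
    from X.comp_lin2[OF this[OF *(1)] this[OF *(2)]]
    show "?f n (scl X a v + scl X b w) = a * ?f n v + b * ?f n w" unfolding up by (simp add: X.functional_simps[OF l])
   next
    fix T assume "T \<in> trees V" "tcell T = tcell ?t"
    then have "El (map m (leaves ?t)) (m (root ?t)) (tdeg T) (ev T) = E T" using E_El[of T] by simp
    then show "?f (tdeg T) (ev T) = phi (Node x (ts[i := T]))" by (simp add: phi_def map_update)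
   qed
   finally show ?thesis .
  qed
  have "l (diff X (E (Node x ts))) = insert_at \<theta> x ts phi +
    (\<Sum>i<length ts. sg (edeg x + sum_list (map tdeg (take i ts))) * D (ts ! i) (%T. phi (Node x (ts[i := T]))))"
   using X.comp_Leibniz[OF c] 1 2 by (simp add: X.functional_simps[OF l] take_map)
  also have "\<dots> = D (Node x ts) phi" unfolding at_vertices.simps(2) by simp
  also have "\<dots> = l (vec (scl X) (D (Node x ts)) ev)"
   unfolding vec_ev(3)[OF at_comb[OF Node.prems(1)] trees_cells[OF Node.prems(1)] l] by (simp add: phi_def[abs_def])
  finally show "l (diff X (E (Node x ts))) = l (vec (scl X) (D (Node x ts)) ev)" .
 qed
qed

end

section \<open>Morphisms out of the free object\<close>

lemma FMlin_cong:
 assumes "\<And>ts. ts \<in> forests V cs ==> phi ts = psi ts"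
 shows "phi \<in> FMlin V cs \<longleftrightarrow> psi \<in> FMlin V cs" unfolding FMlin_def using assms by simp

locale free_morphism = free_evaluation I X V m K \<theta> + differential_data V \<theta>
 for I :: "'i set" and X :: "('k::field, 'i, 'f, 'w::ab_group_add) twocat" and
  V :: "('k, 'i, 'e, 'v::ab_group_add) coll" and m :: "('i, 'e) arr => ('i, 'f) arr"
  and K :: "('i, 'e, 'v) el => 'w" and \<theta> :: "('i, 'e, 'v) el => ('k, 'i, 'e, 'v) tens" +
 fixes h1 :: "'i => 'i => 'e => 'f"
 assumes m_def: "m = (%(i, e, j). (i, h1 i j e, j))"
  and h1: "i \<in> objs V ==> j \<in> objs V ==> h1 i j ` onemor V i j \<subseteq> onemor X i j"
  and objs_V: "objs V = I"
  and K_diff: "x \<in> elems V ==> diff X (KE x) = vec (scl X) (\<theta> x) ev"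
begin

definition extension where "extension = \<lparr>mor1 = h1, mor2 = (%x. vec (scl X) (evec x) ev)\<rparr>"

lemma marr_extension [simp]: "marr extension = m" unfolding marr_def extension_def mor.simps by (rule m_def[symmetric])

lemma mor2_extension: "mor2 extension x = vec (scl X) (evec x) ev" by (simp add: extension_def)

lemma elems_comb:
 assumes "x \<in> elems F"
 shows "fcomb (trdeg V (el_cell x) (edeg x)) (Mlin V (el_cell x)) (evec x)" "el_cell x \<in> cells V"
 using assms free_cx_fcomb[of "evec x" V "el_cell x" "edeg x"] by (simp_all add: F_elems)

lemma decs_elems: "T \<in> trees V ==> decs T \<subseteq> elems V" by (induction rule: trees.induct) auto

lemma mE_elems: "x \<in> elems F ==> mE extension x \<in> elems X"
 using vec_ev(1)[OF elems_comb] m_cells[of "etop x" "ebot x"] elems_comb(2)[of x]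
 by (simp add: mE_def elems_def[of X] mor2_extension)

lemma mor2_lin:
 assumes "(s, t) \<in> cells V" "v \<in> free_cx V (s, t) n" "w \<in> free_cx V (s, t) n"
 shows "vec (scl X) (tscale a v + tscale b w) ev = scl X a (vec (scl X) v ev) + scl X b (vec (scl X) w ev)"
proof (rule X.functionals_separate)
 fix l assume l: "Vector_Spaces.linear (scl X) (*) l"
 have "l (vec (scl X) u ev) = u (%T. l (ev T))" if "u \<in> free_cx V (s, t) n" for u
  by (rule vec_ev(3)[OF free_cx_fcomb[OF that] assms(1) l])
 with assms(2,3) free_cx_lin[OF assms(2,3)]
 show "l (vec (scl X) (tscale a v + tscale b w) ev) = l (scl X a (vec (scl X) v ev) + scl X b (vec (scl X) w ev))"
  by (simp add: X.functional_simps[OF l] tscale_def)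
qed

lemma mor2_diff:
 assumes x: "x \<in> elems F"
 shows "mor2 extension (dE F x) = diff X (mE extension x)"
proof (rule X.functionals_separate)
 fix l assume l: "Vector_Spaces.linear (scl X) (*) l"
 note fc = elems_comb[OF x]
 let ?f = "%n v. l (diff X (El (map m (etop x)) (m (ebot x)) n v))"
 have lm: "(%T. l (ev T)) \<in> Mlin V (el_cell x)" by (rule functional_ev_Mlin[OF l])
 have "l (diff X (mE extension x)) = ?f (edeg x) (vec (scl X) (evec x) ev)" by (simp add: mE_def mor2_extension)
 also have "\<dots> = evec x (%T. D T (%S. l (ev S)))" proof (rule vec_ev_apply(1)[OF fc, where f="?f"])
  fix n a b v w assume "v \<in> cx X (mc (el_cell x)) n" "w \<in> cx X (mc (el_cell x)) n"
  then show "?f n (scl X a v + scl X b w) = a * ?f n v + b * ?f n w"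
   using m_cells[OF fc(2)] by (subst X.diff_lin) (simp_all add: elems_def X.functional_simps[OF l])
 next
  fix T assume T: "T \<in> trees V" "tcell T = el_cell x"
  then have "El (map m (etop x)) (m (ebot x)) (tdeg T) (ev T) = E T" using E_El[of T] by simp
  moreover have "diff X (E T) = vec (scl X) (D T) ev" by (rule E_diff[OF T(1)]) (use K_diff decs_elems[OF T(1)] in blast)
  ultimately show "?f (tdeg T) (ev T) = D T (%S. l (ev S))"
   using vec_ev(3)[OF at_comb[OF T(1)] trees_cells[OF T(1)] l] by simp
 qed
 also have "\<dots> = l (mor2 extension (dE F x))" proof -
  have "fcomb (trdeg V (el_cell x) (edeg x + 1)) (Mlin V (el_cell x)) (diff F x)"
   using elems_comb(1)[OF dE_elems[OF x]] by (simp add: dE_def)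
  from vec_ev(3)[OF this fc(2) l] show ?thesis using lm by (simp add: mor2_extension dE_def F_diff)
 qed
 finally show "l (mor2 extension (dE F x)) = l (diff X (mE extension x))" by simp
qed

text \<open>The prefix \<open>as\<close> holds the arguments that have already been replaced by
  evaluated trees.\<close>

lemma bind_eval:
 assumes l: "Vector_Spaces.linear (scl X) (*) l"
 shows "set ys \<subseteq> elems F ==> composable X z (as @ map (mE extension) ys) ==>
  l (opcomp X z (as @ map (mE extension) ys)) = bind_list (map evec ys) (%ts. l (opcomp X z (as @ map E ts)))"
proof (induction ys arbitrary: as)
 case (Cons y ys)
 have y: "y \<in> elems F" and ys: "set ys \<subseteq> elems F" using Cons.prems by auto
 note fc = elems_comb[OF y]
 let ?y = "%n v. El (map m (etop y)) (m (ebot y)) n v"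
 let ?f = "%n v. l (opcomp X z (as @ ?y n v # map (mE extension) ys))"
 have c: "composable X z (as @ ?y n v # map (mE extension) ys)" if "v \<in> cx X (mc (el_cell y)) n" for n v proof -
  have "?y n v \<in> elems X" using that m_cells[OF fc(2)] by (simp add: elems_def)
  then show ?thesis using Cons.prems(2) by (simp add: composable_def mE_def[of _ y])
 qed
 have "l (opcomp X z (as @ map (mE extension) (y # ys))) = ?f (edeg y) (vec (scl X) (evec y) ev)"
  by (simp add: mE_def mor2_extension)
 also have "\<dots> = evec y (%t. bind_list (map evec ys) (%ts. l (opcomp X z (as @ map E (t # ts)))))"
 proof (rule vec_ev_apply(1)[OF fc, where f="?f"])
  fix n a b v w assume "v \<in> cx X (mc (el_cell y)) n" "w \<in> cx X (mc (el_cell y)) n"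
  from X.comp_lin2[OF c[OF this(1)] c[OF this(2)]]
  show "?f n (scl X a v + scl X b w) = a * ?f n v + b * ?f n w" by (simp add: X.functional_simps[OF l])
 next
  fix t assume t: "t \<in> trees V" "tcell t = el_cell y"
  then have e: "?y (tdeg t) (ev t) = E t" using E_El[of t] by simp
  have "composable X z ((as @ [E t]) @ map (mE extension) ys)" using c[of "ev t" "tdeg t"] E_mem[OF t(1)] t(2) by (simp add: e)
  from Cons.IH[OF ys this] show "?f (tdeg t) (ev t) = bind_list (map evec ys) (%ts. l (opcomp X z (as @ map E (t # ts))))"
   by (simp add: e)
 qed
 finally show ?case by simp
qed simp

lemma mor2_comp:
 assumes xy: "composable F x ys"
 shows "mor2 extension (compE F x ys) = opcomp X (mE extension x) (map (mE extension) ys)"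
proof (rule X.functionals_separate)
 fix l assume l: "Vector_Spaces.linear (scl X) (*) l"
 note c = composableD[OF xy]
 note fc = elems_comb[OF c(1)]
 let ?phi = "%T. l (ev T)"
 let ?f = "%n v. l (opcomp X (El (map m (etop x)) (m (ebot x)) n v) (map (mE extension) ys))"
 have lm: "?phi \<in> Mlin V c" for c by (rule functional_ev_Mlin[OF l])
 have r: "map m (etop x) = map (m \<circ> ebot) ys" using arg_cong[OF c(3), of "map m"] by simp
 have cp: "composable X (El (map m (etop x)) (m (ebot x)) n v) (map (mE extension) ys)" if "v \<in> cx X (mc (el_cell x)) n" for n v
 proof -
  have "El (map m (etop x)) (m (ebot x)) n v \<in> elems X" using that m_cells[OF fc(2)] by (simp add: elems_def)
  moreover have "set (map (mE extension) ys) \<subseteq> elems X" using c(2) mE_elems by auto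
  ultimately show ?thesis using r by (simp add: composable_def mE_def o_def)
 qed
 have "l (opcomp X (mE extension x) (map (mE extension) ys)) = ?f (edeg x) (vec (scl X) (evec x) ev)"
  by (simp add: mE_def[of _ x] mor2_extension)
 also have "\<dots> = evec x (%T. bind_list (map evec ys) (%ts. sg (graft_exp T ts) * ?phi (graft T ts)))"
 proof (rule vec_ev_apply(1)[OF fc, where f="?f"])
  fix n a b v w assume "v \<in> cx X (mc (el_cell x)) n" "w \<in> cx X (mc (el_cell x)) n"
  from X.comp_lin1[OF cp[OF this(1)] cp[OF this(2)]]
  show "?f n (scl X a v + scl X b w) = a * ?f n v + b * ?f n w" by (simp add: X.functional_simps[OF l])
 next
  fix T assume T: "T \<in> trees V" "tcell T = el_cell x"
  then have e: "El (map m (etop x)) (m (ebot x)) (tdeg T) (ev T) = E T" using E_El[of T] by simp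
  have "composable X (E T) ([] @ map (mE extension) ys)" using cp[of "ev T" "tdeg T"] E_mem[OF T(1)] T(2) by (simp add: e)
  from bind_eval[OF l c(2) this]
  have "?f (tdeg T) (ev T) = bind_list (map evec ys) (%ts. l (opcomp X (E T) (map E ts)))" by (simp add: e)
  also have "\<dots> = bind_list (map evec ys) (%ts. sg (graft_exp T ts) * ?phi (graft T ts))" proof -
   have eq: "l (opcomp X (E T) (map E ts)) = sg (graft_exp T ts) * ?phi (graft T ts)" if "ts \<in> forests V (map el_cell ys)" for ts
   proof -
    have "map root ts = leaves T" using that T(2) c(3) forests_rootD[OF that] by (simp add: o_def)
    then show ?thesis using that E_graft[OF T(1), of ts] by (simp add: forests_def X.functional_simps[OF l])
   qed
   have m: "(%ts. sg (graft_exp T ts) * ?phi (graft T ts)) \<in> FMlin V (map el_cell ys)"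
    using T c(4) by (intro comp_term_FMlin[OF lm, where t="ebot x"]) simp_all
   show ?thesis by (rule fcomb_cong[OF bind_comb[OF c(2)] _ m])
     (use m eq FMlin_cong[of V "map el_cell ys" "%ts. l (opcomp X (E T) (map E ts))" "%ts. sg (graft_exp T ts) * ?phi (graft T ts)"]
      in "auto simp: forests_degs_def")
  qed
  finally show "?f (tdeg T) (ev T) = bind_list (map evec ys) (%ts. sg (graft_exp T ts) * ?phi (graft T ts))" .
 qed
 also have "\<dots> = l (mor2 extension (compE F x ys))"
  using vec_ev(3)[OF elems_comb[OF F_comp_elems[OF xy]] l] lm by (simp add: mor2_extension F_opcomp)
 finally show "l (mor2 extension (compE F x ys)) = l (opcomp X (mE extension x) (map (mE extension) ys))" by simp
qed

lemma vec_ptens: "T \<in> trees V ==> vec (scl X) (ptens V T) ev = ev T"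
proof (rule X.functionals_separate)
 fix l assume T: "T \<in> trees V" and l: "Vector_Spaces.linear (scl X) (*) l"
 have "ptens V T \<in> free_cx V (tcell T) (tdeg T)" using T by (intro ptens_free_cx) simp_all
 from vec_ev(3)[OF free_cx_fcomb[OF this] trees_cells[OF T] l]
 show "l (vec (scl X) (ptens V T) ev) = l (ev T)" using functional_ev_Mlin[OF l] by (simp add: Mlin_ptens)
qed

text \<open>The existence half of the universal property of the free object: linear data on
  generators that commute with the differentials there extend to a morphism.\<close>

theorem extension_is_mor: "is_mor F X extension"
 unfolding is_mor_def
proof (intro conjI ballI allI impI)
 show "objs F = objs X" by (simp add: objs_V X.objs_A)
 show "mor1 extension i j ` onemor F i j \<subseteq> onemor X i j" if "i \<in> objs F" "j \<in> objs F" for i j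
  using h1 that by (simp add: extension_def)
 show "case c of (s, t) => \<forall>n. lin_on (scl F) (scl X) (cx F (s, t) n) (%v. mor2 extension (El s t n v))" if "c \<in> cells F" for c
  using that mor2_lin by (cases c) (auto simp: lin_on_def mor2_extension)
 show "mE extension x \<in> elems X" "mor2 extension (dE F x) = diff X (mE extension x)" if "x \<in> elems F" for x
  using that mE_elems mor2_diff by blast+
 show "mor2 extension (compE F x ys) = opcomp X (mE extension x) (map (mE extension) ys)" if "composable F x ys" for x ys
  by (rule mor2_comp[OF that])
 show "mor2 extension (idE F a) = ident X (marr extension a)" if "i \<in> objs F" "j \<in> objs F" "a \<in> arrows F i j" for i j a
 proof -
  have "Leaf a \<in> trees V" using that by (auto simp: trees_Leaf_iff)
  from vec_ptens[OF this] show ?thesis by (simp add: mor2_extension idE_def)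
 qed
qed

end

section \<open>Pure tensors as composites of generators\<close>

context differential_data
begin

lemma bind_ptens:
 "set ts \<subseteq> trees V ==> psi \<in> FMlin V (map tcell ts) ==> bind_list (map (ptens V) ts) psi = psi ts"
proof (induction ts arbitrary: psi)
 case (Cons t ts)
 have t: "t \<in> trees V" "set ts \<subseteq> trees V" using Cons.prems(1) by auto
 have psi: "psi \<in> FMlin V (tcell t # map tcell ts)" using Cons.prems(2) by simp
 have eq: "bind_list (map (ptens V) ts) (%us. psi (t' # us)) = psi (t' # ts)" if "t' \<in> trees V" "tcell t' = tcell t" for t'
  by (rule Cons.IH[OF t(2)]) (rule FMlin_Cons2[OF psi that])
 have "(%t'. psi (t' # ts)) \<in> Mlin V (tcell t)" using psi t(2) by (intro FMlin_Cons1) (auto simp: forests_def)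
 then have "(%t'. bind_list (map (ptens V) ts) (%us. psi (t' # us))) \<in> Mlin V (tcell t)"
  using Mlin_cong[of V "tcell t" "%t'. bind_list (map (ptens V) ts) (%us. psi (t' # us))" "%t'. psi (t' # ts)"] eq by blast
 then show ?case using eq[OF t(1)] by (simp add: Mlin_ptens[of V t])
qed simp

lemma ptensE_elems: "T \<in> trees V ==> ptensE V T \<in> elems F"
 using trees_cells[of T V] by (simp add: F_elems ptensE_def ptens_free_cx)

lemma corolla_V: "x \<in> elems V ==> corolla x \<in> trees V"
 using cell_Leaf_trees[of "etop x" "ebot x" V] by (auto simp: corolla_def elems_def o_def)

lemma ptensE_simps [simp]: "etop (ptensE V T) = leaves T" "ebot (ptensE V T) = root T" "edeg (ptensE V T) = tdeg T"
 "evec (ptensE V T) = ptens V T" by (simp_all add: ptensE_def)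

lemma ptensE_composable:
 assumes "Node x ts \<in> trees V"
 shows "composable F (ptensE V (corolla x)) (map (ptensE V) ts)"
 using assms ptensE_elems corolla_V by (auto simp: composable_def o_def)

text \<open>By iteration every pure tensor is a composite of corollas and identities, so a morphism
  out of the free object is determined by its values on generators.\<close>

lemma ptensE_Node:
 assumes N: "Node x ts \<in> trees V"
 shows "ptensE V (Node x ts) = compE F (ptensE V (corolla x)) (map (ptensE V) ts)"
proof (rule el.expand)
 have x: "x \<in> elems V" "set ts \<subseteq> trees V" "map root ts = etop x" using N by simp_all
 have len: "length ts = length (etop x)" using arg_cong[OF x(3), of length] by simp
 have "ptens V (Node x ts) = opcomp F (ptensE V (corolla x)) (map (ptensE V) ts)" proof
  fix phi
  let ?c = "(fleaves ts, ebot x)"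
  show "ptens V (Node x ts) phi = opcomp F (ptensE V (corolla x)) (map (ptensE V) ts) phi"
  proof (cases "phi \<in> Mlin V ?c")
   case True
   let ?g = "%T. bind_list (map (ptens V) ts) (%ts. sg (graft_exp T ts) * phi (graft T ts))"
   have "?g \<in> Mlin V (etop x, ebot x)" using bind_term_Mlin[OF ptensE_composable[OF N], of phi] True by (simp add: o_def)
   then have "ptens V (corolla x) ?g = ?g (corolla x)" by (simp add: Mlin_ptens)
   also have "\<dots> = sg (graft_exp (corolla x) ts) * phi (graft (corolla x) ts)"
    by (rule bind_ptens[OF x(2)], rule FMlin_graft) (use True x corolla_V in "auto simp: o_def")
   finally show ?thesis using True len by (simp add: F_opcomp Mlin_ptens o_def)
  next
   case False
   then show ?thesis by (simp add: F_opcomp Mlin_ptens o_def)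
  qed
 qed
 then show "etop (ptensE V (Node x ts)) = etop (compE F (ptensE V (corolla x)) (map (ptensE V) ts)) \<and>
  ebot (ptensE V (Node x ts)) = ebot (compE F (ptensE V (corolla x)) (map (ptensE V) ts)) \<and>
  edeg (ptensE V (Node x ts)) = edeg (compE F (ptensE V (corolla x)) (map (ptensE V) ts)) \<and>
  evec (ptensE V (Node x ts)) = evec (compE F (ptensE V (corolla x)) (map (ptensE V) ts))" by (simp add: o_def)
qed

end

section \<open>Trivial fibrations\<close>

lemma mor_arrows:
 assumes "\<And>i j. i \<in> objs A ==> j \<in> objs A ==> mor1 F i j ` onemor A i j \<subseteq> onemor B i j"
 shows "i \<in> objs A ==> j \<in> objs A ==> a \<in> arrows A i j ==> marr F a \<in> arrows B i j"
 using assms by (fastforce simp: arrows_def marr_def)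

lemma mor_cells:
 assumes "objs A = objs B" "\<And>i j. i \<in> objs A ==> j \<in> objs A ==> mor1 F i j ` onemor A i j \<subseteq> onemor B i j"
 shows "(s, t) \<in> cells A ==> (map (marr F) s, marr F t) \<in> cells B"
proof -
 have p: "is_path B i (map (marr F) s) j" if "is_path A i s j" "i \<in> objs A" for i s j
  using that
 proof (induction s arbitrary: i)
  case (Cons a s)
  then obtain l where l: "l \<in> objs A" "a \<in> arrows A i l" "is_path A l s j" by auto
  have "marr F a \<in> arrows B i l" by (rule mor_arrows[OF assms(2) Cons.prems(2) l(1,2)])
  moreover have "is_path B l (map (marr F) s) j" by (rule Cons.IH[OF l(3,1)])
  ultimately show ?case using l(1) assms(1) by auto
 qed simp
 assume "(s, t) \<in> cells A"
 then obtain i j where ij: "s \<noteq> []" "i \<in> objs A" "j \<in> objs A" "is_path A i s j" "t \<in> arrows A i j"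
  by (auto simp: cells_iff)
 have "marr F t \<in> arrows B i j" by (rule mor_arrows[OF assms(2) ij(2,3,5)])
 then show "(map (marr F) s, marr F t) \<in> cells B" using ij p[OF ij(4,2)] assms(1) by (auto simp: cells_iff)
qed

locale morphism = A: two_category I A + B: two_category I B
 for I :: "'i set" and A :: "('k::field, 'i, 'e, 'v::ab_group_add) twocat"
  and B :: "('k, 'i, 'f, 'w::ab_group_add) twocat" +
 fixes F :: "('i, 'e, 'f, 'v, 'w) mor"
 assumes mor: "is_mor A B F"
begin

lemma mor1_sub: "i \<in> objs A ==> j \<in> objs A ==> mor1 F i j ` onemor A i j \<subseteq> onemor B i j"
 using mor by (simp add: is_mor_def)

lemma objs_eq: "objs A = objs B" by (simp add: A.objs_A B.objs_A)

lemma arrows_mor: "i \<in> I ==> j \<in> I ==> a \<in> arrows A i j ==> marr F a \<in> arrows B i j"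
 using mor_arrows[OF mor1_sub] by (simp add: A.objs_A)

lemma cells_mor: "(s, t) \<in> cells A ==> (map (marr F) s, marr F t) \<in> cells B" by (rule mor_cells[OF objs_eq mor1_sub])

lemma mor_lin: "(s, t) \<in> cells A ==> v \<in> cx A (s, t) n ==> w \<in> cx A (s, t) n ==>
  mor2 F (El s t n (scl A a v + scl A b w)) = scl B a (mor2 F (El s t n v)) + scl B b (mor2 F (El s t n w))"
 using mor by (fastforce simp: is_mor_def lin_on_def)

lemma mE_elems: "x \<in> elems A ==> mE F x \<in> elems B"
 and mor_diff: "x \<in> elems A ==> mor2 F (dE A x) = diff B (mE F x)"
 and mor_comp: "composable A x ys ==> mor2 F (compE A x ys) = opcomp B (mE F x) (map (mE F) ys)"
 and mor_ident: "i \<in> I ==> j \<in> I ==> a \<in> arrows A i j ==> mor2 F (idE A a) = ident B (marr F a)"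
 using mor A.objs_A by (simp_all add: is_mor_def)

lemma mE_simps [simp]: "etop (mE F x) = map (marr F) (etop x)" "ebot (mE F x) = marr F (ebot x)"
 "edeg (mE F x) = edeg x" "evec (mE F x) = mor2 F x" by (simp_all add: mE_def)

lemma mor_mem: "(s, t) \<in> cells A ==> v \<in> cx A (s, t) n ==> mor2 F (El s t n v) \<in> cx B (map (marr F) s, marr F t) n"
 using mE_elems[of "El s t n v"] by (simp add: elems_def)

lemma mE_comp: "composable A x ys ==> mE F (compE A x ys) = compE B (mE F x) (map (mE F) ys)"
proof -
 assume c: "composable A x ys"
 have "map (marr F) (concat (map etop ys)) = concat (map etop (map (mE F) ys))" by (simp add: map_concat o_def)
 with mor_comp[OF c] show ?thesis by (intro el.expand) (simp add: o_def)
qed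

lemma mE_id: "Leaf a \<in> trees A ==> mE F (idE A a) = idE B (marr F a)"
proof -
 assume "Leaf a \<in> trees A"
 then obtain i j where "i \<in> I" "j \<in> I" "a \<in> arrows A i j" unfolding trees_Leaf_iff A.objs_A by blast
 from mor_ident[OF this] show ?thesis by (intro el.expand) (simp add: idE_def)
qed

lemma mor_zero: "(s, t) \<in> cells A ==> mor2 F (El s t n 0) = 0"
 using mor_lin[of s t 0 n 0 0 0] A.elems_zero[of s t n] by (simp add: elems_def)

lemma mE_evE:
 assumes "evaluation I A V m K"
 shows "T \<in> trees V ==> mE F (evE A m K T) = evE B (%a. marr F (m a)) (%x. mor2 F (transE m K x)) T"
proof (induction rule: trees.induct)
 interpret ev: evaluation I A V m K by fact
 {
  case (leaf i j a)
  then have "Leaf a \<in> trees V" by (rule trees.leaf)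
  from mE_id[OF ev.m_Leaf[OF this]] show ?case by simp
 next
  case (node x ts)
  then have ts: "set ts \<subseteq> trees V" "\<forall>t\<in>set ts. mE F (evE A m K t) = evE B (%a. marr F (m a)) (%x. mor2 F (transE m K x)) t"
   by auto
  have "composable A (transE m K x) (map (evE A m K) ts)"
   by (rule ev.composable_E[OF ev.KE_elems[OF \<open>x \<in> elems V\<close>] ts(1)])
    (simp only: transE_simps \<open>map root ts = etop x\<close>)
  from mE_comp[OF this] have "mE F (evE A m K (Node x ts)) =
    compE B (mE F (transE m K x)) (map (mE F) (map (evE A m K) ts))" by simp
  also have "map (mE F) (map (evE A m K) ts) = map (evE B (%a. marr F (m a)) (%x. mor2 F (transE m K x))) ts"
   using ts(2) by simp
  also have "mE F (transE m K x) = transE (%a. marr F (m a)) (%x. mor2 F (transE m K x)) x"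
   by (intro el.expand) simp
  finally show ?case by simp
 }
qed

end

text \<open>A basis \<open>C\<close> of a subspace containing the image is lifted and the choice is
  extended linearly. The result is linear on the whole ambient space, so its linearity can be
  applied to any vectors.\<close>

lemma linear_section:
 fixes s1 :: "'k::field => 'v::ab_group_add => 'v" and s2 :: "'k => 'w::ab_group_add => 'w"
 assumes "vector_space s1" "vector_space s2" "module.subspace s1 U" "lin_on s1 s2 U f"
 shows "\<exists>g. Vector_Spaces.linear s2 s1 g \<and> (\<forall>w\<in>f ` U. g w \<in> U \<and> f (g w) = w)"
proof -
 interpret V: vector_space s1 by fact
 interpret W: vector_space s2 by fact
 interpret P: vector_space_pair s2 s1 ..
 have lin: "f (s1 a v + s1 b w) = s2 a (f v) + s2 b (f w)" if "v \<in> U" "w \<in> U" for a b v w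
  using assms(4) that by (auto simp: lin_on_def)
 obtain C where C: "C \<subseteq> f ` U" "W.independent C" "f ` U \<subseteq> W.span C"
  using W.maximal_independent_subset[of "f ` U"] by metis
 have "\<forall>c\<in>C. \<exists>u. u \<in> U \<and> f u = c" using C(1) by auto
 then obtain u where u: "\<And>c. c \<in> C ==> u c \<in> U \<and> f (u c) = c" by metis
 obtain g where g: "Vector_Spaces.linear s2 s1 g" "\<And>c. c \<in> C ==> g c = u c"
  using P.linear_independent_extend[OF C(2), of u] by metis
 have "g w \<in> U \<and> f (g w) = w" if "w \<in> W.span C" for w
  using that
 proof (induction rule: W.span_induct_alt)
  case base
  then show ?case using lin[of 0 0 0 0] V.subspace_0[OF assms(3)] by (simp add: P.linear_0[OF g(1)])
 next
  case (step a c w)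
  then show ?case
   using lin[of "u c" "g w" a 1] u[OF step(1)] V.subspace_add[OF assms(3) V.subspace_scale[OF assms(3)]]
   by (simp add: P.linear_add[OF g(1)] P.linear_scale[OF g(1)] g(2))
 qed
 with g(1) C(3) show ?thesis by blast
qed

section \<open>The kernel of a trivial fibration and its contraction\<close>

locale trivial_fibration = morphism I X Y p
 for I :: "'i set" and X :: "('k::field, 'i, 'f, 'x::ab_group_add) twocat"
  and Y :: "('k, 'i, 'g, 'y::ab_group_add) twocat" and p :: "('i, 'f, 'g, 'x, 'y) mor" +
 assumes fib: "fibration X Y p" and weq: "weak_equivalence X Y p"
begin

lemma p_image:
 assumes "(s, t) \<in> cells X"
 shows "(%v. mor2 p (El s t n v)) ` cx X (s, t) n = cx Y (map (marr p) s, marr p t) n"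
 using fib assms by (fastforce simp: fibration_def mcell_def)

lemma p_surj:
 assumes "(s, t) \<in> cells X" "y \<in> cx Y (map (marr p) s, marr p t) n"
 obtains x where "x \<in> cx X (s, t) n" "mor2 p (El s t n x) = y"
proof -
 have "y \<in> (%v. mor2 p (El s t n v)) ` cx X (s, t) n" using assms(2) by (simp only: p_image[OF assms(1)])
 then show ?thesis using that by auto
qed

lemma section_exists:
 "\<exists>\<sigma>. \<forall>s t n. (s, t) \<in> cells X \<longrightarrow> Vector_Spaces.linear (scl Y) (scl X) (\<sigma> (s, t) n) \<and>
  (\<forall>y\<in>cx Y (map (marr p) s, marr p t) n. \<sigma> (s, t) n y \<in> cx X (s, t) n \<and> mor2 p (El s t n (\<sigma> (s, t) n y)) = y)"
proof -
 have "\<exists>g. Vector_Spaces.linear (scl Y) (scl X) g \<and>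
  (\<forall>y\<in>cx Y (map (marr p) s, marr p t) n. g y \<in> cx X (s, t) n \<and> mor2 p (El s t n (g y)) = y)"
  if st: "(s, t) \<in> cells X" for s t n
 proof -
  have "lin_on (scl X) (scl Y) (cx X (s, t) n) (%v. mor2 p (El s t n v))" using mor_lin[OF st] by (simp add: lin_on_def)
  from linear_section[OF A.vector_space_axioms B.vector_space_axioms A.cx_subspace[OF st] this]
  show ?thesis by (simp add: p_image[OF st])
 qed
 note ex = this
 define P where "P c n g \<longleftrightarrow> Vector_Spaces.linear (scl Y) (scl X) g \<and>
  (\<forall>y\<in>cx Y (map (marr p) (fst c), marr p (snd c)) n. g y \<in> cx X c n \<and> mor2 p (El (fst c) (snd c) n (g y)) = y)" for c n g
 have "P (s, t) n (SOME g. P (s, t) n g)" if "(s, t) \<in> cells X" for s t n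
  by (rule someI_ex[of "P (s, t) n"]) (use ex[OF that, of n] in "simp add: P_def")
 then show ?thesis by (intro exI[of _ "%c n. SOME g. P c n g"]) (simp add: P_def)
qed

definition N :: "('i, 'f) cell => int => 'x set" where
 "N c n = {v \<in> cx X c n. mor2 p (El (fst c) (snd c) n v) = 0}"

lemma N_subspace: "c \<in> cells X ==> A.subspace (N c n)"
proof (rule A.subspaceI)
 assume c: "c \<in> cells X"
 then have c': "(fst c, snd c) \<in> cells X" by simp
 note sub = A.cx_subspace[OF c, of n]
 show "0 \<in> N c n" using A.subspace_0[OF sub] mor_zero[OF c'] by (simp add: N_def)
 show "x + y \<in> N c n" if "x \<in> N c n" "y \<in> N c n" for x y
  using that A.subspace_add[OF sub] mor_lin[OF c', of x n y 1 1] by (simp add: N_def)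
 show "scl X a x \<in> N c n" if "x \<in> N c n" for a x
  using that A.subspace_scale[OF sub] mor_lin[OF c', of x n x a 0] by (simp add: N_def)
qed

abbreviation "dX c n v \<equiv> diff X (El (fst c) (snd c) n v)"

lemma dX_facts:
 assumes "c \<in> cells X"
 shows "v \<in> cx X c n ==> dX c n v \<in> cx X c (n + 1)" "v \<in> cx X c n ==> dX c (n + 1) (dX c n v) = 0"
  "v \<in> cx X c n ==> w \<in> cx X c n ==> dX c n (scl X a v + scl X b w) = scl X a (dX c n v) + scl X b (dX c n w)"
  "v \<in> cx X c n ==> mor2 p (El (fst c) (snd c) (n + 1) (dX c n v)) =
   diff Y (El (map (marr p) (fst c)) (marr p (snd c)) n (mor2 p (El (fst c) (snd c) n v)))"
  "v \<in> N c n ==> dX c n v \<in> N c (n + 1)"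
proof -
 have c: "(fst c, snd c) \<in> cells X" using assms by simp
 have e: "El (fst c) (snd c) n v \<in> elems X" if "v \<in> cx X c n" for v n using that assms by (simp add: elems_def)
 show 1: "dX c n v \<in> cx X c (n + 1)" if "v \<in> cx X c n" for v
  using A.dE_elems[OF e[OF that]] by (simp add: dE_def elems_def)
 show "v \<in> cx X c n ==> dX c (n + 1) (dX c n v) = 0" using A.diff_diff[OF e] by (simp add: dE_def)
 show "v \<in> cx X c n ==> w \<in> cx X c n ==> dX c n (scl X a v + scl X b w) = scl X a (dX c n v) + scl X b (dX c n w)"
  by (rule A.diff_lin[OF e e])
 show 2: "mor2 p (El (fst c) (snd c) (n + 1) (dX c n v)) =
   diff Y (El (map (marr p) (fst c)) (marr p (snd c)) n (mor2 p (El (fst c) (snd c) n v)))" if "v \<in> cx X c n" for v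
  using mor_diff[OF e[OF that]] by (simp add: dE_def mE_def)
 show "v \<in> N c n ==> dX c n v \<in> N c (n + 1)" using 1 2 B.diff_zero[OF cells_mor[OF c]] by (simp add: N_def)
qed

lemma cohom_class_eqD:
 assumes "two_category I B" "c \<in> cells B" "cohom_class B c n z = cohom_class B c n z'"
 obtains b where "b \<in> cx B c (n - 1)" "z = z' + diff B (El (fst c) (snd c) (n - 1) b)"
proof -
 interpret Z: two_category I B by fact
 have "z = z + diff B (El (fst c) (snd c) (n - 1) 0)" "0 \<in> cx B c (n - 1)"
  using Z.diff_zero[of "fst c" "snd c"] Z.subspace_0[OF Z.cx_subspace[OF assms(2)]] assms(2) by simp_all
 then have "z \<in> cohom_class B c n z'" unfolding assms(3)[symmetric] unfolding cohom_class_def by blast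
 then show ?thesis using that unfolding cohom_class_def by blast
qed

lemma cohom_class_eqI:
 assumes "two_category I B" "c \<in> cells B" "b \<in> cx B c (n - 1)"
 shows "cohom_class B c n (z + diff B (El (fst c) (snd c) (n - 1) b)) = cohom_class B c n z"
proof -
 interpret Z: two_category I B by fact
 note sub = Z.cx_subspace[OF assms(2), of "n - 1"]
 have e: "El (fst c) (snd c) (n - 1) b' \<in> elems B" if "b' \<in> cx B c (n - 1)" for b'
  using that assms(2) by (simp add: elems_def)
 have "diff B (El (fst c) (snd c) (n - 1) (b + b')) = diff B (El (fst c) (snd c) (n - 1) b) + diff B (El (fst c) (snd c) (n - 1) b')"
   "diff B (El (fst c) (snd c) (n - 1) (b' - b)) = diff B (El (fst c) (snd c) (n - 1) b') - diff B (El (fst c) (snd c) (n - 1) b)"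
  if "b' \<in> cx B c (n - 1)" for b'
  using Z.diff_lin[OF e[OF assms(3)] e[OF that], of 1 1] Z.diff_lin[OF e[OF assms(3)] e[OF that], of "- 1" 1] by simp_all
 note d = this
 show ?thesis
  unfolding cohom_class_def
 proof (intro set_eqI iffI; clarify)
  fix b' assume b': "b' \<in> cx B c (n - 1)"
  show "\<exists>b''. z + diff B (El (fst c) (snd c) (n - 1) b) + diff B (El (fst c) (snd c) (n - 1) b') =
    z + diff B (El (fst c) (snd c) (n - 1) b'') \<and> b'' \<in> cx B c (n - 1)"
   using Z.subspace_add[OF sub assms(3) b'] d(1)[OF b'] by (intro exI[of _ "b + b'"]) (simp add: add.assoc)
  show "\<exists>b''. z + diff B (El (fst c) (snd c) (n - 1) b') =
    z + diff B (El (fst c) (snd c) (n - 1) b) + diff B (El (fst c) (snd c) (n - 1) b'') \<and> b'' \<in> cx B c (n - 1)"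
   using Z.subspace_diff[OF sub b' assms(3)] d(2)[OF b'] by (intro exI[of _ "b' - b"]) simp
 qed
qed

lemma cohom_map_class:
 assumes c: "c \<in> cells X" and z: "z \<in> cx X c n"
 shows "cohom_map Y p c n (cohom_class X c n z) = cohom_class Y (mcell p c) n (mor2 p (El (fst c) (snd c) n z))"
proof -
 have c': "(fst c, snd c) \<in> cells X" and mc: "mcell p c \<in> cells Y"
  using c cells_mor[of "fst c" "snd c"] by (simp_all add: mcell_def case_prod_unfold)
 have "cohom_class Y (mcell p c) n (mor2 p (El (fst c) (snd c) n (z + dX c (n - 1) b))) =
   cohom_class Y (mcell p c) n (mor2 p (El (fst c) (snd c) n z))" if b: "b \<in> cx X c (n - 1)" for b
 proof -
  have "dX c (n - 1) b \<in> cx X c n" using dX_facts(1)[OF c b] by simp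
  then have "mor2 p (El (fst c) (snd c) n (z + dX c (n - 1) b)) =
    mor2 p (El (fst c) (snd c) n z) + mor2 p (El (fst c) (snd c) n (dX c (n - 1) b))"
   using mor_lin[OF c', of z n "dX c (n - 1) b" 1 1] z by simp
  also have "mor2 p (El (fst c) (snd c) n (dX c (n - 1) b)) =
    diff Y (El (fst (mcell p c)) (snd (mcell p c)) (n - 1) (mor2 p (El (fst c) (snd c) (n - 1) b)))"
   using dX_facts(4)[OF c b] by (simp add: mcell_def case_prod_unfold)
  finally show ?thesis
   using cohom_class_eqI[OF B.two_category_axioms mc, of "mor2 p (El (fst c) (snd c) (n - 1) b)" n] mor_mem[OF c', of b "n - 1"] b
   by (simp add: mcell_def case_prod_unfold)
 qed
 moreover have "z \<in> cohom_class X c n z"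
  using A.diff_zero[OF c'] A.subspace_0[OF A.cx_subspace[OF c]] unfolding cohom_class_def by (auto intro!: exI[of _ 0])
 ultimately show ?thesis unfolding cohom_map_def by (auto simp: cohom_class_def[of X])
qed

text \<open>The long exact sequence by hand. Injectivity on cohomology gives \<open>z = d b\<close>;
  then \<open>p b\<close> is a cocycle, and surjectivity on cohomology one degree lower gives a
  cocycle \<open>b'\<close> whose image differs from \<open>p b\<close> by a coboundary
  \<open>d y\<close>. As \<open>p\<close> is surjective, \<open>y\<close> is the image of some
  \<open>x\<close>.\<close>

lemma kernel_acyclic:
 assumes c: "c \<in> cells X" and z: "z \<in> N c n" "dX c n z = 0"
 shows "\<exists>b\<in>N c (n - 1). dX c (n - 1) b = z"
proof -
 have c': "(fst c, snd c) \<in> cells X" and mc: "mcell p c \<in> cells Y"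
  using c cells_mor[of "fst c" "snd c"] by (simp_all add: mcell_def case_prod_unfold)
 have mcc: "mcell p c = (map (marr p) (fst c), marr p (snd c))" by (simp add: mcell_def case_prod_unfold)
 have bij: "bij_betw (cohom_map Y p c n) (cohom X c n) (cohom Y (mcell p c) n)" for n
  using weq c by (simp add: weak_equivalence_def)
 have zX: "z \<in> cx X c n" "mor2 p (El (fst c) (snd c) n z) = 0" using z(1) by (simp_all add: N_def)
 have 0: "0 \<in> cx X c m" "mor2 p (El (fst c) (snd c) m 0) = 0" "dX c m 0 = 0" for m
  using A.subspace_0[OF A.cx_subspace[OF c]] mor_zero[OF c'] A.diff_zero[OF c'] by simp_all
 have "cohom_map Y p c n (cohom_class X c n z) = cohom_map Y p c n (cohom_class X c n 0)"
  using cohom_map_class[OF c zX(1)] cohom_map_class[OF c 0(1), of n] zX(2) 0(2) by simp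
 moreover have "cohom_class X c n z \<in> cohom X c n" "cohom_class X c n 0 \<in> cohom X c n"
  using zX z(2) 0 by (auto simp: cohom_def cocycles_def)
 ultimately have "cohom_class X c n z = cohom_class X c n 0" using bij[of n] by (auto simp: bij_betw_def inj_on_def)
 from cohom_class_eqD[OF A.two_category_axioms c this] obtain b where b: "b \<in> cx X c (n - 1)" "z = dX c (n - 1) b" by auto
 let ?p = "%n v. mor2 p (El (fst c) (snd c) n v)"
 have pb: "?p (n - 1) b \<in> cocycles Y (mcell p c) (n - 1)"
  using dX_facts(4)[OF c b(1)] mor_mem[OF c', of b "n - 1"] b zX(2) by (simp add: cocycles_def mcc)
 then have "cohom_class Y (mcell p c) (n - 1) (?p (n - 1) b) \<in> cohom Y (mcell p c) (n - 1)" by (simp add: cohom_def)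
 then have "cohom_class Y (mcell p c) (n - 1) (?p (n - 1) b) \<in> cohom_map Y p c (n - 1) ` cohom X c (n - 1)"
  using bij[of "n - 1"] by (simp add: bij_betw_def)
 then obtain K where "K \<in> cohom X c (n - 1)" "cohom_class Y (mcell p c) (n - 1) (?p (n - 1) b) = cohom_map Y p c (n - 1) K"
  by blast
 then obtain b' where b': "b' \<in> cx X c (n - 1)" "dX c (n - 1) b' = 0"
   "cohom_class Y (mcell p c) (n - 1) (?p (n - 1) b') = cohom_class Y (mcell p c) (n - 1) (?p (n - 1) b)"
 proof -
  obtain z' where "K = cohom_class X c (n - 1) z'" "z' \<in> cx X c (n - 1)" "dX c (n - 1) z' = 0"
   using \<open>K \<in> cohom X c (n - 1)\<close> by (auto simp: cohom_def cocycles_def)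
  then show ?thesis using that[of z'] cohom_map_class[OF c] \<open>_ = cohom_map Y p c (n - 1) K\<close> by simp
 qed
 from cohom_class_eqD[OF B.two_category_axioms mc b'(3)[symmetric]] obtain y where
  y: "y \<in> cx Y (mcell p c) (n - 1 - 1)"
   "?p (n - 1) b = ?p (n - 1) b' + diff Y (El (map (marr p) (fst c)) (marr p (snd c)) (n - 1 - 1) y)" by (auto simp: mcc)
 obtain x where x: "x \<in> cx X c (n - 1 - 1)" "?p (n - 1 - 1) x = y"
  using p_surj[OF c', of y "n - 1 - 1"] y(1) by (auto simp: mcc)
 note sub = A.cx_subspace[OF c, of "n - 1"]
 have dx: "dX c (n - 1 - 1) x \<in> cx X c (n - 1)" "dX c (n - 1) (dX c (n - 1 - 1) x) = 0"
   "?p (n - 1) (dX c (n - 1 - 1) x) = diff Y (El (map (marr p) (fst c)) (marr p (snd c)) (n - 1 - 1) y)"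
  using dX_facts(1,2,4)[OF c x(1)] x(2) by simp_all
 \<comment> \<open>The element \<open>b - b' - d x\<close> still bounds \<open>z\<close>, and now it
   lies in the kernel of \<open>p\<close>.\<close>
 define b'' where "b'' = scl X 1 b + scl X (- 1) (b' + dX c (n - 1 - 1) x)"
 have m: "b' + dX c (n - 1 - 1) x \<in> cx X c (n - 1)" by (rule A.subspace_add[OF sub b'(1) dx(1)])
 have "?p (n - 1) b'' = scl Y 1 (?p (n - 1) b) + scl Y (- 1) (?p (n - 1) (b' + dX c (n - 1 - 1) x))"
  unfolding b''_def by (rule mor_lin[OF c' _ _]) (use b(1) m in simp_all)
 then have "?p (n - 1) b'' = 0" using mor_lin[OF c', of b' "n - 1" "dX c (n - 1 - 1) x" 1 1] b'(1) dx y(2) by simp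
 moreover have "dX c (n - 1) b'' = scl X 1 (dX c (n - 1) b) + scl X (- 1) (dX c (n - 1) (b' + dX c (n - 1 - 1) x))"
  unfolding b''_def by (rule dX_facts(3)[OF c b(1) m])
 then have "dX c (n - 1) b'' = z" using dX_facts(3)[OF c b'(1) dx(1), of 1 1] b(2) b'(2) dx(2) by simp
 moreover have "b'' \<in> cx X c (n - 1)" unfolding b''_def by (intro A.subspace_add[OF sub] A.subspace_scale[OF sub] b(1) m)
 ultimately show ?thesis by (auto simp: N_def)
qed

text \<open>Let \<open>j\<close> be a linear right inverse of the differential on the cocycles of
  the kernel. Then \<open>e - j (d e)\<close> is a cocycle, and \<open>h e = j (e - j (d e))\<close>
  has \<open>d (h e) = e - j (d e)\<close> and \<open>h (d e) = j (d e)\<close>.\<close>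

lemma contraction_exists:
 "\<exists>h. \<forall>c\<in>cells X. \<forall>n. (\<forall>e\<in>N c n. h c n e \<in> N c (n - 1) \<and> dX c (n - 1) (h c n e) + h c (n + 1) (dX c n e) = e) \<and>
  lin_on (scl X) (scl X) (N c n) (h c n)"
proof -
 have "\<exists>j. Vector_Spaces.linear (scl X) (scl X) j \<and> (\<forall>z\<in>N c n. dX c n z = 0 \<longrightarrow> j z \<in> N c (n - 1) \<and> dX c (n - 1) (j z) = z)"
  if c: "c \<in> cells X" for c n
 proof -
  have "lin_on (scl X) (scl X) (N c (n - 1)) (dX c (n - 1))" using dX_facts(3)[OF c] by (auto simp: lin_on_def N_def)
  from linear_section[OF A.vector_space_axioms A.vector_space_axioms N_subspace[OF c] this]
  obtain j where j: "Vector_Spaces.linear (scl X) (scl X) j"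
    "\<forall>w\<in>dX c (n - 1) ` N c (n - 1). j w \<in> N c (n - 1) \<and> dX c (n - 1) (j w) = w" by blast
  then show ?thesis using kernel_acyclic[OF c] by (intro exI[of _ j]) blast
 qed
 note ex = this
 define P where "P c n j \<longleftrightarrow> Vector_Spaces.linear (scl X) (scl X) j \<and>
   (\<forall>z\<in>N c n. dX c n z = 0 \<longrightarrow> j z \<in> N c (n - 1) \<and> dX c (n - 1) (j z) = z)" for c n j
 define j where "j c n = (SOME g. P c n g)" for c n
 have j: "P c n (j c n)" if "c \<in> cells X" for c n
  unfolding j_def by (rule someI_ex[of "P c n"]) (use ex[OF that, of n] in "simp add: P_def")
 define h where "h c n e = j c n (e - j c (n + 1) (dX c n e))" for c n e
 show ?thesis proof (intro exI[of _ h] ballI allI conjI)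
  fix c n assume c: "c \<in> cells X"
  note sub = N_subspace[OF c]
  have jz: "j c n z \<in> N c (n - 1)" "dX c (n - 1) (j c n z) = z" if "z \<in> N c n" "dX c n z = 0" for n z
   using j[OF c, of n] that by (simp_all add: P_def)
  have dd: "dX c n e \<in> N c (n + 1)" "dX c (n + 1) (dX c n e) = 0" if "e \<in> N c n" for n e
   using that dX_facts(2,5)[OF c, of e n] by (simp_all add: N_def)
  have jd: "j c (n + 1) (dX c n e) \<in> N c n" "dX c n (j c (n + 1) (dX c n e)) = dX c n e" if "e \<in> N c n" for n e
   using jz[OF dd[OF that]] by simp_all
  have k: "e - j c (n + 1) (dX c n e) \<in> N c n" "dX c n (e - j c (n + 1) (dX c n e)) = 0" if e: "e \<in> N c n" for n e proof -
   show "e - j c (n + 1) (dX c n e) \<in> N c n" by (rule A.subspace_diff[OF sub e jd(1)[OF e]])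
   show "dX c n (e - j c (n + 1) (dX c n e)) = 0"
    using dX_facts(3)[OF c, of e n "j c (n + 1) (dX c n e)" 1 "- 1"] jd[OF e] e by (simp add: N_def)
  qed
  interpret J: Vector_Spaces.linear "scl X" "scl X" "j c n" for n using j[OF c, of n] by (simp add: P_def)
  show "h c n e \<in> N c (n - 1)" if "e \<in> N c n" for e using jz(1)[OF k[OF that]] by (simp add: h_def)
  show "dX c (n - 1) (h c n e) + h c (n + 1) (dX c n e) = e" if e: "e \<in> N c n" for e
   using jz(2)[OF k[OF e]] dd(2)[OF e] by (simp add: h_def J.zero)
  show "lin_on (scl X) (scl X) (N c n) (h c n)"
   unfolding lin_on_def
  proof (intro allI ballI)
   fix a b v w assume vw: "v \<in> N c n" "w \<in> N c n"
   then have "dX c n (scl X a v + scl X b w) = scl X a (dX c n v) + scl X b (dX c n w)"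
    using dX_facts(3)[OF c] by (simp add: N_def)
   then show "h c n (scl X a v + scl X b w) = scl X a (h c n v) + scl X b (h c n w)"
    by (simp add: h_def J.add J.scale J.diff A.scale_right_diff_distrib)
  qed
 qed
qed

lemma arrow_lift:
 assumes ij: "i \<in> I" "j \<in> I" and a: "a \<in> arrows Y i j"
 shows "\<exists>a'\<in>arrows X i j. marr p a' = a"
proof -
 have "is_equivalence (H0 X i j) (H0 Y i j) (marr p) (%s t. cohom_map Y p ([s], t) 0)"
  using weq ij by (simp add: weak_equivalence_def A.objs_A)
 then obtain Go Gm \<theta> where G: "is_functor (H0 Y i j) (H0 X i j) Go Gm"
   "natural_iso (H0 Y i j) (H0 Y i j) (%a. marr p (Go a)) (%a b f. cohom_map Y p ([Go a], Go b) 0 (Gm a b f)) (%a. a) (%a b f. f) \<theta>"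
  unfolding is_equivalence_def by blast
 have Go: "Go a \<in> arrows X i j" using G(1) a by (auto simp: is_functor_def H0_def)
 have iso: "is_iso (H0 Y i j) (marr p (Go a)) a (\<theta> a)" using G(2) a by (auto simp: natural_iso_def H0_def)
 then have "\<theta> a \<in> cohom Y ([marr p (Go a)], a) 0" by (simp add: is_iso_def H0_def)
 then obtain psi where "psi \<in> cocycles Y ([marr p (Go a)], a) 0" "\<theta> a = cohom_class Y ([marr p (Go a)], a) 0 psi"
  by (auto simp: cohom_def)
 then show ?thesis using conjunct2[OF fib[unfolded fibration_def A.objs_A], rule_format, OF ij Go a, of psi] iso by auto
qed

end

section \<open>Lifting against trivial fibrations\<close>

lemma evE_cong_trees:
 assumes "\<And>a. Leaf a \<in> trees V ==> m a = m' a" "\<And>x. x \<in> elems V ==> K x = K' x"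
 shows "T \<in> trees V ==> evE X m K T = evE X m' K' T"
proof (induction rule: trees.induct)
 case (leaf i j a)
 then have "Leaf a \<in> trees V" by (rule trees.leaf)
 with assms(1) show ?case by simp
next
 case (node x ts)
 have "Leaf a \<in> trees V" if "a \<in> set (etop x) \<or> a = ebot x" for a
  using node(1) that by (intro cell_Leaf_trees[of "etop x" "ebot x"]) (auto simp: elems_def)
 then have "transE m K x = transE m' K' x" using assms node(1) by (simp add: transE_def)
 moreover have "map (evE X m K) ts = map (evE X m' K') ts" using node by auto
 ultimately show ?case by (simp only: evE.simps)
qed

lemma (in evaluation) ev_corolla: "x \<in> elems V ==> ev (corolla x) = K x"
 using X.comp_unit(1)[OF KE_elems[of x]] by (simp add: corolla_def o_def)

lemma (in evaluation) K_zero: "El s t n v \<in> elems V ==> scl V 0 v + scl V 0 v = z ==> El s t n z \<in> elems V ==> K (El s t n z) = 0"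
 using K_lin[of s t n v v 0 0] by simp

text \<open>The support is restricted to decorations in \<open>S\<close>, for use with a stage of
  the filtration as \<open>S\<close>.\<close>

lemma (in evaluation) diff_vec_ev:
 assumes "fcomb {T \<in> trdeg V c n. decs T \<subseteq> S} (Mlin V c) \<xi>" "c \<in> cells V"
  and "Vector_Spaces.linear (scl X) (*) l"
  and "\<And>T. T \<in> trees V ==> decs T \<subseteq> S ==> l (diff X (E T)) = Psi T" "Psi \<in> Mlin V c"
 shows "l (diff X (El (map m (fst c)) (m (snd c)) n (vec (scl X) \<xi> ev))) = \<xi> Psi"
proof -
 let ?f = "%n v. l (diff X (El (map m (fst c)) (m (snd c)) n v))"
 have "fcomb (trdeg V c n) (Mlin V c) \<xi>" by (rule fcomb_mono[OF assms(1)]) auto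
 note ap = vec_ev_apply[OF this assms(2), where f="?f" and Psi="%T. l (diff X (E T))"]
 have lin: "?f n (scl X a v + scl X b w) = a * ?f n v + b * ?f n w" if "v \<in> cx X (mc c) n" "w \<in> cx X (mc c) n" for n a b v w
  using that m_cells[of "fst c" "snd c"] assms(2) by (subst X.diff_lin) (simp_all add: elems_def X.functional_simps[OF assms(3)])
 have eq: "?f (tdeg T) (ev T) = l (diff X (E T))" if "T \<in> trees V" "tcell T = c" for T using that E_El[of T] by auto
 have "?f n (vec (scl X) \<xi> ev) = \<xi> (%T. l (diff X (E T)))" "(%T. l (diff X (E T))) \<in> Mlin V c"
  by (rule ap; fact lin eq)+
 moreover have "\<xi> (%T. l (diff X (E T))) = \<xi> Psi"
  by (rule fcomb_cong[OF assms(1) calculation(2) assms(5)]) (use assms(4) in auto)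
 ultimately show ?thesis by simp
qed

locale free_source = differential_data V \<theta> + Y: two_category I Y
 for V :: "('k::field, 'i, 'e, 'v::ab_group_add) coll" and \<theta> :: "('i, 'e, 'v) el => ('k, 'i, 'e, 'v) tens"
  and I :: "'i set" and Y :: "('k, 'i, 'g, 'y::ab_group_add) twocat" +
 fixes v :: "('i, 'e, 'g, ('k, 'i, 'e, 'v) tens, 'y) mor"
 assumes objs_I: "objs V = I" and v: "is_mor F Y v"
begin

sublocale mor: morphism I F Y v using two_cat_free_obj v objs_I by unfold_locales simp_all

definition KY where "KY x = mor2 v (ptensE V (corolla x))"

lemma m_Leaf_v: "Leaf a \<in> trees V ==> Leaf (marr v a) \<in> trees Y"
 using mor.arrows_mor unfolding trees_Leaf_iff Y.objs_A objs_I by (fastforce simp: F_cells)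

sublocale Yev: evaluation I Y V "marr v" KY
proof
 show "Leaf e \<in> trees V ==> Leaf (marr v e) \<in> trees Y" for e by (rule m_Leaf_v)
 show "(s, t) \<in> cells V ==> (map (marr v) s, marr v t) \<in> cells Y" for s t using mor.cells_mor[of s t] by simp
 show "x \<in> elems V ==> KY x \<in> cx Y (map (marr v) (etop x), marr v (ebot x)) (edeg x)" for x
  using mor.mE_elems[OF ptensE_elems[OF corolla_V[of x]]] by (simp add: KY_def elems_def)
 fix s t n u u' a b
 assume *: "El s t n u \<in> elems V" "El s t n u' \<in> elems V" "El s t n (scl V a u + scl V b u') \<in> elems V"
 have c: "(s, t) \<in> cells F" using * by (simp add: elems_def)
 have e: "ptensE V (corolla (El s t n z)) = El s t n (ptens V (Node (El s t n z) (map Leaf s)))" for z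
  by (simp add: ptensE_def corolla_def o_def sum_list_0)
 have m: "ptens V (Node (El s t n z) (map Leaf s)) \<in> cx F (s, t) n" "Node (El s t n z) (map Leaf s) \<in> trees V" if "El s t n z \<in> elems V" for z
  using ptensE_elems[OF corolla_V[OF that]] corolla_V[OF that] by (simp_all add: e F_elems corolla_def)
 have "ptens V (Node (El s t n (scl V a u + scl V b u')) (map Leaf s)) =
   tscale a (ptens V (Node (El s t n u) (map Leaf s))) + tscale b (ptens V (Node (El s t n u') (map Leaf s)))"
  by (rule ptens_tree_lin[OF tree_lin.here]) (intro m *)+
 then show "KY (El s t n (scl V a u + scl V b u')) = scl Y a (KY (El s t n u)) + scl Y b (KY (El s t n u'))"
  using mor.mor_lin[OF c m(1)[OF *(1)] m(1)[OF *(2)], of a b] by (simp add: KY_def e)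
qed

lemma mE_ptensE: "T \<in> trees V ==> mE v (ptensE V T) = Yev.E T"
proof (induction rule: trees.induct)
 case (leaf i j a)
 then have "Leaf a \<in> trees F" by (auto simp: trees_Leaf_iff)
 from mor.mE_id[OF this] show ?case by (simp add: ptensE_def idE_def)
next
 case (node x ts)
 then have N: "Node x ts \<in> trees V" and ts: "map (mE v \<circ> ptensE V) ts = map Yev.E ts" and x: "x \<in> elems V" by auto
 have "mE v (ptensE V (corolla x)) = Yev.KE x" by (intro el.expand) (simp add: KY_def)
 then show ?case using mor.mE_comp[OF ptensE_composable[OF N]] ts by (simp add: ptensE_Node[OF N] del: map_eq_conv)
qed

text \<open>The given morphism is recovered from its values \<open>KY\<close> on generators by
  evaluation of trees; this makes it comparable with lifts, which are built from values on
  generators.\<close>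

lemma mor_vec:
 assumes "(s, t) \<in> cells V" "\<xi> \<in> free_cx V (s, t) n"
 shows "mor2 v (El s t n \<xi>) = vec (scl Y) \<xi> Yev.ev"
proof (rule Y.functionals_separate)
 fix l assume l: "Vector_Spaces.linear (scl Y) (*) l"
 let ?f = "%\<xi>. l (mor2 v (El s t n \<xi>))"
 have "?f \<xi> = \<xi> (%T. l (Yev.ev T))"
 proof (rule ptens_span_linear[where f="?f" and S="trdeg V (s, t) n" and c="(s, t)"])
  show "trdeg V (s, t) n \<subseteq> trees_of V (s, t)" by (auto simp: trdeg_def)
  show "\<xi> \<in> module.span tscale (ptens V ` trdeg V (s, t) n)" using assms(2) by (simp add: free_cx_span)
  show "?f (tscale a z + tscale b z') = a * ?f z + b * ?f z'"
   if "z \<in> module.span tscale (ptens V ` trdeg V (s, t) n)" "z' \<in> module.span tscale (ptens V ` trdeg V (s, t) n)" for a b z z'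
   using mor.mor_lin[of s t z n z' a b] that assms(1) by (simp add: free_cx_span Y.functional_simps[OF l])
  show "(%T. l (Yev.ev T)) \<in> Mlin V (s, t)" by (rule Yev.functional_ev_Mlin[OF l])
  show "?f (ptens V T) = l (Yev.ev T)" if "T \<in> trdeg V (s, t) n" for T proof -
   have "mor2 v (ptensE V T) = Yev.ev T" using that mE_ptensE[of T] by (metis mor.mE_simps(4) trdeg_iff)
   then show ?thesis using that by (auto simp: ptensE_def)
  qed
 qed
 then show "?f \<xi> = l (vec (scl Y) \<xi> Yev.ev)" using Yev.vec_ev(3)[OF free_cx_fcomb[OF assms(2)] assms(1) l] by simp
qed

lemma KY_diff:
 assumes x: "x \<in> elems V"
 shows "diff Y (Yev.KE x) = vec (scl Y) (\<theta> x) Yev.ev"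
proof -
 let ?p = "ptensE V (corolla x)"
 have c: "(etop x, ebot x) \<in> cells V" using x by (simp add: elems_def)
 have p: "?p \<in> elems F" by (rule ptensE_elems[OF corolla_V[OF x]])
 have "mE v ?p = Yev.KE x" by (intro el.expand) (simp add: KY_def)
 then have "diff Y (Yev.KE x) = mor2 v (El (etop x) (ebot x) (edeg x + 1) (diff F ?p))"
  using mor.mor_diff[OF p] by (simp add: dE_def)
 also have "\<dots> = vec (scl Y) (diff F ?p) Yev.ev" using dE_elems[OF p] by (intro mor_vec[OF c]) (simp add: F_elems dE_def)
 also have "\<dots> = vec (scl Y) (\<theta> x) Yev.ev" proof (rule Y.functionals_separate)
  fix l assume l: "Vector_Spaces.linear (scl Y) (*) l"
  have fc: "fcomb (trdeg V (etop x, ebot x) (edeg x + 1)) (Mlin V (etop x, ebot x)) (diff F ?p)"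
   using dE_elems[OF p] by (intro free_cx_fcomb) (simp add: F_elems dE_def)
  have m: "(%T. l (Yev.ev T)) \<in> Mlin V (etop x, ebot x)" by (rule Yev.functional_ev_Mlin[OF l])
  have "diff F ?p (%T. l (Yev.ev T)) = D (corolla x) (%T. l (Yev.ev T))"
   using m at_Mlin[OF m] by (simp add: F_diff Mlin_ptens)
  then show "l (vec (scl Y) (diff F ?p) Yev.ev) = l (vec (scl Y) (\<theta> x) Yev.ev)"
   unfolding Yev.vec_ev(3)[OF fc c l] Yev.vec_ev(3)[OF \<theta>_comb[OF x] c l] D_corolla[OF x m] .
 qed
 finally show ?thesis .
qed

end

definition topEl :: "(('i, 'e, 'v) el => 'v) => ('i, 'e, 'v) el => ('i, 'e, 'v) el" where
 "topEl d x = El (etop x) (ebot x) (edeg x + 1) (d x)"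

lemma topEl_simps [simp]: "etop (topEl d x) = etop x" "ebot (topEl d x) = ebot x" "edeg (topEl d x) = edeg x + 1"
 "evec (topEl d x) = d x" by (simp_all add: topEl_def)

text \<open>What the lifting uses of the bar construction: the part \<open>w\<close> of the
  differential involves only generators of lower stages, whereas \<open>d1\<close> keeps its stage
  and squares to zero by itself. Stage 0 consists of zero vectors, on which linear maps have no
  choice.\<close>

locale filtered_generators = differential_data V \<theta>
 for V :: "('k::field, 'i, 'e, 'v::ab_group_add) coll" and \<theta> :: "('i, 'e, 'v) el => ('k, 'i, 'e, 'v) tens" +
 fixes d1 :: "('i, 'e, 'v) el => 'v" and w :: "('i, 'e, 'v) el => ('k, 'i, 'e, 'v) tens"
  and Fil :: "nat => ('i, 'e, 'v) el set"
 assumes zero_elems: "El s t n u \<in> elems V ==> El s t n 0 \<in> elems V"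
  and d1_elems: "x \<in> elems V ==> topEl d1 x \<in> elems V"
  and d1_lin: "El s t n u \<in> elems V ==> El s t n u' \<in> elems V ==>
   d1 (El s t n (scl V a u + scl V b u')) = scl V a (d1 (El s t n u)) + scl V b (d1 (El s t n u'))"
  and d1_sq: "x \<in> elems V ==> d1 (topEl d1 x) = 0"
  and w_comb: "x \<in> elems V ==> fcomb (trdeg V (etop x, ebot x) (edeg x + 1)) (Mlin V (etop x, ebot x)) (w x)"
  and \<theta>_split: "x \<in> elems V ==> phi \<in> Mlin V (etop x, ebot x) ==> \<theta> x phi = phi (corolla (topEl d1 x)) + w x phi"
  and Fil_0: "x \<in> Fil 0 ==> x \<in> elems V ==> evec x = 0"
  and Fil_Suc: "Fil N \<subseteq> Fil (Suc N)"
  and Fil_ex: "x \<in> elems V ==> \<exists>N. x \<in> Fil N"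
  and Fil_d1: "x \<in> Fil N ==> x \<in> elems V ==> topEl d1 x \<in> Fil N"
  and Fil_w: "x \<in> Fil (Suc N) ==> x \<in> elems V ==>
   fcomb {T \<in> trdeg V (etop x, ebot x) (edeg x + 1). decs T \<subseteq> Fil N} (Mlin V (etop x, ebot x)) (w x)"
begin

sublocale V: vector_space "scl V" by (rule vs)

lemma corolla_zero:
 assumes "x \<in> elems V" "phi \<in> Mlin V (etop x, ebot x)" "El (etop x) (ebot x) n u \<in> elems V"
 shows "phi (corolla (El (etop x) (ebot x) n 0)) = 0"
proof -
 have c: "corolla (El (etop x) (ebot x) n z) = Node (El (etop x) (ebot x) n z) (map Leaf (etop x))" for z
  by (simp add: corolla_def)
 have z: "El (etop x) (ebot x) n 0 \<in> elems V" by (rule zero_elems[OF assms(3)])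
 note t = corolla_V[OF z, unfolded c]
 have "tree_lin (scl V) 0 0 (Node (El (etop x) (ebot x) n 0) (map Leaf (etop x))) (Node (El (etop x) (ebot x) n 0) (map Leaf (etop x)))
   (Node (El (etop x) (ebot x) n (scl V 0 0 + scl V 0 0)) (map Leaf (etop x)))" by (rule tree_lin.here)
 from Mlin_D[OF assms(2) this t t] t show ?thesis by (simp add: c o_def)
qed

text \<open>The square of the whole differential is zero and so is that of \<open>d1\<close>; this
  is the remaining identity. It determines the differential of the defect
  \<open>err\<close>.\<close>

lemma w_square:
 assumes x: "x \<in> elems V" and phi: "phi \<in> Mlin V (etop x, ebot x)"
 shows "w x (%S. D S phi) = - w (topEl d1 x) phi"
proof -
 note y = d1_elems[OF x]
 have "\<theta> x (%S. D S phi) = D (corolla (topEl d1 x)) phi + w x (%S. D S phi)"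
  by (rule \<theta>_split[OF x at_Mlin[OF phi]])
 also have "D (corolla (topEl d1 x)) phi = \<theta> (topEl d1 x) phi" by (rule D_corolla[OF y]) (use phi in simp)
 also have "\<dots> = phi (corolla (topEl d1 (topEl d1 x))) + w (topEl d1 x) phi"
  by (rule \<theta>_split[OF y]) (use phi in simp)
 also have "topEl d1 (topEl d1 x) = El (etop x) (ebot x) (edeg x + 2) 0" by (simp add: topEl_def[of d1 "topEl d1 x"] d1_sq[OF x])
 also have "phi (corolla \<dots>) = 0"
  using corolla_zero[OF x phi] d1_elems[OF y] by (simp add: topEl_def[of d1 "topEl d1 x"] add.assoc)
 finally show ?thesis using \<theta>_sq[OF x phi] by (simp add: eq_neg_iff_add_eq_0 add.commute)
qed

lemma w_lin:
 assumes "El s t n u \<in> elems V" "El s t n u' \<in> elems V" "El s t n (scl V a u + scl V b u') \<in> elems V" "phi \<in> Mlin V (s, t)"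
 shows "w (El s t n (scl V a u + scl V b u')) phi = a * w (El s t n u) phi + b * w (El s t n u') phi"
proof -
 let ?z = "scl V a u + scl V b u'"
 have e: "corolla (topEl d1 (El s t n z)) = Node (El s t (n + 1) (d1 (El s t n z))) (map Leaf s)" for z
  by (simp add: corolla_def topEl_def)
 have t: "corolla (topEl d1 (El s t n z)) \<in> trees V" "tcell (corolla (topEl d1 (El s t n z))) = (s, t)" if "El s t n z \<in> elems V" for z
  using corolla_V[OF d1_elems[OF that]] by simp_all
 have "phi (corolla (topEl d1 (El s t n ?z))) = a * phi (corolla (topEl d1 (El s t n u))) + b * phi (corolla (topEl d1 (El s t n u')))"
  by (rule Mlin_D[OF assms(4) _ t(1)[OF assms(1)] t(1)[OF assms(2)] t(1)[OF assms(3)] t(2)[OF assms(1)]])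
   (simp only: e d1_lin[OF assms(1,2)] tree_lin.here)
 then show ?thesis
  using \<theta>_lin[OF assms(4,1-3)] \<theta>_split[of "El s t n u" phi] \<theta>_split[of "El s t n u'" phi] \<theta>_split[of "El s t n ?z" phi] assms
  by (simp add: algebra_simps)
qed

lemma vec_\<theta>:
 assumes ev: "evaluation I X V m K" and x: "x \<in> elems V"
 shows "vec (scl X) (\<theta> x) (%T. evec (evE X m K T)) = K (topEl d1 x) + vec (scl X) (w x) (%T. evec (evE X m K T))"
proof -
 interpret ev: evaluation I X V m K by fact
 have c: "(etop x, ebot x) \<in> cells V" using x by (simp add: elems_def)
 show ?thesis proof (rule ev.X.functionals_separate)
  fix l assume l: "Vector_Spaces.linear (scl X) (*) l"
  show "l (vec (scl X) (\<theta> x) ev.ev) = l (K (topEl d1 x) + vec (scl X) (w x) ev.ev)"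
   unfolding ev.X.functional_simps(1)[OF l] ev.vec_ev(3)[OF \<theta>_comb[OF x] c l] ev.vec_ev(3)[OF w_comb[OF x] c l]
   using \<theta>_split[OF x ev.functional_ev_Mlin[OF l]] ev.ev_corolla[OF d1_elems[OF x]] by simp
 qed
qed

end


section \<open>The recursion for the lift\<close>

locale lifting = free_source V \<theta> I Y v + filtered_generators V \<theta> d1 w Fil + tf: trivial_fibration I X Y p
 for V :: "('k::field, 'i, 'e, 'v::ab_group_add) coll" and \<theta> :: "('i, 'e, 'v) el => ('k, 'i, 'e, 'v) tens"
  and I :: "'i set" and Y :: "('k, 'i, 'g, 'y::ab_group_add) twocat"
  and v :: "('i, 'e, 'g, ('k, 'i, 'e, 'v) tens, 'y) mor"
  and d1 :: "('i, 'e, 'v) el => 'v" and w :: "('i, 'e, 'v) el => ('k, 'i, 'e, 'v) tens"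
  and Fil :: "nat => ('i, 'e, 'v) el set"
  and X :: "('k, 'i, 'f, 'x::ab_group_add) twocat" and p :: "('i, 'f, 'g, 'x, 'y) mor" +
 fixes \<sigma> :: "('i, 'f) cell => int => 'y => 'x" and h :: "('i, 'f) cell => int => 'x => 'x"
  and h1 :: "'i => 'i => 'e => 'f" and m :: "('i, 'e) arr => ('i, 'f) arr"
 assumes \<sigma>_lin: "(s, t) \<in> cells X ==> Vector_Spaces.linear (scl Y) (scl X) (\<sigma> (s, t) n)"
  and \<sigma>: "(s, t) \<in> cells X ==> y \<in> cx Y (map (marr p) s, marr p t) n ==>
    \<sigma> (s, t) n y \<in> cx X (s, t) n \<and> mor2 p (El s t n (\<sigma> (s, t) n y)) = y"
  and h_N: "c \<in> cells X ==> e \<in> tf.N c n ==> h c n e \<in> tf.N c (n - 1)"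
  and h_homotopy: "c \<in> cells X ==> e \<in> tf.N c n ==> tf.dX c (n - 1) (h c n e) + h c (n + 1) (tf.dX c n e) = e"
  and h_lin: "c \<in> cells X ==> lin_on (scl X) (scl X) (tf.N c n) (h c n)"
  and m_def: "m = (%(i, e, j). (i, h1 i j e, j))"
  and m_arrows: "i \<in> I ==> j \<in> I ==> a \<in> arrows V i j ==> m a \<in> arrows X i j \<and> marr p (m a) = marr v a"
begin

abbreviation "ccell x \<equiv> (map m (etop x), m (ebot x))"

lemma m_Leaf_X: "Leaf a \<in> trees V ==> Leaf (m a) \<in> trees X \<and> marr p (m a) = marr v a"
 using m_arrows unfolding trees_Leaf_iff tf.A.objs_A objs_I by blast

lemma m_path: "is_path V i s j ==> i \<in> I ==> is_path X i (map m s) j"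
proof (induction s arbitrary: i)
 case (Cons a s)
 then obtain l where l: "l \<in> I" "a \<in> arrows V i l" "is_path V l s j" by (auto simp: objs_I)
 then show ?case using m_arrows[OF Cons.prems(2) l(1,2)] Cons.IH[OF l(3,1)] by (auto simp: tf.A.objs_A)
qed simp

lemma m_cells_X: "(s, t) \<in> cells V ==> (map m s, m t) \<in> cells X"
 and m_cells_p: "(s, t) \<in> cells V ==> map (marr p) (map m s) = map (marr v) s \<and> marr p (m t) = marr v t"
proof -
 assume st: "(s, t) \<in> cells V"
 then obtain i j where ij: "s \<noteq> []" "i \<in> I" "j \<in> I" "is_path V i s j" "t \<in> arrows V i j"
  by (auto simp: cells_iff objs_I)
 then show "(map m s, m t) \<in> cells X" unfolding cells_iff tf.A.objs_A using m_path[OF ij(4,2)] m_arrows[OF ij(2,3,5)] by blast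
 show "map (marr p) (map m s) = map (marr v) s \<and> marr p (m t) = marr v t" using cell_Leaf_trees[OF st] m_Leaf_X by auto
qed

lemma elems_ccell: "x \<in> elems V ==> ccell x \<in> cells X" "x \<in> elems V ==> (etop x, ebot x) \<in> cells V"
 using m_cells_X by (auto simp: elems_def)

definition S where "S x = \<sigma> (ccell x) (edeg x) (KY x)"

lemma S: 
 assumes x: "x \<in> elems V"
 shows "S x \<in> cx X (ccell x) (edeg x)" "mor2 p (transE m S x) = KY x"
proof -
 have "KY x \<in> cx Y (map (marr p) (map m (etop x)), marr p (m (ebot x))) (edeg x)"
  using Yev.K_mem[OF x] m_cells_p[OF elems_ccell(2)[OF x]] by (simp del: map_map)
 from \<sigma>[OF elems_ccell(1)[OF x] this] show "S x \<in> cx X (ccell x) (edeg x)" "mor2 p (transE m S x) = KY x"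
  by (simp_all add: S_def transE_def)
qed

lemma S_lin:
 assumes "El s t n u \<in> elems V" "El s t n u' \<in> elems V" "El s t n (scl V a u + scl V b u') \<in> elems V"
 shows "S (El s t n (scl V a u + scl V b u')) = scl X a (S (El s t n u)) + scl X b (S (El s t n u'))"
proof -
 interpret s: Vector_Spaces.linear "scl Y" "scl X" "\<sigma> (map m s, m t) n"
  by (rule \<sigma>_lin) (use elems_ccell(1)[OF assms(1)] in simp)
 show ?thesis using Yev.K_lin[OF assms] by (simp add: S_def s.add s.scale)
qed

text \<open>The property shared by all stages of the recursion: \<open>K\<close> is a linear lift of
  \<open>v\<close> on generators, compatible with cells and degrees.\<close>

definition good where
 "good K \<longleftrightarrow> evaluation I X V m K \<and> (\<forall>x\<in>elems V. mor2 p (transE m K x) = KY x)"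

text \<open>The failure to commute with the differentials when \<open>x\<close> and its
  \<open>d1\<close> part are sent by \<open>S\<close> and the rest is evaluated with
  \<open>K\<close>.\<close>

definition err where
 "err K x = diff X (transE m S x) - S (topEl d1 x) - vec (scl X) (w x) (%T. evec (evE X m K T))"

text \<open>\<open>Kn N\<close> has its final values on \<open>Fil N\<close>. Elsewhere it is still
  linear and lifts \<open>v\<close> by \<open>good_Kn\<close>, so every stage is a total map on
  generators and evaluation of trees with it makes sense.\<close>

primrec Kn :: "nat => ('i, 'e, 'v) el => 'x" where
 "Kn 0 = S"
| "Kn (Suc N) = (%x. S x - h (ccell x) (edeg x + 1) (err (Kn N) x))"

lemma p_vec:
 assumes g: "good K" and \<xi>: "fcomb (trdeg V (s, t) n) (Mlin V (s, t)) \<xi>" and c: "(s, t) \<in> cells V"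
 shows "mor2 p (El (map m s) (m t) n (vec (scl X) \<xi> (%T. evec (evE X m K T)))) = vec (scl Y) \<xi> Yev.ev"
proof (rule Y.functionals_separate)
 interpret ev: evaluation I X V m K using g by (simp add: good_def)
 fix l assume l: "Vector_Spaces.linear (scl Y) (*) l"
 let ?f = "%n u. l (mor2 p (El (map m s) (m t) n u))"
 have "?f n (vec (scl X) \<xi> ev.ev) = \<xi> (%T. l (Yev.ev T))" proof (rule ev.vec_ev_apply(1)[OF \<xi> c, where f="?f"])
  fix n a b u u' assume "u \<in> cx X (ev.mc (s, t)) n" "u' \<in> cx X (ev.mc (s, t)) n"
  then show "?f n (scl X a u + scl X b u') = a * ?f n u + b * ?f n u'"
   using tf.mor_lin[OF m_cells_X[OF c]] by (simp add: Y.functional_simps[OF l])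
 next
  fix T assume T: "T \<in> trees V" "tcell T = (s, t)"
  have "mE p (ev.E T) = evE Y (%a. marr p (m a)) (%x. mor2 p (ev.KE x)) T"
   by (rule tf.mE_evE[OF ev.evaluation_axioms T(1)])
  also have "\<dots> = Yev.E T" using g m_Leaf_X by (intro evE_cong_trees[OF _ _ T(1)]) (simp_all add: good_def)
  finally have "mor2 p (ev.E T) = Yev.ev T" by (metis tf.mE_simps(4))
  moreover have "El (map m s) (m t) (tdeg T) (ev.ev T) = ev.E T" using T(2) ev.E_El[of T] by auto
  ultimately show "?f (tdeg T) (ev.ev T) = l (Yev.ev T)" by simp
 qed
 then show "?f n (vec (scl X) \<xi> ev.ev) = l (vec (scl Y) \<xi> Yev.ev)" using Yev.vec_ev(3)[OF \<xi> c l] by simp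
qed

text \<open>The images under \<open>p\<close> of the three summands are known, and they cancel by
  \<open>KY_diff\<close> and \<open>vec_\<theta>\<close>, that is, because \<open>v\<close> commutes
  with the differentials.\<close>

lemma err_parts:
 assumes g: "good K" and x: "x \<in> elems V"
 shows "diff X (transE m S x) \<in> cx X (ccell x) (edeg x + 1)" "S (topEl d1 x) \<in> cx X (ccell x) (edeg x + 1)"
  "vec (scl X) (w x) (%T. evec (evE X m K T)) \<in> cx X (ccell x) (edeg x + 1)"
  "err K x \<in> tf.N (ccell x) (edeg x + 1)"
proof -
 interpret ev: evaluation I X V m K using g by (simp add: good_def)
 let ?c = "ccell x" and ?n = "edeg x + 1" and ?w = "vec (scl X) (w x) (%T. evec (evE X m K T))"
 note c = elems_ccell[OF x]
 have SE: "transE m S x \<in> elems X" using S(1)[OF x] c(1) by (simp add: elems_def)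
 show 1: "diff X (transE m S x) \<in> cx X ?c ?n" using tf.A.dE_elems[OF SE] by (simp add: elems_def dE_def)
 show 2: "S (topEl d1 x) \<in> cx X ?c ?n" using S(1)[OF d1_elems[OF x]] by simp
 show 3: "?w \<in> cx X ?c ?n" using ev.vec_ev(1)[OF w_comb[OF x] c(2)] by simp
 have p1: "mor2 p (El (fst ?c) (snd ?c) ?n (diff X (transE m S x))) = vec (scl Y) (\<theta> x) Yev.ev" proof -
  have "mE p (transE m S x) = Yev.KE x" using S(2)[OF x] m_cells_p[OF c(2)] by (intro el.expand) (simp del: map_map)
  then show ?thesis using tf.mor_diff[OF SE] KY_diff[OF x] by (simp add: dE_def)
 qed
 have p2: "mor2 p (El (fst ?c) (snd ?c) ?n (S (topEl d1 x))) = KY (topEl d1 x)"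
  using S(2)[OF d1_elems[OF x]] by (simp add: transE_def)
 have p3: "mor2 p (El (fst ?c) (snd ?c) ?n ?w) = vec (scl Y) (w x) Yev.ev" using p_vec[OF g w_comb[OF x] c(2)] by simp
 have sub: "tf.A.subspace (cx X ?c ?n)" by (rule tf.A.cx_subspace[OF c(1)])
 have d: "diff X (transE m S x) - S (topEl d1 x) \<in> cx X ?c ?n" by (rule tf.A.subspace_diff[OF sub 1 2])
 have "mor2 p (El (fst ?c) (snd ?c) ?n (err K x)) = 0"
  using tf.mor_lin[of "fst ?c" "snd ?c" _ ?n _ 1 "- 1"] c(1) 1 2 3 d p1 p2 p3
   vec_\<theta>[OF Yev.evaluation_axioms x] by (simp add: err_def)
 moreover have "err K x \<in> cx X ?c ?n" unfolding err_def by (rule tf.A.subspace_diff[OF sub d 3])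
 ultimately show "err K x \<in> tf.N ?c ?n" by (simp add: tf.N_def)
qed

lemma err_lin:
 assumes g: "good K" and e: "El s t n u \<in> elems V" "El s t n u' \<in> elems V" "El s t n (scl V a u + scl V b u') \<in> elems V"
 shows "err K (El s t n (scl V a u + scl V b u')) = scl X a (err K (El s t n u)) + scl X b (err K (El s t n u'))"
proof -
 interpret ev: evaluation I X V m K using g by (simp add: good_def)
 let ?z = "scl V a u + scl V b u'" and ?w = "%u. vec (scl X) (w (El s t n u)) ev.ev"
 have c: "(s, t) \<in> cells V" using e(1) by (simp add: elems_def)
 have SE: "El (map m s) (m t) n (S (El s t n y)) \<in> elems X" if "El s t n y \<in> elems V" for y
  using S(1)[OF that] m_cells_X[OF c] by (simp add: elems_def)
 have 1: "diff X (transE m S (El s t n ?z)) = scl X a (diff X (transE m S (El s t n u))) + scl X b (diff X (transE m S (El s t n u')))"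
  using tf.A.diff_lin[OF SE[OF e(1)] SE[OF e(2)]] S_lin[OF e] by (simp add: transE_def)
 have d: "topEl d1 (El s t n y) = El s t (n + 1) (d1 (El s t n y))" for y by (simp add: topEl_def)
 note de = d1_elems[OF e(1), unfolded d] d1_elems[OF e(2), unfolded d] d1_elems[OF e(3), unfolded d d1_lin[OF e(1,2)]]
 have 2: "S (topEl d1 (El s t n ?z)) = scl X a (S (topEl d1 (El s t n u))) + scl X b (S (topEl d1 (El s t n u')))"
  unfolding d d1_lin[OF e(1,2)] by (rule S_lin[OF de])
 have 3: "?w ?z = scl X a (?w u) + scl X b (?w u')" proof (rule tf.A.functionals_separate)
  fix l assume l: "Vector_Spaces.linear (scl X) (*) l"
  have "l (?w y) = w (El s t n y) (%T. l (ev.ev T))" if "El s t n y \<in> elems V" for y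
   using ev.vec_ev(3)[OF w_comb[OF that] _ l] c by simp
  then show "l (?w ?z) = l (scl X a (?w u) + scl X b (?w u'))"
   using w_lin[OF e ev.functional_ev_Mlin[OF l]] e by (simp add: tf.A.functional_simps[OF l])
 qed
 show ?thesis unfolding err_def 1 2 3 by (simp add: algebra_simps tf.A.scale_right_diff_distrib)
qed

lemma good_Kn: "good (Kn N)"
proof (induction N)
 case 0
 show ?case
  unfolding good_def
 proof (intro conjI ballI)
  show "evaluation I X V m (Kn 0)" by unfold_locales (use m_Leaf_X m_cells_X S(1) S_lin in simp_all)
 qed (use S(2) in simp)
next
 case (Suc N)
 have hN: "h (ccell x) (edeg x + 1) (err (Kn N) x) \<in> tf.N (ccell x) (edeg x)" if "x \<in> elems V" for x
  using h_N[OF elems_ccell(1)[OF that] err_parts(4)[OF Suc that]] by simp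
 have hX: "h (ccell x) (edeg x + 1) (err (Kn N) x) \<in> cx X (ccell x) (edeg x)" if "x \<in> elems V" for x
  using hN[OF that] by (simp add: tf.N_def)
 show ?case
  unfolding good_def
 proof (intro conjI ballI)
  show "evaluation I X V m (Kn (Suc N))" proof
   show "Leaf e \<in> trees V ==> Leaf (m e) \<in> trees X" "(s, t) \<in> cells V ==> (map m s, m t) \<in> cells X" for e s t
    using m_Leaf_X m_cells_X by blast+
   show "Kn (Suc N) x \<in> cx X (map m (etop x), m (ebot x)) (edeg x)" if "x \<in> elems V" for x
    using tf.A.subspace_diff[OF tf.A.cx_subspace[OF elems_ccell(1)[OF that]] S(1)[OF that] hX[OF that]] by simp
   fix s t n u u' a b
   assume e: "El s t n u \<in> elems V" "El s t n u' \<in> elems V" "El s t n (scl V a u + scl V b u') \<in> elems V"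
   have c: "(map m s, m t) \<in> cells X" using elems_ccell(1)[OF e(1)] by simp
   show "Kn (Suc N) (El s t n (scl V a u + scl V b u')) = scl X a (Kn (Suc N) (El s t n u)) + scl X b (Kn (Suc N) (El s t n u'))"
    using h_lin[OF c, of "n + 1", unfolded lin_on_def, rule_format, of "err (Kn N) (El s t n u)" "err (Kn N) (El s t n u')" a b]
     err_parts(4)[OF Suc e(1)] err_parts(4)[OF Suc e(2)] err_lin[OF Suc e] S_lin[OF e]
    by (simp add: algebra_simps tf.A.scale_right_diff_distrib)
  qed
  show "mor2 p (transE m (Kn (Suc N)) x) = KY x" if x: "x \<in> elems V" for x proof -
   have "mor2 p (El (map m (etop x)) (m (ebot x)) (edeg x) (scl X 1 (S x) + scl X (- 1) (h (ccell x) (edeg x + 1) (err (Kn N) x)))) =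
     scl Y 1 (mor2 p (El (map m (etop x)) (m (ebot x)) (edeg x) (S x))) +
     scl Y (- 1) (mor2 p (El (map m (etop x)) (m (ebot x)) (edeg x) (h (ccell x) (edeg x + 1) (err (Kn N) x))))"
    by (rule tf.mor_lin[OF elems_ccell(1)[OF x] S(1)[OF x] hX[OF x]])
   then show ?thesis using S(2)[OF x] hN[OF x] by (simp add: transE_def tf.N_def)
  qed
 qed
qed

end

context lifting
begin

abbreviation evX where "evX K \<equiv> %T. evec (evE X m K T)"

lemma goodD: "good K ==> evaluation I X V m K" by (simp add: good_def)

lemma vec_w_cong:
 assumes g: "good K" "good K'" and x: "x \<in> elems V" "x \<in> Fil (Suc N)"
  and eq: "\<And>y. y \<in> Fil N ==> y \<in> elems V ==> K y = K' y"
 shows "vec (scl X) (w x) (evX K) = vec (scl X) (w x) (evX K')"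
proof (rule tf.A.functionals_separate)
 fix l assume l: "Vector_Spaces.linear (scl X) (*) l"
 interpret e: evaluation I X V m K by (rule goodD[OF g(1)])
 interpret e': evaluation I X V m K' by (rule goodD[OF g(2)])
 note c = elems_ccell(2)[OF x(1)]
 have "w x (%T. l (e.ev T)) = w x (%T. l (e'.ev T))"
 proof (rule fcomb_cong[OF Fil_w[OF x(2,1)] e.functional_ev_Mlin[OF l] e'.functional_ev_Mlin[OF l]])
  fix T assume "T \<in> {T \<in> trdeg V (etop x, ebot x) (edeg x + 1). decs T \<subseteq> Fil N}"
  then have T: "T \<in> trees V" "decs T \<subseteq> Fil N" by auto
  have "decs T \<subseteq> elems V" using T(1) by (induction rule: trees.induct) auto
  with T(2) have "evE X m K T = evE X m K' T" by (intro evE_cong eq) auto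
  then show "l (e.ev T) = l (e'.ev T)" by simp
 qed
 then show "l (vec (scl X) (w x) (evX K)) = l (vec (scl X) (w x) (evX K'))"
  using e.vec_ev(3)[OF w_comb[OF x(1)] c l] e'.vec_ev(3)[OF w_comb[OF x(1)] c l] by simp
qed

lemma good_zero:
 assumes g: "good K" and x: "x \<in> elems V" "evec x = 0"
 shows "K x = 0"
proof -
 interpret e: evaluation I X V m K by (rule goodD[OF g])
 have "El (etop x) (ebot x) (edeg x) 0 = x" using x(2) by (intro el.expand) simp
 then show ?thesis using e.K_zero[of "etop x" "ebot x" "edeg x" 0 0] x(1) by simp
qed

text \<open>The correction at an element of \<open>Fil (Suc N)\<close> sees \<open>Kn\<close> only
  through \<open>w x\<close>, hence only on \<open>Fil N\<close>, where the values are already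
  stable. On \<open>Fil 0\<close> both values are zero.\<close>

lemma Kn_Suc: "x \<in> elems V ==> x \<in> Fil N ==> Kn (Suc N) x = Kn N x"
proof (induction N arbitrary: x)
 case 0
 then show ?case using good_zero[OF good_Kn] Fil_0 by metis
next
 case (Suc N)
 have "vec (scl X) (w x) (evX (Kn (Suc N))) = vec (scl X) (w x) (evX (Kn N))"
  by (rule vec_w_cong[OF good_Kn good_Kn Suc.prems]) (rule Suc.IH)
 then have "err (Kn (Suc N)) x = err (Kn N) x" by (simp only: err_def)
 then show ?case by (simp only: Kn.simps(2))
qed

lemma Fil_mono: "M \<le> N ==> Fil M \<subseteq> Fil N" by (rule lift_Suc_mono_le[of Fil, OF Fil_Suc])

lemma Kn_mono: "M \<le> N ==> x \<in> elems V ==> x \<in> Fil M ==> Kn N x = Kn M x"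
proof (induction N rule: dec_induct)
 case (step N)
 then show ?case using Kn_Suc[of x N] Fil_mono[of M N] by auto
qed simp

text \<open>On the kernel, \<open>d h + h d = 1\<close> turns \<open>d (h (err x))\<close> into
  \<open>err x + h (err (d1 x))\<close>. Subtracting \<open>err x\<close> from
  \<open>d (S x)\<close> leaves \<open>S (d1 x)\<close> and the evaluated rest, and the second
  summand changes \<open>S (d1 x)\<close> into the corrected value at \<open>d1 x\<close>.\<close>

lemma Kn_diff:
 "x \<in> elems V ==> x \<in> Fil N ==> diff X (transE m (Kn N) x) = vec (scl X) (\<theta> x) (evX (Kn N))"
proof (induction N arbitrary: x)
 case 0
 note x = 0
 interpret e: evaluation I X V m "Kn 0" by (rule goodD[OF good_Kn])
 have z: "evec x = 0" using Fil_0 x by blast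
 have K0: "Kn 0 x = 0" by (rule good_zero[OF good_Kn x(1) z])
 have d0: "d1 x = 0" using d1_lin[of "etop x" "ebot x" "edeg x" 0 0 0 0] x(1) z by (cases x) simp
 have dz: "Kn 0 (topEl d1 x) = 0" using good_zero[OF good_Kn[of 0] d1_elems[OF x(1)]] d0 by simp
 have "vec (scl X) (w x) (evX (Kn 0)) = 0" proof (rule tf.A.functionals_separate)
  fix l assume l: "Vector_Spaces.linear (scl X) (*) l"
  have "w x (%T. l (e.ev T)) = 0"
   using w_lin[of "etop x" "ebot x" "edeg x" 0 0 0 0 "%T. l (e.ev T)"] x(1) z e.functional_ev_Mlin[OF l] by (cases x) simp
  then show "l (vec (scl X) (w x) (evX (Kn 0))) = l 0"
   using e.vec_ev(3)[OF w_comb[OF x(1)] elems_ccell(2)[OF x(1)] l] by (simp add: tf.A.functional_simps[OF l])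
 qed
 then show ?case
  using vec_\<theta>[OF e.evaluation_axioms x(1)] dz K0 tf.A.diff_zero[OF elems_ccell(1)[OF x(1)]] by (simp add: transE_def)
next
 case (Suc N)
 note x = Suc.prems
 let ?K = "Kn N" and ?c = "ccell x" and ?n = "edeg x" and ?y = "topEl d1 x"
 note g = good_Kn[of N]
 interpret e: free_evaluation I X V m ?K \<theta> using goodD[OF g] derivation_data_axioms by (rule free_evaluation.intro)
 let ?w = "%x. vec (scl X) (w x) e.ev"
 note c = elems_ccell[OF x(1)] and y = d1_elems[OF x(1)]
 note parts = err_parts[OF g x(1)] and hom = h_homotopy[OF c(1)]
 have E: "err ?K x \<in> tf.N ?c (?n + 1)" "err ?K ?y \<in> tf.N ?c (?n + 2)"
  using parts(4) err_parts(4)[OF g y] by (simp_all add: add.assoc)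
 \<comment> \<open>The induction hypothesis enters here: \<open>w x\<close> consists of trees
   decorated from \<open>Fil N\<close>, where \<open>Kn N\<close> commutes with the differentials,
   so its evaluation may be differentiated on trees; then \<open>w_square\<close> applies.\<close>
 have dw: "tf.dX ?c (?n + 1) (?w x) = - ?w ?y" proof (rule tf.A.functionals_separate)
  fix l assume l: "Vector_Spaces.linear (scl X) (*) l"
  let ?l = "%T. l (e.ev T)"
  have lm: "?l \<in> Mlin V c" for c by (rule e.functional_ev_Mlin[OF l])
  have "l (diff X (El (map m (fst (etop x, ebot x))) (m (snd (etop x, ebot x))) (?n + 1) (?w x))) = w x (%T. D T ?l)"
  proof (rule e.diff_vec_ev[OF Fil_w[OF x(2,1)] c(2) l])
   fix T assume T: "T \<in> trees V" "decs T \<subseteq> Fil N"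
   have "decs T \<subseteq> elems V" using T(1) by (induction rule: trees.induct) auto
   then have "diff X (e.E T) = vec (scl X) (D T) e.ev" using T(2) by (intro e.E_diff[OF T(1)] Suc.IH) auto
   then show "l (diff X (e.E T)) = D T ?l" using e.vec_ev(3)[OF at_comb[OF T(1)] trees_cells[OF T(1)] l] by simp
  qed (rule at_Mlin[OF lm])
  also have "\<dots> = - w ?y ?l" by (rule w_square[OF x(1) lm])
  also have "\<dots> = l (- ?w ?y)" using e.vec_ev(3)[OF w_comb[OF y] _ l] c(2) by (simp add: tf.A.functional_simps[OF l])
  finally show "l (tf.dX ?c (?n + 1) (?w x)) = l (- ?w ?y)" by simp
 qed
 note lin = tf.dX_facts(3)[OF c(1)]
 have SX: "S x \<in> cx X ?c ?n" by (rule S(1)[OF x(1)])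
 have dS: "diff X (transE m S x) = tf.dX ?c ?n (S x)" "diff X (transE m S ?y) = tf.dX ?c (?n + 1) (S ?y)"
  by (simp_all add: transE_def)
 have "topEl d1 ?y \<in> elems V" by (rule d1_elems[OF y])
 from good_zero[OF good_Kn[of 0] this] have SS: "S (topEl d1 ?y) = 0" using d1_sq[OF x(1)] by simp
 have sub: "tf.A.subspace (cx X ?c (?n + 1))" by (rule tf.A.cx_subspace[OF c(1)])
 have "tf.dX ?c (?n + 1) (err ?K x) = tf.dX ?c (?n + 1) (scl X 1 (tf.dX ?c ?n (S x)) + scl X (- 1) (S ?y + ?w x))"
  by (simp add: err_def dS algebra_simps)
 also have "\<dots> = scl X 1 (tf.dX ?c (?n + 1) (tf.dX ?c ?n (S x))) + scl X (- 1) (tf.dX ?c (?n + 1) (S ?y + ?w x))"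
  by (rule lin) (use parts(1-3) tf.A.subspace_add[OF sub] in "simp_all add: dS")
 also have "tf.dX ?c (?n + 1) (tf.dX ?c ?n (S x)) = 0" by (rule tf.dX_facts(2)[OF c(1) SX])
 also have "tf.dX ?c (?n + 1) (S ?y + ?w x) = tf.dX ?c (?n + 1) (S ?y) + tf.dX ?c (?n + 1) (?w x)"
  using lin[OF parts(2,3), of 1 1] by simp
 finally have dE: "tf.dX ?c (?n + 1) (err ?K x) = - err ?K ?y" unfolding err_def[of ?K ?y] dS(2) SS dw by simp
 have E2: "err ?K ?y \<in> tf.N ?c (?n + 1 + 1)" using E(2) by (simp only: add.assoc one_add_one)
 have "h ?c (?n + 1 + 1) (scl X (- 1) (err ?K ?y) + scl X 0 (err ?K ?y)) =
   scl X (- 1) (h ?c (?n + 1 + 1) (err ?K ?y)) + scl X 0 (h ?c (?n + 1 + 1) (err ?K ?y))"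
  using h_lin[OF c(1), of "?n + 1 + 1"] E2 unfolding lin_on_def by blast
 then have hneg: "h ?c (?n + 1 + 1) (- err ?K ?y) = - h ?c (?n + 1 + 1) (err ?K ?y)"
  by (simp only: tf.A.scale_minus_left tf.A.scale_one tf.A.scale_zero_left add_0_right)
 have Eh: "h ?c (?n + 1) (err ?K x) \<in> cx X ?c ?n" using h_N[OF c(1) E(1)] by (simp add: tf.N_def)
 have "tf.dX ?c ?n (Kn (Suc N) x) = tf.dX ?c ?n (scl X 1 (S x) + scl X (- 1) (h ?c (?n + 1) (err ?K x)))" by simp
 also have "\<dots> = scl X 1 (tf.dX ?c ?n (S x)) + scl X (- 1) (tf.dX ?c ?n (h ?c (?n + 1) (err ?K x)))" by (rule lin[OF SX Eh])
 \<comment> \<open>The sign of the second summand comes from \<open>dE\<close>: the differential of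
   the defect at \<open>x\<close> is minus the defect at \<open>d1 x\<close>.\<close>
 also have "tf.dX ?c ?n (h ?c (?n + 1) (err ?K x)) = err ?K x + h ?c (?n + 1 + 1) (err ?K ?y)"
  using hom[OF E(1)] unfolding dE hneg by (simp add: algebra_simps)
 also have "scl X 1 (tf.dX ?c ?n (S x)) + scl X (- 1) (err ?K x + h ?c (?n + 1 + 1) (err ?K ?y)) =
   (S ?y - h ?c (?n + 1 + 1) (err ?K ?y)) + ?w x" by (simp add: err_def[of ?K x] dS)
 also have "S ?y - h ?c (?n + 1 + 1) (err ?K ?y) = Kn (Suc N) ?y" by simp
 also have "?w x = vec (scl X) (w x) (evX (Kn (Suc N)))" by (rule vec_w_cong[OF g good_Kn x]) (simp add: Kn_Suc del: Kn.simps)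
 also have "Kn (Suc N) ?y + \<dots> = vec (scl X) (\<theta> x) (evX (Kn (Suc N)))"
  by (rule vec_\<theta>[OF goodD[OF good_Kn] x(1), symmetric])
 finally show ?case by (simp add: transE_def del: Kn.simps)
qed

definition KK where "KK x = Kn (LEAST N. x \<in> Fil N) x"

lemma KK_eq: "x \<in> elems V ==> x \<in> Fil N ==> KK x = Kn N x"
 unfolding KK_def using Kn_mono[OF Least_le[of "%N. x \<in> Fil N"] _ LeastI[of "%N. x \<in> Fil N"]] by metis

lemma good_KK: "good KK"
 unfolding good_def
proof (intro conjI ballI)
 have ex: "\<exists>N. x \<in> Fil N \<and> KK x = Kn N x" if "x \<in> elems V" for x using Fil_ex[OF that] KK_eq[OF that] by blast
 show "evaluation I X V m KK" proof
  show "Leaf e \<in> trees V ==> Leaf (m e) \<in> trees X" "(s, t) \<in> cells V ==> (map m s, m t) \<in> cells X" for e s t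
   using m_Leaf_X m_cells_X by blast+
  show "KK x \<in> cx X (map m (etop x), m (ebot x)) (edeg x)" if "x \<in> elems V" for x
   using ex[OF that] evaluation.K_mem[OF goodD[OF good_Kn] that] by metis
  fix s t n u u' a b
  assume e: "El s t n u \<in> elems V" "El s t n u' \<in> elems V" "El s t n (scl V a u + scl V b u') \<in> elems V"
  \<comment> \<open>A common stage is needed for the two vectors and for their combination, because
    the stages are arbitrary sets and the combination has a stage of its own.\<close>
  obtain N1 N2 N3 where "El s t n u \<in> Fil N1" "El s t n u' \<in> Fil N2" "El s t n (scl V a u + scl V b u') \<in> Fil N3"
   using Fil_ex e by meson
  then have f: "El s t n u \<in> Fil (max N1 (max N2 N3))" "El s t n u' \<in> Fil (max N1 (max N2 N3))"
    "El s t n (scl V a u + scl V b u') \<in> Fil (max N1 (max N2 N3))"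
   using Fil_mono[of N1 "max N1 (max N2 N3)"] Fil_mono[of N2 "max N1 (max N2 N3)"] Fil_mono[of N3 "max N1 (max N2 N3)"] by (auto simp: le_max_iff_disj)
  show "KK (El s t n (scl V a u + scl V b u')) = scl X a (KK (El s t n u)) + scl X b (KK (El s t n u'))"
   unfolding KK_eq[OF e(1) f(1)] KK_eq[OF e(2) f(2)] KK_eq[OF e(3) f(3)] by (rule evaluation.K_lin[OF goodD[OF good_Kn] e])
 qed
 show "mor2 p (transE m KK x) = KY x" if x: "x \<in> elems V" for x proof -
  obtain N where "KK x = Kn N x" using ex[OF x] by blast
  then show ?thesis using good_Kn[of N] x by (simp add: good_def transE_def del: Kn.simps)
 qed
qed

lemma KK_diff:
 assumes x: "x \<in> elems V"
 shows "diff X (transE m KK x) = vec (scl X) (\<theta> x) (evX KK)"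
proof -
 obtain N where "x \<in> Fil N" using Fil_ex[OF x] by blast
 \<comment> \<open>The index is raised by one, because it is for elements of
   \<open>Fil (Suc N)\<close> that \<open>Fil_w\<close> bounds the decorations in
   \<open>w x\<close>, by \<open>Fil N\<close>.\<close>
 then have N: "x \<in> Fil (Suc N)" by (rule subsetD[OF Fil_Suc])
 have "diff X (transE m KK x) = diff X (transE m (Kn (Suc N)) x)" by (simp only: transE_def KK_eq[OF x N])
 also have "\<dots> = vec (scl X) (\<theta> x) (evX (Kn (Suc N)))" by (rule Kn_diff[OF x N])
 also have "\<dots> = Kn (Suc N) (topEl d1 x) + vec (scl X) (w x) (evX (Kn (Suc N)))"
  by (rule vec_\<theta>[OF goodD[OF good_Kn] x])
 also have "Kn (Suc N) (topEl d1 x) = KK (topEl d1 x)" by (rule KK_eq[OF d1_elems[OF x] Fil_d1[OF N x], symmetric])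
 also have "vec (scl X) (w x) (evX (Kn (Suc N))) = vec (scl X) (w x) (evX KK)" proof (rule vec_w_cong[OF good_Kn good_KK x N])
  fix y assume "y \<in> Fil N" "y \<in> elems V"
  then show "Kn (Suc N) y = KK y" using KK_eq[of y "Suc N"] subsetD[OF Fil_Suc, of y N] by simp
 qed
 also have "KK (topEl d1 x) + vec (scl X) (w x) (evX KK) = vec (scl X) (\<theta> x) (evX KK)"
  by (rule vec_\<theta>[OF goodD[OF good_KK] x, symmetric])
 finally show ?thesis .
qed

lemma lift_exists: "\<exists>H. is_mor F X H \<and> mor_eq F (mor_comp p H) v"
proof -
 interpret e: evaluation I X V m KK by (rule goodD[OF good_KK])
 interpret fm: free_morphism I X V m KK \<theta> h1
 proof
  show "m = (%(i, e, j). (i, h1 i j e, j))" by (rule m_def)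
  show "objs V = I" by (rule objs_I)
  show "h1 i j ` onemor V i j \<subseteq> onemor X i j" if "i \<in> objs V" "j \<in> objs V" for i j proof
   fix f assume "f \<in> h1 i j ` onemor V i j"
   then obtain e where "e \<in> onemor V i j" "f = h1 i j e" by blast
   then have "m (i, e, j) \<in> arrows X i j" using m_arrows[of i j "(i, e, j)"] that by (simp add: arrows_def objs_I)
   then show "f \<in> onemor X i j" by (simp add: m_def arrows_def \<open>f = h1 i j e\<close>)
  qed
  show "x \<in> elems V ==> diff X (transE m KK x) = vec (scl X) (\<theta> x) (evX KK)" for x by (rule KK_diff)
 qed
 have "mor1 p i j (h1 i j e) = mor1 v i j e" if "i \<in> I" "j \<in> I" "e \<in> onemor V i j" for i j e
  using m_arrows[of i j "(i, e, j)"] that by (simp add: arrows_def m_def marr_def)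
 moreover have "mor2 p (mE fm.extension x) = mor2 v x" if x: "x \<in> elems F" for x
 proof -
  note fc = fm.elems_comb[OF x]
  have "mor2 p (mE fm.extension x) = vec (scl Y) (evec x) Yev.ev"
   using p_vec[OF good_KK fc] by (simp add: mE_def fm.mor2_extension)
  also have "\<dots> = mor2 v (El (etop x) (ebot x) (edeg x) (evec x))"
   using x by (intro mor_vec[symmetric]) (simp_all add: F_elems)
  finally show ?thesis by simp
 qed
 ultimately have "mor_eq F (mor_comp p fm.extension) v" by (simp add: mor_eq_def mor_comp_def objs_I fm.extension_def)
 with fm.extension_is_mor show ?thesis by blast
qed

end

theorem (in filtered_generators) lift_trivial_fibration:
 fixes X :: "('k, 'i, 'f, 'x::ab_group_add) twocat" and Y :: "('k, 'i, 'g, 'y::ab_group_add) twocat"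
 assumes XY: "two_cat I X" "two_cat I Y" and p: "is_mor X Y p" "fibration X Y p" "weak_equivalence X Y p"
  and v: "objs V = I" "is_mor F Y v"
 shows "\<exists>H. is_mor F X H \<and> mor_eq F (mor_comp p H) v"
proof -
 interpret tf: trivial_fibration I X Y p using XY p by unfold_locales
 interpret src: free_source V \<theta> I Y v using v by unfold_locales
 obtain \<sigma> where \<sigma>: "\<forall>s t n. (s, t) \<in> cells X \<longrightarrow> Vector_Spaces.linear (scl Y) (scl X) (\<sigma> (s, t) n) \<and>
  (\<forall>y\<in>cx Y (map (marr p) s, marr p t) n. \<sigma> (s, t) n y \<in> cx X (s, t) n \<and> mor2 p (El s t n (\<sigma> (s, t) n y)) = y)"
  by (rule exE[OF tf.section_exists])
 obtain h where h: "\<forall>c\<in>cells X. \<forall>n. (\<forall>e\<in>tf.N c n. h c n e \<in> tf.N c (n - 1) \<and> tf.dX c (n - 1) (h c n e) + h c (n + 1) (tf.dX c n e) = e) \<and>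
  lin_on (scl X) (scl X) (tf.N c n) (h c n)" by (rule exE[OF tf.contraction_exists])
 \<comment> \<open>A chosen arrow over \<open>marr v (i, e, j)\<close> again leads from
   \<open>i\<close> to \<open>j\<close>; its label is the middle component.\<close>
 define h1 where "h1 i j e = fst (snd (SOME a'. a' \<in> arrows X i j \<and> marr p a' = marr v (i, e, j)))" for i j e
 define m where "m = (%(i, e, j). (i, h1 i j e, j))"
 have m: "m a \<in> arrows X i j \<and> marr p (m a) = marr v a" if ij: "i \<in> I" "j \<in> I" and a: "a \<in> arrows V i j" for i j a
 proof -
  obtain e where e: "a = (i, e, j)" using a by (auto simp: arrows_def)
  have "marr v a \<in> arrows Y i j" using src.mor.arrows_mor[OF ij] a by simp
  from tf.arrow_lift[OF ij this] have "\<exists>a'. a' \<in> arrows X i j \<and> marr p a' = marr v (i, e, j)" by (auto simp: e)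
  from someI_ex[OF this] obtain f where f: "(SOME a'. a' \<in> arrows X i j \<and> marr p a' = marr v (i, e, j)) = (i, f, j)"
    "(i, f, j) \<in> arrows X i j \<and> marr p (i, f, j) = marr v (i, e, j)" by (auto simp: arrows_def)
  then have "m a = (i, f, j)" by (simp add: m_def h1_def e)
  then show ?thesis using f(2) by (simp add: e)
 qed
 interpret L: lifting V \<theta> I Y v d1 w Fil X p \<sigma> h h1 m
 proof (intro lifting.intro lifting_axioms.intro)
  show "free_source V \<theta> I Y v" "filtered_generators V \<theta> d1 w Fil" "trivial_fibration I X Y p"
   by (rule src.free_source_axioms filtered_generators_axioms tf.trivial_fibration_axioms)+
  note \<sigma>' = \<sigma>[THEN spec, THEN spec, THEN spec, THEN mp]
  show "Vector_Spaces.linear (scl Y) (scl X) (\<sigma> (s, t) n)" if "(s, t) \<in> cells X" for s t n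
   by (rule conjunct1[OF \<sigma>'[OF that]])
  show "\<sigma> (s, t) n y \<in> cx X (s, t) n \<and> mor2 p (El s t n (\<sigma> (s, t) n y)) = y"
   if "(s, t) \<in> cells X" "y \<in> cx Y (map (marr p) s, marr p t) n" for s t y n
   by (rule bspec[OF conjunct2[OF \<sigma>'[OF that(1)]] that(2)])
  show "h c n e \<in> tf.N c (n - 1)" "tf.dX c (n - 1) (h c n e) + h c (n + 1) (tf.dX c n e) = e"
   if "c \<in> cells X" "e \<in> tf.N c n" for c e n
   using bspec[OF conjunct1[OF spec[OF bspec[OF h that(1)]]] that(2)] by simp_all
  show "lin_on (scl X) (scl X) (tf.N c n) (h c n)" if "c \<in> cells X" for c n by (rule conjunct2[OF spec[OF bspec[OF h that]]])
  show "m = (%(i, e, j). (i, h1 i j e, j))" by (rule m_def)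
  show "i \<in> I ==> j \<in> I ==> a \<in> arrows V i j ==> m a \<in> arrows X i j \<and> marr p (m a) = marr v a" for i j a
   by (rule m)
 qed
 show ?thesis by (rule L.lift_exists)
qed

section \<open>The filtration by the number of vertices\<close>

lemma at_vertices_plus:
 "at_vertices (%x ts phi. rho x ts phi + rho' x ts phi) T phi = at_vertices rho T phi + at_vertices rho' T phi"
 "forest_at (%x ts phi. rho x ts phi + rho' x ts phi) ts psi = forest_at rho ts psi + forest_at rho' ts psi"
 by (induction T and ts arbitrary: phi and psi rule: tree_induct) (simp_all add: algebra_simps)

context augmented
begin

abbreviation "B0 \<equiv> at_vertices internal.rho"

definition rho1 :: "('i, 'e, 'v) el => ('i, 'e, 'v) dtree list => ('k, 'i, 'e, 'v) tens" where
 "rho1 x ts = (%phi. sg (edeg x + 1) * pick ts (%as y us bs. phi (Node (glue A x (length as) y) (as @ us @ bs))))"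

abbreviation "B1 \<equiv> at_vertices rho1"

lemma B_split: "B T phi = B0 T phi + B1 T phi"
proof -
 have "full.rho = (%x ts phi. internal.rho x ts phi + rho1 x ts phi)"
  by (intro ext) (simp add: full.rho_def internal.rho_def rho1_def)
 then show ?thesis by (simp only: at_vertices_plus(1))
qed

lemma B0_comb:
 assumes "T \<in> trees V"
 shows "fcomb {S \<in> trees_node V (tcell T) (tdeg T + 1). vcount S = vcount T} UNIV (B0 T)"
proof -
 have "fcomb {S \<in> trees_node V (tcell T) (tdeg T + 1). vcount S + 0 = vcount T} UNIV (B0 T)"
 proof (rule at_comb_vcount(1)[OF _ _ assms, where R="%a b. a + 0 = b"])
  fix x ts assume "Node x ts \<in> trees V"
  then have "fcomb {S \<in> trees_node V (fleaves ts, ebot x) (edeg x + deg_sum ts + 1). vcount S + 0 = vcount (Node x ts)}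
    UNIV (%phi. phi (Node (dE V x) ts))" by (intro fcomb_point) (auto simp: full.dE_elems)
  then show "fcomb {S \<in> trees_node V (fleaves ts, ebot x) (edeg x + deg_sum ts + 1). vcount S + 0 = vcount (Node x ts)}
    UNIV (internal.rho x ts)" by (simp add: internal.rho_def[abs_def])
 qed simp
 then show ?thesis by simp
qed

lemma B1_comb:
 assumes "T \<in> trees V"
 shows "fcomb {S \<in> trees_node V (tcell T) (tdeg T + 1). vcount S + 1 = vcount T} UNIV (B1 T)"
proof (rule at_comb_vcount(1)[OF _ _ assms, where R="%a b. a + 1 = b"])
 fix x ts assume N: "Node x ts \<in> trees V"
 show "fcomb {S \<in> trees_node V (fleaves ts, ebot x) (edeg x + deg_sum ts + 1). vcount S + 1 = vcount (Node x ts)} UNIV (rho1 x ts)"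
  unfolding rho1_def
 proof (intro fcomb_scale pick_comb fcomb_point)
  fix as y us bs assume ts: "ts = as @ Node y us # bs"
  show "Node (glue A x (length as) y) (as @ us @ bs) \<in>
    {S \<in> trees_node V (fleaves ts, ebot x) (edeg x + deg_sum ts + 1). vcount S + 1 = vcount (Node x ts)}"
   using full.contract_trees[of x as y us bs] N by (simp add: ts full.g_simps)
 qed
qed simp

text \<open>The part of \<open>\<Theta>\<close> whose terms are decorated by trees with fewer
  vertices than \<open>T\<close>: contractions of a chord and cuts.\<close>

definition \<Omega> :: "('i, 'e, 'v) dtree => (('i, 'e, ('k, 'i, 'e, 'v) tens) dtree => 'k) => 'k" where
 "\<Omega> T phi = - B1 T (%S. phi (corolla (gen S))) +
  cut_sum T (%T' p U. sg (tdeg T') * phi (two_vertex_tree (gen T') p (gen U)))"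

lemma \<Theta>_\<Omega>: "\<Theta> T phi = - B0 T (%S. phi (corolla (gen S))) + \<Omega> T phi"
 by (simp add: \<Theta>_def \<Omega>_def B_split)

lemma \<Omega>_Mlin: "phi \<in> Mlin W c ==> (%T. \<Omega> T phi) \<in> Mlin V c"
proof -
 assume phi: "phi \<in> Mlin W c"
 have "(%T. \<Theta> T phi + B0 T (%S. phi (corolla (gen S)))) \<in> Mlin V c"
  by (rule Mlin_plus[OF \<Theta>_Mlin[OF phi] internal.bar.at_Mlin[OF gen_Mlin[OF phi]]])
 then show ?thesis by (simp add: \<Theta>_\<Omega>)
qed

text \<open>The internal differential of the bar construction, with the sign of the desuspension. It
  is set to zero at functions that are not multilinear, as tensors are.\<close>

definition d1 :: "('i, 'e, ('k, 'i, 'e, 'v) tens) el => ('k, 'i, 'e, 'v) tens" where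
 "d1 x = (%psi. if psi \<in> Mlin V (etop x, ebot x) then - evec x (%T. B0 T psi) else 0)"

definition rest :: "('i, 'e, ('k, 'i, 'e, 'v) tens) el => (('i, 'e, ('k, 'i, 'e, 'v) tens) dtree => 'k) => 'k" where
 "rest x phi = evec x (%T. \<Omega> T phi)"

abbreviation few :: "nat => ('i, 'e) cell => int => ('i, 'e, 'v) dtree set" where
 "few N c n \<equiv> {T \<in> trees_node V c n. vcount T \<le> N}"

definition Fil :: "nat => ('i, 'e, ('k, 'i, 'e, 'v) tens) el set" where
 "Fil N = {x \<in> elems W. evec x \<in> module.span tscale (ptens V ` few N (etop x, ebot x) (edeg x - 1))}"

lemma few_subset: "few N c n \<subseteq> trees_of V c" using trees_node_subset by blast

lemma Fil_iff: "x \<in> Fil N \<longleftrightarrow> x \<in> elems W \<and> fcomb (few N (etop x, ebot x) (edeg x - 1)) (Mlin V (etop x, ebot x)) (evec x)"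
proof -
 have "\<forall>phi. phi \<notin> Mlin V (etop x, ebot x) \<longrightarrow> evec x phi = 0" if "x \<in> elems W"
  using that by (simp add: elems_def W_cx ptens_span_iff[OF trees_node_subset])
 then show ?thesis unfolding Fil_def mem_Collect_eq ptens_span_iff[OF few_subset] by blast
qed

lemma elems_comb: "x \<in> elems W ==> fcomb (trees_node V (etop x, ebot x) (edeg x - 1)) (Mlin V (etop x, ebot x)) (evec x)"
 by (rule W_cx_comb) (simp add: elems_def)

lemma Fil_exists: "x \<in> elems W ==> \<exists>N. x \<in> Fil N"
proof -
 assume x: "x \<in> elems W"
 obtain L where L: "\<And>a T. (a, T) \<in> set L ==> T \<in> trees_node V (etop x, ebot x) (edeg x - 1)"
   "\<And>phi. phi \<in> Mlin V (etop x, ebot x) ==> evec x phi = (\<Sum>(a, T)\<leftarrow>L. a * phi T)"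
  using elems_comb[OF x] by (rule fcombE) blast
 \<comment> \<open>A crude common bound for the numbers of vertices of the finitely many trees in
   the combination.\<close>
 let ?N = "sum_list (map (%(a, T). vcount T) L)"
 have "fcomb (few ?N (etop x, ebot x) (edeg x - 1)) (Mlin V (etop x, ebot x)) (evec x)" proof (rule fcombI[of L])
  fix a T assume aT: "(a, T) \<in> set L"
  then have "vcount T \<in> set (map (%(a, T). vcount T) L)" by force
  then have "vcount T \<le> ?N" by (intro member_le_sum_list) simp_all
  with L(1)[OF aT] show "T \<in> few ?N (etop x, ebot x) (edeg x - 1)" by simp
 qed (rule L(2))
 with x show ?thesis unfolding Fil_iff by blast
qed

lemma gen_Fil: "S \<in> trees V ==> \<exists>x ts. S = Node x ts ==> vcount S \<le> N ==> gen S \<in> Fil N"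
proof -
 assume S: "S \<in> trees V" "\<exists>x ts. S = Node x ts" "vcount S \<le> N"
 interpret M: vector_space "tscale :: 'k => ('k, 'i, 'e, 'v) tens => _" by (rule vector_space_tscale)
 have "S \<in> few N (tcell S) (tdeg S)" using S by auto
 then show ?thesis using gen_elems[OF S(1,2)] by (simp add: Fil_def M.span_base)
qed

lemma d1_facts:
 assumes x: "x \<in> elems W"
 shows "topEl d1 x \<in> elems W"
  and "phi \<in> Mlin W (etop x, ebot x) ==> phi (corolla (topEl d1 x)) = - evec x (%T. B0 T (%S. phi (corolla (gen S))))"
proof -
 note v = vertex_op_eval[OF x internal.B_comb internal.bar.at_Mlin, of "d1 x"]
 show "topEl d1 x \<in> elems W" using v(1) x by (simp add: d1_def elems_def topEl_def)
 show "phi \<in> Mlin W (etop x, ebot x) ==> phi (corolla (topEl d1 x)) = - evec x (%T. B0 T (%S. phi (corolla (gen S))))"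
  using v(2) by (simp add: d1_def topEl_def)
qed

text \<open>A contraction loses one vertex, and a cut distributes the vertices among two
  decorations. The degree grows by two: one for the differential and one for the desuspension in
  \<open>gen\<close>.\<close>

lemma \<Omega>_comb:
 assumes T: "T \<in> trees V" "vcount T \<le> Suc N"
 shows "fcomb {R \<in> trdeg W (tcell T) (tdeg T + 2). decs R \<subseteq> Fil N} G (\<Omega> T)"
proof -
 let ?S = "{R \<in> trdeg W (tcell T) (tdeg T + 2). decs R \<subseteq> Fil N}"
 have 1: "fcomb ?S G (%phi. B1 T (%S. 1 * phi (corolla (gen S))))"
 proof (rule fcomb_image[OF B1_comb[OF T(1)]])
  fix S assume S: "S \<in> {S \<in> trees_node V (tcell T) (tdeg T + 1). vcount S + 1 = vcount T}"
  then have N: "\<exists>x ts. S = Node x ts" by (intro not_Leaf) (simp add: trees_node_def del: split_paired_All)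
  have S': "S \<in> trees V" "tcell S = tcell T" "tdeg S = tdeg T + 1" "vcount S \<le> N"
   using S T(2) by (simp_all add: trees_node_def del: split_paired_All)
  have "corolla (gen S) \<in> trees W" by (rule corolla_trees[OF gen_elems[OF S'(1) N]])
  moreover have "decs (corolla (gen S)) \<subseteq> Fil N" using gen_Fil[OF S'(1) N S'(4)] by (simp add: corolla_def)
  ultimately show "corolla (gen S) \<in> ?S" using S' by simp
 qed simp
 have "fcomb ?S G (%phi. (%Psi. cut_sum T (%a b c. Psi (a, b, c)))
    (%s. (case s of (T', p, U) => sg (tdeg T')) * phi (case s of (T', p, U) => two_vertex_tree (gen T') p (gen U))))"
 proof (rule fcomb_image[OF cut_comb(1)[OF T(1)], where
    c="%s. case s of (T', p, U) => sg (tdeg T')" and h="%s. case s of (T', p, U) => two_vertex_tree (gen T') p (gen U)"])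
  fix s assume s: "s \<in> cuts V T"
  obtain T' p U where e: "s = (T', p, U)" by (cases s)
  note c = cutsD[OF s[unfolded e]]
  \<comment> \<open>Neither piece is a leaf, so each takes at least one vertex away from the
    other.\<close>
  have "vcount T' \<le> N" "vcount U \<le> N" using c(3,4,11) T(2) by auto
  then have "decs (two_vertex_tree (gen T') p (gen U)) \<subseteq> Fil N"
   using gen_Fil[OF c(1,3)] gen_Fil[OF c(2,4)] by (auto simp: two_vertex_tree_def corolla_def)
  then show "(case s of (T', p, U) => two_vertex_tree (gen T') p (gen U)) \<in> ?S"
   using cut_typed_gen[OF cuts_typed[OF s[unfolded e]]] c(9) by (simp add: e)
 qed simp
 then have 2: "fcomb ?S G (%phi. cut_sum T (%T' p U. sg (tdeg T') * phi (two_vertex_tree (gen T') p (gen U))))"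
  by simp
 have "fcomb ?S G (%phi. (- 1) * B1 T (%S. phi (corolla (gen S))) +
   cut_sum T (%T' p U. sg (tdeg T') * phi (two_vertex_tree (gen T') p (gen U))))"
  using 1 2 by (intro fcomb_plus fcomb_scale) simp_all
 then show ?thesis by (simp add: \<Omega>_def[abs_def])
qed

lemma rest_comb:
 assumes x: "x \<in> Fil (Suc N)"
 shows "fcomb {R \<in> trdeg W (etop x, ebot x) (edeg x + 1). decs R \<subseteq> Fil N} (Mlin W (etop x, ebot x)) (rest x)"
 unfolding rest_def[abs_def]
proof (rule fcomb_bind[OF _ _ \<Omega>_Mlin])
 show "fcomb (few (Suc N) (etop x, ebot x) (edeg x - 1)) (Mlin V (etop x, ebot x)) (evec x)" using x by (simp only: Fil_iff)
 fix T assume "T \<in> few (Suc N) (etop x, ebot x) (edeg x - 1)"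
 then have T: "T \<in> trees V" "tcell T = (etop x, ebot x)" "tdeg T = edeg x - 1" "vcount T \<le> Suc N"
  by (simp_all add: trees_node_def del: split_paired_All)
 show "fcomb {R \<in> trdeg W (etop x, ebot x) (edeg x + 1). decs R \<subseteq> Fil N} (Mlin W (etop x, ebot x)) (\<Omega> T)"
  using \<Omega>_comb[OF T(1,4), of "Mlin W (etop x, ebot x)"] T(2,3) by (simp add: add.commute)
qed

lemma Fil_Suc: "Fil N \<subseteq> Fil (Suc N)" by (auto simp: Fil_iff elim!: fcomb_mono)

sublocale cobar: filtered_generators W \<theta> d1 rest Fil
proof
 interpret M: vector_space "tscale :: 'k => ('k, 'i, 'e, 'v) tens => _" by (rule vector_space_tscale)
 show "El s t n 0 \<in> elems W" if "El s t n u \<in> elems W" for s t n u using that M.span_zero by (simp add: elems_def W_cx)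
 show "topEl d1 x \<in> elems W" if "x \<in> elems W" for x by (rule d1_facts(1)[OF that])
 show "d1 (El s t n (scl W a u + scl W b u')) = scl W a (d1 (El s t n u)) + scl W b (d1 (El s t n u'))" for s t n u u' a b
  by (simp add: d1_def tscale_def fun_eq_iff algebra_simps)
 show "d1 (topEl d1 x) = 0" if x: "x \<in> elems W" for x proof
  fix psi
  show "d1 (topEl d1 x) psi = 0 psi" proof (cases "psi \<in> Mlin V (etop x, ebot x)")
   case True
   \<comment> \<open>\<open>B0\<close> is the operator of \<open>contraction_data\<close> with
     \<open>\<kappa> = 0\<close>, so the argument for the bar differential also shows that its
     internal part squares to zero.\<close>
   have "evec x (%T. B0 T (%S. B0 S psi)) = 0"
   proof (rule fcomb_zero[OF elems_comb[OF x] internal.bar.at_Mlin[OF internal.bar.at_Mlin[OF True]]])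
    fix T assume "T \<in> trees_node V (etop x, ebot x) (edeg x - 1)"
    then show "B0 T (%S. B0 S psi) = 0"
     using True by (intro internal.B_square(1)) (simp_all add: trees_node_def del: split_paired_All)
   qed
   then show ?thesis using True internal.bar.at_Mlin[OF True] by (simp add: d1_def)
  qed (simp add: d1_def)
 qed
 show "fcomb (trdeg W (etop x, ebot x) (edeg x + 1)) (Mlin W (etop x, ebot x)) (rest x)" if "x \<in> elems W" for x proof -
  obtain N where "x \<in> Fil N" using Fil_exists[OF \<open>x \<in> elems W\<close>] by blast
  then have "x \<in> Fil (Suc N)" by (rule subsetD[OF Fil_Suc])
  from rest_comb[OF this] show ?thesis by (rule fcomb_mono) auto
 qed
 show "\<theta> x phi = phi (corolla (topEl d1 x)) + rest x phi" if x: "x \<in> elems W" and phi: "phi \<in> Mlin W (etop x, ebot x)" for x phi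
 proof -
  have "evec x (%T. \<Theta> T phi) = (- 1) * evec x (%T. B0 T (%S. phi (corolla (gen S)))) + 1 * evec x (%T. \<Omega> T phi)"
   by (rule fcomb_lin[OF elems_comb[OF x] internal.bar.at_Mlin[OF gen_Mlin[OF phi]] \<Omega>_Mlin[OF phi] \<Theta>_Mlin[OF phi]])
    (simp add: \<Theta>_\<Omega>)
  then show ?thesis using \<theta>_eval[OF x phi] d1_facts(2)[OF x phi] by (simp add: rest_def)
 qed
 show "evec x = 0" if "x \<in> Fil 0" "x \<in> elems W" for x proof -
  have "T \<notin> few 0 (etop x, ebot x) (edeg x - 1)" for T by (cases T) (auto simp: trees_node_def simp del: split_paired_All)
  then have e: "few 0 (etop x, ebot x) (edeg x - 1) = {}" by blast
  have "evec x \<in> M.span (ptens V ` {})" using that(1) by (simp only: Fil_def mem_Collect_eq e)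
  then show ?thesis by simp
 qed
 show "Fil N \<subseteq> Fil (Suc N)" for N by (rule Fil_Suc)
 show "\<exists>N. x \<in> Fil N" if "x \<in> elems W" for x by (rule Fil_exists[OF that])
 show "topEl d1 x \<in> Fil N" if x: "x \<in> Fil N" "x \<in> elems W" for x N proof -
  let ?c = "(etop x, ebot x)"
  have "fcomb (few N ?c (edeg x)) (Mlin V ?c) (%psi. evec x (%T. B0 T psi))"
  proof (rule fcomb_bind[OF _ _ internal.bar.at_Mlin])
   show "fcomb (few N ?c (edeg x - 1)) (Mlin V ?c) (evec x)" using x by (simp only: Fil_iff)
   fix T assume "T \<in> few N ?c (edeg x - 1)"
   then have T: "T \<in> trees V" "tcell T = ?c" "tdeg T = edeg x - 1" "vcount T \<le> N"
    by (simp_all add: trees_node_def del: split_paired_All)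
   show "fcomb (few N ?c (edeg x)) (Mlin V ?c) (B0 T)"
    by (rule fcomb_mono[OF B0_comb[OF T(1)]]) (use T in "auto simp del: split_paired_All")
  qed
  from fcomb_scale[OF this, of "- 1"]
  have "fcomb (few N ?c (edeg x)) (Mlin V ?c) (d1 x)" by (simp add: fcomb_def d1_def)
  then show ?thesis using d1_facts(1)[OF x(2)] by (simp add: Fil_iff)
 qed
 show "fcomb {T \<in> trdeg W (etop x, ebot x) (edeg x + 1). decs T \<subseteq> Fil N} (Mlin W (etop x, ebot x)) (rest x)"
  if "x \<in> Fil (Suc N)" "x \<in> elems W" for x N by (rule rest_comb[OF that(1)])
qed

end

theorem lemma7p11:
 fixes I :: "'i set"
  and A :: "('k::field, 'i, 'e, 'v::ab_group_add) twocat"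
  and \<epsilon> :: "('i, 'e, 'e, 'v, 'k) mor"
 assumes "two_cat I A" and "augmentation A \<epsilon>"
 shows "cofibrant TYPE('f \<times> 'x::ab_group_add) TYPE('g \<times> 'y::ab_group_add) I (cobar (bar A \<epsilon>))"
proof -
 interpret augmented I A \<epsilon> using assms by unfold_locales
 have "\<exists>h. is_mor (cobar (bar A \<epsilon>)) X h \<and> mor_eq (cobar (bar A \<epsilon>)) (mor_comp p h) v"
  if "two_cat I X" "two_cat I Y" "is_mor X Y p" "fibration X Y p" "weak_equivalence X Y p" "is_mor (cobar (bar A \<epsilon>)) Y v"
  for X :: "('k, 'i, 'f, 'x) twocat" and Y :: "('k, 'i, 'g, 'y) twocat" and p v
  using cobar.lift_trivial_fibration[OF that(1-5)] that(6) by (simp add: cobar_bar objs_A)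
 \<comment> \<open>All morphisms out of the initial object agree, so the triangle starting there
   commutes for every lift.\<close>
 then show ?thesis using cobar_two_cat initial_obj_initial(3) unfolding cofibrant_def has_llp_def objs_A by blast
qed

end
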